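(* Let $\alpha\in(1,2]$, let $\sigma:\mathbb{R}\to\mathbb{R}$ be a Lipschitz function, let $\mu>0$ be a constant, and let $\{u_\mu(t,x):t\ge0,\,x\in\mathbb{R}\}$ be the mild solution of $$\frac{\partial}{\partial t}u_\mu=\mu\Delta_\alpha u_\mu+\sigma(u_\mu(t,x))\frac{\partial^2}{\partial t\,\partial x}W,\quad t\ge0,\ x\in\mathbb{R},\qquad u_\mu(0,x)=0,$$ where $W$ is a space-time white noise. Fix $0<T_1<T_2$ and $x\in\mathbb{R}$, and for $n\ge1$ let $\delta=\frac{T_2-T_1}{n}$ and $t_i=T_1+i\delta$ for $i=0,1,\dots,n$. Let $c_\alpha=\frac{\Gamma(1/\alpha)}{\pi(\alpha-1)}$. Then $$\lim_{n\to\infty}\frac{1}{n^{1/\alpha}}\sum_{i=1}^{n}\bigl(u_\mu(t_i,x)-u_\mu(t_{i-1},x)\bigr)^2=\frac{c_\alpha(T_2-T_1)^{-\frac1\alpha}}{\mu^{\frac1\alpha}}\int_{T_1}^{T_2}\sigma^2(u_\mu(r,x))\,dr$$ holds in probability. Moreover, suppose that there is a constant $\sigma_0>0$ with $|\sigma(y)|\ge\sigma_0$ for all $y\in\mathbb{R}$, and define $$\hat\mu_n=\left[\frac{c_\alpha(T_2-T_1)^{\frac{\alpha-1}{\alpha}}}{n^{(\alpha-1)/\alpha}}\cdot\frac{\sum_{i=1}^{n}\sigma^2(u_\mu(t_i,x))}{\sum_{i=1}^{n}\bigl(u_\mu(t_i,x)-u_\mu(t_{i-1},x)\bigr)^2}\right]^\alpha.$$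 Then $\hat\mu_n\to\mu$ in probability as $n\to\infty$, i.e. $\hat\mu_n$ is a consistent estimator of $\mu$.
   Context: $W$ is a space-time white noise on $[0,\infty)\times\mathbb{R}$: a centered Gaussian family $W(A)$ indexed by bounded Borel sets $A\subset[0,\infty)\times\mathbb{R}$ with $\mathbb{E}[W(A)W(B)]=|A\cap B|$ (Lebesgue measure), with filtration $\mathcal{F}_t=\sigma\{W([0,r]\times A):0\le r\le t,\ A\subset\mathbb{R}\text{ bounded Borel}\}$ (augmented by null sets). $\Delta_\alpha=-(-\Delta)^{\alpha/2}$ is the fractional Laplacian on $\mathbb{R}$. $G_\alpha(t,x)$, $t>0$, $x\in\mathbb{R}$, is the fundamental solution of $\partial_t-\Delta_\alpha$, i.e. the function with $\int_{\mathbb{R}}e^{-ix\xi}G_\alpha(t,x)\,dx=\exp(-t|\xi|^\alpha)$. The mild solution is the (unique) predictable random field with $\sup_{t\in[0,T],x\in\mathbb{R}}\mathbb{E}|u_\mu(t,x)|^2<\infty$ for every $T>0$ such that, for all $t>0$, $x\in\mathbb{R}$, almost surely $$u_\mu(t,x)=\int_0^t\int_{\mathbb{R}}G_\alpha(\mu(t-s),x-z)\,\sigma(u_\mu(s,z))\,W(ds,dz),$$ the integral being Walsh's stochastic integral; existence and uniqueness are known, and $u_\mu$ is taken in its continuous version. *)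

theory Defs
  imports "HOL-Probability.Probability"
begin

section \<open>Space-time white noise\<close>

text \<open>Degenerate Gaussian variables (variance 0) are admitted.\<close>

definition centered_gaussian :: "'w measure \<Rightarrow> ('w \<Rightarrow> real) \<Rightarrow> bool" where
  "centered_gaussian M X \<longleftrightarrow> X \<in> borel_measurable M \<and>
     ((\<exists>s>0. distributed M lborel X (normal_density 0 s)) \<or> (AE \<omega> in M. X \<omega> = 0))"

definition centered_gaussian_family ::
    "'w measure \<Rightarrow> 'i set \<Rightarrow> ('i \<Rightarrow> 'w \<Rightarrow> real) \<Rightarrow> bool" where
  "centered_gaussian_family M I X \<longleftrightarrow>
     (\<forall>J c. finite J \<longrightarrow> J \<subseteq> I \<longrightarrow> centered_gaussian M (\<lambda>\<omega>. \<Sum>j\<in>J. c j * X j \<omega>))"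

definition bounded_borel_sets :: "'a::metric_space set set" where
  "bounded_borel_sets = {A. A \<in> sets borel \<and> bounded A}"

text \<open>Points of \<^term>\<open>{0..} \<times> UNIV :: (real \<times> real) set\<close> are pairs (time, space). Values of \<open>W\<close> on
  other sets are irrelevant.\<close>

definition space_time_white_noise ::
    "'w measure \<Rightarrow> ((real \<times> real) set \<Rightarrow> 'w \<Rightarrow> real) \<Rightarrow> bool" where
  "space_time_white_noise M W \<longleftrightarrow>
     (let \<A> = {A \<in> bounded_borel_sets. A \<subseteq> {0..} \<times> UNIV} in
        centered_gaussian_family M \<A> W \<and>
        (\<forall>A\<in>\<A>. \<forall>B\<in>\<A>. integral\<^sup>L M (\<lambda>\<omega>. W A \<omega> * W B \<omega>) = measure lborel (A \<inter> B)))"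

definition noise_filtration ::
    "'w measure \<Rightarrow> ((real \<times> real) set \<Rightarrow> 'w \<Rightarrow> real) \<Rightarrow> real \<Rightarrow> 'w measure" where
  "noise_filtration M W t = sigma (space M)
     ({W ({0..r} \<times> A) -` B \<inter> space M | r A B.
         0 \<le> r \<and> r \<le> t \<and> A \<in> bounded_borel_sets \<and> B \<in> sets borel} \<union> null_sets M)"


section \<open>Predictable random fields and Walsh's stochastic integral\<close>

definition predictable_sigma ::
    "'w measure \<Rightarrow> ((real \<times> real) set \<Rightarrow> 'w \<Rightarrow> real) \<Rightarrow> (real \<times> real \<times> 'w) measure" where
  "predictable_sigma M W = sigma ({0..} \<times> UNIV \<times> space M)
     ({{a<..b} \<times> A \<times> E | a b A E.
         0 \<le> a \<and> a \<le> b \<and> A \<in> sets borel \<and> E \<in> sets (noise_filtration M W a)} \<union>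
      {{0} \<times> A \<times> E | A E. A \<in> sets borel \<and> E \<in> sets (noise_filtration M W 0)})"

definition predictable_field ::
    "'w measure \<Rightarrow> ((real \<times> real) set \<Rightarrow> 'w \<Rightarrow> real) \<Rightarrow> (real \<Rightarrow> real \<Rightarrow> 'w \<Rightarrow> real) \<Rightarrow> bool" where
  "predictable_field M W h \<longleftrightarrow>
     (\<lambda>(s, z, \<omega>). h s z \<omega>) \<in> borel_measurable (predictable_sigma M W)"

text \<open>A list of quadruples \<open>(X, a, b, A)\<close> encodes the simple field
  \<open>\<Sum> X(\<omega>) 1\<^bsub>(a,b]\<^esub>(s) 1\<^bsub>A\<^esub>(z)\<close>.\<close>

type_synonym 'w simple_field = "(('w \<Rightarrow> real) \<times> real \<times> real \<times> real set) list"

definition simple_field ::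
    "'w measure \<Rightarrow> ((real \<times> real) set \<Rightarrow> 'w \<Rightarrow> real) \<Rightarrow> 'w simple_field \<Rightarrow> bool" where
  "simple_field M W fs \<longleftrightarrow> (\<forall>(X, a, b, A) \<in> set fs.
     0 \<le> a \<and> a \<le> b \<and> A \<in> bounded_borel_sets \<and>
     X \<in> borel_measurable (noise_filtration M W a) \<and> (\<exists>K. \<forall>\<omega>\<in>space M. \<bar>X \<omega>\<bar> \<le> K))"

definition simple_eval :: "'w simple_field \<Rightarrow> real \<Rightarrow> real \<Rightarrow> 'w \<Rightarrow> real" where
  "simple_eval fs s z \<omega> =
     (\<Sum>(X, a, b, A)\<leftarrow>fs. X \<omega> * indicator {a<..b} s * indicator A z)"

definition simple_integral ::
    "((real \<times> real) set \<Rightarrow> 'w \<Rightarrow> real) \<Rightarrow> real \<Rightarrow> 'w simple_field \<Rightarrow> 'w \<Rightarrow> real" where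
  "simple_integral W t fs \<omega> =
     (\<Sum>(X, a, b, A)\<leftarrow>fs. X \<omega> * W ({min a t<..min b t} \<times> A) \<omega>)"

text \<open>\<open>I\<close> is (a version of) the integral of \<open>h\<close> over \<open>[0,t] \<times> \<real>\<close> against \<open>W\<close>, obtained as the
  \<open>L\<^sup>2\<close>-limit of the integrals of simple fields. By the Walsh isometry this determines \<open>I\<close>
  exactly up to almost sure equality, so that the relation expresses the identity
  "\<open>I = \<integral>\<integral> h dW\<close> almost surely".\<close>

definition has_walsh_integral ::
    "'w measure \<Rightarrow> ((real \<times> real) set \<Rightarrow> 'w \<Rightarrow> real) \<Rightarrow> real \<Rightarrow>
       (real \<Rightarrow> real \<Rightarrow> 'w \<Rightarrow> real) \<Rightarrow> ('w \<Rightarrow> real) \<Rightarrow> bool" where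
  "has_walsh_integral M W t h I \<longleftrightarrow>
     predictable_field M W h \<and>
     (\<integral>\<^sup>+\<omega>. (\<integral>\<^sup>+s\<in>{0..t}. (\<integral>\<^sup>+z. ennreal ((h s z \<omega>)\<^sup>2) \<partial>lborel) \<partial>lborel) \<partial>M) < \<infinity> \<and>
     I \<in> borel_measurable M \<and>
     (\<exists>fs. (\<forall>k. simple_field M W (fs k)) \<and>
        (\<lambda>k. \<integral>\<^sup>+\<omega>. (\<integral>\<^sup>+s\<in>{0..t}. (\<integral>\<^sup>+z. ennreal ((simple_eval (fs k) s z \<omega> - h s z \<omega>)\<^sup>2)
                \<partial>lborel) \<partial>lborel) \<partial>M) \<longlonglongrightarrow> 0 \<and>
        (\<lambda>k. \<integral>\<^sup>+\<omega>. ennreal ((simple_integral W t (fs k) \<omega> - I \<omega>)\<^sup>2) \<partial>M) \<longlonglongrightarrow> 0)"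


section \<open>The fractional stochastic heat equation\<close>

text \<open>\<open>G t\<close> is the fundamental solution of \<open>\<partial>\<^sub>t - \<Delta>\<^sub>\<alpha>\<close> with \<open>\<Delta>\<^sub>\<alpha> = -(-\<Delta>)\<^bsup>\<alpha>/2\<^esup>\<close>, given by its
  Fourier transform. Continuity selects the usual representative; the Fourier transform alone
  determines \<open>G t\<close> only almost everywhere. Values at \<open>t \<le> 0\<close> are unconstrained.\<close>

definition fractional_heat_kernel :: "real \<Rightarrow> (real \<Rightarrow> real \<Rightarrow> real) \<Rightarrow> bool" where
  "fractional_heat_kernel \<alpha> G \<longleftrightarrow> (\<forall>t>0.
     continuous_on UNIV (G t) \<and> integrable lborel (G t) \<and>
     (\<forall>\<xi>. (CLBINT x. exp (- \<i> * of_real (x * \<xi>)) * of_real (G t x))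
            = of_real (exp (- t * \<bar>\<xi>\<bar> powr \<alpha>))))"

text \<open>Mild solution of \<open>\<partial>\<^sub>t u = \<mu> \<Delta>\<^sub>\<alpha> u + \<sigma>(u) \<partial>\<^sub>t \<partial>\<^sub>x W\<close> with \<open>u(0,\<cdot>) = 0\<close>. The indicator
  only removes the time \<open>s = t\<close>, where \<open>G (\<mu> * (t - s))\<close> has no meaning, and later times, which do
  not contribute.\<close>

definition mild_solution ::
    "'w measure \<Rightarrow> ((real \<times> real) set \<Rightarrow> 'w \<Rightarrow> real) \<Rightarrow> (real \<Rightarrow> real \<Rightarrow> real) \<Rightarrow>
       real \<Rightarrow> (real \<Rightarrow> real) \<Rightarrow> (real \<Rightarrow> real \<Rightarrow> 'w \<Rightarrow> real) \<Rightarrow> bool" where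
  "mild_solution M W G \<mu> \<sigma> u \<longleftrightarrow>
     predictable_field M W u \<and>
     (\<forall>T>0. (SUP (t, x) \<in> {0..T} \<times> UNIV. \<integral>\<^sup>+\<omega>. ennreal (\<bar>u t x \<omega>\<bar>\<^sup>2) \<partial>M) < \<infinity>) \<and>
     (\<forall>x. AE \<omega> in M. u 0 x \<omega> = 0) \<and>
     (\<forall>t>0. \<forall>x. has_walsh_integral M W t
        (\<lambda>s z \<omega>. indicator {0..<t} s * (G (\<mu> * (t - s)) (x - z) * \<sigma> (u s z \<omega>))) (u t x))"

definition continuous_field :: "'w measure \<Rightarrow> (real \<Rightarrow> real \<Rightarrow> 'w \<Rightarrow> real) \<Rightarrow> bool" where
  "continuous_field M u \<longleftrightarrow>
     (AE \<omega> in M. continuous_on ({0..} \<times> UNIV) (\<lambda>(t, x). u t x \<omega>))"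


section \<open>Convergence in probability and the estimator\<close>

definition tendsto_in_probability ::
    "'w measure \<Rightarrow> (nat \<Rightarrow> 'w \<Rightarrow> real) \<Rightarrow> ('w \<Rightarrow> real) \<Rightarrow> bool" where
  "tendsto_in_probability M X Y \<longleftrightarrow>
     (\<forall>n. X n \<in> borel_measurable M) \<and> Y \<in> borel_measurable M \<and>
     (\<forall>\<epsilon>>0. (\<lambda>n. measure M {\<omega> \<in> space M. \<bar>X n \<omega> - Y \<omega>\<bar> > \<epsilon>}) \<longlonglongrightarrow> 0)"

definition c_const :: "real \<Rightarrow> real" where
  "c_const \<alpha> = Gamma (1 / \<alpha>) / (pi * (\<alpha> - 1))"

definition grid_time :: "real \<Rightarrow> real \<Rightarrow> nat \<Rightarrow> nat \<Rightarrow> real" where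
  "grid_time T1 T2 n i = T1 + real i * ((T2 - T1) / real n)"

definition quadratic_variation_sum ::
    "(real \<Rightarrow> real \<Rightarrow> 'w \<Rightarrow> real) \<Rightarrow> real \<Rightarrow> real \<Rightarrow> real \<Rightarrow> nat \<Rightarrow> 'w \<Rightarrow> real" where
  "quadratic_variation_sum u x T1 T2 n \<omega> =
     (\<Sum>i=1..n. (u (grid_time T1 T2 n i) x \<omega> - u (grid_time T1 T2 n (i - 1)) x \<omega>)\<^sup>2)"

definition drift_estimator ::
    "real \<Rightarrow> (real \<Rightarrow> real) \<Rightarrow> (real \<Rightarrow> real \<Rightarrow> 'w \<Rightarrow> real) \<Rightarrow> real \<Rightarrow> real \<Rightarrow> real \<Rightarrow> nat \<Rightarrow> 'w \<Rightarrow> real" where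
  "drift_estimator \<alpha> \<sigma> u x T1 T2 n \<omega> =
     (c_const \<alpha> * (T2 - T1) powr ((\<alpha> - 1) / \<alpha>) / real n powr ((\<alpha> - 1) / \<alpha>) *
       ((\<Sum>i=1..n. (\<sigma> (u (grid_time T1 T2 n i) x \<omega>))\<^sup>2) / quadratic_variation_sum u x T1 T2 n \<omega>))
     powr \<alpha>"

end

theory Submission
  imports Defs "HOL-Real_Asymp.Real_Asymp"
begin

text \<open>A mild solution is locally a Gaussian field with a frozen coefficient: up to an error that is
  small in \<open>L\<^sup>2\<close> compared with the increment itself, \<open>u(t, x) - u(t - \<delta>, x)\<close> equals \<open>X Z\<close>, where \<open>X\<close> is
  \<open>\<sigma>(u(t - K \<delta>, x))\<close> (truncated) and \<open>Z\<close> is a Wiener integral over the noise between times \<open>t - K \<delta>\<close> and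
  \<open>t\<close>.  By the self-similarity of the kernel the variance of \<open>Z\<close> is close to
  \<open>c\<^sub>\<alpha> \<mu>\<^bsup>-1/\<alpha>\<^esup> \<delta>\<^bsup>1-1/\<alpha>\<^esup>\<close>; the constant is the squared \<open>L\<^sup>2\<close> norm of the increment of the kernel, which
  Plancherel's identity reduces to the on-diagonal values \<open>G(t, 0)\<close>.  The variables \<open>X\<^sub>i\<^sup>2 (Z\<^sub>i\<^sup>2 - E Z\<^sub>i\<^sup>2)\<close>
  along the grid are uncorrelated at distance at least \<open>K\<close>, so their normalised sum vanishes in
  \<open>L\<^sup>2\<close>, and what remains is a Riemann sum.  All approximations hold in \<open>L\<^sup>1\<close>, hence in probability;
  the second claim follows by taking the ratio of two Riemann-type sums.\<close>

section \<open>Gaussian variables and trigonometric test functions\<close>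

text \<open>The increments of \<open>u\<close> are not martingale increments: from one time to the
  next the kernel changes on the whole past, so neighbouring increments are correlated.
  Self-similarity resolves this. After rescaling, every kernel increment is the same
  square-integrable function \<open>increment_kernel \<mu>\<close>, so one boundedly supported step
  function approximates it for all \<delta> at once, and its support fixes the memory length K. Only
  second moments of \<open>u\<close> are at hand, while the variance of a sum of squares needs
  fourth moments; hence the coefficient is truncated to a bounded X and the fourth moment is taken
  of the Gaussian Z alone. The level sets of the step function are Borel sets, not rectangles, which
  is why integrals, filtration and independence are set up for all bounded Borel sets. Independence
  comes from zero covariance of jointly Gaussian variables. The constant: the diagonal values of G
  behave like r^(-1/\<alpha>), and integrating over time gives a factor 1 / (1 - 1/\<alpha>), which
  turns Gamma (1/\<alpha>) / (pi \<alpha>) into Gamma (1/\<alpha>) / (pi (\<alpha> - 1)); \<alpha> >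
  1 makes the integral converge at 0.\<close>

lemma (in prob_space)
  assumes "centered_gaussian M X"
  shows centered_gaussian_measurable: "X \<in> borel_measurable M"
    and centered_gaussian_integrable_power: "integrable M (\<lambda>\<omega>. X \<omega> ^ k)"
    and centered_gaussian_expectation: "expectation X = 0"
    and centered_gaussian_fourth_moment: "expectation (\<lambda>\<omega>. X \<omega> ^ 4) = 3 * (expectation (\<lambda>\<omega>. (X \<omega>)\<^sup>2))\<^sup>2"
    and centered_gaussian_cos: "expectation (\<lambda>\<omega>. cos (X \<omega>)) = exp (- expectation (\<lambda>\<omega>. (X \<omega>)\<^sup>2) / 2)"
    and centered_gaussian_sin: "expectation (\<lambda>\<omega>. sin (X \<omega>)) = 0"
proof -
  have X[measurable]: "X \<in> borel_measurable M"
    using assms by (simp add: centered_gaussian_def)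
  then show "X \<in> borel_measurable M" .
  have "integrable M (\<lambda>\<omega>. X \<omega> ^ k) \<and> expectation X = 0 \<and>
    expectation (\<lambda>\<omega>. X \<omega> ^ 4) = 3 * (expectation (\<lambda>\<omega>. (X \<omega>)\<^sup>2))\<^sup>2 \<and>
    expectation (\<lambda>\<omega>. cos (X \<omega>)) = exp (- expectation (\<lambda>\<omega>. (X \<omega>)\<^sup>2) / 2) \<and>
    expectation (\<lambda>\<omega>. sin (X \<omega>)) = 0"
  \<comment> \<open>A degenerate variable satisfies every identity with variance 0; in particular
    \<open>exp (- 0 / 2) = 1\<close> matches the mean of \<open>cos 0\<close>.\<close>
  proof (cases "AE \<omega> in M. X \<omega> = 0")
    case True
    have "integrable M (\<lambda>\<omega>. X \<omega> ^ k)"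
      by (rule integrable_cong_AE_imp[of _ "\<lambda>\<omega>. 0 ^ k"]) (use True in auto)
    moreover have "expectation X = expectation (\<lambda>_. 0)"
      by (rule integral_cong_AE) (use True in auto)
    moreover have "expectation (\<lambda>\<omega>. X \<omega> ^ 4) = expectation (\<lambda>_. 0)"
      by (rule integral_cong_AE) (use True in auto)
    moreover have "expectation (\<lambda>\<omega>. (X \<omega>)\<^sup>2) = expectation (\<lambda>_. 0)"
      by (rule integral_cong_AE) (use True in auto)
    moreover have "expectation (\<lambda>\<omega>. cos (X \<omega>)) = expectation (\<lambda>_. 1)"
      by (rule integral_cong_AE) (use True in auto)
    moreover have "expectation (\<lambda>\<omega>. sin (X \<omega>)) = expectation (\<lambda>_. 0)"
      by (rule integral_cong_AE) (use True in auto)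
    ultimately show ?thesis by (simp add: prob_space)
  next
    case False
    then obtain s where s: "s > 0" and d: "distributed M lborel X (normal_density 0 s)"
      using assms by (auto simp: centered_gaussian_def)
    have d1: "distributed M lborel (\<lambda>\<omega>. X \<omega> / s) std_normal_density"
      using d normal_standard_normal_convert[of s X 0] s by simp
    have int: "integrable M (\<lambda>\<omega>. X \<omega> ^ k)" for k
      using distributed_integrable[OF d, of "\<lambda>x. x ^ k"] integrable_normal_moment[OF s, of 0 k]
      by simp
    have m: "expectation (\<lambda>\<omega>. X \<omega> ^ (2 * k)) = fact (2 * k) / ((2 / s\<^sup>2) ^ k * fact k)" for k
      using distributed_integral[OF d, of "\<lambda>x. x ^ (2 * k)"] integral_normal_moment_even[OF s, of 0 k]
      by simp
    have m1: "expectation X = 0"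
      using distributed_integral[OF d, of "\<lambda>x. x"] integral_normal_moment_odd[OF s, of 0 0]
      by simp
    have m2: "expectation (\<lambda>\<omega>. (X \<omega>)\<^sup>2) = s\<^sup>2"
      using m[of 1] s by (simp add: fact_numeral field_simps power2_eq_square)
    have m4: "expectation (\<lambda>\<omega>. X \<omega> ^ 4) = 3 * (s\<^sup>2)\<^sup>2"
      using m[of 2] s by (simp add: fact_numeral field_simps power2_eq_square power4_eq_xxxx)
    have distr: "distr M borel (\<lambda>\<omega>. X \<omega> / s) = std_normal_distribution"
      using d1 unfolding distributed_def by (metis distr_cong sets_lborel)
    \<comment> \<open>The characteristic function of the standard normal law at the point
      \<open>s\<close> is the transform of \<open>X\<close> at 1, since
      \<open>s * (X / s) = X\<close>; its real and imaginary parts are the means of cosine and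
      sine.\<close>
    have ch: "expectation (\<lambda>\<omega>. iexp (X \<omega>)) = complex_of_real (exp (- s\<^sup>2 / 2))"
    proof -
      have "char std_normal_distribution s = (CLINT x|distr M borel (\<lambda>\<omega>. X \<omega> / s). iexp (s * x))"
        by (simp add: char_def distr)
      also have "\<dots> = expectation (\<lambda>\<omega>. iexp (s * (X \<omega> / s)))"
        by (subst integral_distr) auto
      finally show ?thesis using s by (simp add: char_std_normal_distribution)
    qed
    have ic: "integrable M (\<lambda>\<omega>. iexp (X \<omega>))"
      by (rule integrable_const_bound[of _ 1]) auto
    have "expectation (\<lambda>\<omega>. cos (X \<omega>)) = Re (expectation (\<lambda>\<omega>. iexp (X \<omega>)))"
      by (simp add: integral_Re[OF ic, symmetric] exp_Euler[symmetric] Re_exp)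
    moreover have "expectation (\<lambda>\<omega>. sin (X \<omega>)) = Im (expectation (\<lambda>\<omega>. iexp (X \<omega>)))"
      by (simp add: integral_Im[OF ic, symmetric] exp_Euler[symmetric] Im_exp)
    ultimately show ?thesis using int m1 m2 m4 ch by simp
  qed
  then show "integrable M (\<lambda>\<omega>. X \<omega> ^ k)" "expectation X = 0"
    "expectation (\<lambda>\<omega>. X \<omega> ^ 4) = 3 * (expectation (\<lambda>\<omega>. (X \<omega>)\<^sup>2))\<^sup>2"
    "expectation (\<lambda>\<omega>. cos (X \<omega>)) = exp (- expectation (\<lambda>\<omega>. (X \<omega>)\<^sup>2) / 2)"
    "expectation (\<lambda>\<omega>. sin (X \<omega>)) = 0"
    by blast+
qed

text \<open>The variables \<open>V\<close> below are closed under multiplication by \<open>sin \<theta>\<close> for \<open>\<theta> \<in> L\<close>, hence by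
  Stone-Weierstrass under multiplication by continuous functions of \<open>sin \<theta>\<close>, and since
  \<open>n sin (Y / n) \<longlonglongrightarrow> Y\<close> also by bounded continuous functions of \<open>Y\<close>.  This replaces the uniqueness theorem
  for multivariate characteristic functions.\<close>

definition (in prob_space) trig_factor ::
    "('a \<Rightarrow> real) set \<Rightarrow> ('a \<Rightarrow> real) \<Rightarrow> ('a \<Rightarrow> real) \<Rightarrow> bool" where
  "trig_factor L h V \<longleftrightarrow> V \<in> borel_measurable M \<and> (\<exists>K. \<forall>\<omega>. \<bar>V \<omega>\<bar> \<le> K) \<and>
     (\<forall>Y\<in>L. expectation (\<lambda>\<omega>. V \<omega> * cos (Y \<omega>) * h \<omega>) = expectation (\<lambda>\<omega>. V \<omega> * cos (Y \<omega>)) * expectation h \<and>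
            expectation (\<lambda>\<omega>. V \<omega> * sin (Y \<omega>) * h \<omega>) = expectation (\<lambda>\<omega>. V \<omega> * sin (Y \<omega>)) * expectation h)"

text \<open>\<open>L\<close> is a linear space of random variables and \<open>h\<close> a fixed
  bounded factor. For \<open>V = 1\<close> the predicate says that \<open>h\<close> is uncorrelated
  with all cosines and sines of \<open>L\<close>; the lemmas of the locale enlarge the class of
  admissible \<open>V\<close> until it contains products of half-line indicators, the input of a
  pi-system argument.\<close>

locale trig_system = prob_space +
  fixes L :: "('a \<Rightarrow> real) set" and h :: "'a \<Rightarrow> real"
  assumes L_measurable: "Y \<in> L \<Longrightarrow> Y \<in> borel_measurable M"
    and L_add: "Y \<in> L \<Longrightarrow> Z \<in> L \<Longrightarrow> (\<lambda>\<omega>. Y \<omega> + Z \<omega>) \<in> L"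
    and L_scale: "Y \<in> L \<Longrightarrow> (\<lambda>\<omega>. c * Y \<omega>) \<in> L"
    and h_measurable[measurable]: "h \<in> borel_measurable M"
    and h_bounded: "\<exists>K. \<forall>\<omega>. \<bar>h \<omega>\<bar> \<le> K"
begin

lemma integrable_prod3:
  fixes f g :: "'a \<Rightarrow> real"
  assumes [measurable]: "f \<in> borel_measurable M" "g \<in> borel_measurable M"
    and "\<exists>K. \<forall>\<omega>. \<bar>f \<omega>\<bar> \<le> K" "\<And>\<omega>. \<bar>g \<omega>\<bar> \<le> 1"
  shows "integrable M (\<lambda>\<omega>. f \<omega> * g \<omega> * h \<omega>)" "integrable M (\<lambda>\<omega>. f \<omega> * g \<omega>)"
proof -
  obtain K1 K2 where K: "\<And>\<omega>. \<bar>f \<omega>\<bar> \<le> K1" "\<And>\<omega>. \<bar>h \<omega>\<bar> \<le> K2"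
    using assms(3) h_bounded by blast
  have b: "\<bar>f \<omega> * g \<omega>\<bar> \<le> K1 * 1" for \<omega>
    unfolding abs_mult by (intro mult_mono assms K) (use K[of \<omega>] in auto)
  have "\<bar>f \<omega> * g \<omega> * h \<omega>\<bar> \<le> K1 * 1 * K2" for \<omega>
    unfolding abs_mult[of "f \<omega> * g \<omega>"] by (intro mult_mono b K) (use K[of \<omega>] in auto)
  then show "integrable M (\<lambda>\<omega>. f \<omega> * g \<omega> * h \<omega>)"
    by (intro integrable_const_bound[of _ "K1 * 1 * K2"]) auto
  show "integrable M (\<lambda>\<omega>. f \<omega> * g \<omega>)"
    using b by (intro integrable_const_bound[of _ "K1 * 1"]) auto
qed

lemma trig_factor_lincomb:
  assumes "trig_factor L h V" "trig_factor L h V'"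
  shows "trig_factor L h (\<lambda>\<omega>. a * V \<omega> + b * V' \<omega>)"
proof -
  have Vm[measurable]: "V \<in> borel_measurable M" "V' \<in> borel_measurable M"
    using assms by (auto simp: trig_factor_def)
  obtain K K' where K: "\<And>\<omega>. \<bar>V \<omega>\<bar> \<le> K" "\<And>\<omega>. \<bar>V' \<omega>\<bar> \<le> K'"
    using assms unfolding trig_factor_def by blast
  have b: "\<exists>K. \<forall>\<omega>. \<bar>V \<omega>\<bar> \<le> K" "\<exists>K. \<forall>\<omega>. \<bar>V' \<omega>\<bar> \<le> K"
    using K by blast+
  have "\<bar>a * V \<omega> + b * V' \<omega>\<bar> \<le> \<bar>a\<bar> * K + \<bar>b\<bar> * K'" for \<omega>
    by (rule order_trans[OF abs_triangle_ineq]) (auto simp: abs_mult intro!: add_mono mult_left_mono K)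
  moreover
  { fix g :: "'a \<Rightarrow> real" assume g[measurable]: "g \<in> borel_measurable M" "\<And>\<omega>. \<bar>g \<omega>\<bar> \<le> 1"
      and e: "expectation (\<lambda>\<omega>. V \<omega> * g \<omega> * h \<omega>) = expectation (\<lambda>\<omega>. V \<omega> * g \<omega>) * expectation h"
        "expectation (\<lambda>\<omega>. V' \<omega> * g \<omega> * h \<omega>) = expectation (\<lambda>\<omega>. V' \<omega> * g \<omega>) * expectation h"
    have i: "integrable M (\<lambda>\<omega>. V \<omega> * g \<omega> * h \<omega>)" "integrable M (\<lambda>\<omega>. V \<omega> * g \<omega>)"
      "integrable M (\<lambda>\<omega>. V' \<omega> * g \<omega> * h \<omega>)" "integrable M (\<lambda>\<omega>. V' \<omega> * g \<omega>)"
      using integrable_prod3[OF Vm(1) g(1) b(1) g(2)] integrable_prod3[OF Vm(2) g(1) b(2) g(2)] by blast+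
    have "expectation (\<lambda>\<omega>. (a * V \<omega> + b * V' \<omega>) * g \<omega> * h \<omega>) =
        expectation (\<lambda>\<omega>. a * (V \<omega> * g \<omega> * h \<omega>) + b * (V' \<omega> * g \<omega> * h \<omega>))"
      by (simp add: algebra_simps)
    also have "\<dots> = (a * expectation (\<lambda>\<omega>. V \<omega> * g \<omega>) + b * expectation (\<lambda>\<omega>. V' \<omega> * g \<omega>)) * expectation h"
      using i e by (simp add: algebra_simps)
    also have "\<dots> = expectation (\<lambda>\<omega>. a * (V \<omega> * g \<omega>) + b * (V' \<omega> * g \<omega>)) * expectation h"
      using i by simp
    also have "\<dots> = expectation (\<lambda>\<omega>. (a * V \<omega> + b * V' \<omega>) * g \<omega>) * expectation h"
      by (simp add: algebra_simps)
    finally have "expectation (\<lambda>\<omega>. (a * V \<omega> + b * V' \<omega>) * g \<omega> * h \<omega>) =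
      expectation (\<lambda>\<omega>. (a * V \<omega> + b * V' \<omega>) * g \<omega>) * expectation h" . }
  note * = this
  have "expectation (\<lambda>\<omega>. (a * V \<omega> + b * V' \<omega>) * cos (Y \<omega>) * h \<omega>) =
      expectation (\<lambda>\<omega>. (a * V \<omega> + b * V' \<omega>) * cos (Y \<omega>)) * expectation h \<and>
     expectation (\<lambda>\<omega>. (a * V \<omega> + b * V' \<omega>) * sin (Y \<omega>) * h \<omega>) =
      expectation (\<lambda>\<omega>. (a * V \<omega> + b * V' \<omega>) * sin (Y \<omega>)) * expectation h" if "Y \<in> L" for Y
    using assms that L_measurable[OF that] by (intro conjI *) (auto simp: trig_factor_def)
  ultimately show ?thesis by (auto simp: trig_factor_def)
qed

text \<open>Product-to-sum formulas: sin \<theta> times cos Y or sin Y is a combination of sines or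
  cosines of Y + \<theta> and Y - \<theta>, and both arguments lie in \<open>L\<close> again. This
  is where linearity of \<open>L\<close> enters.\<close>

lemma trig_factor_sin:
  assumes V: "trig_factor L h V" and T: "\<theta> \<in> L"
  shows "trig_factor L h (\<lambda>\<omega>. V \<omega> * sin (\<theta> \<omega>))"
proof -
  have [measurable]: "V \<in> borel_measurable M" "\<theta> \<in> borel_measurable M"
    using assms L_measurable by (auto simp: trig_factor_def)
  obtain K where K: "\<And>\<omega>. \<bar>V \<omega>\<bar> \<le> K"
    using assms unfolding trig_factor_def by blast
  have "\<bar>V \<omega> * sin (\<theta> \<omega>)\<bar> \<le> K * 1" for \<omega>
    unfolding abs_mult by (intro mult_mono K) (use K[of \<omega>] in auto)
  moreover have "expectation (\<lambda>\<omega>. V \<omega> * sin (\<theta> \<omega>) * cos (Y \<omega>) * h \<omega>) =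
      expectation (\<lambda>\<omega>. V \<omega> * sin (\<theta> \<omega>) * cos (Y \<omega>)) * expectation h \<and>
     expectation (\<lambda>\<omega>. V \<omega> * sin (\<theta> \<omega>) * sin (Y \<omega>) * h \<omega>) =
      expectation (\<lambda>\<omega>. V \<omega> * sin (\<theta> \<omega>) * sin (Y \<omega>)) * expectation h" if Y: "Y \<in> L" for Y
  proof -
    have [measurable]: "Y \<in> borel_measurable M" using Y L_measurable by auto
    have p: "(\<lambda>\<omega>. Y \<omega> + \<theta> \<omega>) \<in> L" "(\<lambda>\<omega>. Y \<omega> - \<theta> \<omega>) \<in> L"
      using L_add[OF Y T] L_add[OF Y L_scale[OF T, of "-1"]] by auto
    have i: "integrable M (\<lambda>\<omega>. V \<omega> * cos (Z \<omega>) * h \<omega>)" "integrable M (\<lambda>\<omega>. V \<omega> * cos (Z \<omega>))"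
      "integrable M (\<lambda>\<omega>. V \<omega> * sin (Z \<omega>) * h \<omega>)" "integrable M (\<lambda>\<omega>. V \<omega> * sin (Z \<omega>))"
      if "Z \<in> L" for Z
      using L_measurable[OF that] K
      by (auto intro!: integrable_prod3[of V "\<lambda>\<omega>. cos (Z \<omega>)"] integrable_prod3[of V "\<lambda>\<omega>. sin (Z \<omega>)"])
    note i1 = i[OF p(1)] and i2 = i[OF p(2)]
    have f: "expectation (\<lambda>\<omega>. V \<omega> * cos (Z \<omega>) * h \<omega>) = expectation (\<lambda>\<omega>. V \<omega> * cos (Z \<omega>)) * expectation h"
      "expectation (\<lambda>\<omega>. V \<omega> * sin (Z \<omega>) * h \<omega>) = expectation (\<lambda>\<omega>. V \<omega> * sin (Z \<omega>)) * expectation h"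
      if "Z \<in> L" for Z using V that by (auto simp: trig_factor_def)
    note f1 = f[OF p(1)] and f2 = f[OF p(2)]
    have c: "v * sin t * cos y = 1/2 * (v * sin (y + t)) - 1/2 * (v * sin (y - t))"
      "v * sin t * sin y = 1/2 * (v * cos (y - t)) - 1/2 * (v * cos (y + t))"
      "v * sin t * cos y * k = 1/2 * (v * sin (y + t) * k) - 1/2 * (v * sin (y - t) * k)"
      "v * sin t * sin y * k = 1/2 * (v * cos (y - t) * k) - 1/2 * (v * cos (y + t) * k)" for v y t k :: real
      by (simp_all add: sin_add sin_diff cos_add cos_diff algebra_simps)
    show ?thesis unfolding c using f1 f2 i1 i2 by (simp add: algebra_simps)
  qed
  ultimately show ?thesis by (auto simp: trig_factor_def)
qed

text \<open>Dominated convergence on both sides of the factorisation. The common bound is a separate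
  hypothesis because \<open>trig_factor\<close> only provides a bound for each single
  \<open>V n\<close>.\<close>

lemma trig_factor_limit:
  assumes V: "\<And>n. trig_factor L h (V n)" and B: "\<And>n \<omega>. \<bar>V n \<omega>\<bar> \<le> K"
    and lim: "\<And>\<omega>. (\<lambda>n. V n \<omega>) \<longlonglongrightarrow> U \<omega>"
  shows "trig_factor L h U"
proof -
  have [measurable]: "V n \<in> borel_measurable M" for n
    using V by (auto simp: trig_factor_def)
  have [measurable]: "U \<in> borel_measurable M"
    by (rule borel_measurable_LIMSEQ_real[of _ V]) (auto intro: lim)
  have BU: "\<bar>U \<omega>\<bar> \<le> K" for \<omega>
    by (rule LIMSEQ_le_const2[OF tendsto_rabs[OF lim]]) (auto intro: B)
  obtain H where H: "\<And>\<omega>. \<bar>h \<omega>\<bar> \<le> H" using h_bounded by blast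
  { fix g :: "'a \<Rightarrow> real" assume g[measurable]: "g \<in> borel_measurable M" "\<And>\<omega>. \<bar>g \<omega>\<bar> \<le> 1"
      and e: "\<And>n. expectation (\<lambda>\<omega>. V n \<omega> * g \<omega> * h \<omega>) = expectation (\<lambda>\<omega>. V n \<omega> * g \<omega>) * expectation h"
    have "(\<lambda>n. expectation (\<lambda>\<omega>. V n \<omega> * g \<omega> * h \<omega>)) \<longlonglongrightarrow> expectation (\<lambda>\<omega>. U \<omega> * g \<omega> * h \<omega>)"
    proof (rule integral_dominated_convergence[where w="\<lambda>_. K * 1 * H"])
      have "\<bar>V n \<omega> * g \<omega> * h \<omega>\<bar> \<le> K * 1 * H" for n \<omega>
        unfolding abs_mult by (intro mult_mono B H g) (use B[of n \<omega>] H[of \<omega>] in auto)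
      then show "AE \<omega> in M. norm (V n \<omega> * g \<omega> * h \<omega>) \<le> K * 1 * H" for n by simp
      show "AE \<omega> in M. (\<lambda>n. V n \<omega> * g \<omega> * h \<omega>) \<longlonglongrightarrow> U \<omega> * g \<omega> * h \<omega>"
        by (auto intro!: tendsto_intros lim)
    qed auto
    moreover have "(\<lambda>n. expectation (\<lambda>\<omega>. V n \<omega> * g \<omega>)) \<longlonglongrightarrow> expectation (\<lambda>\<omega>. U \<omega> * g \<omega>)"
    proof (rule integral_dominated_convergence[where w="\<lambda>_. K * 1"])
      have "\<bar>V n \<omega> * g \<omega>\<bar> \<le> K * 1" for n \<omega>
        unfolding abs_mult by (intro mult_mono B H g) (use B[of n \<omega>] H[of \<omega>] in auto)
      then show "AE \<omega> in M. norm (V n \<omega> * g \<omega>) \<le> K * 1" for n by simp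
      show "AE \<omega> in M. (\<lambda>n. V n \<omega> * g \<omega>) \<longlonglongrightarrow> U \<omega> * g \<omega>"
        by (auto intro!: tendsto_intros lim)
    qed auto
    ultimately have "expectation (\<lambda>\<omega>. U \<omega> * g \<omega> * h \<omega>) = expectation (\<lambda>\<omega>. U \<omega> * g \<omega>) * expectation h"
      unfolding e by (auto intro: LIMSEQ_unique tendsto_mult_right) }
  note * = this
  have "expectation (\<lambda>\<omega>. U \<omega> * cos (Y \<omega>) * h \<omega>) = expectation (\<lambda>\<omega>. U \<omega> * cos (Y \<omega>)) * expectation h \<and>
      expectation (\<lambda>\<omega>. U \<omega> * sin (Y \<omega>) * h \<omega>) = expectation (\<lambda>\<omega>. U \<omega> * sin (Y \<omega>)) * expectation h" if "Y \<in> L" for Y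
    using V that L_measurable[OF that] by (intro conjI *) (auto simp: trig_factor_def)
  with BU show ?thesis by (auto simp: trig_factor_def)
qed

text \<open>The detour through sin keeps the argument in the compact interval [-1, 1], where
  polynomial approximation is uniform and the approximants stay bounded.\<close>

lemma trig_factor_continuous_sin:
  assumes V: "trig_factor L h V" and T: "\<theta> \<in> L" and F: "continuous_on {-1..1} F"
  shows "trig_factor L h (\<lambda>\<omega>. V \<omega> * F (sin (\<theta> \<omega>)))"
proof -
  \<comment> \<open>Induction on the polynomial with \<open>V\<close> arbitrary, so that a product
    of two polynomials is handled by applying the induction hypotheses one after the other.\<close>
  have poly: "trig_factor L h V \<Longrightarrow> trig_factor L h (\<lambda>\<omega>. V \<omega> * p (sin (\<theta> \<omega>)))"
    if "real_polynomial_function p" for p V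
    using that
  proof (induction p arbitrary: V)
    case (linear f)
    then obtain c where "f = (\<lambda>x. x * c)" using real_bounded_linear by blast
    with trig_factor_lincomb[OF trig_factor_sin[OF linear(2) T] trig_factor_sin[OF linear(2) T], of c 0]
    show ?case by (simp add: mult_ac)
  next
    case (const c)
    with trig_factor_lincomb[OF const const, of c 0] show ?case by (simp add: mult_ac)
  next
    case (add f g)
    with trig_factor_lincomb[OF add.IH(1)[OF add.prems] add.IH(2)[OF add.prems], of 1 1]
    show ?case by (simp add: algebra_simps)
  next
    case (mult f g)
    with mult.IH(2)[OF mult.IH(1)[OF mult.prems]] show ?case by (simp add: mult_ac)
  qed
  have "\<forall>n. \<exists>p. real_polynomial_function p \<and> (\<forall>x\<in>{-1..1}. \<bar>F x - p x\<bar> < 1 / real (Suc n))"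
    using Stone_Weierstrass_real_polynomial_function[OF _ F] by (metis compact_Icc zero_less_divide_1_iff of_nat_0_less_iff zero_less_Suc)
  then obtain p where p: "\<And>n. real_polynomial_function (p n)"
    and pF: "\<And>n x. x \<in> {-1..1} \<Longrightarrow> \<bar>F x - p n x\<bar> < 1 / real (Suc n)" by metis
  obtain K where K: "\<And>\<omega>. \<bar>V \<omega>\<bar> \<le> K"
    using V unfolding trig_factor_def by blast
  have "bounded (F ` {-1..1})" by (intro compact_imp_bounded compact_continuous_image F) auto
  then obtain B where B: "\<And>x. x \<in> {-1..1} \<Longrightarrow> \<bar>F x\<bar> \<le> B"
    unfolding bounded_iff by (metis imageI real_norm_def)
  show ?thesis
  proof (rule trig_factor_limit[of "\<lambda>n \<omega>. V \<omega> * p n (sin (\<theta> \<omega>))" "K * (B + 1)"])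
    show "trig_factor L h (\<lambda>\<omega>. V \<omega> * p n (sin (\<theta> \<omega>)))" for n by (rule poly[OF p V])
    show "\<bar>V \<omega> * p n (sin (\<theta> \<omega>))\<bar> \<le> K * (B + 1)" for n \<omega>
    proof -
      have "1 / real (Suc n) \<le> 1" by simp
      moreover have "sin (\<theta> \<omega>) \<in> {-1..1}" by simp
      ultimately have "\<bar>p n (sin (\<theta> \<omega>))\<bar> \<le> B + 1"
        using pF[of "sin (\<theta> \<omega>)" n] B[of "sin (\<theta> \<omega>)"] by (smt (verit))
      then show ?thesis unfolding abs_mult by (intro mult_mono K) (use K[of \<omega>] in auto)
    qed
    show "(\<lambda>n. V \<omega> * p n (sin (\<theta> \<omega>))) \<longlonglongrightarrow> V \<omega> * F (sin (\<theta> \<omega>))" for \<omega>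
    proof (intro tendsto_intros Lim_transform_bound[OF _ LIMSEQ_inverse_real_of_nat, THEN LIM_zero_cancel] always_eventually allI)
      show "norm (p n (sin (\<theta> \<omega>)) - F (sin (\<theta> \<omega>))) \<le> norm (inverse (real (Suc n)))" for n
        using pF[of "sin (\<theta> \<omega>)" n] by (simp add: inverse_eq_divide abs_minus_commute)
    qed
  qed
qed

lemma trig_factor_continuous:
  assumes V: "trig_factor L h V" and T: "Y \<in> L" and F: "continuous_on UNIV F"
    and B: "\<And>x. \<bar>F x\<bar> \<le> B"
  shows "trig_factor L h (\<lambda>\<omega>. V \<omega> * F (Y \<omega>))"
proof -
  obtain K where K: "\<And>\<omega>. \<bar>V \<omega>\<bar> \<le> K"
    using V unfolding trig_factor_def by blast
  show ?thesis
  proof (rule trig_factor_limit[of "\<lambda>n \<omega>. V \<omega> * F (real (Suc n) * sin (inverse (real (Suc n)) * Y \<omega>))" "K * B"])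
    show "trig_factor L h (\<lambda>\<omega>. V \<omega> * F (real (Suc n) * sin (inverse (real (Suc n)) * Y \<omega>)))" for n
      by (rule trig_factor_continuous_sin[OF V L_scale[OF T], of "\<lambda>x. F (real (Suc n) * x)"])
        (auto intro!: continuous_intros continuous_on_compose2[OF F])
    show "\<bar>V \<omega> * F (real (Suc n) * sin (inverse (real (Suc n)) * Y \<omega>))\<bar> \<le> K * B" for n \<omega>
      unfolding abs_mult by (intro mult_mono K B) (use K[of \<omega>] in auto)
    show "(\<lambda>n. V \<omega> * F (real (Suc n) * sin (inverse (real (Suc n)) * Y \<omega>))) \<longlonglongrightarrow> V \<omega> * F (Y \<omega>)" for \<omega>
    proof (intro tendsto_intros isCont_tendsto_compose[of _ F])
      show "isCont F (Y \<omega>)" using F by (simp add: continuous_on_eq_continuous_at)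
      have "((\<lambda>t. sin (t * Y \<omega>)) has_real_derivative Y \<omega>) (at 0)"
        by (auto intro!: derivative_eq_intros)
      then have "((\<lambda>t. sin (t * Y \<omega>) / t) \<longlongrightarrow> Y \<omega>) (at 0)"
        by (simp add: DERIV_def)
      moreover have "filterlim (\<lambda>n. inverse (real (Suc n))) (at 0) sequentially"
        using LIMSEQ_inverse_real_of_nat by (auto simp: filterlim_at)
      ultimately have "(\<lambda>n. sin (inverse (real (Suc n)) * Y \<omega>) / inverse (real (Suc n))) \<longlonglongrightarrow> Y \<omega>"
        by (rule filterlim_compose)
      then show "(\<lambda>n. real (Suc n) * sin (inverse (real (Suc n)) * Y \<omega>)) \<longlonglongrightarrow> Y \<omega>"
        by (simp add: field_simps)
    qed
  qed
qed

lemma trig_factor_atMost: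
  assumes V: "trig_factor L h V" and T: "Y \<in> L"
  shows "trig_factor L h (\<lambda>\<omega>. V \<omega> * indicator {..c} (Y \<omega>))"
proof -
  obtain K where K: "\<And>\<omega>. \<bar>V \<omega>\<bar> \<le> K"
    using V unfolding trig_factor_def by blast
  \<comment> \<open>A linear ramp: 1 up to \<open>c\<close>, falling to 0 at \<open>c + 1/n\<close>.
    For n = 0 it is constantly 1, which is harmless for the limit and respects the bound.\<close>
  define F where "F n x = max 0 (min 1 (1 - real n * (x - c)))" for n :: nat and x
  have F01: "0 \<le> F n x" "F n x \<le> 1" for n x by (auto simp: F_def)
  show ?thesis
  proof (rule trig_factor_limit[of "\<lambda>n \<omega>. V \<omega> * F n (Y \<omega>)" "K * 1"])
    show "trig_factor L h (\<lambda>\<omega>. V \<omega> * F n (Y \<omega>))" for n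
      by (rule trig_factor_continuous[OF V T, of _ 1])
        (use F01 in \<open>auto simp: F_def intro!: continuous_intros\<close>)
    show "\<bar>V \<omega> * F n (Y \<omega>)\<bar> \<le> K * 1" for n \<omega>
      unfolding abs_mult by (intro mult_mono K) (use K[of \<omega>] F01 in auto)
    show "(\<lambda>n. V \<omega> * F n (Y \<omega>)) \<longlonglongrightarrow> V \<omega> * indicator {..c} (Y \<omega>)" for \<omega>
    proof (intro tendsto_intros)
      show "(\<lambda>n. F n (Y \<omega>)) \<longlonglongrightarrow> indicator {..c} (Y \<omega>)"
      proof (cases "Y \<omega> \<le> c")
        case True
        have "F n (Y \<omega>) = 1" for n
          using True by (auto simp: F_def min_def max_def mult_le_0_iff)
        then show ?thesis using True by simp
      next
        case False
        have "filterlim (\<lambda>n. real n * (Y \<omega> - c)) at_top sequentially"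
          using False by (intro filterlim_at_top_mult_tendsto_pos[OF tendsto_const _ filterlim_real_sequentially]) auto
        then have "eventually (\<lambda>n. real n * (Y \<omega> - c) \<ge> 1) sequentially"
          by (simp add: filterlim_at_top)
        then have "eventually (\<lambda>n. F n (Y \<omega>) = 0) sequentially"
          by eventually_elim (auto simp: F_def)
        then show ?thesis using False by (simp add: tendsto_eventually)
      qed
    qed
  qed
qed

lemma expectation_halfspaces_mult:
  assumes base: "trig_factor L h (\<lambda>_. 1)"
    and "finite J" "\<And>j. j \<in> J \<Longrightarrow> X j \<in> L" and Z: "(\<lambda>_. 0) \<in> L"
  shows "expectation (\<lambda>\<omega>. (\<Prod>j\<in>J. indicator {..c j} (X j \<omega>)) * h \<omega>) =
         expectation (\<lambda>\<omega>. \<Prod>j\<in>J. indicator {..c j} (X j \<omega>)) * expectation h"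
proof -
  have "trig_factor L h (\<lambda>\<omega>. \<Prod>j\<in>J. indicator {..c j} (X j \<omega>))"
    using assms(2,3)
  proof (induction J rule: finite_induct)
    case empty then show ?case using base by simp
  next
    case (insert j J)
    with trig_factor_atMost[of "\<lambda>\<omega>. \<Prod>j\<in>J. indicator {..c j} (X j \<omega>)" "X j" "c j"]
    show ?case by (simp add: mult_ac)
  qed
  \<comment> \<open>The zero variable of \<open>L\<close> turns cos into 1 and so removes the
    trigonometric factor.\<close>
  then show ?thesis using Z by (force simp: trig_factor_def)
qed

end

section \<open>Independence of past and future noise\<close>

definition noise_sets :: "(real \<times> real) set set" where
  "noise_sets = {A \<in> bounded_borel_sets. A \<subseteq> {0..} \<times> UNIV}"

text \<open>Finite linear combinations as literal functions, with no closure and no almost sure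
  identification. Joint Gaussianity of the noise is thereby available as Gaussianity of each single
  member, and \<open>D\<close> records where the noise is taken from.\<close>

definition gspan :: "((real \<times> real) set \<Rightarrow> 'w \<Rightarrow> real) \<Rightarrow> (real \<times> real) set set \<Rightarrow> ('w \<Rightarrow> real) set" where
  "gspan W D = {Y. \<exists>S c. finite S \<and> S \<subseteq> D \<and> Y = (\<lambda>\<omega>. \<Sum>C\<in>S. c C * W C \<omega>)}"

lemma gspan_mono: "D \<subseteq> D' \<Longrightarrow> gspan W D \<subseteq> gspan W D'"
  unfolding gspan_def by blast

lemma gspan_add:
  assumes "Y \<in> gspan W D" "Z \<in> gspan W D"
  shows "(\<lambda>\<omega>. Y \<omega> + Z \<omega>) \<in> gspan W D"
proof -
  obtain S c where S: "finite S" "S \<subseteq> D" "Y = (\<lambda>\<omega>. \<Sum>C\<in>S. c C * W C \<omega>)"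
    using assms(1) unfolding gspan_def by blast
  obtain S' c' where S': "finite S'" "S' \<subseteq> D" "Z = (\<lambda>\<omega>. \<Sum>C\<in>S'. c' C * W C \<omega>)"
    using assms(2) unfolding gspan_def by blast
  \<comment> \<open>The index sets may overlap; a noise set that occurs in both sums gets the sum of
    its two coefficients.\<close>
  define d where "d C = (if C \<in> S then c C else 0) + (if C \<in> S' then c' C else 0)" for C
  have "Y \<omega> + Z \<omega> = (\<Sum>C\<in>S \<union> S'. d C * W C \<omega>)" for \<omega>
  proof -
    have "(\<Sum>C\<in>S. c C * W C \<omega>) = (\<Sum>C\<in>S \<union> S'. (if C \<in> S then c C else 0) * W C \<omega>)"
      using S S' by (intro sum.mono_neutral_cong_left) auto
    moreover have "(\<Sum>C\<in>S'. c' C * W C \<omega>) = (\<Sum>C\<in>S \<union> S'. (if C \<in> S' then c' C else 0) * W C \<omega>)"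
      using S S' by (intro sum.mono_neutral_cong_left) auto
    ultimately show ?thesis unfolding S(3) S'(3) d_def by (simp add: sum.distrib distrib_right)
  qed
  then show ?thesis unfolding gspan_def using S S'
    by (intro CollectI exI[of _ "S \<union> S'"] exI[of _ d]) auto
qed

lemma gspan_scale:
  assumes "Y \<in> gspan W D"
  shows "(\<lambda>\<omega>. k * Y \<omega>) \<in> gspan W D"
proof -
  obtain S c where S: "finite S" "S \<subseteq> D" "Y = (\<lambda>\<omega>. \<Sum>C\<in>S. c C * W C \<omega>)"
    using assms(1) unfolding gspan_def by blast
  then show ?thesis unfolding gspan_def
    by (intro CollectI exI[of _ S] exI[of _ "\<lambda>C. k * c C"]) (auto simp: sum_distrib_left mult_ac)
qed

lemma gspan_diff:
  "Y \<in> gspan W D \<Longrightarrow> Z \<in> gspan W D \<Longrightarrow> (\<lambda>\<omega>. Y \<omega> - Z \<omega>) \<in> gspan W D"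
  using gspan_add[OF _ gspan_scale[of Z W D "-1"], of Y] by simp

lemma gspan_zero: "(\<lambda>_. 0) \<in> gspan W D"
  unfolding gspan_def by (intro CollectI exI[of _ "{}"]) auto

lemma gspan_base: "C \<in> D \<Longrightarrow> W C \<in> gspan W D"
  unfolding gspan_def by (intro CollectI exI[of _ "{C}"] exI[of _ "\<lambda>_. 1"]) auto

lemma gspan_sum:
  "(\<And>i. i \<in> I \<Longrightarrow> Y i \<in> gspan W D) \<Longrightarrow> (\<lambda>\<omega>. \<Sum>i\<in>I. Y i \<omega>) \<in> gspan W D"
  by (induction I rule: infinite_finite_induct) (auto intro: gspan_zero gspan_add)

text \<open>Larger than \<^const>\<open>noise_filtration\<close>, which only uses rectangles.  It makes
  \<open>W C\<close> measurable at time \<open>a\<close> for every bounded Borel set \<open>C\<close> before time \<open>a\<close>.\<close>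

definition full_filtration ::
    "'w measure \<Rightarrow> ((real \<times> real) set \<Rightarrow> 'w \<Rightarrow> real) \<Rightarrow> real \<Rightarrow> 'w measure" where
  "full_filtration M W a = sigma (space M)
     ({W C -` B \<inter> space M | C B. C \<in> bounded_borel_sets \<and> C \<subseteq> {0..a} \<times> UNIV \<and> B \<in> sets borel} \<union> null_sets M)"

locale white_noise = prob_space M for M :: "'w measure" +
  fixes W :: "(real \<times> real) set \<Rightarrow> 'w \<Rightarrow> real"
  assumes noise: "space_time_white_noise M W"
begin

text \<open>Time \<open>a\<close> itself belongs to the past only. Hence past and future sets are
  disjoint, and every noise set is the disjoint union of a past and a future one.\<close>

abbreviation "past a \<equiv> {C \<in> bounded_borel_sets. C \<subseteq> {0..a} \<times> (UNIV :: real set)}"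
abbreviation "future a \<equiv> {C \<in> noise_sets. C \<subseteq> {a<..} \<times> (UNIV :: real set)}"

lemma past_noise: "past a \<subseteq> noise_sets"
  by (auto simp: noise_sets_def)

lemma gaussian_gspan:
  assumes "Y \<in> gspan W noise_sets"
  shows "centered_gaussian M Y"
  using assms noise
  unfolding space_time_white_noise_def centered_gaussian_family_def gspan_def Let_def noise_sets_def
  by blast

lemma W_gspan: "C \<in> noise_sets \<Longrightarrow> W C \<in> gspan W noise_sets"
  by (rule gspan_base)

lemma gspan_measurable: "Y \<in> gspan W noise_sets \<Longrightarrow> Y \<in> borel_measurable M"
  using gaussian_gspan centered_gaussian_measurable by blast

lemma W_measurable[measurable]: "C \<in> noise_sets \<Longrightarrow> W C \<in> borel_measurable M"
  by (intro gspan_measurable W_gspan)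

lemma covariance: "A \<in> noise_sets \<Longrightarrow> B \<in> noise_sets \<Longrightarrow>
    expectation (\<lambda>\<omega>. W A \<omega> * W B \<omega>) = measure lborel (A \<inter> B)"
  using noise unfolding space_time_white_noise_def noise_sets_def Let_def by blast

lemma integrable_square_gspan:
  assumes "Y \<in> gspan W noise_sets"
  shows "integrable M (\<lambda>\<omega>. (Y \<omega>)\<^sup>2)"
  using centered_gaussian_integrable_power[OF gaussian_gspan[OF assms], of 2] .

lemma integrable_gspan:
  assumes "Y \<in> gspan W noise_sets"
  shows "integrable M Y"
  using centered_gaussian_integrable_power[OF gaussian_gspan[OF assms], of 1] by simp

lemma integrable_mult_square:
  fixes f g :: "'w \<Rightarrow> real"
  assumes [measurable]: "f \<in> borel_measurable M" "g \<in> borel_measurable M"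
    and "integrable M (\<lambda>\<omega>. (f \<omega>)\<^sup>2)" "integrable M (\<lambda>\<omega>. (g \<omega>)\<^sup>2)"
  shows "integrable M (\<lambda>\<omega>. f \<omega> * g \<omega>)"
proof (rule Bochner_Integration.integrable_bound)
  show "integrable M (\<lambda>\<omega>. (f \<omega>)\<^sup>2 + (g \<omega>)\<^sup>2)" using assms by simp
  show "AE \<omega> in M. norm (f \<omega> * g \<omega>) \<le> norm ((f \<omega>)\<^sup>2 + (g \<omega>)\<^sup>2)"
  proof (rule AE_I2)
    fix \<omega>
    have "2 * \<bar>f \<omega> * g \<omega>\<bar> \<le> (f \<omega>)\<^sup>2 + (g \<omega>)\<^sup>2"
      using sum_squares_bound[of "\<bar>f \<omega>\<bar>" "\<bar>g \<omega>\<bar>"] by (simp add: abs_mult)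
    moreover have "0 \<le> \<bar>f \<omega> * g \<omega>\<bar>" by simp
    ultimately show "norm (f \<omega> * g \<omega>) \<le> norm ((f \<omega>)\<^sup>2 + (g \<omega>)\<^sup>2)" by simp
  qed
qed simp

lemma integrable_mult_gspan:
  assumes "Y \<in> gspan W noise_sets" "Z \<in> gspan W noise_sets"
  shows "integrable M (\<lambda>\<omega>. Y \<omega> * Z \<omega>)"
  by (intro integrable_mult_square gspan_measurable integrable_square_gspan assms)

text \<open>The covariance of two noise values is the measure of the intersection, so disjointness
  of the sets passes to orthogonality of the spans by bilinearity.\<close>

lemma gspan_orthogonal:
  assumes Y: "Y \<in> gspan W D1" and Z: "Z \<in> gspan W D2"
    and D: "D1 \<subseteq> noise_sets" "D2 \<subseteq> noise_sets"
    and disj: "\<And>A B. A \<in> D1 \<Longrightarrow> B \<in> D2 \<Longrightarrow> A \<inter> B = {}"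
  shows "expectation (\<lambda>\<omega>. Y \<omega> * Z \<omega>) = 0"
proof -
  obtain S c where S: "finite S" "S \<subseteq> D1" "Y = (\<lambda>\<omega>. \<Sum>C\<in>S. c C * W C \<omega>)"
    using Y unfolding gspan_def by blast
  obtain S' c' where S': "finite S'" "S' \<subseteq> D2" "Z = (\<lambda>\<omega>. \<Sum>C\<in>S'. c' C * W C \<omega>)"
    using Z unfolding gspan_def by blast
  have i: "integrable M (\<lambda>\<omega>. W A \<omega> * W B \<omega>)" if "A \<in> S" "B \<in> S'" for A B
    using that S S' D by (intro integrable_mult_gspan W_gspan) auto
  have "(\<lambda>\<omega>. Y \<omega> * Z \<omega>) = (\<lambda>\<omega>. \<Sum>A\<in>S. \<Sum>B\<in>S'. c A * c' B * (W A \<omega> * W B \<omega>))"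
    unfolding S(3) S'(3) sum_product by (simp add: mult_ac)
  then have "expectation (\<lambda>\<omega>. Y \<omega> * Z \<omega>) = (\<Sum>A\<in>S. \<Sum>B\<in>S'. c A * c' B * expectation (\<lambda>\<omega>. W A \<omega> * W B \<omega>))"
    using i by (simp add: Bochner_Integration.integral_sum)
  also have "\<dots> = 0"
    using S S' D disj by (intro sum.neutral ballI) (simp add: covariance subset_eq)
  finally show ?thesis .
qed

text \<open>\<^locale>\<open>trig_system\<close> is used twice: first with a trigonometric function of \<open>Z\<close>
  as the bounded factor, then with the indicator of a past event.\<close>

lemma halfspaces_independent:
  fixes c :: "(real \<times> real) set \<Rightarrow> real" and d :: real
  assumes Z: "Z \<in> gspan W D2" and D: "D1 \<subseteq> noise_sets" "D2 \<subseteq> noise_sets"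
    and disj: "\<And>A B. A \<in> D1 \<Longrightarrow> B \<in> D2 \<Longrightarrow> A \<inter> B = {}"
    and J: "finite J" "J \<subseteq> D1"
  shows "expectation (\<lambda>\<omega>. (\<Prod>C\<in>J. indicator {..c C} (W C \<omega>)) * indicator {..d} (Z \<omega>)) =
    expectation (\<lambda>\<omega>. \<Prod>C\<in>J. indicator {..c C} (W C \<omega>)) * (expectation (\<lambda>\<omega>. indicator {..d} (Z \<omega>)) :: real)"
proof -
  have sub: "gspan W D1 \<subseteq> gspan W noise_sets" "gspan W D2 \<subseteq> gspan W noise_sets"
    using D by (auto intro: gspan_mono[THEN subsetD])
  have gm: "Y \<in> borel_measurable M" if "Y \<in> gspan W D1 \<or> Y \<in> gspan W D2" for Y
    using that sub gspan_measurable by blast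
  let ?P = "\<lambda>\<omega>. \<Prod>C\<in>J. indicator {..c C} (W C \<omega>) :: real"
  have Pm[measurable]: "?P \<in> borel_measurable M"
    using J D by (intro borel_measurable_prod) (auto intro!: borel_measurable_indicator' W_measurable)
  have Pb: "\<bar>?P \<omega>\<bar> \<le> 1" for \<omega>
    by (auto simp: abs_prod intro!: prod_le_1)
  \<comment> \<open>Orthogonality gives Pythagoras. The mean of a cosine of a Gaussian variable
    depends on the variance only, so this is all that enters about joint laws.\<close>
  have pyth: "expectation (\<lambda>\<omega>. (Y \<omega> + U \<omega>)\<^sup>2) = expectation (\<lambda>\<omega>. (Y \<omega>)\<^sup>2) + expectation (\<lambda>\<omega>. (U \<omega>)\<^sup>2)"
    if "Y \<in> gspan W D1" "U \<in> gspan W D2" for Y U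
  proof -
    have g: "Y \<in> gspan W noise_sets" "U \<in> gspan W noise_sets" using that sub by auto
    have "expectation (\<lambda>\<omega>. (Y \<omega> + U \<omega>)\<^sup>2) = expectation (\<lambda>\<omega>. (Y \<omega>)\<^sup>2 + (U \<omega>)\<^sup>2 + 2 * (Y \<omega> * U \<omega>))"
      by (simp add: power2_sum mult.assoc)
    also have "\<dots> = expectation (\<lambda>\<omega>. (Y \<omega>)\<^sup>2) + expectation (\<lambda>\<omega>. (U \<omega>)\<^sup>2)"
      using gspan_orthogonal[OF that D disj] integrable_square_gspan[OF g(1)]
        integrable_square_gspan[OF g(2)] integrable_mult_gspan[OF g] by simp
    finally show ?thesis .
  qed
  have sc: "expectation (\<lambda>\<omega>. cos (Y \<omega>) * cos (U \<omega>)) = expectation (\<lambda>\<omega>. cos (Y \<omega>)) * expectation (\<lambda>\<omega>. cos (U \<omega>))"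
     "expectation (\<lambda>\<omega>. sin (Y \<omega>) * cos (U \<omega>)) = expectation (\<lambda>\<omega>. sin (Y \<omega>)) * expectation (\<lambda>\<omega>. cos (U \<omega>))"
     "expectation (\<lambda>\<omega>. cos (Y \<omega>) * sin (U \<omega>)) = expectation (\<lambda>\<omega>. cos (Y \<omega>)) * expectation (\<lambda>\<omega>. sin (U \<omega>))"
     "expectation (\<lambda>\<omega>. sin (Y \<omega>) * sin (U \<omega>)) = expectation (\<lambda>\<omega>. sin (Y \<omega>)) * expectation (\<lambda>\<omega>. sin (U \<omega>))"
    if Y: "Y \<in> gspan W D1" and U: "U \<in> gspan W D2" for Y U
  proof -
    have g: "Y \<in> gspan W noise_sets" "U \<in> gspan W noise_sets" using Y U sub by auto
    have m: "(\<lambda>\<omega>. - U \<omega>) \<in> gspan W D2" using gspan_scale[OF U, of "-1"] by simp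
    have g2: "(\<lambda>\<omega>. Y \<omega> + U \<omega>) \<in> gspan W noise_sets" "(\<lambda>\<omega>. Y \<omega> - U \<omega>) \<in> gspan W noise_sets"
      by (intro gspan_add gspan_diff g)+
    note [measurable] = gspan_measurable[OF g(1)] gspan_measurable[OF g(2)]
    note G = gaussian_gspan[OF g(1)] gaussian_gspan[OF g(2)] gaussian_gspan[OF g2(1)] gaussian_gspan[OF g2(2)]
    note C = G[THEN centered_gaussian_cos] G[THEN centered_gaussian_sin]
    have pm: "expectation (\<lambda>\<omega>. (Y \<omega> - U \<omega>)\<^sup>2) = expectation (\<lambda>\<omega>. (Y \<omega>)\<^sup>2) + expectation (\<lambda>\<omega>. (U \<omega>)\<^sup>2)"
      using pyth[OF Y m] by simp
    have i: "integrable M (\<lambda>\<omega>. cos (Y \<omega> + U \<omega>))" "integrable M (\<lambda>\<omega>. cos (Y \<omega> - U \<omega>))"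
      "integrable M (\<lambda>\<omega>. sin (Y \<omega> + U \<omega>))" "integrable M (\<lambda>\<omega>. sin (Y \<omega> - U \<omega>))"
      by (auto intro!: integrable_const_bound[of _ 1])
    \<comment> \<open>\<open>Y + U\<close> and \<open>Y - U\<close> have the same variance, so their
      cosines have equal means. In the product-to-sum formulas this makes the mean of sin Y sin U
      vanish and leaves the product of the two exponentials for cos Y cos U.\<close>
    have e: "expectation (\<lambda>\<omega>. cos (Y \<omega> + U \<omega>)) = expectation (\<lambda>\<omega>. cos (Y \<omega> - U \<omega>))"
      using C(3,4) by (simp add: pm pyth[OF Y U])
    have "expectation (\<lambda>\<omega>. cos (Y \<omega>) * cos (U \<omega>)) = expectation (\<lambda>\<omega>. cos (Y \<omega> + U \<omega>))"
      unfolding cos_times_cos using i e by simp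
    also have "\<dots> = expectation (\<lambda>\<omega>. cos (Y \<omega>)) * expectation (\<lambda>\<omega>. cos (U \<omega>))"
      unfolding C pyth[OF Y U] exp_add[symmetric] by (simp add: field_simps)
    finally show "expectation (\<lambda>\<omega>. cos (Y \<omega>) * cos (U \<omega>)) = expectation (\<lambda>\<omega>. cos (Y \<omega>)) * expectation (\<lambda>\<omega>. cos (U \<omega>))" .
    show "expectation (\<lambda>\<omega>. sin (Y \<omega>) * cos (U \<omega>)) = expectation (\<lambda>\<omega>. sin (Y \<omega>)) * expectation (\<lambda>\<omega>. cos (U \<omega>))"
      unfolding sin_times_cos using i C by simp
    show "expectation (\<lambda>\<omega>. cos (Y \<omega>) * sin (U \<omega>)) = expectation (\<lambda>\<omega>. cos (Y \<omega>)) * expectation (\<lambda>\<omega>. sin (U \<omega>))"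
      unfolding cos_times_sin using i C by simp
    show "expectation (\<lambda>\<omega>. sin (Y \<omega>) * sin (U \<omega>)) = expectation (\<lambda>\<omega>. sin (Y \<omega>)) * expectation (\<lambda>\<omega>. sin (U \<omega>))"
      unfolding sin_times_sin using i C e by simp
  qed
  have ts1: "trig_system M (gspan W D1) h"
    if "h \<in> borel_measurable M" "\<And>\<omega>. \<bar>h \<omega>\<bar> \<le> 1" for h
    using that by unfold_locales (auto intro: gm gspan_add gspan_scale)
  have P: "expectation (\<lambda>\<omega>. ?P \<omega> * cos (U \<omega>)) = expectation ?P * expectation (\<lambda>\<omega>. cos (U \<omega>))"
    "expectation (\<lambda>\<omega>. ?P \<omega> * sin (U \<omega>)) = expectation ?P * expectation (\<lambda>\<omega>. sin (U \<omega>))"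
    if U: "U \<in> gspan W D2" for U
  proof -
    have [measurable]: "U \<in> borel_measurable M" using U gm by auto
    have 1: "trig_factor (gspan W D1) (\<lambda>\<omega>. cos (U \<omega>)) (\<lambda>_. 1)"
      "trig_factor (gspan W D1) (\<lambda>\<omega>. sin (U \<omega>)) (\<lambda>_. 1)"
      using sc[OF _ U] by (auto simp: trig_factor_def)
    show "expectation (\<lambda>\<omega>. ?P \<omega> * cos (U \<omega>)) = expectation ?P * expectation (\<lambda>\<omega>. cos (U \<omega>))"
      by (rule trig_system.expectation_halfspaces_mult[OF ts1 1(1) J(1)])
        (use J in \<open>auto intro: gspan_base gspan_zero\<close>)
    show "expectation (\<lambda>\<omega>. ?P \<omega> * sin (U \<omega>)) = expectation ?P * expectation (\<lambda>\<omega>. sin (U \<omega>))"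
      by (rule trig_system.expectation_halfspaces_mult[OF ts1 1(2) J(1)])
        (use J in \<open>auto intro: gspan_base gspan_zero\<close>)
  qed
  have ts2: "trig_system M (gspan W D2) ?P"
    using Pb Pm by unfold_locales (auto intro: gm gspan_add gspan_scale)
  have "trig_factor (gspan W D2) ?P (\<lambda>_. 1)"
    using P by (auto simp: trig_factor_def mult.commute)
  from trig_system.expectation_halfspaces_mult[OF ts2 this, of "{()}" "\<lambda>_. Z" "\<lambda>_. d"] Z
  show ?thesis by (simp add: gspan_zero mult.commute)
qed

section \<open>From half-spaces to the generated sigma-algebras\<close>

lemma full_filtration_space[simp]: "space (full_filtration M W a) = space M"
  by (simp add: full_filtration_def space_measure_of_conv)

lemma full_filtration_generator_sub:
  "{W C -` B \<inter> space M | C B. C \<in> past a \<and> B \<in> sets borel} \<union> null_sets M \<subseteq> sets M"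
  using past_noise[of a] by (auto intro!: measurable_sets[OF W_measurable] simp: subset_eq)

lemma full_filtration_sets:
  "sets (full_filtration M W a) = sigma_sets (space M)
     ({W C -` B \<inter> space M | C B. C \<in> past a \<and> B \<in> sets borel} \<union> null_sets M)"
  unfolding full_filtration_def
  by (subst sets_measure_of) (use full_filtration_generator_sub[of a] sets.space_closed[of M] in \<open>auto simp: conj_assoc\<close>)

lemma full_filtration_sub: "sets (full_filtration M W a) \<subseteq> sets M"
  unfolding full_filtration_sets by (rule sets.sigma_sets_subset[OF full_filtration_generator_sub])

lemma full_filtration_measurable_sub:
  "f \<in> borel_measurable (full_filtration M W a) \<Longrightarrow> f \<in> borel_measurable M"
  using full_filtration_sub[of a] by (auto simp: measurable_def)

lemma full_filtration_mono:
  assumes "a \<le> b" shows "sets (full_filtration M W a) \<subseteq> sets (full_filtration M W b)"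
proof -
  have "past a \<subseteq> past b" using assms by force
  then show ?thesis unfolding full_filtration_sets by (intro sigma_sets_mono') blast
qed

lemma full_filtration_measurable_mono:
  "f \<in> borel_measurable (full_filtration M W a) \<Longrightarrow> a \<le> b \<Longrightarrow> f \<in> borel_measurable (full_filtration M W b)"
  using full_filtration_mono[of a b] by (auto simp: measurable_def)

lemma noise_filtration_sub:
  "sets (noise_filtration M W a) \<subseteq> sets (full_filtration M W a)"
proof -
  let ?G = "{W ({0..r} \<times> A) -` B \<inter> space M | r A B.
         0 \<le> r \<and> r \<le> a \<and> A \<in> bounded_borel_sets \<and> B \<in> sets borel} \<union> null_sets M"
  have "{0..r} \<times> A \<in> past a" if "r \<le> a" "A \<in> bounded_borel_sets" for r and A :: "real set"
    using that by (auto simp: bounded_borel_sets_def intro!: bounded_Times borel_Times)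
  then have "?G \<subseteq> {W C -` B \<inter> space M | C B. C \<in> past a \<and> B \<in> sets borel} \<union> null_sets M" (is "_ \<subseteq> ?H")
    by blast
  moreover from this have "?G \<subseteq> Pow (space M)"
    using full_filtration_generator_sub[of a] sets.space_closed[of M] by blast
  ultimately show ?thesis
    unfolding full_filtration_sets noise_filtration_def by (simp add: sigma_sets_mono')
qed

lemma noise_filtration_measurable:
  "f \<in> borel_measurable (noise_filtration M W a) \<Longrightarrow> f \<in> borel_measurable (full_filtration M W a)"
  using noise_filtration_sub[of a]
  by (auto simp: measurable_def noise_filtration_def space_measure_of_conv)

lemma W_full_filtration: "C \<in> past a \<Longrightarrow> W C \<in> borel_measurable (full_filtration M W a)"
  by (rule measurableI) (auto simp: full_filtration_sets intro!: sigma_sets.Basic)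

lemma gspan_full_filtration:
  "Y \<in> gspan W (past a) \<Longrightarrow> Y \<in> borel_measurable (full_filtration M W a)"
  unfolding gspan_def by (auto intro!: borel_measurable_sum borel_measurable_times W_full_filtration)

text \<open>Two pi-systems: finite intersections of events \<open>W C \<le> c\<close> for past sets
  together with the null sets, and the events \<open>Z \<le> d\<close>. On them independence is
  \<open>halfspaces_independent\<close>, and it extends to the generated sigma-algebras.\<close>

lemma full_filtration_independent:
  fixes X :: "'w \<Rightarrow> real"
  assumes X: "X \<in> borel_measurable (full_filtration M W a)" and Z: "Z \<in> gspan W (future a)"
  shows "indep_var borel X borel Z"
proof -
  \<comment> \<open>Null sets are members because the filtration is augmented; they do not spoil
    stability under intersection, and independence is trivial on them.\<close>
  define P where "P = {E \<in> sets M. E \<in> null_sets M \<or>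
    (\<exists>J c. finite J \<and> J \<subseteq> past a \<and> E = {\<omega> \<in> space M. \<forall>C\<in>J. W C \<omega> \<le> c C})}"
  define Q where "Q = range (\<lambda>d. {\<omega> \<in> space M. Z \<omega> \<le> d})"
  have D: "past a \<subseteq> noise_sets" "future a \<subseteq> noise_sets" using past_noise by auto
  have disj: "A \<inter> B = {}" if "A \<in> past a" "B \<in> future a" for A B
    using that by fastforce
  have Zg: "Z \<in> gspan W noise_sets" using Z gspan_mono[OF D(2)] by auto
  have Zm[measurable]: "Z \<in> borel_measurable M" using gspan_measurable[OF Zg] .
  have Pint: "Int_stable P"
  proof (rule Int_stableI)
    fix A B assume AB: "A \<in> P" "B \<in> P"
    then have s: "A \<in> sets M" "B \<in> sets M" by (auto simp: P_def)
    show "A \<inter> B \<in> P"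
    proof (cases "A \<in> null_sets M \<or> B \<in> null_sets M")
      case True
      then have "A \<inter> B \<in> null_sets M" using s by (auto intro: null_set_Int1 null_set_Int2)
      then show ?thesis using s by (auto simp: P_def)
    next
      case False
      then obtain J c J' c' where J: "finite J" "J \<subseteq> past a" "A = {\<omega> \<in> space M. \<forall>C\<in>J. W C \<omega> \<le> c C}"
        and J': "finite J'" "J' \<subseteq> past a" "B = {\<omega> \<in> space M. \<forall>C\<in>J'. W C \<omega> \<le> c' C}"
        using AB by (auto simp: P_def)
      \<comment> \<open>A noise set that constrains both events keeps the smaller threshold.\<close>
      define d where "d C = (if C \<in> J \<and> C \<in> J' then min (c C) (c' C) else if C \<in> J then c C else c' C)" for C
      have e: "A \<inter> B = {\<omega> \<in> space M. \<forall>C\<in>J \<union> J'. W C \<omega> \<le> d C}"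
        unfolding J J' d_def by (auto split: if_splits)
      have "finite (J \<union> J')" "J \<union> J' \<subseteq> past a" using J J' by auto
      with e have "\<exists>J c. finite J \<and> J \<subseteq> past a \<and> A \<inter> B = {\<omega> \<in> space M. \<forall>C\<in>J. W C \<omega> \<le> c C}"
        by blast
      then show ?thesis using sets.Int[OF s] unfolding P_def by blast
    qed
  qed
  have Qint: "Int_stable Q"
  proof (rule Int_stableI)
    fix A B assume "A \<in> Q" "B \<in> Q"
    then obtain d d' where "A = {\<omega> \<in> space M. Z \<omega> \<le> d}" "B = {\<omega> \<in> space M. Z \<omega> \<le> d'}" by (auto simp: Q_def)
    then have "A \<inter> B = {\<omega> \<in> space M. Z \<omega> \<le> min d d'}" by auto
    then show "A \<inter> B \<in> Q" unfolding Q_def by (rule image_eqI[OF _ UNIV_I])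
  qed
  have PQ: "indep_set P Q"
  proof (rule indep_setI)
    show "P \<subseteq> events" by (auto simp: P_def)
    show "Q \<subseteq> events" by (auto simp: Q_def)
    fix A B assume A: "A \<in> P" and B: "B \<in> Q"
    obtain d where d: "B = {\<omega> \<in> space M. Z \<omega> \<le> d}" using B by (auto simp: Q_def)
    have s: "A \<in> sets M" "B \<in> sets M" using A d by (auto simp: P_def)
    show "prob (A \<inter> B) = prob A * prob B"
    proof (cases "A \<in> null_sets M")
      case True
      then have "A \<inter> B \<in> null_sets M" using s by (auto intro: null_set_Int2)
      then show ?thesis using True by (simp add: measure_def null_setsD1)
    next
      case False
      then obtain J c where J: "finite J" "J \<subseteq> past a" and Ae: "A = {\<omega> \<in> space M. \<forall>C\<in>J. W C \<omega> \<le> c C}"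
        using A by (auto simp: P_def)
      have ind: "(\<Prod>C\<in>J. indicator {..c C} (W C \<omega>)) = (indicator A \<omega> :: real)" if "\<omega> \<in> space M" for \<omega>
        using J(1) that unfolding Ae by (induction J rule: finite_induct) (auto simp: indicator_def)
      have indB: "indicator {..d} (Z \<omega>) = (indicator B \<omega> :: real)" if "\<omega> \<in> space M" for \<omega>
        using that unfolding d by (auto simp: indicator_def)
      have "expectation (\<lambda>\<omega>. indicator A \<omega> * indicator B \<omega> :: real) =
          expectation (\<lambda>\<omega>. (\<Prod>C\<in>J. indicator {..c C} (W C \<omega>)) * indicator {..d} (Z \<omega>))"
        by (intro Bochner_Integration.integral_cong refl) (simp add: ind indB)
      also have "\<dots> = expectation (\<lambda>\<omega>. \<Prod>C\<in>J. indicator {..c C} (W C \<omega>)) * (expectation (\<lambda>\<omega>. indicator {..d} (Z \<omega>)))"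
        by (rule halfspaces_independent[OF Z D disj J])
      also have "expectation (\<lambda>\<omega>. \<Prod>C\<in>J. indicator {..c C} (W C \<omega>) :: real) = expectation (indicator A)"
        by (intro Bochner_Integration.integral_cong refl) (simp add: ind)
      also have "expectation (\<lambda>\<omega>. indicator {..d} (Z \<omega>) :: real) = expectation (indicator B)"
        by (intro Bochner_Integration.integral_cong refl) (simp add: indB)
      finally have "expectation (\<lambda>\<omega>. indicator A \<omega> * indicator B \<omega>) = expectation (indicator A) * (expectation (indicator B) :: real)" .
      then show ?thesis using s by (simp add: indicator_inter_arith[symmetric])
    qed
  qed
  have 1: "indep_set (sigma_sets (space M) P) (sigma_sets (space M) Q)"
    by (rule indep_set_sigma_sets[OF PQ Pint Qint])
  have PM: "P \<subseteq> Pow (space M)" "Q \<subseteq> Pow (space M)"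
    using sets.space_closed[of M] by (auto simp: P_def Q_def)
  \<comment> \<open>Preimages of half-lines under \<open>W C\<close> generate the preimages of all
    Borel sets, so \<open>P\<close> generates at least the filtration.\<close>
  have FP: "sets (full_filtration M W a) \<subseteq> sigma_sets (space M) P"
    unfolding full_filtration_sets
  proof (intro sigma_sets_mono subsetI, elim UnE)
    fix E assume "E \<in> null_sets M" then show "E \<in> sigma_sets (space M) P"
      by (intro sigma_sets.Basic) (auto simp: P_def)
  next
    fix E assume "E \<in> {W C -` B \<inter> space M | C B. C \<in> past a \<and> B \<in> sets borel}"
    then obtain C B where C: "C \<in> past a" "B \<in> sets borel" "E = W C -` B \<inter> space M" by blast
    have "{\<omega> \<in> space M. W C \<omega> \<le> d} \<in> P" for d
    proof -
      have "C \<in> noise_sets" using C D by blast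
      then have "{\<omega> \<in> space M. W C \<omega> \<le> d} \<in> sets M" by measurable
      moreover have "\<exists>J c. finite J \<and> J \<subseteq> past a \<and> {\<omega> \<in> space M. W C \<omega> \<le> d} = {\<omega> \<in> space M. \<forall>C\<in>J. W C \<omega> \<le> c C}"
        by (rule exI[of _ "{C}"], rule exI[of _ "\<lambda>_. d"]) (use C in simp)
      ultimately show ?thesis unfolding P_def by (intro CollectI conjI disjI2)
    qed
    then have "W C \<in> borel_measurable (sigma (space M) P)"
      unfolding borel_measurable_iff_le using PM by (simp add: space_measure_of_conv)
    from measurable_sets[OF this C(2)] show "E \<in> sigma_sets (space M) P"
      using PM C by (simp add: space_measure_of_conv)
  qed
  have Xm: "X \<in> borel_measurable M" by (rule full_filtration_measurable_sub[OF X])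
  have "Z \<in> borel_measurable (sigma (space M) Q)"
    unfolding borel_measurable_iff_le using PM by (auto simp: space_measure_of_conv Q_def)
  then have ZQ: "Z -` B \<inter> space M \<in> sigma_sets (space M) Q" if "B \<in> sets borel" for B
    using measurable_sets[OF _ that, of Z "sigma (space M) Q"] PM by (simp add: space_measure_of_conv)
  have XP: "X -` B \<inter> space M \<in> sigma_sets (space M) P" if "B \<in> sets borel" for B
    using measurable_sets[OF X that] FP by auto
  have "indep_set (sigma_sets (space M) {X -` A \<inter> space M | A. A \<in> sets borel})
     (sigma_sets (space M) {Z -` A \<inter> space M | A. A \<in> sets borel})"
    unfolding indep_set_def
  proof (rule indep_sets_mono_sets[OF 1[unfolded indep_set_def]])
    fix b :: bool
    have "sigma_sets (space M) {X -` A \<inter> space M | A. A \<in> sets borel} \<subseteq> sigma_sets (space M) P"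
      "sigma_sets (space M) {Z -` A \<inter> space M | A. A \<in> sets borel} \<subseteq> sigma_sets (space M) Q"
      using XP ZQ by (auto intro!: sigma_sets_mono)
    then show "case_bool (sigma_sets (space M) {X -` A \<inter> space M | A. A \<in> sets borel})
          (sigma_sets (space M) {Z -` A \<inter> space M | A. A \<in> sets borel}) b
         \<subseteq> case_bool (sigma_sets (space M) P) (sigma_sets (space M) Q) b"
      by (cases b) auto
  qed
  then show ?thesis unfolding indep_var_eq using Xm by auto
qed

text \<open>The form in which conditioning on the past is used: a factor known at time
  \<open>a\<close> comes out of the mean, for a function of one future Gaussian variable. Products
  of two future variables are reduced to this by polarisation.\<close>

lemma expectation_past_future:
  fixes X :: "'w \<Rightarrow> real" and f :: "real \<Rightarrow> real"
  assumes "X \<in> borel_measurable (full_filtration M W a)" "Z \<in> gspan W (future a)"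
    and [measurable]: "f \<in> borel_measurable borel" and "integrable M X" "integrable M (\<lambda>\<omega>. f (Z \<omega>))"
  shows "integrable M (\<lambda>\<omega>. X \<omega> * f (Z \<omega>))"
    and "expectation (\<lambda>\<omega>. X \<omega> * f (Z \<omega>)) = expectation X * expectation (\<lambda>\<omega>. f (Z \<omega>))"
proof -
  have "indep_var borel ((\<lambda>x. x) \<circ> X) borel (f \<circ> Z)"
    by (rule indep_var_compose[OF full_filtration_independent[OF assms(1,2)]]) auto
  then have "indep_var borel X borel (\<lambda>\<omega>. f (Z \<omega>))" by (simp add: comp_def)
  from indep_var_lebesgue_integral[OF this assms(4,5)] indep_var_integrable[OF this assms(4,5)]
  show "integrable M (\<lambda>\<omega>. X \<omega> * f (Z \<omega>))"
    "expectation (\<lambda>\<omega>. X \<omega> * f (Z \<omega>)) = expectation X * expectation (\<lambda>\<omega>. f (Z \<omega>))" by auto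
qed

end

section \<open>The Walsh isometry\<close>

lemma measurable_fst_snd_lborel[measurable]:
  "(\<lambda>z. fst (snd z)) \<in> borel_measurable (N \<Otimes>\<^sub>M (lborel :: (real \<times> real) measure))"
  "(\<lambda>z. snd (snd z)) \<in> borel_measurable (N \<Otimes>\<^sub>M (lborel :: (real \<times> real) measure))"
  by (rule measurable_compose[OF measurable_snd], simp add: borel_prod[symmetric])+

context white_noise begin

text \<open>Step integrands in which \<open>C\<close> is any bounded Borel set after time
  \<open>a\<close>, whereas \<open>simple_field\<close> only has rectangles. The level sets of the
  approximate kernel need this generality.\<close>

definition elementary :: "(('w \<Rightarrow> real) \<times> real \<times> (real \<times> real) set) list \<Rightarrow> bool" where
  "elementary gs \<longleftrightarrow> (\<forall>(X, a, C) \<in> set gs. X \<in> borel_measurable (full_filtration M W a) \<and>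
     (\<exists>K. \<forall>\<omega>\<in>space M. \<bar>X \<omega>\<bar> \<le> K) \<and> C \<in> future a)"

definition elementary_eval :: "(('w \<Rightarrow> real) \<times> real \<times> (real \<times> real) set) list \<Rightarrow> 'w \<Rightarrow> real \<times> real \<Rightarrow> real" where
  "elementary_eval gs \<omega> p = (\<Sum>(X, a, C)\<leftarrow>gs. X \<omega> * indicator C p)"

definition elementary_integral :: "(('w \<Rightarrow> real) \<times> real \<times> (real \<times> real) set) list \<Rightarrow> 'w \<Rightarrow> real" where
  "elementary_integral gs \<omega> = (\<Sum>(X, a, C)\<leftarrow>gs. X \<omega> * W C \<omega>)"

lemma noise_sets_Int: "C \<in> noise_sets \<Longrightarrow> D \<in> sets borel \<Longrightarrow> C \<inter> D \<in> noise_sets"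
  by (auto simp: noise_sets_def bounded_borel_sets_def intro: bounded_subset)

lemma noise_sets_borel: "C \<in> noise_sets \<Longrightarrow> C \<in> sets borel"
  by (auto simp: noise_sets_def bounded_borel_sets_def)

lemma noise_sets_finite: "C \<in> noise_sets \<Longrightarrow> emeasure lborel C < \<infinity>"
  using emeasure_bounded_finite[of C] by (auto simp: noise_sets_def bounded_borel_sets_def)

text \<open>Additivity is not among the axioms of the noise; it follows from the covariance, because
  expanding the square of the defect leaves only measures that cancel.\<close>

lemma noise_additive:
  assumes C: "C \<in> noise_sets" "D \<in> noise_sets" "C \<inter> D = {}" "C \<union> D \<in> noise_sets"
  shows "AE \<omega> in M. W (C \<union> D) \<omega> = W C \<omega> + W D \<omega>"
proof -
  let ?w = "\<lambda>\<omega>. W (C \<union> D) \<omega> - W C \<omega> - W D \<omega>"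
  have [measurable]: "W C \<in> borel_measurable M" "W D \<in> borel_measurable M" "W (C \<union> D) \<in> borel_measurable M"
    using C by auto
  have i: "integrable M (\<lambda>\<omega>. W A \<omega> * W B \<omega>)" if "A \<in> noise_sets" "B \<in> noise_sets" for A B
    using that by (intro integrable_mult_gspan W_gspan)
  have m: "measure lborel (C \<union> D) = measure lborel C + measure lborel D"
    using C noise_sets_finite[OF C(1)] noise_sets_finite[OF C(2)] noise_sets_borel
    by (intro measure_Union) auto
  have "?w \<omega> ^ 2 = W (C \<union> D) \<omega> * W (C \<union> D) \<omega> + W C \<omega> * W C \<omega> + W D \<omega> * W D \<omega>
      + 2 * (W C \<omega> * W D \<omega>) - 2 * (W (C \<union> D) \<omega> * W C \<omega>) - 2 * (W (C \<union> D) \<omega> * W D \<omega>)" for \<omega>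
    by (simp add: power2_eq_square algebra_simps)
  then have e: "(\<lambda>\<omega>. ?w \<omega> ^ 2) = (\<lambda>\<omega>. W (C \<union> D) \<omega> * W (C \<union> D) \<omega> + W C \<omega> * W C \<omega> + W D \<omega> * W D \<omega>
      + 2 * (W C \<omega> * W D \<omega>) - 2 * (W (C \<union> D) \<omega> * W C \<omega>) - 2 * (W (C \<union> D) \<omega> * W D \<omega>))" by blast
  have "expectation (\<lambda>\<omega>. ?w \<omega> ^ 2) = 0"
    unfolding e using C m by (simp add: i covariance Int_absorb1 Int_absorb2)
  moreover have "integrable M (\<lambda>\<omega>. ?w \<omega> ^ 2)"
    unfolding e using C by (intro Bochner_Integration.integrable_add Bochner_Integration.integrable_diff integrable_mult_right i)
  ultimately have "AE \<omega> in M. ?w \<omega> ^ 2 = 0"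
    by (subst (asm) integral_nonneg_eq_0_iff_AE) auto
  then show ?thesis by eventually_elim simp
qed

lemma integrable_bounded_mult:
  fixes X f :: "'w \<Rightarrow> real"
  assumes X[measurable]: "X \<in> borel_measurable M" and B: "\<And>\<omega>. \<omega> \<in> space M \<Longrightarrow> \<bar>X \<omega>\<bar> \<le> K"
    and f: "integrable M f"
  shows "integrable M (\<lambda>\<omega>. X \<omega> * f \<omega>)"
proof (rule Bochner_Integration.integrable_bound[of _ "\<lambda>\<omega>. K * f \<omega>"])
  show "AE \<omega> in M. norm (X \<omega> * f \<omega>) \<le> norm (K * f \<omega>)"
  proof (rule AE_I2)
    fix \<omega> assume "\<omega> \<in> space M"
    then have "\<bar>X \<omega>\<bar> \<le> \<bar>K\<bar>" using B[of \<omega>] by simp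
    then show "norm (X \<omega> * f \<omega>) \<le> norm (K * f \<omega>)" by (simp add: abs_mult mult_right_mono)
  qed
qed (use f in auto)

lemma integrable_square_bounded_gspan:
  fixes X :: "'w \<Rightarrow> real"
  assumes X[measurable]: "X \<in> borel_measurable M" and B: "\<And>\<omega>. \<omega> \<in> space M \<Longrightarrow> \<bar>X \<omega>\<bar> \<le> K"
    and Z: "Z \<in> gspan W noise_sets"
  shows "integrable M (\<lambda>\<omega>. (X \<omega> * Z \<omega>)\<^sup>2)"
proof -
  have "integrable M (\<lambda>\<omega>. (X \<omega>)\<^sup>2 * (Z \<omega>)\<^sup>2)"
  proof (rule integrable_bounded_mult[of _ "K\<^sup>2"])
    show "\<bar>(X \<omega>)\<^sup>2\<bar> \<le> K\<^sup>2" if "\<omega> \<in> space M" for \<omega>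
      using power_mono[OF B[OF that], of 2] by simp
  qed (auto intro: integrable_square_gspan Z)
  then show ?thesis by (simp add: power_mult_distrib)
qed

text \<open>Cut \<open>C\<close> at the later time \<open>b\<close>. The part before
  \<open>b\<close> is known at time \<open>b\<close>, and the centred factor \<open>W D\<close>
  annihilates it; the part after \<open>b\<close> is paired with \<open>W D\<close>, and the factor
  \<open>X Y\<close> known at \<open>b\<close> comes out of the mean.\<close>

lemma elementary_pair_ordered:
  fixes X Y :: "'w \<Rightarrow> real"
  assumes X: "X \<in> borel_measurable (full_filtration M W a)" "\<And>\<omega>. \<omega> \<in> space M \<Longrightarrow> \<bar>X \<omega>\<bar> \<le> K" "C \<in> future a"
    and Y: "Y \<in> borel_measurable (full_filtration M W b)" "\<And>\<omega>. \<omega> \<in> space M \<Longrightarrow> \<bar>Y \<omega>\<bar> \<le> L" "D \<in> future b"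
    and ab: "a \<le> b"
  shows "expectation (\<lambda>\<omega>. (X \<omega> * W C \<omega>) * (Y \<omega> * W D \<omega>)) = expectation (\<lambda>\<omega>. X \<omega> * Y \<omega>) * measure lborel (C \<inter> D)"
proof -
  note [measurable] = full_filtration_measurable_sub[OF X(1)] full_filtration_measurable_sub[OF Y(1)]
  define C1 where "C1 = C \<inter> ({..b} \<times> UNIV)"
  define C2 where "C2 = C \<inter> ({b<..} \<times> UNIV)"
  have Cn: "C \<in> noise_sets" "D \<in> noise_sets" using X Y by auto
  have C1n: "C1 \<in> noise_sets" "C2 \<in> noise_sets"
    unfolding C1_def C2_def by (intro noise_sets_Int Cn borel_Times; simp)+
  have CU: "C = C1 \<union> C2" "C1 \<inter> C2 = {}" unfolding C1_def C2_def by auto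
  have C1p: "C1 \<in> past b" using C1n(1) by (auto simp: noise_sets_def C1_def)
  have C2f: "C2 \<in> future b" using C1n(2) by (auto simp: C2_def)
  have CD: "C2 \<inter> D = C \<inter> D" using Y(3) by (auto simp: C2_def)
  note [measurable] = W_measurable[OF Cn(1)] W_measurable[OF Cn(2)] W_measurable[OF C1n(1)] W_measurable[OF C1n(2)]
  have Xb: "X \<in> borel_measurable (full_filtration M W b)"
    by (rule full_filtration_measurable_mono[OF X(1) ab])
  have XY: "(\<lambda>\<omega>. X \<omega> * Y \<omega>) \<in> borel_measurable (full_filtration M W b)"
    using Xb Y(1) by measurable
  have XYb: "\<bar>X \<omega> * Y \<omega>\<bar> \<le> K * L" if "\<omega> \<in> space M" for \<omega>
    unfolding abs_mult using X(2)[OF that] Y(2)[OF that] by (intro mult_mono) auto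
  have XYi: "integrable M (\<lambda>\<omega>. X \<omega> * Y \<omega>)"
    by (rule integrable_const_bound[of _ "K * L"]) (use XYb in auto)
  note bm = integrable_bounded_mult[where X="\<lambda>\<omega>. X \<omega> * Y \<omega>", OF _ XYb]
  have DG: "W D \<in> gspan W (future b)" "W C2 \<in> gspan W (future b)"
    using Y(3) C2f by (auto intro: gspan_base)
  have G: "W C1 \<in> gspan W noise_sets" "W C2 \<in> gspan W noise_sets" "W D \<in> gspan W noise_sets"
    using C1n Cn by (auto intro: W_gspan)
  have V: "integrable M (\<lambda>\<omega>. X \<omega> * Y \<omega> * W C1 \<omega>)"
    by (intro bm integrable_gspan G) auto
  have 1: "expectation (\<lambda>\<omega>. (X \<omega> * Y \<omega> * W C1 \<omega>) * W D \<omega>) = 0"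
    "integrable M (\<lambda>\<omega>. (X \<omega> * Y \<omega> * W C1 \<omega>) * W D \<omega>)"
    using expectation_past_future[of "\<lambda>\<omega>. X \<omega> * Y \<omega> * W C1 \<omega>" b "W D" "\<lambda>x. x", OF _ DG(1) _ V integrable_gspan[OF G(3)]]
      borel_measurable_times[OF XY W_full_filtration[OF C1p]] centered_gaussian_expectation[OF gaussian_gspan[OF G(3)]]
    by auto
  have sq: "expectation (\<lambda>\<omega>. (X \<omega> * Y \<omega>) * (Z \<omega>)\<^sup>2) = expectation (\<lambda>\<omega>. X \<omega> * Y \<omega>) * expectation (\<lambda>\<omega>. (Z \<omega>)\<^sup>2)"
    "integrable M (\<lambda>\<omega>. (X \<omega> * Y \<omega>) * (Z \<omega>)\<^sup>2)" "integrable M (\<lambda>\<omega>. (Z \<omega>)\<^sup>2)"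
    if "Z \<in> gspan W (future b)" for Z
  proof -
    have "Z \<in> gspan W noise_sets" using that gspan_mono[of "future b" noise_sets] by auto
    then show i: "integrable M (\<lambda>\<omega>. (Z \<omega>)\<^sup>2)" by (rule integrable_square_gspan)
    show "expectation (\<lambda>\<omega>. (X \<omega> * Y \<omega>) * (Z \<omega>)\<^sup>2) = expectation (\<lambda>\<omega>. X \<omega> * Y \<omega>) * expectation (\<lambda>\<omega>. (Z \<omega>)\<^sup>2)"
    "integrable M (\<lambda>\<omega>. (X \<omega> * Y \<omega>) * (Z \<omega>)\<^sup>2)"
      using expectation_past_future[OF XY that _ XYi i] by auto
  qed
  have p: "(\<lambda>\<omega>. W C2 \<omega> + W D \<omega>) \<in> gspan W (future b)" "(\<lambda>\<omega>. W C2 \<omega> - W D \<omega>) \<in> gspan W (future b)"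
    by (intro gspan_add gspan_diff DG)+
  \<comment> \<open>Polarisation writes the product of two future variables through squares of
    single members of the future span, to which \<open>expectation_past_future\<close>
    applies.\<close>
  have pol: "(\<lambda>\<omega>. W C2 \<omega> * W D \<omega>) = (\<lambda>\<omega>. 1/4 * (W C2 \<omega> + W D \<omega>)\<^sup>2 - 1/4 * (W C2 \<omega> - W D \<omega>)\<^sup>2)"
    by (simp add: fun_eq_iff power2_eq_square algebra_simps)
  have "(\<lambda>\<omega>. (X \<omega> * Y \<omega>) * (W C2 \<omega> * W D \<omega>)) = (\<lambda>\<omega>. 1/4 * ((X \<omega> * Y \<omega>) * (W C2 \<omega> + W D \<omega>)\<^sup>2) - 1/4 * ((X \<omega> * Y \<omega>) * (W C2 \<omega> - W D \<omega>)\<^sup>2))"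
    by (simp add: fun_eq_iff power2_eq_square algebra_simps)
  then have "expectation (\<lambda>\<omega>. (X \<omega> * Y \<omega>) * (W C2 \<omega> * W D \<omega>)) =
      expectation (\<lambda>\<omega>. X \<omega> * Y \<omega>) * (1/4 * expectation (\<lambda>\<omega>. (W C2 \<omega> + W D \<omega>)\<^sup>2) - 1/4 * expectation (\<lambda>\<omega>. (W C2 \<omega> - W D \<omega>)\<^sup>2))"
    using sq[OF p(1)] sq[OF p(2)] by (simp add: right_diff_distrib)
  also have "1/4 * expectation (\<lambda>\<omega>. (W C2 \<omega> + W D \<omega>)\<^sup>2) - 1/4 * expectation (\<lambda>\<omega>. (W C2 \<omega> - W D \<omega>)\<^sup>2)
     = expectation (\<lambda>\<omega>. W C2 \<omega> * W D \<omega>)"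
    unfolding pol using sq(3)[OF p(1)] sq(3)[OF p(2)] by simp
  also have "\<dots> = measure lborel (C \<inter> D)"
    using covariance[OF C1n(2) Cn(2)] CD by simp
  finally have 2: "expectation (\<lambda>\<omega>. (X \<omega> * Y \<omega>) * (W C2 \<omega> * W D \<omega>)) = expectation (\<lambda>\<omega>. X \<omega> * Y \<omega>) * measure lborel (C \<inter> D)" .
  have 3: "integrable M (\<lambda>\<omega>. (X \<omega> * Y \<omega>) * (W C2 \<omega> * W D \<omega>))"
    by (intro bm integrable_mult_gspan G) auto
  have "AE \<omega> in M. W C \<omega> = W C1 \<omega> + W C2 \<omega>"
    using noise_additive[OF C1n CU(2)] Cn(1) CU(1) by simp
  then have "AE \<omega> in M. (X \<omega> * W C \<omega>) * (Y \<omega> * W D \<omega>) = (X \<omega> * Y \<omega> * W C1 \<omega>) * W D \<omega> + (X \<omega> * Y \<omega>) * (W C2 \<omega> * W D \<omega>)"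
    by eventually_elim (simp add: algebra_simps)
  then have "expectation (\<lambda>\<omega>. (X \<omega> * W C \<omega>) * (Y \<omega> * W D \<omega>)) =
     expectation (\<lambda>\<omega>. (X \<omega> * Y \<omega> * W C1 \<omega>) * W D \<omega> + (X \<omega> * Y \<omega>) * (W C2 \<omega> * W D \<omega>))"
    by (intro integral_cong_AE) auto
  also have "\<dots> = expectation (\<lambda>\<omega>. X \<omega> * Y \<omega>) * measure lborel (C \<inter> D)"
    using 1 2 3 by simp
  finally show ?thesis .
qed

sublocale noise_product: pair_sigma_finite M "lborel :: (real \<times> real) measure" ..

lemma elementary_pair:
  fixes X Y :: "'w \<Rightarrow> real"
  assumes X: "elementary [(X, a, C)]" and Y: "elementary [(Y, b, D)]"
  shows "expectation (\<lambda>\<omega>. (X \<omega> * W C \<omega>) * (Y \<omega> * W D \<omega>)) =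
      integral\<^sup>L (M \<Otimes>\<^sub>M lborel) (\<lambda>z. (X (fst z) * indicator C (snd z)) * (Y (fst z) * indicator D (snd z)))"
    and "integrable M (\<lambda>\<omega>. (X \<omega> * W C \<omega>) * (Y \<omega> * W D \<omega>))"
    and "integrable (M \<Otimes>\<^sub>M lborel) (\<lambda>z. (X (fst z) * indicator C (snd z)) * (Y (fst z) * indicator D (snd z)))"
proof -
  obtain K L where X': "X \<in> borel_measurable (full_filtration M W a)" "\<And>\<omega>. \<omega> \<in> space M \<Longrightarrow> \<bar>X \<omega>\<bar> \<le> K" "C \<in> future a"
    and Y': "Y \<in> borel_measurable (full_filtration M W b)" "\<And>\<omega>. \<omega> \<in> space M \<Longrightarrow> \<bar>Y \<omega>\<bar> \<le> L" "D \<in> future b"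
    using X Y unfolding elementary_def by auto
  note [measurable] = full_filtration_measurable_sub[OF X'(1)] full_filtration_measurable_sub[OF Y'(1)]
  have CD: "C \<in> noise_sets" "D \<in> noise_sets" using X' Y' by auto
  note [measurable] = noise_sets_borel[OF CD(1)] noise_sets_borel[OF CD(2)] W_measurable[OF CD(1)] W_measurable[OF CD(2)]
  have XYb: "\<bar>X \<omega> * Y \<omega>\<bar> \<le> K * L" if "\<omega> \<in> space M" for \<omega>
    unfolding abs_mult using X'(2)[OF that] Y'(2)[OF that] by (intro mult_mono) auto
  show "integrable M (\<lambda>\<omega>. (X \<omega> * W C \<omega>) * (Y \<omega> * W D \<omega>))"
    by (intro integrable_mult_square integrable_square_bounded_gspan[OF _ X'(2)] integrable_square_bounded_gspan[OF _ Y'(2)] W_gspan CD) auto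
  have fin: "emeasure (M \<Otimes>\<^sub>M lborel) (space M \<times> C) < \<infinity>"
    using noise_sets_finite[OF CD(1)] emeasure_space_1
    by (subst lborel.emeasure_pair_measure_Times) auto
  have "integrable (M \<Otimes>\<^sub>M lborel) (\<lambda>z. K * L * indicator (space M \<times> C) z)"
    using fin by (intro integrable_mult_right integrable_real_indicator) auto
  then show i: "integrable (M \<Otimes>\<^sub>M lborel) (\<lambda>z. (X (fst z) * indicator C (snd z)) * (Y (fst z) * indicator D (snd z)))"
  proof (rule Bochner_Integration.integrable_bound)
    have "norm (X \<omega> * indicator C p * (Y \<omega> * indicator D p)) \<le> norm (K * L * indicator (space M \<times> C) (\<omega>, p))"
      if "\<omega> \<in> space M" for \<omega> p
      using XYb[OF that] that by (auto simp: indicator_def)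
    then show "AE x in M \<Otimes>\<^sub>M lborel. norm ((X (fst x) * indicator C (snd x)) * (Y (fst x) * indicator D (snd x)))
        \<le> norm (K * L * indicator (space M \<times> C) x)"
      by (intro AE_I2) (auto simp: space_pair_measure)
  qed measurable
  have "integral\<^sup>L (M \<Otimes>\<^sub>M lborel) (\<lambda>z. (X (fst z) * indicator C (snd z)) * (Y (fst z) * indicator D (snd z))) =
     (\<integral>\<omega>. (\<integral>p. (X \<omega> * indicator C p) * (Y \<omega> * indicator D p) \<partial>lborel) \<partial>M)"
    using noise_product.integral_fst'[OF i] by simp
  also have "\<dots> = (\<integral>\<omega>. X \<omega> * Y \<omega> * measure lborel (C \<inter> D) \<partial>M)"
  proof (intro Bochner_Integration.integral_cong refl)
    fix \<omega>
    have "(\<integral>p. (X \<omega> * indicator C p) * (Y \<omega> * indicator D p) \<partial>lborel) = (\<integral>p. (X \<omega> * Y \<omega>) * indicator (C \<inter> D) p \<partial>lborel)"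
      by (intro Bochner_Integration.integral_cong refl) (auto simp: indicator_def)
    then show "(\<integral>p. (X \<omega> * indicator C p) * (Y \<omega> * indicator D p) \<partial>lborel) = X \<omega> * Y \<omega> * measure lborel (C \<inter> D)"
      by simp
  qed
  also have "\<dots> = expectation (\<lambda>\<omega>. X \<omega> * Y \<omega>) * measure lborel (C \<inter> D)" by simp
  also have "\<dots> = expectation (\<lambda>\<omega>. (X \<omega> * W C \<omega>) * (Y \<omega> * W D \<omega>))"
  \<comment> \<open>The times \<open>a\<close> and \<open>b\<close> come in no particular order;
    both sides are symmetric, so the earlier one may be taken first.\<close>
  proof (cases "a \<le> b")
    case True
    show ?thesis using elementary_pair_ordered[OF X' Y' True] by simp
  next
    case False
    then have "b \<le> a" by simp
    from elementary_pair_ordered[OF Y' X' this] show ?thesis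
      by (simp add: mult.commute Int_commute)
  qed
  finally show "expectation (\<lambda>\<omega>. (X \<omega> * W C \<omega>) * (Y \<omega> * W D \<omega>)) =
      integral\<^sup>L (M \<Otimes>\<^sub>M lborel) (\<lambda>z. (X (fst z) * indicator C (snd z)) * (Y (fst z) * indicator D (snd z)))" by simp
qed

lemma elementary_Cons: "elementary (x # gs) \<longleftrightarrow> elementary [x] \<and> elementary gs"
  by (auto simp: elementary_def)

text \<open>The isometry in polarised form: equality of inner products is additive in each list and
  so admits induction along both, whereas equality of norms would not control the mixed
  terms.\<close>

lemma elementary_isometry_inner:
  assumes "elementary gs" "elementary hs"
  shows "integrable M (\<lambda>\<omega>. elementary_integral gs \<omega> * elementary_integral hs \<omega>) \<and>
    integrable (M \<Otimes>\<^sub>M lborel) (\<lambda>z. elementary_eval gs (fst z) (snd z) * elementary_eval hs (fst z) (snd z)) \<and>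
    expectation (\<lambda>\<omega>. elementary_integral gs \<omega> * elementary_integral hs \<omega>) =
     integral\<^sup>L (M \<Otimes>\<^sub>M lborel) (\<lambda>z. elementary_eval gs (fst z) (snd z) * elementary_eval hs (fst z) (snd z))"
    (is "?P gs hs")
proof -
  have add: "?P (x # gs) hs" if 1: "?P [x] hs" and 2: "?P gs hs" for x gs hs
  proof -
    have e: "elementary_integral (x # gs) \<omega> = elementary_integral [x] \<omega> + elementary_integral gs \<omega>"
      "elementary_eval (x # gs) \<omega> p = elementary_eval [x] \<omega> p + elementary_eval gs \<omega> p" for \<omega> p
      by (simp_all add: elementary_integral_def elementary_eval_def)
    show ?thesis unfolding e distrib_right using 1 2 by simp
  qed
  have sym: "?P gs hs \<Longrightarrow> ?P hs gs" for gs hs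
    by (simp add: mult.commute)
  have nil: "?P [] hs" for hs by (simp add: elementary_integral_def elementary_eval_def)
  have single: "?P [x] [y]" if "elementary [x]" "elementary [y]" for x y
  proof -
    obtain X a C Y b D where xy: "x = (X, a, C)" "y = (Y, b, D)" by (metis prod_cases3)
    show ?thesis using elementary_pair[OF that[unfolded xy]]
      by (simp add: xy elementary_integral_def elementary_eval_def)
  qed
  have 1: "?P [x] hs" if "elementary [x]" "elementary hs" for x hs
    using that(2)
  proof (induction hs)
    case Nil then show ?case using sym[OF nil] by blast
  next
    case (Cons y hs)
    then have y: "elementary [y]" "elementary hs" by (simp_all add: elementary_Cons[of y hs])
    show ?case by (rule sym[OF add[OF sym[OF single[OF that(1) y(1)]] sym[OF Cons.IH[OF y(2)]]]])
  qed
  show ?thesis using assms(1)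
  proof (induction gs)
    case (Cons x gs)
    then have x: "elementary [x]" "elementary gs" by (simp_all add: elementary_Cons[of x gs])
    show ?case by (rule add[OF 1[OF x(1) assms(2)] Cons.IH[OF x(2)]])
  qed (use nil in blast)
qed

lemma elementary_measurable:
  assumes "elementary gs"
  shows "elementary_integral gs \<in> borel_measurable M"
    and "(\<lambda>(\<omega>, p). elementary_eval gs \<omega> p) \<in> borel_measurable (M \<Otimes>\<^sub>M lborel)"
proof -
  have "elementary_integral gs \<in> borel_measurable M \<and>
    (\<lambda>(\<omega>, p). elementary_eval gs \<omega> p) \<in> borel_measurable (M \<Otimes>\<^sub>M lborel)"
    using assms
  proof (induction gs)
    case Nil
    then show ?case by (simp add: elementary_integral_def[abs_def] elementary_eval_def)
  next
    case (Cons x gs)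
    obtain X a C where x: "x = (X, a, C)" by (metis prod_cases3)
    have X: "X \<in> borel_measurable (full_filtration M W a)" "C \<in> noise_sets" and gs: "elementary gs"
      using Cons.prems by (auto simp: elementary_def x)
    note [measurable] = full_filtration_measurable_sub[OF X(1)] noise_sets_borel[OF X(2)] W_measurable[OF X(2)]
    have e: "elementary_integral (x # gs) = (\<lambda>\<omega>. X \<omega> * W C \<omega> + elementary_integral gs \<omega>)"
      "(\<lambda>(\<omega>, p). elementary_eval (x # gs) \<omega> p) = (\<lambda>z. X (fst z) * indicator C (snd z) + (case z of (\<omega>, p) \<Rightarrow> elementary_eval gs \<omega> p))"
      by (auto simp: elementary_integral_def elementary_eval_def x)
    note [measurable] = Cons.IH[OF gs, THEN conjunct1] Cons.IH[OF gs, THEN conjunct2]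
    show ?case unfolding e by (intro conjI) measurable
  qed
  then show "elementary_integral gs \<in> borel_measurable M"
    "(\<lambda>(\<omega>, p). elementary_eval gs \<omega> p) \<in> borel_measurable (M \<Otimes>\<^sub>M lborel)" by auto
qed

lemma elementary_isometry:
  assumes "elementary gs"
  shows "(\<integral>\<^sup>+\<omega>. ennreal ((elementary_integral gs \<omega>)\<^sup>2) \<partial>M) =
         (\<integral>\<^sup>+z. ennreal ((elementary_eval gs (fst z) (snd z))\<^sup>2) \<partial>(M \<Otimes>\<^sub>M lborel))"
  using elementary_isometry_inner[OF assms assms]
  by (subst (1 2) nn_integral_eq_integral) (auto simp: power2_eq_square)

definition noise_integral :: "('w \<times> (real \<times> real) \<Rightarrow> real) \<Rightarrow> ('w \<Rightarrow> real) \<Rightarrow> bool" where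
  "noise_integral f I \<longleftrightarrow> f \<in> borel_measurable (M \<Otimes>\<^sub>M lborel) \<and> I \<in> borel_measurable M \<and>
    (\<exists>gs. (\<forall>k. elementary (gs k)) \<and>
     (\<lambda>k. \<integral>\<^sup>+z. ennreal ((elementary_eval (gs k) (fst z) (snd z) - f z)\<^sup>2) \<partial>(M \<Otimes>\<^sub>M lborel)) \<longlonglongrightarrow> 0 \<and>
     (\<lambda>k. \<integral>\<^sup>+\<omega>. ennreal ((elementary_integral (gs k) \<omega> - I \<omega>)\<^sup>2) \<partial>M) \<longlonglongrightarrow> 0)"

lemma noise_integral_elementary:
  "elementary gs \<Longrightarrow> noise_integral (\<lambda>z. elementary_eval gs (fst z) (snd z)) (elementary_integral gs)"
  unfolding noise_integral_def using elementary_measurable[of gs]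
  by (intro conjI exI[of _ "\<lambda>_. gs"]) (auto simp: case_prod_beta)

text \<open>The sum is passed as \<open>h\<close> with a pointwise equation, so that the same bound
  serves differences and regroupings of terms.\<close>

lemma nn_integral_square_add:
  assumes [measurable]: "f \<in> borel_measurable N" "g \<in> borel_measurable N" and h: "\<And>x. h x = f x + g x"
  shows "(\<integral>\<^sup>+x. ennreal ((h x)\<^sup>2) \<partial>N) \<le> 2 * (\<integral>\<^sup>+x. ennreal ((f x)\<^sup>2) \<partial>N) + 2 * (\<integral>\<^sup>+x. ennreal ((g x)\<^sup>2) \<partial>N)"
proof -
  have "ennreal ((h x)\<^sup>2) \<le> 2 * ennreal ((f x)\<^sup>2) + 2 * ennreal ((g x)\<^sup>2)" for x
  proof -
    have "(h x)\<^sup>2 \<le> 2 * (f x)\<^sup>2 + 2 * (g x)\<^sup>2"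
      using sum_squares_bound[of "f x" "g x"] unfolding h power2_sum by simp
    then have "ennreal ((h x)\<^sup>2) \<le> ennreal (2 * (f x)\<^sup>2 + 2 * (g x)\<^sup>2)" by (rule ennreal_leI)
    then show ?thesis by (simp add: ennreal_mult)
  qed
  then have "(\<integral>\<^sup>+x. ennreal ((h x)\<^sup>2) \<partial>N) \<le> (\<integral>\<^sup>+x. 2 * ennreal ((f x)\<^sup>2) + 2 * ennreal ((g x)\<^sup>2) \<partial>N)"
    by (intro nn_integral_mono) auto
  also have "\<dots> = 2 * (\<integral>\<^sup>+x. ennreal ((f x)\<^sup>2) \<partial>N) + 2 * (\<integral>\<^sup>+x. ennreal ((g x)\<^sup>2) \<partial>N)"
    by (simp add: nn_integral_add nn_integral_cmult)
  finally show ?thesis .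
qed

lemma nn_integral_square_diff_null:
  assumes "\<And>k. f k \<in> borel_measurable N" "\<And>k. g k \<in> borel_measurable N"
    and "(\<lambda>k. \<integral>\<^sup>+x. ennreal ((f k x)\<^sup>2) \<partial>N) \<longlonglongrightarrow> 0" "(\<lambda>k. \<integral>\<^sup>+x. ennreal ((g k x)\<^sup>2) \<partial>N) \<longlonglongrightarrow> 0"
    and h: "\<And>k x. h k x = f k x - g k x"
  shows "(\<lambda>k. \<integral>\<^sup>+x. ennreal ((h k x)\<^sup>2) \<partial>N) \<longlonglongrightarrow> 0"
proof (rule tendsto_sandwich[OF _ _ tendsto_const])
  show "\<forall>\<^sub>F k in sequentially. (\<integral>\<^sup>+x. ennreal ((h k x)\<^sup>2) \<partial>N) \<le> 2 * (\<integral>\<^sup>+x. ennreal ((f k x)\<^sup>2) \<partial>N) + 2 * (\<integral>\<^sup>+x. ennreal ((g k x)\<^sup>2) \<partial>N)"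
  proof (rule always_eventually, rule allI)
    fix k
    show "(\<integral>\<^sup>+x. ennreal ((h k x)\<^sup>2) \<partial>N) \<le> 2 * (\<integral>\<^sup>+x. ennreal ((f k x)\<^sup>2) \<partial>N) + 2 * (\<integral>\<^sup>+x. ennreal ((g k x)\<^sup>2) \<partial>N)"
      using nn_integral_square_add[of "f k" N "\<lambda>x. - g k x" "h k"] assms(1)[of k] assms(2)[of k] h by simp
  qed
  have "(\<lambda>k. 2 * (\<integral>\<^sup>+x. ennreal ((f k x)\<^sup>2) \<partial>N) + 2 * (\<integral>\<^sup>+x. ennreal ((g k x)\<^sup>2) \<partial>N)) \<longlonglongrightarrow> 2 * 0 + 2 * 0"
    by (intro tendsto_add ennreal_tendsto_cmult assms) auto
  then show "(\<lambda>k. 2 * (\<integral>\<^sup>+x. ennreal ((f k x)\<^sup>2) \<partial>N) + 2 * (\<integral>\<^sup>+x. ennreal ((g k x)\<^sup>2) \<partial>N)) \<longlonglongrightarrow> 0" by simp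
qed auto

lemma noise_integral_diff:
  assumes "noise_integral f I" "noise_integral f' I'"
  shows "noise_integral (\<lambda>z. f z - f' z) (\<lambda>\<omega>. I \<omega> - I' \<omega>)"
proof -
  obtain gs where gs: "\<And>k. elementary (gs k)"
     "(\<lambda>k. \<integral>\<^sup>+z. ennreal ((elementary_eval (gs k) (fst z) (snd z) - f z)\<^sup>2) \<partial>(M \<Otimes>\<^sub>M lborel)) \<longlonglongrightarrow> 0"
     "(\<lambda>k. \<integral>\<^sup>+\<omega>. ennreal ((elementary_integral (gs k) \<omega> - I \<omega>)\<^sup>2) \<partial>M) \<longlonglongrightarrow> 0"
    using assms(1) unfolding noise_integral_def by blast
  obtain hs where hs: "\<And>k. elementary (hs k)"
     "(\<lambda>k. \<integral>\<^sup>+z. ennreal ((elementary_eval (hs k) (fst z) (snd z) - f' z)\<^sup>2) \<partial>(M \<Otimes>\<^sub>M lborel)) \<longlonglongrightarrow> 0"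
     "(\<lambda>k. \<integral>\<^sup>+\<omega>. ennreal ((elementary_integral (hs k) \<omega> - I' \<omega>)\<^sup>2) \<partial>M) \<longlonglongrightarrow> 0"
    using assms(2) unfolding noise_integral_def by blast
  have m[measurable]: "f \<in> borel_measurable (M \<Otimes>\<^sub>M lborel)" "f' \<in> borel_measurable (M \<Otimes>\<^sub>M lborel)"
    "I \<in> borel_measurable M" "I' \<in> borel_measurable M"
    using assms by (auto simp: noise_integral_def)
  \<comment> \<open>Approximants of the difference: the two lists appended, the coefficients of the
    second negated.\<close>
  define ks where "ks k = gs k @ map (\<lambda>(X, a, C). (\<lambda>\<omega>. - X \<omega>, a, C)) (hs k)" for k
  have ks: "elementary (ks k)" for k
    using gs(1)[of k] hs(1)[of k] unfolding elementary_def ks_def by fastforce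
  have neg: "elementary_integral (map (\<lambda>(X, a, C). (\<lambda>\<omega>. - X \<omega>, a, C)) l) \<omega> = - elementary_integral l \<omega>"
    "elementary_eval (map (\<lambda>(X, a, C). (\<lambda>\<omega>. - X \<omega>, a, C)) l) \<omega> p = - elementary_eval l \<omega> p" for l \<omega> p
    by (induction l) (auto simp: elementary_integral_def elementary_eval_def)
  have app: "elementary_integral (l @ l') \<omega> = elementary_integral l \<omega> + elementary_integral l' \<omega>"
    "elementary_eval (l @ l') \<omega> p = elementary_eval l \<omega> p + elementary_eval l' \<omega> p" for l l' \<omega> p
    by (simp_all add: elementary_integral_def elementary_eval_def)
  have e: "elementary_integral (ks k) \<omega> = elementary_integral (gs k) \<omega> - elementary_integral (hs k) \<omega>"
    "elementary_eval (ks k) \<omega> p = elementary_eval (gs k) \<omega> p - elementary_eval (hs k) \<omega> p" for k \<omega> p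
    unfolding ks_def app neg by simp_all
  note [measurable] = elementary_measurable(1)[OF gs(1)] elementary_measurable(1)[OF hs(1)]
    elementary_measurable(2)[OF gs(1), unfolded case_prod_beta] elementary_measurable(2)[OF hs(1), unfolded case_prod_beta]
  show ?thesis unfolding noise_integral_def
  proof (intro conjI exI[of _ ks] allI ks)
    show "(\<lambda>k. \<integral>\<^sup>+z. ennreal ((elementary_eval (ks k) (fst z) (snd z) - (f z - f' z))\<^sup>2) \<partial>(M \<Otimes>\<^sub>M lborel)) \<longlonglongrightarrow> 0"
      by (rule nn_integral_square_diff_null[OF _ _ gs(2) hs(2)]) (auto simp: e)
    show "(\<lambda>k. \<integral>\<^sup>+\<omega>. ennreal ((elementary_integral (ks k) \<omega> - (I \<omega> - I' \<omega>))\<^sup>2) \<partial>M) \<longlonglongrightarrow> 0"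
      by (rule nn_integral_square_diff_null[OF _ _ gs(3) hs(3)]) (auto simp: e)
  qed auto
qed

text \<open>The factor 4 is an artefact of replacing Minkowski's inequality by
  \<open>(a + b)\<^sup>2 \<le> 2 a\<^sup>2 + 2 b\<^sup>2\<close>; only the order of magnitude of errors matters.\<close>

lemma noise_integral_bound:
  assumes "noise_integral f I"
  shows "(\<integral>\<^sup>+\<omega>. ennreal ((I \<omega>)\<^sup>2) \<partial>M) \<le> 4 * (\<integral>\<^sup>+z. ennreal ((f z)\<^sup>2) \<partial>(M \<Otimes>\<^sub>M lborel))"
proof -
  obtain gs where gs: "\<And>k. elementary (gs k)"
     "(\<lambda>k. \<integral>\<^sup>+z. ennreal ((elementary_eval (gs k) (fst z) (snd z) - f z)\<^sup>2) \<partial>(M \<Otimes>\<^sub>M lborel)) \<longlonglongrightarrow> 0" (is "?a \<longlonglongrightarrow> 0")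
     "(\<lambda>k. \<integral>\<^sup>+\<omega>. ennreal ((elementary_integral (gs k) \<omega> - I \<omega>)\<^sup>2) \<partial>M) \<longlonglongrightarrow> 0" (is "?b \<longlonglongrightarrow> 0")
    using assms(1) unfolding noise_integral_def by blast
  have m[measurable]: "f \<in> borel_measurable (M \<Otimes>\<^sub>M lborel)" "I \<in> borel_measurable M"
    using assms by (auto simp: noise_integral_def)
  note [measurable] = elementary_measurable(1)[OF gs(1)] elementary_measurable(2)[OF gs(1), unfolded case_prod_beta]
  let ?F = "\<integral>\<^sup>+z. ennreal ((f z)\<^sup>2) \<partial>(M \<Otimes>\<^sub>M lborel)"
  have le: "(\<integral>\<^sup>+\<omega>. ennreal ((I \<omega>)\<^sup>2) \<partial>M) \<le> 2 * ?b k + 2 * (2 * ?a k + 2 * ?F)" for k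
  proof -
    have "(\<integral>\<^sup>+\<omega>. ennreal ((I \<omega>)\<^sup>2) \<partial>M) \<le> 2 * (\<integral>\<^sup>+\<omega>. ennreal ((I \<omega> - elementary_integral (gs k) \<omega>)\<^sup>2) \<partial>M) +
       2 * (\<integral>\<^sup>+\<omega>. ennreal ((elementary_integral (gs k) \<omega>)\<^sup>2) \<partial>M)"
      by (rule nn_integral_square_add) auto
    also have "(\<integral>\<^sup>+\<omega>. ennreal ((elementary_integral (gs k) \<omega>)\<^sup>2) \<partial>M) \<le> 2 * ?a k + 2 * ?F"
      unfolding elementary_isometry[OF gs(1)] by (rule nn_integral_square_add) auto
    finally show ?thesis by (simp add: power2_commute add_mono mult_left_mono)
  qed
  have "(\<lambda>k. 2 * ?b k + 2 * (2 * ?a k + 2 * ?F)) \<longlonglongrightarrow> 2 * 0 + 2 * (2 * 0 + 2 * ?F)"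
    by (intro tendsto_add ennreal_tendsto_cmult gs tendsto_const) auto
  then have "(\<integral>\<^sup>+\<omega>. ennreal ((I \<omega>)\<^sup>2) \<partial>M) \<le> 2 * 0 + 2 * (2 * 0 + 2 * ?F)"
    by (rule LIMSEQ_le_const) (use le in auto)
  then show ?thesis by (simp add: mult.assoc[symmetric])
qed

text \<open>The predictable sigma-algebra lives over non-negative times only, while
  \<open>lborel\<close> charges the whole plane; \<open>max 0\<close> extends the field to negative
  times, where it is later multiplied by 0.\<close>

lemma predictable_field_measurable:
  assumes "predictable_field M W h"
  shows "(\<lambda>z. h (max 0 (fst (snd z))) (snd (snd z)) (fst z)) \<in> borel_measurable (M \<Otimes>\<^sub>M lborel)"
proof -
  let ?g = "\<lambda>z. (max 0 (fst (snd z)), snd (snd z), fst z) :: real \<times> real \<times> 'w"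
  let ?G = "{{a<..b} \<times> A \<times> E | a b (A :: real set) E.
         0 \<le> a \<and> a \<le> b \<and> A \<in> sets borel \<and> E \<in> sets (noise_filtration M W a)} \<union>
      {{0} \<times> A \<times> E | (A :: real set) E. A \<in> sets borel \<and> E \<in> sets (noise_filtration M W 0)}"
  have E: "E \<in> sets M" if "E \<in> sets (noise_filtration M W a)" for a E
    using that noise_filtration_sub full_filtration_sub by blast
  then have Esub: "E \<subseteq> space M" if "E \<in> sets (noise_filtration M W a)" for a E
    using that sets.sets_into_space by blast
  have meas: "?g \<in> measurable (M \<Otimes>\<^sub>M lborel) (predictable_sigma M W)"
    unfolding predictable_sigma_def
  proof (rule measurable_measure_of)
    show "?G \<subseteq> Pow ({0..} \<times> UNIV \<times> space M)" using Esub by fastforce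
    show "?g \<in> space (M \<Otimes>\<^sub>M lborel) \<rightarrow> {0..} \<times> UNIV \<times> space M" by (auto simp: space_pair_measure)
    fix S assume "S \<in> ?G"
    then obtain T A E a where S: "S = T \<times> A \<times> E" "T \<in> sets borel" "A \<in> sets borel" "E \<in> sets (noise_filtration M W a)"
      by auto
    note [measurable] = S(2,3) E[OF S(4)]
    have "?g -` S \<inter> space (M \<Otimes>\<^sub>M lborel) = {z \<in> space (M \<Otimes>\<^sub>M lborel). max 0 (fst (snd z)) \<in> T \<and> snd (snd z) \<in> A \<and> fst z \<in> E}"
      unfolding S by auto
    also have "\<dots> \<in> sets (M \<Otimes>\<^sub>M lborel)"
    proof -
      have "{z \<in> space (M \<Otimes>\<^sub>M lborel). max 0 (fst (snd z)) \<in> T} \<in> sets (M \<Otimes>\<^sub>M (lborel :: (real \<times> real) measure))"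
        "{z \<in> space (M \<Otimes>\<^sub>M lborel). snd (snd z) \<in> A} \<in> sets (M \<Otimes>\<^sub>M (lborel :: (real \<times> real) measure))"
        "{z \<in> space (M \<Otimes>\<^sub>M lborel). fst z \<in> E} \<in> sets (M \<Otimes>\<^sub>M (lborel :: (real \<times> real) measure))"
        by measurable
      then show ?thesis by (intro sets.sets_Collect_conj)
    qed
    finally show "?g -` S \<inter> space (M \<Otimes>\<^sub>M lborel) \<in> sets (M \<Otimes>\<^sub>M lborel)" .
  qed
  from measurable_compose[OF meas assms[unfolded predictable_field_def]]
  show ?thesis by simp
qed

text \<open>At a time \<open>t > 0\<close> a generating box over \<open>{a<..b}\<close> has a
  non-empty section only if \<open>a < t\<close>, and then the section is an event known at
  \<open>t\<close>; the generators at time 0 have empty section.\<close>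

lemma predictable_field_section:
  assumes "predictable_field M W h" and t: "0 < t"
  shows "h t x \<in> borel_measurable (full_filtration M W t)"
proof -
  let ?G = "{{a<..b} \<times> A \<times> E | a b (A :: real set) E.
         0 \<le> a \<and> a \<le> b \<and> A \<in> sets borel \<and> E \<in> sets (noise_filtration M W a)} \<union>
      {{0} \<times> A \<times> E | (A :: real set) E. A \<in> sets borel \<and> E \<in> sets (noise_filtration M W 0)}"
  have E: "E \<in> sets M" if "E \<in> sets (noise_filtration M W a)" for a E
    using that noise_filtration_sub full_filtration_sub by blast
  then have Esub: "E \<subseteq> space M" if "E \<in> sets (noise_filtration M W a)" for a E
    using that sets.sets_into_space by blast
  have meas: "(\<lambda>\<omega>. (t, x, \<omega>)) \<in> measurable (full_filtration M W t) (predictable_sigma M W)"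
    unfolding predictable_sigma_def
  proof (rule measurable_measure_of)
    show "?G \<subseteq> Pow ({0..} \<times> UNIV \<times> space M)" using Esub by fastforce
    show "(\<lambda>\<omega>. (t, x, \<omega>)) \<in> space (full_filtration M W t) \<rightarrow> {0..} \<times> UNIV \<times> space M" using t by auto
    fix S assume S: "S \<in> ?G"
    show "(\<lambda>\<omega>. (t, x, \<omega>)) -` S \<inter> space (full_filtration M W t) \<in> sets (full_filtration M W t)"
    proof (cases "S \<in> {{0} \<times> A \<times> E | (A :: real set) E. A \<in> sets borel \<and> E \<in> sets (noise_filtration M W 0)}")
      case True
      then have "(\<lambda>\<omega>. (t, x, \<omega>)) -` S = {}" using t by auto
      then show ?thesis by simp
    next
      case False
      then obtain a b A E where S': "S = {a<..b} \<times> A \<times> E" "E \<in> sets (noise_filtration M W a)" using S by blast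
      show ?thesis
      proof (cases "a < t \<and> t \<le> b \<and> x \<in> A")
        case True
        then have "(\<lambda>\<omega>. (t, x, \<omega>)) -` S = E" using S' by auto
        moreover have "E \<in> sets (full_filtration M W t)"
          using S'(2) noise_filtration_sub[of a] full_filtration_mono[of a t] True by auto
        ultimately show ?thesis using sets.sets_into_space by (metis Int_absorb2)
      next
        case False
        then have "(\<lambda>\<omega>. (t, x, \<omega>)) -` S = {}" using S' by auto
        then show ?thesis by simp
      qed
    qed
  qed
  from measurable_compose[OF meas assms(1)[unfolded predictable_field_def]]
  show ?thesis by simp
qed

lemma has_walsh_integral_noise_integral:
  assumes h: "has_walsh_integral M W t h I" and t: "0 \<le> t"
  shows "noise_integral (\<lambda>z. indicator {0..t} (fst (snd z)) * h (fst (snd z)) (snd (snd z)) (fst z)) I"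
proof -
  obtain fs where fs: "\<And>k. simple_field M W (fs k)"
    "(\<lambda>k. \<integral>\<^sup>+\<omega>. (\<integral>\<^sup>+s\<in>{0..t}. (\<integral>\<^sup>+z. ennreal ((simple_eval (fs k) s z \<omega> - h s z \<omega>)\<^sup>2)
                \<partial>lborel) \<partial>lborel) \<partial>M) \<longlonglongrightarrow> 0"
    "(\<lambda>k. \<integral>\<^sup>+\<omega>. ennreal ((simple_integral W t (fs k) \<omega> - I \<omega>)\<^sup>2) \<partial>M) \<longlonglongrightarrow> 0"
    and p: "predictable_field M W h" and I: "I \<in> borel_measurable M"
    using h unfolding has_walsh_integral_def by blast
  let ?f = "\<lambda>z. indicator {0..t} (fst (snd z)) * h (fst (snd z)) (snd (snd z)) (fst z)"
  have fe: "?f = (\<lambda>z. indicator {0..t} (fst (snd z)) * h (max 0 (fst (snd z))) (snd (snd z)) (fst z))"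
    by (auto simp: fun_eq_iff indicator_def)
  have fm[measurable]: "?f \<in> borel_measurable (M \<Otimes>\<^sub>M lborel)"
    unfolding fe 
    by (rule borel_measurable_times[OF _ predictable_field_measurable[OF p]]) measurable
  \<comment> \<open>A rectangle is cut off at time \<open>t\<close>. For \<open>a \<ge> t\<close>
    the interval is empty; otherwise it still starts at \<open>a\<close>, so the coefficient is
    known before the interval begins.\<close>
  define gs where "gs k = map (\<lambda>(X, a, b, A). (X, a, {min a t<..min b t} \<times> A)) (fs k)" for k
  have gs: "elementary (gs k)" for k
    unfolding elementary_def
  proof (intro ballI, clarify)
    fix X a C assume "(X, a, C) \<in> set (gs k)"
    then obtain b A where m: "(X, a, b, A) \<in> set (fs k)" and C: "C = {min a t<..min b t} \<times> A" by (auto simp: gs_def)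
    have ok: "0 \<le> a" "a \<le> b" "A \<in> bounded_borel_sets" "X \<in> borel_measurable (noise_filtration M W a)"
      "\<exists>K. \<forall>\<omega>\<in>space M. \<bar>X \<omega>\<bar> \<le> K"
      using fs(1)[of k] m unfolding simple_field_def by auto
    have "C \<in> noise_sets"
      using ok t unfolding C noise_sets_def bounded_borel_sets_def
      by (auto intro!: bounded_Times borel_Times)
    moreover have "C \<subseteq> {a<..} \<times> UNIV" unfolding C by auto
    ultimately show "X \<in> borel_measurable (full_filtration M W a) \<and> (\<exists>K. \<forall>\<omega>\<in>space M. \<bar>X \<omega>\<bar> \<le> K) \<and> C \<in> future a"
      using ok noise_filtration_measurable by auto
  qed
  have int: "elementary_integral (gs k) \<omega> = simple_integral W t (fs k) \<omega>" for k \<omega>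
    unfolding elementary_integral_def simple_integral_def gs_def by (simp add: comp_def case_prod_unfold)
  have nonneg: "0 \<le> a" if "(X, a, b, A) \<in> set (fs k)" for X a b A k
    using fs(1)[of k] that unfolding simple_field_def by auto
  have ev: "elementary_eval (gs k) \<omega> p = indicator {0..t} (fst p) * simple_eval (fs k) (fst p) (snd p) \<omega>" for k \<omega> p
  proof -
    have "elementary_eval (gs k) \<omega> p = (\<Sum>(X, a, b, A)\<leftarrow>fs k. X \<omega> * indicator ({min a t<..min b t} \<times> A) p)"
      unfolding elementary_eval_def gs_def by (simp add: comp_def case_prod_unfold)
    also have "\<dots> = (\<Sum>(X, a, b, A)\<leftarrow>fs k. indicator {0..t} (fst p) * (X \<omega> * indicator {a<..b} (fst p) * indicator A (snd p)))"
    proof (intro arg_cong[where f=sum_list] map_cong refl, clarify)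
      fix X a b A assume "(X, a, b, A) \<in> set (fs k)"
      then have "0 \<le> a" by (rule nonneg)
      then show "X \<omega> * indicator ({min a t<..min b t} \<times> A) p = indicator {0..t} (fst p) * (X \<omega> * indicator {a<..b} (fst p) * indicator A (snd p))"
        using t by (cases p) (auto simp: indicator_def min_def split: if_splits)
    qed
    also have "\<dots> = indicator {0..t} (fst p) * simple_eval (fs k) (fst p) (snd p) \<omega>"
      unfolding simple_eval_def by (simp add: sum_list_const_mult[symmetric] case_prod_unfold comp_def)
    finally show ?thesis .
  qed
  note em[measurable] = elementary_measurable(2)[OF gs, unfolded case_prod_beta]
  \<comment> \<open>Tonelli turns the iterated integral in the definition of the Walsh integral into
    a squared norm over the product space.\<close>
  have nn: "(\<integral>\<^sup>+z. ennreal ((elementary_eval (gs k) (fst z) (snd z) - ?f z)\<^sup>2) \<partial>(M \<Otimes>\<^sub>M lborel)) =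
      (\<integral>\<^sup>+\<omega>. (\<integral>\<^sup>+s\<in>{0..t}. (\<integral>\<^sup>+z. ennreal ((simple_eval (fs k) s z \<omega> - h s z \<omega>)\<^sup>2) \<partial>lborel) \<partial>lborel) \<partial>M)" for k
  proof -
    let ?F = "\<lambda>z. ennreal ((elementary_eval (gs k) (fst z) (snd z) - ?f z)\<^sup>2)"
    have Fm[measurable]: "?F \<in> borel_measurable (M \<Otimes>\<^sub>M lborel)" by measurable
    have "(\<integral>\<^sup>+z. ?F z \<partial>(M \<Otimes>\<^sub>M lborel)) = (\<integral>\<^sup>+\<omega>. (\<integral>\<^sup>+p. ?F (\<omega>, p) \<partial>lborel) \<partial>M)"
      by (subst lborel.nn_integral_fst[symmetric]) auto
    also have "\<dots> = (\<integral>\<^sup>+\<omega>. (\<integral>\<^sup>+s\<in>{0..t}. (\<integral>\<^sup>+z. ennreal ((simple_eval (fs k) s z \<omega> - h s z \<omega>)\<^sup>2) \<partial>lborel) \<partial>lborel) \<partial>M)"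
    proof (rule nn_integral_cong)
      fix \<omega> assume w: "\<omega> \<in> space M"
      have m2: "(\<lambda>p. ?F (\<omega>, p)) \<in> borel_measurable (lborel \<Otimes>\<^sub>M lborel)"
        using measurable_compose[OF measurable_Pair1'[OF w] Fm] by (simp add: lborel_prod)
      have "(\<integral>\<^sup>+p. ?F (\<omega>, p) \<partial>lborel) = (\<integral>\<^sup>+s. (\<integral>\<^sup>+z. ?F (\<omega>, (s, z)) \<partial>lborel) \<partial>lborel)"
        unfolding lborel_prod[symmetric] by (subst lborel.nn_integral_fst[OF m2, symmetric]) simp
      also have "\<dots> = (\<integral>\<^sup>+s\<in>{0..t}. (\<integral>\<^sup>+z. ennreal ((simple_eval (fs k) s z \<omega> - h s z \<omega>)\<^sup>2) \<partial>lborel) \<partial>lborel)"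
        by (intro nn_integral_cong) (auto simp: ev indicator_def)
      finally show "(\<integral>\<^sup>+p. ?F (\<omega>, p) \<partial>lborel) = (\<integral>\<^sup>+s\<in>{0..t}. (\<integral>\<^sup>+z. ennreal ((simple_eval (fs k) s z \<omega> - h s z \<omega>)\<^sup>2) \<partial>lborel) \<partial>lborel)" .
    qed
    finally show ?thesis .
  qed
  show ?thesis unfolding noise_integral_def
    using fm I gs fs(2,3) by (intro conjI exI[of _ gs]) (auto simp: nn int)
qed

end

section \<open>Fourier inversion\<close>

text \<open>The substitution \<open>y = t * x powr \<alpha>\<close> in Euler's integral for Gamma (1
  / \<alpha>), followed by even reflection, which accounts for the factor 2.\<close>

lemma has_bochner_integral_stretched_exp:
  fixes \<alpha> t :: real
  assumes \<alpha>: "0 < \<alpha>" and t: "0 < t"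
  shows "has_bochner_integral lborel (\<lambda>\<xi>. exp (- t * \<bar>\<xi>\<bar> powr \<alpha>)) (2 * (Gamma (1 / \<alpha>) / \<alpha> * t powr (- 1 / \<alpha>)))"
proof -
  define f where "f y = y powr (1 / \<alpha> - 1) / exp y" for y :: real
  define g where "g x = t * x powr \<alpha>" for x :: real
  define g' where "g' x = t * (\<alpha> * x powr (\<alpha> - 1))" for x :: real
  have "(f has_integral Gamma (1 / \<alpha>)) {0..}"
    unfolding f_def by (rule Gamma_integral_real) (use \<alpha> in auto)
  \<comment> \<open>The origin is dropped, since the substitution is differentiated on the open
    half-line only.\<close>
  then have fi: "(f has_integral Gamma (1 / \<alpha>)) {0<..}"
    by (rule has_integral_spike_set_eq[THEN iffD1, rotated 2]) (auto intro: negligible_subset[of "{0}"])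
  then have fa: "f absolutely_integrable_on {0<..}"
    by (intro nonnegative_absolutely_integrable_1) (auto simp: f_def has_integral_integrable)
  have img: "g ` {0<..} = {0<..}"
  proof (intro equalityI subsetI)
    fix y :: real assume "y \<in> {0<..}"
    then show "y \<in> g ` {0<..}" using \<alpha> t
      by (intro image_eqI[of _ _ "(y / t) powr (1 / \<alpha>)"]) (auto simp: g_def powr_powr)
  qed (use t in \<open>auto simp: g_def\<close>)
  have der: "(g has_field_derivative g' x) (at x within {0<..})" if "x \<in> {0<..}" for x
    unfolding g_def g'_def using that by (auto intro!: derivative_eq_intros)
  have inj: "inj_on g {0<..}"
  proof (rule inj_onI)
    fix x y assume xy: "x \<in> {0<..}" "y \<in> {0<..}" "g x = g y"
    then have "(x powr \<alpha>) powr (1 / \<alpha>) = (y powr \<alpha>) powr (1 / \<alpha>)" using t by (simp add: g_def)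
    then show "x = y" using xy \<alpha> by (simp add: powr_powr)
  qed
  have "f absolutely_integrable_on g ` {0<..} \<and> integral (g ` {0<..}) f = Gamma (1 / \<alpha>)"
    using fa fi img by (auto intro: integral_unique)
  then have "(\<lambda>x. \<bar>g' x\<bar> * f (g x)) absolutely_integrable_on {0<..} \<and>
      integral {0<..} (\<lambda>x. \<bar>g' x\<bar> * f (g x)) = Gamma (1 / \<alpha>)"
    using has_absolute_integral_change_of_variables_1'[OF _ der inj, of f "Gamma (1 / \<alpha>)"] by simp
  then have "((\<lambda>x. \<bar>g' x\<bar> * f (g x)) has_integral Gamma (1 / \<alpha>)) {0<..}"
    by (metis has_integral_iff set_lebesgue_integral_eq_integral(1))
  moreover have "\<bar>g' x\<bar> * f (g x) = \<alpha> * t powr (1 / \<alpha>) * exp (- t * \<bar>x\<bar> powr \<alpha>)" if "x \<in> {0<..}" for x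
  proof -
    have "\<alpha> * (1 / \<alpha> - 1) = 1 - \<alpha>" using \<alpha> by (simp add: field_simps)
    then have "(t * x powr \<alpha>) powr (1 / \<alpha> - 1) = t powr (1 / \<alpha> - 1) * x powr (1 - \<alpha>)"
      using that t by (simp add: powr_mult powr_powr del: right_diff_distrib)
    then have "\<bar>g' x\<bar> * f (g x) = \<alpha> * (t * t powr (1 / \<alpha> - 1)) * (x powr (\<alpha> - 1) * x powr (1 - \<alpha>)) * exp (- t * \<bar>x\<bar> powr \<alpha>)"
      using that t \<alpha> by (simp add: f_def g_def g'_def exp_minus divide_inverse)
    moreover have "t * t powr (1 / \<alpha> - 1) = t powr (1 / \<alpha>)"
      using t by (simp add: powr_mult_base)
    moreover have "x powr (\<alpha> - 1) * x powr (1 - \<alpha>) = 1"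
      using that by (simp flip: powr_add)
    ultimately show ?thesis by simp
  qed
  ultimately have "((\<lambda>x. \<alpha> * t powr (1 / \<alpha>) * exp (- t * \<bar>x\<bar> powr \<alpha>)) has_integral Gamma (1 / \<alpha>)) {0<..}"
    by (rule has_integral_eq[rotated])
  from has_integral_mult_right[OF this, of "1 / \<alpha> * t powr (- 1 / \<alpha>)"]
  have "((\<lambda>x. exp (- t * \<bar>x\<bar> powr \<alpha>)) has_integral (Gamma (1 / \<alpha>) / \<alpha> * t powr (- 1 / \<alpha>))) {0<..}"
    using t \<alpha> by (simp add: powr_minus field_simps)
  then have "((\<lambda>x. exp (- t * \<bar>x\<bar> powr \<alpha>)) has_integral (Gamma (1 / \<alpha>) / \<alpha> * t powr (- 1 / \<alpha>))) {0..}"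
    by (rule has_integral_spike_set_eq[THEN iffD1, rotated 2]) (auto intro: negligible_subset[of "{0}"])
  then have "(\<integral>\<^sup>+x. ennreal (indicator {0..} x * exp (- t * \<bar>x\<bar> powr \<alpha>)) \<partial>lborel) = ennreal (Gamma (1 / \<alpha>) / \<alpha> * t powr (- 1 / \<alpha>))"
    by (intro nn_integral_has_integral_lebesgue) auto
  then have "has_bochner_integral lborel (\<lambda>x. indicator {0..} x *\<^sub>R exp (- t * \<bar>x\<bar> powr \<alpha>)) (Gamma (1 / \<alpha>) / \<alpha> * t powr (- 1 / \<alpha>))"
    using \<alpha> by (intro has_bochner_integral_nn_integral) (auto intro!: Gamma_real_nonneg mult_nonneg_nonneg divide_nonneg_nonneg)
  from has_bochner_integral_even_function[OF this] show ?thesis by simp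
qed

text \<open>The characteristic function of the standard normal law, read as a cosine integral and
  rescaled: a Gaussian in the frequency transforms into a normal density of width \<epsilon> in
  \<open>a\<close>.\<close>

lemma integral_cos_gaussian:
  fixes a \<epsilon> :: real
  assumes \<epsilon>: "0 < \<epsilon>"
  shows "(LBINT \<xi>. cos (a * \<xi>) * exp (- (\<epsilon> * \<xi>)\<^sup>2 / 2)) = 2 * pi * normal_density 0 \<epsilon> a"
    and "integrable lborel (\<lambda>\<xi>. exp (- (\<epsilon> * \<xi>)\<^sup>2 / 2))"
proof -
  have sn: "(LBINT x. std_normal_density x * cos (b * x)) = exp (- b\<^sup>2 / 2)" for b
  proof -
    have i: "integrable std_normal_distribution (\<lambda>x. iexp (b * x))"
      using real_dist_normal_dist
      by (intro finite_measure.integrable_const_bound[of _ _ 1])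
        (auto simp: real_distribution_def prob_space_def intro: prob_space.finite_measure)
    have "exp (- b\<^sup>2 / 2) = Re (char std_normal_distribution b)"
      by (simp add: char_std_normal_distribution)
    also have "\<dots> = (LINT x|std_normal_distribution. Re (iexp (b * x)))"
      unfolding char_def by (rule integral_Re[OF i, symmetric])
    also have "\<dots> = (LINT x|std_normal_distribution. cos (b * x))"
      by (simp add: Re_exp)
    also have "\<dots> = (LBINT x. std_normal_density x * cos (b * x))"
      by (subst integral_density) (auto simp: normal_density_nonneg)
    finally show ?thesis by simp
  qed
  have "(LBINT \<xi>. cos (a * \<xi>) * exp (- (\<epsilon> * \<xi>)\<^sup>2 / 2)) = sqrt (2 * pi) * (LBINT \<xi>. std_normal_density (\<epsilon> * \<xi>) * cos (a / \<epsilon> * (\<epsilon> * \<xi>)))"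
    using \<epsilon> by (simp add: std_normal_density_def field_simps flip: integral_mult_right_zero)
  also have "(LBINT \<xi>. std_normal_density (\<epsilon> * \<xi>) * cos (a / \<epsilon> * (\<epsilon> * \<xi>))) = exp (- (a / \<epsilon>)\<^sup>2 / 2) / \<epsilon>"
    using lborel_integral_real_affine[of \<epsilon> "\<lambda>x. std_normal_density x * cos (a / \<epsilon> * x)" 0] \<epsilon> sn[of "a / \<epsilon>"]
    by (simp add: field_simps)
  also have "sqrt (2 * pi) * (exp (- (a / \<epsilon>)\<^sup>2 / 2) / \<epsilon>) = 2 * pi * normal_density 0 \<epsilon> a"
    using \<epsilon> real_sqrt_mult_self[of "2 * pi"]
    by (simp add: normal_density_def real_sqrt_mult power_divide field_simps)
  finally show "(LBINT \<xi>. cos (a * \<xi>) * exp (- (\<epsilon> * \<xi>)\<^sup>2 / 2)) = 2 * pi * normal_density 0 \<epsilon> a" .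
  have "integrable lborel (\<lambda>\<xi>. sqrt (2 * pi) * std_normal_density (0 + \<epsilon> * \<xi>))"
    using \<epsilon> by (intro integrable_mult_right lborel_integrable_real_affine) auto
  then show "integrable lborel (\<lambda>\<xi>. exp (- (\<epsilon> * \<xi>)\<^sup>2 / 2))"
    by (simp add: std_normal_density_def)
qed

text \<open>\<open>y < exp y\<close> at \<open>y = d\<^sup>2 / (2 * \<epsilon>\<^sup>2)\<close>,
  with 1 / sqrt (2 pi) bounded by 1. What matters is that the density away from 0 is of order
  \<epsilon>, uniformly.\<close>

lemma normal_density_far_bound:
  assumes "0 < \<epsilon>" "0 < r" "r \<le> \<bar>d\<bar>"
  shows "normal_density 0 \<epsilon> d \<le> 2 * \<epsilon> / r\<^sup>2"
proof -
  have d: "r\<^sup>2 \<le> d\<^sup>2" using assms by (metis abs_le_square_iff abs_of_pos)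
  have d0: "0 < d\<^sup>2" using d assms by (meson less_le_trans zero_less_power)
  have "d\<^sup>2 / (2 * \<epsilon>\<^sup>2) < exp (d\<^sup>2 / (2 * \<epsilon>\<^sup>2))" by (rule exp_gt_self)
  then have "exp (- (d\<^sup>2 / (2 * \<epsilon>\<^sup>2))) \<le> 2 * \<epsilon>\<^sup>2 / d\<^sup>2"
    using d0 assms by (simp add: exp_minus field_simps)
  also have "\<dots> \<le> 2 * \<epsilon>\<^sup>2 / r\<^sup>2" using d assms by (intro divide_left_mono) auto
  finally have e: "exp (- (d\<^sup>2 / (2 * \<epsilon>\<^sup>2))) \<le> 2 * \<epsilon>\<^sup>2 / r\<^sup>2" .
  have "1 \<le> 2 * pi" using pi_ge_two by simp
  then have "\<epsilon>\<^sup>2 \<le> 2 * pi * \<epsilon>\<^sup>2" using mult_right_mono[of 1 "2 * pi" "\<epsilon>\<^sup>2"] by simp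
  then have "\<epsilon> \<le> sqrt (2 * pi * \<epsilon>\<^sup>2)" using assms by (intro real_le_rsqrt) auto
  then have "1 / sqrt (2 * pi * \<epsilon>\<^sup>2) \<le> 1 / \<epsilon>" using assms by (intro divide_left_mono) auto
  then have "normal_density 0 \<epsilon> d \<le> 1 / \<epsilon> * (2 * \<epsilon>\<^sup>2 / r\<^sup>2)"
    unfolding normal_density_def using e assms by (intro mult_mono) auto
  then show ?thesis using assms by (simp add: power2_eq_square)
qed

text \<open>\<open>f\<close> may be unbounded away from \<open>x\<close>. Near \<open>x\<close> it
  is bounded by \<open>\<bar>f x\<bar> + 1\<close>, and dominated convergence applies after
  rescaling; away from \<open>x\<close> the density is uniformly small, and integrability of
  \<open>f\<close> suffices.\<close>

lemma gaussian_approximate_identity: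
  fixes f :: "real \<Rightarrow> real"
  assumes f: "integrable lborel f" and c: "isCont f x"
  shows "(\<lambda>n. LBINT y. f y * normal_density 0 (1 / real (Suc n)) (x - y)) \<longlonglongrightarrow> f x"
proof -
  obtain r where r: "0 < r" and near: "\<And>y. \<bar>y - x\<bar> < r \<Longrightarrow> \<bar>f y - f x\<bar> < 1"
    using c[unfolded continuous_at_eps_delta, rule_format, of 1] by (auto simp: dist_real_def)
  have fm[measurable]: "f \<in> borel_measurable borel" using f by auto
  define e where "e n = 1 / real (Suc n)" for n
  have e0: "0 < e n" for n by (simp add: e_def)
  have e_lim: "e \<longlonglongrightarrow> 0"
    unfolding e_def using LIMSEQ_inverse_real_of_nat by (simp add: inverse_eq_divide)
  define fn where "fn y = indicator {x - r<..<x + r} y * f y" for y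
  define ff where "ff y = indicator (- {x - r<..<x + r}) y * f y" for y
  have [measurable]: "fn \<in> borel_measurable borel" "ff \<in> borel_measurable borel"
    unfolding fn_def ff_def by measurable
  have fnb: "\<bar>fn y\<bar> \<le> \<bar>f x\<bar> + 1" for y
  proof (cases "y \<in> {x - r<..<x + r}")
    case True
    then have "\<bar>y - x\<bar> < r" by (auto simp: abs_less_iff)
    from near[OF this] abs_triangle_ineq[of "f x" "f y - f x"] True show ?thesis by (simp add: fn_def)
  qed (simp add: fn_def)
  \<comment> \<open>The substitution \<open>y = x - e n * w\<close> maps the density of width
    \<open>e n\<close> to the standard one.\<close>
  have nd: "normal_density 0 (e n) (x - (x + (- e n) * w)) * e n = std_normal_density w" for n w
    using e0[of n] by (simp add: normal_density_def real_sqrt_mult power_mult_distrib)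
  have ni: "integrable lborel (\<lambda>y. fn y * normal_density 0 (e n) (x - y))" for n
  proof -
    have "integrable lborel (\<lambda>y. (\<bar>f x\<bar> + 1) * normal_density 0 (e n) (x + (- 1) * y))"
      by (intro integrable_mult_right lborel_integrable_real_affine) (use e0 in auto)
    then show ?thesis
      by (rule Bochner_Integration.integrable_bound)
        (auto simp: abs_mult normal_density_nonneg intro!: mult_right_mono order_trans[OF fnb])
  qed
  have 1: "(\<lambda>n. LBINT y. fn y * normal_density 0 (e n) (x - y)) \<longlonglongrightarrow> f x"
  proof -
    have "(\<lambda>n. LBINT w. fn (x + (- e n) * w) * std_normal_density w) \<longlonglongrightarrow> (LBINT w. f x * std_normal_density w)"
    proof (rule integral_dominated_convergence[where w="\<lambda>w. (\<bar>f x\<bar> + 1) * std_normal_density w"])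
      show "AE w in lborel. norm (fn (x + (- e n) * w) * std_normal_density w) \<le> (\<bar>f x\<bar> + 1) * std_normal_density w" for n
        by (auto simp: abs_mult normal_density_nonneg intro!: mult_right_mono fnb)
      show "AE w in lborel. (\<lambda>n. fn (x + (- e n) * w) * std_normal_density w) \<longlonglongrightarrow> f x * std_normal_density w"
      proof (intro AE_I2 tendsto_mult tendsto_const)
        fix w
        have lim: "(\<lambda>n. x + (- e n) * w) \<longlonglongrightarrow> x"
          using tendsto_add[OF tendsto_const[of x] tendsto_mult_left_zero[OF tendsto_minus[OF e_lim, simplified], of w]] by simp
        then have "(\<lambda>n. f (x + (- e n) * w)) \<longlonglongrightarrow> f x" by (rule isCont_tendsto_compose[OF c])
        moreover have "\<forall>\<^sub>F n in sequentially. x + (- e n) * w \<in> {x - r<..<x + r}"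
          using lim r by (intro topological_tendstoD) auto
        then have "\<forall>\<^sub>F n in sequentially. f (x + (- e n) * w) = fn (x + (- e n) * w)"
          by eventually_elim (simp add: fn_def)
        ultimately show "(\<lambda>n. fn (x + (- e n) * w)) \<longlonglongrightarrow> f x" by (rule Lim_transform_eventually)
      qed
    qed auto
    moreover have "(LBINT y. fn y * normal_density 0 (e n) (x - y)) = (LBINT w. fn (x + (- e n) * w) * std_normal_density w)" for n
    proof -
      have "(LBINT y. fn y * normal_density 0 (e n) (x - y)) =
          e n * (LBINT w. fn (x + (- e n) * w) * normal_density 0 (e n) (x - (x + (- e n) * w)))"
        using lborel_integral_real_affine[of "- e n" "\<lambda>y. fn y * normal_density 0 (e n) (x - y)" x] e0[of n]
        by simp
      also have "\<dots> = (LBINT w. fn (x + (- e n) * w) * (normal_density 0 (e n) (x - (x + (- e n) * w)) * e n))"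
        by (subst integral_mult_right_zero[symmetric]) (simp only: mult_ac)
      finally show ?thesis unfolding nd .
    qed
    ultimately show ?thesis by simp
  qed
  have fi: "integrable lborel (\<lambda>y. ff y * normal_density 0 (e n) (x - y)) \<and>
      \<bar>LBINT y. ff y * normal_density 0 (e n) (x - y)\<bar> \<le> e n * (2 / r\<^sup>2 * (LBINT y. \<bar>f y\<bar>))" for n
  proof -
    have b: "\<bar>ff y * normal_density 0 (e n) (x - y)\<bar> \<le> (2 * e n / r\<^sup>2) * \<bar>f y\<bar>" for y
    proof (cases "r \<le> \<bar>x - y\<bar>")
      case True
      have "\<bar>ff y\<bar> * normal_density 0 (e n) (x - y) \<le> \<bar>f y\<bar> * (2 * e n / r\<^sup>2)"
        by (intro mult_mono normal_density_far_bound e0 r True) (auto simp: ff_def indicator_def normal_density_nonneg)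
      then show ?thesis by (simp add: abs_mult normal_density_nonneg mult.commute)
    next
      case False
      then have "ff y = 0" by (auto simp: ff_def indicator_def)
      then show ?thesis using e0[of n] by simp
    qed
    have ib: "integrable lborel (\<lambda>y. (2 * e n / r\<^sup>2) * \<bar>f y\<bar>)" using f by simp
    have i: "integrable lborel (\<lambda>y. ff y * normal_density 0 (e n) (x - y))"
    proof (rule Bochner_Integration.integrable_bound[OF ib])
      show "AE y in lborel. norm (ff y * normal_density 0 (e n) (x - y)) \<le> norm ((2 * e n / r\<^sup>2) * \<bar>f y\<bar>)"
        by (intro AE_I2) (metis b abs_ge_self order_trans real_norm_def)
    qed measurable
    have "\<bar>LBINT y. ff y * normal_density 0 (e n) (x - y)\<bar> \<le> (LBINT y. (2 * e n / r\<^sup>2) * \<bar>f y\<bar>)"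
      by (rule order_trans[OF integral_abs_bound integral_mono]) (use i ib b in auto)
    then show ?thesis using i by (simp add: mult_ac)
  qed
  have 2: "(\<lambda>n. LBINT y. ff y * normal_density 0 (e n) (x - y)) \<longlonglongrightarrow> 0"
  proof (rule Lim_null_comparison)
    show "\<forall>\<^sub>F n in sequentially. norm (LBINT y. ff y * normal_density 0 (e n) (x - y)) \<le> e n * (2 / r\<^sup>2 * (LBINT y. \<bar>f y\<bar>))"
      using fi by simp
    show "(\<lambda>n. e n * (2 / r\<^sup>2 * (LBINT y. \<bar>f y\<bar>))) \<longlonglongrightarrow> 0"
      using tendsto_mult_left_zero[OF e_lim] by blast
  qed
  have "(LBINT y. f y * normal_density 0 (e n) (x - y)) =
     (LBINT y. fn y * normal_density 0 (e n) (x - y)) + (LBINT y. ff y * normal_density 0 (e n) (x - y))" for n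
  proof -
    have "f y = fn y + ff y" for y by (simp add: fn_def ff_def indicator_def)
    then show ?thesis using ni[of n] fi[of n] by (simp add: distrib_right)
  qed
  then show ?thesis using tendsto_add[OF 1 2] by (simp add: e_def)
qed

text \<open>Gaussian regularisation: the factor exp (- (e \<xi>)^2 / 2) makes Fubini applicable, its
  transform is an approximate identity for \<open>f\<close>, and integrability of \<phi> allows the
  factor to be removed again. The hypotheses on cosine and sine are the real form of a real-valued
  Fourier transform.\<close>

lemma Fourier_inversion_real:
  fixes f \<phi> :: "real \<Rightarrow> real"
  assumes f: "integrable lborel f" and \<phi>: "integrable lborel \<phi>" and c: "isCont f x"
    and cos: "\<And>\<xi>. (LBINT y. cos (y * \<xi>) * f y) = \<phi> \<xi>" and sin: "\<And>\<xi>. (LBINT y. sin (y * \<xi>) * f y) = 0"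
  shows "f x = (LBINT \<xi>. cos (x * \<xi>) * \<phi> \<xi>) / (2 * pi)"
proof -
  have [measurable]: "f \<in> borel_measurable borel" "\<phi> \<in> borel_measurable borel" using f \<phi> by auto
  define e where "e n = 1 / real (Suc n)" for n
  have e0: "0 < e n" for n by (simp add: e_def)
  have e_lim: "e \<longlonglongrightarrow> 0"
    unfolding e_def using LIMSEQ_inverse_real_of_nat by (simp add: inverse_eq_divide)
  have "(\<lambda>n. LBINT \<xi>. cos (x * \<xi>) * \<phi> \<xi> * exp (- (e n * \<xi>)\<^sup>2 / 2)) \<longlonglongrightarrow> (LBINT \<xi>. cos (x * \<xi>) * \<phi> \<xi> * exp (- (0 * \<xi>)\<^sup>2 / 2))"
  proof (rule integral_dominated_convergence[where w="\<lambda>\<xi>. \<bar>\<phi> \<xi>\<bar>"])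
    have "\<bar>cos (x * \<xi>)\<bar> * \<bar>\<phi> \<xi>\<bar> * exp (- (e n * \<xi>)\<^sup>2 / 2) \<le> 1 * \<bar>\<phi> \<xi>\<bar> * 1" for n \<xi>
      by (intro mult_mono) auto
    then show "AE \<xi> in lborel. norm (cos (x * \<xi>) * \<phi> \<xi> * exp (- (e n * \<xi>)\<^sup>2 / 2)) \<le> \<bar>\<phi> \<xi>\<bar>" for n
      by (simp add: abs_mult)
    show "AE \<xi> in lborel. (\<lambda>n. cos (x * \<xi>) * \<phi> \<xi> * exp (- (e n * \<xi>)\<^sup>2 / 2)) \<longlonglongrightarrow> cos (x * \<xi>) * \<phi> \<xi> * exp (- (0 * \<xi>)\<^sup>2 / 2)"
      by (intro AE_I2 tendsto_intros e_lim) auto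
  qed (use \<phi> in auto)
  moreover have "(LBINT \<xi>. cos (x * \<xi>) * \<phi> \<xi> * exp (- (e n * \<xi>)\<^sup>2 / 2)) = 2 * pi * (LBINT y. f y * normal_density 0 (e n) (x - y))" for n
  proof -
    let ?g = "\<lambda>\<xi>. exp (- (e n * \<xi>)\<^sup>2 / 2)"
    have gi: "integrable lborel ?g" using integral_cos_gaussian(2)[OF e0] .
    have fc: "integrable lborel (\<lambda>y. cos (y * \<xi>) * f y)" "integrable lborel (\<lambda>y. sin (y * \<xi>) * f y)" for \<xi>
      by (rule Bochner_Integration.integrable_bound[OF f], auto simp: abs_mult intro!: mult_left_le_one_le)+
    have inner: "(LBINT y. cos ((x - y) * \<xi>) * f y) = cos (x * \<xi>) * \<phi> \<xi>" for \<xi>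
    proof -
      have "(LBINT y. cos ((x - y) * \<xi>) * f y) = (LBINT y. cos (x * \<xi>) * (cos (y * \<xi>) * f y) + sin (x * \<xi>) * (sin (y * \<xi>) * f y))"
        by (intro Bochner_Integration.integral_cong refl) (simp add: left_diff_distrib cos_diff algebra_simps)
      then show ?thesis using fc[of \<xi>] by (simp add: cos sin)
    qed
    have int: "integrable (lborel \<Otimes>\<^sub>M lborel) (\<lambda>(\<xi>, y). ?g \<xi> * (cos ((x - y) * \<xi>) * f y))"
    proof (rule lborel_pair.Fubini_integrable)
      have "\<bar>f y\<bar> * ?g \<xi> \<ge> 0" for y \<xi> by simp
      have i1: "integrable lborel (\<lambda>y. cos ((x - y) * \<xi>) * f y)" for \<xi>
        by (rule Bochner_Integration.integrable_bound[OF f]) (auto simp: abs_mult intro!: mult_left_le_one_le)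
      show "integrable lborel (\<lambda>\<xi>. LBINT y. norm (case (\<xi>, y) of (\<xi>, y) \<Rightarrow> ?g \<xi> * (cos ((x - y) * \<xi>) * f y)))"
      proof (rule Bochner_Integration.integrable_bound[of _ "\<lambda>\<xi>. ?g \<xi> * (LBINT y. \<bar>f y\<bar>)"])
        show "integrable lborel (\<lambda>\<xi>. ?g \<xi> * (LBINT y. \<bar>f y\<bar>))" using gi by simp
        have "(LBINT y. \<bar>cos ((x - y) * \<xi>) * f y\<bar>) \<le> (LBINT y. \<bar>f y\<bar>)" for \<xi>
          by (intro integral_mono integrable_abs i1 f) (auto simp: abs_mult intro!: mult_left_le_one_le)
        then show "AE \<xi> in lborel. norm (LBINT y. norm (case (\<xi>, y) of (\<xi>, y) \<Rightarrow> ?g \<xi> * (cos ((x - y) * \<xi>) * f y))) \<le> norm (?g \<xi> * (LBINT y. \<bar>f y\<bar>))"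
          by (simp add: abs_mult)
      qed measurable
      show "AE \<xi> in lborel. integrable lborel (\<lambda>y. case (\<xi>, y) of (\<xi>, y) \<Rightarrow> ?g \<xi> * (cos ((x - y) * \<xi>) * f y))"
        using i1 by simp
    qed measurable
    have "(LBINT \<xi>. cos (x * \<xi>) * \<phi> \<xi> * ?g \<xi>) = (LBINT \<xi>. LBINT y. ?g \<xi> * (cos ((x - y) * \<xi>) * f y))"
      by (simp only: integral_mult_right_zero inner) (simp only: mult_ac)
    also have "\<dots> = (LBINT y. LBINT \<xi>. ?g \<xi> * (cos ((x - y) * \<xi>) * f y))"
      using lborel_pair.Fubini_integral[OF int] by simp
    also have "\<dots> = (LBINT y. f y * (LBINT \<xi>. cos ((x - y) * \<xi>) * ?g \<xi>))"
      by (subst integral_mult_right_zero[symmetric]) (simp only: mult_ac)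
    also have "\<dots> = 2 * pi * (LBINT y. f y * normal_density 0 (e n) (x - y))"
      unfolding integral_cos_gaussian(1)[OF e0]
      by (subst integral_mult_right_zero[symmetric]) (simp only: mult_ac)
    finally show ?thesis .
  qed
  moreover have "(\<lambda>n. 2 * pi * (LBINT y. f y * normal_density 0 (e n) (x - y))) \<longlonglongrightarrow> 2 * pi * f x"
    unfolding e_def by (intro tendsto_mult_left gaussian_approximate_identity f c)
  ultimately have "(\<lambda>n. 2 * pi * (LBINT y. f y * normal_density 0 (e n) (x - y))) \<longlonglongrightarrow> (LBINT \<xi>. cos (x * \<xi>) * \<phi> \<xi>)"
    and "(\<lambda>n. 2 * pi * (LBINT y. f y * normal_density 0 (e n) (x - y))) \<longlonglongrightarrow> 2 * pi * f x" by simp_all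
  from LIMSEQ_unique[OF this] have "(LBINT \<xi>. cos (x * \<xi>) * \<phi> \<xi>) = 2 * pi * f x" .
  then show ?thesis by simp
qed

section \<open>The fractional heat kernel\<close>

locale fractional_kernel =
  fixes \<alpha> :: real and G :: "real \<Rightarrow> real \<Rightarrow> real"
  assumes alpha: "1 < \<alpha>" "\<alpha> \<le> 2" and kernel: "fractional_heat_kernel \<alpha> G"
begin

section \<open>Pointwise formulas for the kernel from Fourier inversion\<close>

lemma G_integrable: "0 < t \<Longrightarrow> integrable lborel (G t)"
  and G_continuous: "0 < t \<Longrightarrow> continuous_on UNIV (G t)"
  using kernel by (auto simp: fractional_heat_kernel_def)

lemma G_isCont: "0 < t \<Longrightarrow> isCont (G t) x"
  using G_continuous by (simp add: continuous_on_eq_continuous_at)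

lemma G_borel: "0 < t \<Longrightarrow> G t \<in> borel_measurable borel"
  by (rule borel_measurable_continuous_onI[OF G_continuous])

lemma integrable_symbol: "0 < t \<Longrightarrow> integrable lborel (\<lambda>\<xi>. exp (- t * \<bar>\<xi>\<bar> powr \<alpha>))"
  using has_bochner_integral_stretched_exp[of \<alpha> t] alpha by (auto intro: integrable.intros)

lemma G_trig:
  assumes t: "0 < t"
  shows "(LBINT y. cos (y * \<xi>) * G t y) = exp (- t * \<bar>\<xi>\<bar> powr \<alpha>)"
    and "(LBINT y. sin (y * \<xi>) * G t y) = 0"
proof -
  note [measurable] = G_borel[OF t]
  let ?f = "\<lambda>x. exp (- \<i> * of_real (x * \<xi>)) * of_real (G t x) :: complex"
  have f: "?f x = Complex (cos (x * \<xi>) * G t x) (- sin (x * \<xi>) * G t x)" for x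
    by (simp add: complex_eq_iff Re_exp Im_exp)
  have "integrable lborel ?f"
    by (rule Bochner_Integration.integrable_bound[OF G_integrable[OF t]]) (auto simp: norm_mult)
  note i = this
  have e: "(CLBINT x. ?f x) = of_real (exp (- t * \<bar>\<xi>\<bar> powr \<alpha>))"
    using kernel t unfolding fractional_heat_kernel_def by blast
  have "Re (CLBINT x. ?f x) = (LBINT y. cos (y * \<xi>) * G t y)"
    by (subst integral_Re[OF i, symmetric]) (simp only: f complex.sel)
  then show "(LBINT y. cos (y * \<xi>) * G t y) = exp (- t * \<bar>\<xi>\<bar> powr \<alpha>)" using e by simp
  have "Im (CLBINT x. ?f x) = (LBINT y. - sin (y * \<xi>) * G t y)"
    by (subst integral_Im[OF i, symmetric]) (simp only: f complex.sel)
  then show "(LBINT y. sin (y * \<xi>) * G t y) = 0" using e by simp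
qed

text \<open>Continuity of \<open>G t\<close> enters here: it turns the transform, which determines
  \<open>G t\<close> up to null sets, into a formula valid at every point. Scaling, bounds and
  measurability of \<open>G\<close> are read off from it.\<close>

lemma G_inversion:
  assumes t: "0 < t"
  shows "G t x = (LBINT \<xi>. cos (x * \<xi>) * exp (- t * \<bar>\<xi>\<bar> powr \<alpha>)) / (2 * pi)"
  by (rule Fourier_inversion_real[OF G_integrable[OF t] integrable_symbol[OF t] G_isCont[OF t] G_trig[OF t]])

text \<open>\<open>k = c powr (- 1 / \<alpha>)\<close> solves
  \<open>c * k powr \<alpha> = 1\<close>, so replacing \<xi> by \<open>k * \<xi>\<close> absorbs
  \<open>c\<close> in the symbol.\<close>

lemma G_scale:
  assumes c: "0 < c" and t: "0 < t"
  shows "G (c * t) x = c powr (- 1 / \<alpha>) * G t (c powr (- 1 / \<alpha>) * x)"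
proof -
  define k where "k = c powr (- 1 / \<alpha>)"
  have k: "0 < k" using c by (simp add: k_def)
  have ck: "c * k powr \<alpha> = 1"
  proof -
    have "k powr \<alpha> = c powr (- 1)" unfolding k_def powr_powr using alpha by simp
    then show ?thesis using c by (simp add: powr_minus_divide)
  qed
  have "(LBINT \<xi>. cos (x * \<xi>) * exp (- (c * t) * \<bar>\<xi>\<bar> powr \<alpha>)) =
      k * (LBINT \<xi>. cos (x * (0 + k * \<xi>)) * exp (- (c * t) * \<bar>0 + k * \<xi>\<bar> powr \<alpha>))"
    using lborel_integral_real_affine[of k "\<lambda>\<xi>. cos (x * \<xi>) * exp (- (c * t) * \<bar>\<xi>\<bar> powr \<alpha>)" 0] k by simp
  also have "(\<lambda>\<xi>. cos (x * (0 + k * \<xi>)) * exp (- (c * t) * \<bar>0 + k * \<xi>\<bar> powr \<alpha>)) =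
      (\<lambda>\<xi>. cos (k * x * \<xi>) * exp (- t * \<bar>\<xi>\<bar> powr \<alpha>))"
  proof
    fix \<xi>
    have "(c * t) * \<bar>0 + k * \<xi>\<bar> powr \<alpha> = (c * k powr \<alpha>) * (t * \<bar>\<xi>\<bar> powr \<alpha>)"
      using k by (simp add: abs_mult powr_mult)
    then show "cos (x * (0 + k * \<xi>)) * exp (- (c * t) * \<bar>0 + k * \<xi>\<bar> powr \<alpha>) = cos (k * x * \<xi>) * exp (- t * \<bar>\<xi>\<bar> powr \<alpha>)"
      unfolding ck by (simp add: mult_ac)
  qed
  finally show ?thesis
    using c t by (simp add: G_inversion k_def)
qed

text \<open>The frequency integral 2 Gamma (1 / \<alpha>) / \<alpha> * t^(-1/\<alpha>), divided by 2
  pi.\<close>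

lemma G_zero:
  assumes t: "0 < t"
  shows "G t 0 = Gamma (1 / \<alpha>) / (pi * \<alpha>) * t powr (- 1 / \<alpha>)"
  using has_bochner_integral_stretched_exp[of \<alpha> t, THEN has_bochner_integral_integral_eq] t alpha
  by (simp add: G_inversion)

text \<open>The symbol is positive, so the cosine integral is largest where all cosines are
  1.\<close>

lemma G_bounded:
  assumes t: "0 < t"
  shows "\<bar>G t x\<bar> \<le> G t 0"
proof -
  have i: "integrable lborel (\<lambda>\<xi>. cos (x * \<xi>) * exp (- t * \<bar>\<xi>\<bar> powr \<alpha>))"
    by (rule Bochner_Integration.integrable_bound[OF integrable_symbol[OF t]]) (auto simp: abs_mult)
  have "\<bar>LBINT \<xi>. cos (x * \<xi>) * exp (- t * \<bar>\<xi>\<bar> powr \<alpha>)\<bar> \<le> (LBINT \<xi>. \<bar>cos (x * \<xi>) * exp (- t * \<bar>\<xi>\<bar> powr \<alpha>)\<bar>)"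
    by (rule integral_abs_bound)
  also have "\<dots> \<le> (LBINT \<xi>. exp (- t * \<bar>\<xi>\<bar> powr \<alpha>))"
    by (intro integral_mono integrable_abs i integrable_symbol t) (auto simp: abs_mult)
  finally have "\<bar>LBINT \<xi>. cos (x * \<xi>) * exp (- t * \<bar>\<xi>\<bar> powr \<alpha>)\<bar> \<le> (LBINT \<xi>. exp (- t * \<bar>\<xi>\<bar> powr \<alpha>))" .
  then show ?thesis using t by (simp add: G_inversion divide_right_mono)
qed

text \<open>\<open>fractional_heat_kernel\<close> speaks of each time separately; joint
  measurability comes from the inversion formula as an integral depending on parameters. The
  indicator removes the times at which \<open>G\<close> is arbitrary.\<close>

lemma G_measurable[measurable]:
  "(\<lambda>z. indicator {0<..} (fst z) * G (fst z) (snd z)) \<in> borel_measurable (borel \<Otimes>\<^sub>M borel)"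
proof -
  have "(\<lambda>z. indicator {0<..} (fst z) * ((LBINT \<xi>. cos (snd z * \<xi>) * exp (- fst z * \<bar>\<xi>\<bar> powr \<alpha>)) / (2 * pi)))
     \<in> borel_measurable (borel \<Otimes>\<^sub>M borel)"
    by measurable
  also have "(\<lambda>z. indicator {0<..} (fst z) * ((LBINT \<xi>. cos (snd z * \<xi>) * exp (- fst z * \<bar>\<xi>\<bar> powr \<alpha>)) / (2 * pi))) =
     (\<lambda>z. indicator {0<..} (fst z) * G (fst z) (snd z))"
    by (auto simp: fun_eq_iff indicator_def G_inversion)
  finally show ?thesis .
qed

lemma G_times_integrable:
  assumes t: "0 < t" and s: "0 < s"
  shows "integrable lborel (\<lambda>y. G t (x - y) * G s (z - y))"
proof -
  note [measurable] = G_borel[OF t] G_borel[OF s]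
  have "integrable lborel (\<lambda>y. G s 0 * G t (x + (- 1) * y))"
    by (intro integrable_mult_right lborel_integrable_real_affine G_integrable t) auto
  then show ?thesis
  proof (rule Bochner_Integration.integrable_bound)
    have "\<bar>G t (x - y)\<bar> * \<bar>G s (z - y)\<bar> \<le> \<bar>G t (x - y)\<bar> * \<bar>G s 0\<bar>" for y
      by (intro mult_left_mono order_trans[OF G_bounded[OF s]]) auto
    then show "AE y in lborel. norm (G t (x - y) * G s (z - y)) \<le> norm (G s 0 * G t (x + - 1 * y))"
      by (simp add: abs_mult mult.commute)
  qed measurable
qed

text \<open>Plancherel's identity and the semigroup law in one: inversion is inserted for
  \<open>G s\<close> only, and after Fubini the inner integral is the transform of
  \<open>G t\<close>, so the symbols multiply to that of time \<open>t + s\<close>.\<close>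

lemma G_correlation:
  assumes t: "0 < t" and s: "0 < s"
  shows "(LBINT y. G t (x - y) * G s (z - y)) = G (t + s) (z - x)"
proof -
  note [measurable] = G_borel[OF t] G_borel[OF s]
  define h where "h = z - x"
  let ?e = "\<lambda>\<xi>. exp (- s * \<bar>\<xi>\<bar> powr \<alpha>)"
  have cs: "integrable lborel (\<lambda>y. cos (y * \<xi>) * G t y)" "integrable lborel (\<lambda>y. sin (y * \<xi>) * G t y)" for \<xi>
    by (rule Bochner_Integration.integrable_bound[OF G_integrable[OF t]], auto simp: abs_mult intro!: mult_left_le_one_le)+
  have inner: "(LBINT y. cos ((y + h) * \<xi>) * G t y) = cos (h * \<xi>) * exp (- t * \<bar>\<xi>\<bar> powr \<alpha>)" for \<xi>
  proof -
    have "(LBINT y. cos ((y + h) * \<xi>) * G t y) = (LBINT y. cos (h * \<xi>) * (cos (y * \<xi>) * G t y) - sin (h * \<xi>) * (sin (y * \<xi>) * G t y))"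
      by (intro Bochner_Integration.integral_cong refl) (simp add: distrib_right cos_add algebra_simps)
    then show ?thesis using cs[of \<xi>] by (simp add: G_trig[OF t])
  qed
  have int: "integrable (lborel \<Otimes>\<^sub>M lborel) (\<lambda>(y, \<xi>). G t y * (cos ((y + h) * \<xi>) * ?e \<xi>))"
  proof (rule lborel_pair.Fubini_integrable)
    have i1: "integrable lborel (\<lambda>\<xi>. cos ((y + h) * \<xi>) * ?e \<xi>)" for y
      by (rule Bochner_Integration.integrable_bound[OF integrable_symbol[OF s]]) (auto simp: abs_mult)
    show "integrable lborel (\<lambda>y. LBINT \<xi>. norm (case (y, \<xi>) of (y, \<xi>) \<Rightarrow> G t y * (cos ((y + h) * \<xi>) * ?e \<xi>)))"
    proof (rule Bochner_Integration.integrable_bound[of _ "\<lambda>y. G t y * (LBINT \<xi>. ?e \<xi>)"])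
      show "integrable lborel (\<lambda>y. G t y * (LBINT \<xi>. ?e \<xi>))" using G_integrable[OF t] by simp
      have "(LBINT \<xi>. \<bar>cos ((y + h) * \<xi>) * ?e \<xi>\<bar>) \<le> (LBINT \<xi>. ?e \<xi>)" for y
        by (intro integral_mono integrable_abs i1 integrable_symbol s) (auto simp: abs_mult)
      then have b: "\<bar>G t y\<bar> * (LBINT \<xi>. \<bar>cos ((y + h) * \<xi>) * ?e \<xi>\<bar>) \<le> \<bar>G t y\<bar> * \<bar>LBINT \<xi>. ?e \<xi>\<bar>" for y
        by (rule mult_left_mono[OF order_trans[OF _ abs_ge_self]]) auto
      have "norm (LBINT \<xi>. norm (case (y, \<xi>) of (y, \<xi>) \<Rightarrow> G t y * (cos ((y + h) * \<xi>) * ?e \<xi>))) = \<bar>G t y\<bar> * (LBINT \<xi>. \<bar>cos ((y + h) * \<xi>) * ?e \<xi>\<bar>)" for y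
        by (simp add: abs_mult[of "G t y"])
      with b show "AE y in lborel. norm (LBINT \<xi>. norm (case (y, \<xi>) of (y, \<xi>) \<Rightarrow> G t y * (cos ((y + h) * \<xi>) * ?e \<xi>))) \<le> norm (G t y * (LBINT \<xi>. ?e \<xi>))"
        by (simp only: real_norm_def abs_mult[of "G t _"] AE_I2)
    qed measurable
    show "AE y in lborel. integrable lborel (\<lambda>\<xi>. case (y, \<xi>) of (y, \<xi>) \<Rightarrow> G t y * (cos ((y + h) * \<xi>) * ?e \<xi>))"
      using i1 by simp
  qed measurable
  have "(LBINT y. G t (x - y) * G s (z - y)) = (LBINT y. G t y * G s (y + h))"
    using lborel_integral_real_affine[of "-1" "\<lambda>y. G t (x - y) * G s (z - y)" x] by (simp add: h_def algebra_simps)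
  also have "\<dots> = (LBINT y. LBINT \<xi>. G t y * (cos ((y + h) * \<xi>) * ?e \<xi>)) / (2 * pi)"
    by (simp add: G_inversion[OF s])
  also have "(LBINT y. LBINT \<xi>. G t y * (cos ((y + h) * \<xi>) * ?e \<xi>)) = (LBINT \<xi>. LBINT y. G t y * (cos ((y + h) * \<xi>) * ?e \<xi>))"
    using lborel_pair.Fubini_integral[OF int] by simp
  also have "\<dots> = (LBINT \<xi>. ?e \<xi> * (LBINT y. cos ((y + h) * \<xi>) * G t y))"
    by (subst integral_mult_right_zero[symmetric]) (simp only: mult_ac)
  also have "\<dots> = (LBINT \<xi>. cos (h * \<xi>) * exp (- (t + s) * \<bar>\<xi>\<bar> powr \<alpha>))"
    unfolding inner by (intro Bochner_Integration.integral_cong refl) (simp add: exp_add[symmetric] algebra_simps)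
  finally show ?thesis using t s by (simp add: G_inversion h_def)
qed

lemma G_square_integral:
  assumes t: "0 < t"
  shows "(\<integral>\<^sup>+y. ennreal ((G t (x - y))\<^sup>2) \<partial>lborel) = ennreal (G (2 * t) 0)"
  using G_correlation[OF t t, of x x] G_times_integrable[OF t t, of x x]
  by (subst nn_integral_eq_integral) (auto simp: power2_eq_square)

lemma G_diff_square_integral:
  assumes t: "0 < t" and s: "0 < s"
  shows "(\<integral>\<^sup>+y. ennreal ((G t (x - y) - G s (z - y))\<^sup>2) \<partial>lborel) = ennreal (G (2 * t) 0 - 2 * G (t + s) (z - x) + G (2 * s) 0)"
    and "0 \<le> G (2 * t) 0 - 2 * G (t + s) (z - x) + G (2 * s) 0"
proof -
  have e: "(\<lambda>y. (G t (x - y) - G s (z - y))\<^sup>2) =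
      (\<lambda>y. G t (x - y) * G t (x - y) - 2 * (G t (x - y) * G s (z - y)) + G s (z - y) * G s (z - y))"
    by (simp add: fun_eq_iff power2_eq_square algebra_simps)
  have i: "integrable lborel (\<lambda>y. (G t (x - y) - G s (z - y))\<^sup>2)"
    unfolding e by (intro Bochner_Integration.integrable_add Bochner_Integration.integrable_diff integrable_mult_right G_times_integrable t s)
  have I: "(LBINT y. (G t (x - y) - G s (z - y))\<^sup>2) = G (2 * t) 0 - 2 * G (t + s) (z - x) + G (2 * s) 0"
    unfolding e using G_times_integrable[OF t t, of x x] G_times_integrable[OF t s, of x z] G_times_integrable[OF s s, of z z]
      G_correlation[OF t t, of x x] G_correlation[OF t s, of x z] G_correlation[OF s s, of z z]
    by simp
  show "(\<integral>\<^sup>+y. ennreal ((G t (x - y) - G s (z - y))\<^sup>2) \<partial>lborel) = ennreal (G (2 * t) 0 - 2 * G (t + s) (z - x) + G (2 * s) 0)"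
    using i I by (subst nn_integral_eq_integral) auto
  show "0 \<le> G (2 * t) 0 - 2 * G (t + s) (z - x) + G (2 * s) 0"
    unfolding I[symmetric] by simp
qed

section \<open>The squared norm of the unit kernel increment\<close>

lemma powr_second_difference_limit:
  fixes \<gamma> :: real
  assumes "0 < \<gamma>" "\<gamma> < 1"
  shows "((\<lambda>r. (2 * r) powr \<gamma> - 2 * (2 * r - 1) powr \<gamma> + (2 * r - 2) powr \<gamma>) \<longlongrightarrow> 0) at_top"
  using assms by real_asymp

text \<open>Explicit primitives with \<gamma> = 1 - \<beta>: \<open>A\<close> on (0, 1] and
  \<open>B\<close>, a second difference of powers, beyond 1. Since \<open>A 0 = 0\<close> and
  \<open>B\<close> vanishes at infinity, the integral is
  \<open>A 1 - B 1 = 2 / (2 * \<gamma>)\<close>.\<close>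

lemma second_difference_integral:
  fixes \<beta> :: real
  assumes \<beta>: "0 < \<beta>" "\<beta> < 1"
    and nonneg: "\<And>r. 1 < r \<Longrightarrow> 0 \<le> (2 * r) powr (- \<beta>) - 2 * (2 * r - 1) powr (- \<beta>) + (2 * r - 2) powr (- \<beta>)"
  shows "(\<integral>\<^sup>+r. ennreal (if 1 < r then (2 * r) powr (- \<beta>) - 2 * (2 * r - 1) powr (- \<beta>) + (2 * r - 2) powr (- \<beta>)
      else if 0 < r then (2 * r) powr (- \<beta>) else 0) \<partial>lborel) = ennreal (1 / (1 - \<beta>))"
proof -
  define \<gamma> where "\<gamma> = 1 - \<beta>"
  have g: "0 < \<gamma>" "\<gamma> < 1" "- \<beta> = \<gamma> - 1" using \<beta> by (auto simp: \<gamma>_def)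
  define b where "b r = (2 * r) powr (\<gamma> - 1) - 2 * (2 * r - 1) powr (\<gamma> - 1) + (2 * r - 2) powr (\<gamma> - 1)" for r :: real
  define a where "a r = (2 * r) powr (\<gamma> - 1)" for r :: real
  define A where "A r = (2 * r) powr \<gamma> / (2 * \<gamma>)" for r :: real
  define B where "B r = ((2 * r) powr \<gamma> - 2 * (2 * r - 1) powr \<gamma> + (2 * r - 2) powr \<gamma>) / (2 * \<gamma>)" for r :: real
  have [measurable]: "a \<in> borel_measurable borel" "b \<in> borel_measurable borel"
    unfolding a_def b_def by measurable
  have bn: "0 \<le> b r" if "1 < r" for r using nonneg[OF that] by (simp add: b_def g)
  have "(a has_integral A 1 - A 0) {0..1}"
  proof (rule fundamental_theorem_of_calculus_interior)
    show "continuous_on {0..1} A" unfolding A_def using g by (auto intro!: continuous_intros continuous_on_powr')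
    show "(A has_vector_derivative a r) (at r)" if "r \<in> {0<..<1}" for r
      unfolding A_def a_def has_real_derivative_iff_has_vector_derivative[symmetric]
      using that g by (auto intro!: derivative_eq_intros)
  qed auto
  then have "(\<integral>\<^sup>+r. ennreal (a r) * indicator {0..1} r \<partial>lborel) = ennreal (A 1 - A 0)"
    by (rule nn_integral_has_integral_lebesgue'[rotated]) (simp add: a_def)
  moreover have "(\<integral>\<^sup>+r. ennreal (a r) * indicator {0..1} r \<partial>lborel) = (\<integral>\<^sup>+r. ennreal (a r) * indicator {0<..1} r \<partial>lborel)"
  proof (rule nn_integral_cong_AE)
    show "AE r in lborel. ennreal (a r) * indicator {0..1} r = ennreal (a r) * indicator {0<..1} r"
      using AE_lborel_singleton[of "0 :: real"] by eventually_elim (auto simp: indicator_def)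
  qed
  ultimately have Aint: "(\<integral>\<^sup>+r. ennreal (a r) * indicator {0<..1} r \<partial>lborel) = ennreal (A 1 - A 0)" by simp
  have dB: "(B has_real_derivative b r) (at r)" if "1 < r" for r
  proof -
    have dp: "((\<lambda>r. (2 * r - c) powr \<gamma>) has_real_derivative \<gamma> * (2 * r - c) powr (\<gamma> - 1) * 2) (at r)" if "c < 2 * r" for c
      by (rule DERIV_chain2[OF has_real_derivative_powr]) (use that in \<open>auto intro!: derivative_eq_intros\<close>)
    have "(B has_real_derivative (\<gamma> * (2 * r - 0) powr (\<gamma> - 1) * 2 - 2 * (\<gamma> * (2 * r - 1) powr (\<gamma> - 1) * 2)
        + \<gamma> * (2 * r - 2) powr (\<gamma> - 1) * 2) / (2 * \<gamma>)) (at r)"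
      using that DERIV_cdivide[OF DERIV_add[OF DERIV_diff[OF dp[of 0] DERIV_cmult[OF dp[of 1], of 2]] dp[of 2]], of "2 * \<gamma>"]
      unfolding B_def by simp
    moreover have "(\<gamma> * x * 2 - 2 * (\<gamma> * y * 2) + \<gamma> * z * 2) / (2 * \<gamma>) = x - 2 * y + z" for x y z
      using g by (simp add: field_simps)
    ultimately show ?thesis by (simp add: b_def)
  qed
  \<comment> \<open>The term (2 r - 2)^(-\<beta>) blows up as r decreases to 1, so the fundamental
    theorem is used on [1, 2] in the form that asks for derivatives in the interior only; the
    half-line form takes over at 2.\<close>
  have "(b has_integral B 2 - B 1) {1..2}"
  proof (rule fundamental_theorem_of_calculus_interior)
    show "continuous_on {1..2} B" unfolding B_def using g by (auto intro!: continuous_intros continuous_on_powr')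
    show "(B has_vector_derivative b r) (at r)" if "r \<in> {1<..<2}" for r
      unfolding has_real_derivative_iff_has_vector_derivative[symmetric] using that dB by auto
  qed auto
  then have bi: "(b has_integral B 2 - B 1) {1<..<2}"
    by (simp only: has_integral_Icc_iff_Ioo)
  then have Bint: "(\<integral>\<^sup>+r. ennreal (b r) * indicator {1<..<2} r \<partial>lborel) = ennreal (B 2 - B 1)"
    by (rule nn_integral_has_integral_lebesgue'[rotated]) (simp add: bn)
  have B12: "0 \<le> B 2 - B 1"
    by (rule has_integral_nonneg[OF bi]) (simp add: bn)
  have Blim: "(B \<longlongrightarrow> 0) at_top"
    unfolding B_def using tendsto_divide[OF powr_second_difference_limit[OF g(1,2)] tendsto_const[of "2 * \<gamma>"]] g by simp
  have Cint: "(\<integral>\<^sup>+r. ennreal (b r) * indicator {2..} r \<partial>lborel) = ennreal (0 - B 2)"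
    by (rule nn_integral_FTC_atLeast[OF _ dB _ Blim]) (use bn in auto)
  \<comment> \<open>\<open>B\<close> increases to 0, hence \<open>B 2 \<le> 0\<close>. Without this
    sign \<open>ennreal (0 - B 2)\<close> would be cut off at 0 and the pieces could not be
    added.\<close>
  have "incseq (\<lambda>n. B (2 + real n))"
  proof (rule incseq_SucI)
    fix n
    show "B (2 + real n) \<le> B (2 + real (Suc n))"
      by (rule DERIV_nonneg_imp_nondecreasing) (use dB bn in force)+
  qed
  moreover have "(\<lambda>n. B (2 + real n)) \<longlonglongrightarrow> 0"
    by (rule filterlim_compose[OF Blim]) real_asymp
  ultimately have B2: "B (2 + real 0) \<le> 0" by (rule incseq_le)
  have "(\<integral>\<^sup>+r. ennreal (if 1 < r then b r else if 0 < r then a r else 0) \<partial>lborel) =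
     (\<integral>\<^sup>+r. ennreal (a r) * indicator {0<..1} r + (ennreal (b r) * indicator {1<..<2} r + ennreal (b r) * indicator {2..} r) \<partial>lborel)"
    by (intro nn_integral_cong) (auto simp: indicator_def)
  also have "\<dots> = ennreal (A 1 - A 0) + (ennreal (B 2 - B 1) + ennreal (0 - B 2))"
    by (subst nn_integral_add, measurable)+ (simp add: Aint Bint Cint)
  also have "\<dots> = ennreal ((A 1 - A 0) + ((B 2 - B 1) + (0 - B 2)))"
  proof -
    have "0 \<le> A 1 - A 0" using g by (simp add: A_def)
    then show ?thesis using B12 B2 by (simp add: ennreal_plus[symmetric] del: ennreal_plus)
  qed
  also have "(A 1 - A 0) + ((B 2 - B 1) + (0 - B 2)) = A 1 - A 0 - B 1" by simp
  also have "\<dots> = 1 / \<gamma>" using g by (simp add: A_def B_def field_simps)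
  also have "\<gamma> = 1 - \<beta>" by (simp add: \<gamma>_def)
  finally show ?thesis unfolding a_def b_def g(3)[symmetric] .
qed

text \<open>The change of the kernel over one unit of time, seen backwards from its end:
  \<open>fst p\<close> is the elapsed time. Up to elapsed time 1 only the newer kernel is present,
  beyond 1 the difference of both.\<close>

definition increment_kernel :: "real \<Rightarrow> real \<times> real \<Rightarrow> real" where
  "increment_kernel \<mu> p = indicator {0<..} (fst p) * G (\<mu> * fst p) (snd p) -
     indicator {1<..} (fst p) * G (\<mu> * (fst p - 1)) (snd p)"

lemma G_measurable_shift:
  assumes \<mu>: "0 < \<mu>" and [measurable]: "f \<in> borel_measurable N" "g \<in> borel_measurable N"
  shows "(\<lambda>z. indicator {0<..} (f z) * G (\<mu> * f z) (g z)) \<in> borel_measurable N"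
proof -
  have "(\<lambda>z. (\<mu> * f z, g z)) \<in> measurable N (borel \<Otimes>\<^sub>M borel)" by measurable
  from measurable_compose[OF this G_measurable]
  have "(\<lambda>z. indicator {0<..} (\<mu> * f z) * G (\<mu> * f z) (g z)) \<in> borel_measurable N" by simp
  also have "(\<lambda>z. indicator {0<..} (\<mu> * f z) * G (\<mu> * f z) (g z)) = (\<lambda>z. indicator {0<..} (f z) * G (\<mu> * f z) (g z))"
    using \<mu> by (auto simp: fun_eq_iff indicator_def zero_less_mult_iff)
  finally show ?thesis .
qed

lemma increment_kernel_measurable:
  assumes \<mu>: "0 < \<mu>"
  shows "increment_kernel \<mu> \<in> borel_measurable borel"
proof -
  have [measurable]: "(\<lambda>p. fst p) \<in> borel_measurable (borel :: (real \<times> real) measure)" "(\<lambda>p. snd p) \<in> borel_measurable (borel :: (real \<times> real) measure)"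
    by (auto simp: borel_prod[symmetric])
  have "(\<lambda>p :: real \<times> real. indicator {0<..} (fst p) * G (\<mu> * fst p) (snd p) -
     indicator {0<..} (fst p - 1) * G (\<mu> * (fst p - 1)) (snd p)) \<in> borel_measurable borel"
    by (intro borel_measurable_diff G_measurable_shift \<mu>) measurable
  moreover have "increment_kernel \<mu> = (\<lambda>p :: real \<times> real. indicator {0<..} (fst p) * G (\<mu> * fst p) (snd p) -
     indicator {0<..} (fst p - 1) * G (\<mu> * (fst p - 1)) (snd p))"
    by (auto simp: fun_eq_iff increment_kernel_def indicator_def)
  ultimately show ?thesis by simp
qed

text \<open>At elapsed time r > 1 the spatial squared norm is \<kappa> times a second difference of
  powers, at 0 < r \<le> 1 it is \<kappa> (2 r)^(-\<beta>). Integration over r contributes 1 / (1 -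
  \<beta>), and \<alpha> (1 - \<beta>) = \<alpha> - 1 yields \<open>c_const\<close>.\<close>

theorem increment_kernel_square_integral:
  assumes \<mu>: "0 < \<mu>"
  shows "(\<integral>\<^sup>+p. ennreal ((increment_kernel \<mu> p)\<^sup>2) \<partial>lborel) = ennreal (c_const \<alpha> / \<mu> powr (1 / \<alpha>))"
proof -
  define \<beta> where "\<beta> = 1 / \<alpha>"
  define \<kappa> where "\<kappa> = Gamma \<beta> / (pi * \<alpha>) * \<mu> powr (- \<beta>)"
  have \<beta>: "0 < \<beta>" "\<beta> < 1" using alpha by (auto simp: \<beta>_def)
  have \<kappa>: "0 < \<kappa>" using \<beta> alpha \<mu> by (auto simp: \<kappa>_def intro!: mult_pos_pos divide_pos_pos Gamma_real_pos)
  have G0: "G (\<mu> * c) 0 = \<kappa> * c powr (- \<beta>)" if "0 < c" for c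
    using that \<mu> G_zero[of "\<mu> * c"] by (simp add: \<kappa>_def \<beta>_def powr_mult)
  let ?b = "\<lambda>r. (2 * r) powr (- \<beta>) - 2 * (2 * r - 1) powr (- \<beta>) + (2 * r - 2) powr (- \<beta>)"
  have bk: "G (2 * (\<mu> * r)) 0 - 2 * G (\<mu> * r + \<mu> * (r - 1)) (z - z) + G (2 * (\<mu> * (r - 1))) 0 = \<kappa> * ?b r" if "1 < r" for r z
  proof -
    have e: "2 * (\<mu> * r) = \<mu> * (2 * r)" "\<mu> * r + \<mu> * (r - 1) = \<mu> * (2 * r - 1)" "2 * (\<mu> * (r - 1)) = \<mu> * (2 * r - 2)"
      by (auto simp: algebra_simps)
    have g: "G (\<mu> * (2 * r)) 0 = \<kappa> * (2 * r) powr (- \<beta>)" "G (\<mu> * (2 * r - 1)) 0 = \<kappa> * (2 * r - 1) powr (- \<beta>)"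
      "G (\<mu> * (2 * r - 2)) 0 = \<kappa> * (2 * r - 2) powr (- \<beta>)"
      by (rule G0; use that in simp)+
    show ?thesis unfolding e diff_self g by (simp add: algebra_simps)
  qed
  \<comment> \<open>Up to \<kappa> the second difference is a squared norm; this supplies the sign
    demanded by \<open>second_difference_integral\<close>.\<close>
  have nonneg: "0 \<le> ?b r" if "1 < r" for r
    using G_diff_square_integral(2)[of "\<mu> * r" "\<mu> * (r - 1)" 0 0] that \<mu> \<kappa> bk[OF that, of 0]
    by (simp add: zero_le_mult_iff)
  have inner: "(\<integral>\<^sup>+y. ennreal ((increment_kernel \<mu> (r, y))\<^sup>2) \<partial>lborel) =
      ennreal \<kappa> * ennreal (if 1 < r then ?b r else if 0 < r then (2 * r) powr (- \<beta>) else 0)" for r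
  proof -
    have refl: "(\<integral>\<^sup>+y. ennreal (f y) \<partial>lborel) = (\<integral>\<^sup>+y. ennreal (f (0 - y)) \<partial>lborel)"
      if [measurable]: "f \<in> borel_measurable borel" for f :: "real \<Rightarrow> real"
      using nn_integral_real_affine[of "\<lambda>y. ennreal (f y)" "-1" 0] by simp
    consider "1 < r" | "0 < r" "r \<le> 1" | "r \<le> 0" by linarith
    then show ?thesis
    proof cases
      case 1
      then have p: "0 < \<mu> * r" "0 < \<mu> * (r - 1)" using \<mu> by auto
      note [measurable] = G_borel[OF p(1)] G_borel[OF p(2)]
      have "(\<integral>\<^sup>+y. ennreal ((increment_kernel \<mu> (r, y))\<^sup>2) \<partial>lborel) = (\<integral>\<^sup>+y. ennreal ((G (\<mu> * r) y - G (\<mu> * (r - 1)) y)\<^sup>2) \<partial>lborel)"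
        using 1 by (simp add: increment_kernel_def)
      also have "\<dots> = (\<integral>\<^sup>+y. ennreal ((G (\<mu> * r) (0 - y) - G (\<mu> * (r - 1)) (0 - y))\<^sup>2) \<partial>lborel)"
        by (rule refl) measurable
      also have "\<dots> = ennreal (\<kappa> * ?b r)"
        unfolding G_diff_square_integral(1)[OF p] bk[OF 1] ..
      finally show ?thesis using 1 \<kappa> nonneg[OF 1] by (simp add: ennreal_mult)
    next
      case 2
      then have p: "0 < \<mu> * r" using \<mu> by auto
      note [measurable] = G_borel[OF p(1)]
      have "(\<integral>\<^sup>+y. ennreal ((increment_kernel \<mu> (r, y))\<^sup>2) \<partial>lborel) = (\<integral>\<^sup>+y. ennreal ((G (\<mu> * r) y)\<^sup>2) \<partial>lborel)"
        using 2 by (simp add: increment_kernel_def)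
      also have "\<dots> = (\<integral>\<^sup>+y. ennreal ((G (\<mu> * r) (0 - y))\<^sup>2) \<partial>lborel)"
        by (rule refl) measurable
      also have "\<dots> = ennreal (\<kappa> * (2 * r) powr (- \<beta>))"
        unfolding G_square_integral[OF p] using G0[of "2 * r"] 2 by (simp add: mult_ac)
      finally show ?thesis using 2 \<kappa> by (simp add: ennreal_mult)
    next
      case 3
      then show ?thesis by (simp add: increment_kernel_def)
    qed
  qed
  have m: "(\<lambda>p. ennreal ((increment_kernel \<mu> p)\<^sup>2)) \<in> borel_measurable (lborel \<Otimes>\<^sub>M lborel)"
    using increment_kernel_measurable[OF \<mu>] by (simp add: lborel_prod)
  have "(\<integral>\<^sup>+p. ennreal ((increment_kernel \<mu> p)\<^sup>2) \<partial>lborel) = (\<integral>\<^sup>+r. (\<integral>\<^sup>+y. ennreal ((increment_kernel \<mu> (r, y))\<^sup>2) \<partial>lborel) \<partial>lborel)"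
    unfolding lborel_prod[symmetric] by (subst lborel.nn_integral_fst[OF m, symmetric]) simp
  also have "\<dots> = ennreal \<kappa> * ennreal (1 / (1 - \<beta>))"
    unfolding inner by (subst nn_integral_cmult) (auto simp: second_difference_integral[OF \<beta> nonneg])
  also have "\<dots> = ennreal (\<kappa> / (1 - \<beta>))"
    using \<kappa> \<beta> by (simp add: ennreal_mult[symmetric])
  also have "\<kappa> / (1 - \<beta>) = c_const \<alpha> / \<mu> powr (1 / \<alpha>)"
  proof -
    have "pi * \<alpha> * (1 - \<beta>) = pi * (\<alpha> - 1)" using alpha by (simp add: \<beta>_def field_simps)
    then show ?thesis by (simp add: \<kappa>_def c_const_def powr_minus divide_inverse \<beta>_def mult_ac flip: inverse_mult_distrib)
  qed
  finally show ?thesis .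
qed

text \<open>For each r the spatial norm is
  \<open>2 * G (2 * (\<mu> * r)) 0 - 2 * G (2 * (\<mu> * r)) h\<close>, which tends to 0 by
  continuity and is at most four times the diagonal value. That value is a multiple of
  r^(-1/\<alpha>), integrable at 0 because \<alpha> > 1.\<close>

lemma kernel_shift_continuous:
  assumes \<mu>: "0 < \<mu>" and T: "0 < T"
  shows "((\<lambda>h. \<integral>\<^sup>+r\<in>{0<..T}. (\<integral>\<^sup>+y. ennreal ((G (\<mu> * r) (x - y) - G (\<mu> * r) (x + h - y))\<^sup>2) \<partial>lborel) \<partial>lborel) \<longlongrightarrow> 0) (at 0)"
  unfolding tendsto_at_iff_sequentially
proof (intro allI impI)
  fix h :: "nat \<Rightarrow> real" assume h: "\<forall>i. h i \<in> UNIV - {0}" "h \<longlonglongrightarrow> 0"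
  define q where "q i r = indicator {0<..T} r * (2 * G (2 * (\<mu> * r)) 0 - 2 * G (2 * (\<mu> * r)) (h i))" for i r
  define w where "w r = indicator {0<..T} r * (4 * G (2 * (\<mu> * r)) 0)" for r
  have e: "(\<integral>\<^sup>+r\<in>{0<..T}. (\<integral>\<^sup>+y. ennreal ((G (\<mu> * r) (x - y) - G (\<mu> * r) (x + h i - y))\<^sup>2) \<partial>lborel) \<partial>lborel) = (\<integral>\<^sup>+r. ennreal (q i r) \<partial>lborel)" for i
  proof (intro nn_integral_cong)
    fix r
    show "(\<integral>\<^sup>+y. ennreal ((G (\<mu> * r) (x - y) - G (\<mu> * r) (x + h i - y))\<^sup>2) \<partial>lborel) * indicator {0<..T} r = ennreal (q i r)"
    proof (cases "r \<in> {0<..T}")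
      case True
      then have p: "0 < \<mu> * r" using \<mu> by simp
      have "\<mu> * r + \<mu> * r = 2 * (\<mu> * r)" by simp
      then show ?thesis using True G_diff_square_integral(1)[OF p p, of x "x + h i"] by (simp add: q_def algebra_simps)
    qed (simp add: q_def)
  qed
  have m2: "(\<lambda>r. indicator {0<..} r * G (2 * \<mu> * r) c) \<in> borel_measurable borel" for c
    by (intro G_measurable_shift) (use \<mu> in auto)
  have qe: "q i = (\<lambda>r. indicator {..T} r * (2 * (indicator {0<..} r * G (2 * \<mu> * r) 0) - 2 * (indicator {0<..} r * G (2 * \<mu> * r) (h i))))" for i
    by (auto simp: q_def fun_eq_iff indicator_def mult_ac)
  have we: "w = (\<lambda>r. indicator {..T} r * (4 * (indicator {0<..} r * G (2 * \<mu> * r) 0)))"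
    by (auto simp: w_def fun_eq_iff indicator_def mult_ac)
  have [measurable]: "q i \<in> borel_measurable borel" for i
    unfolding qe by (intro borel_measurable_times borel_measurable_diff m2) measurable
  have [measurable]: "w \<in> borel_measurable borel"
    unfolding we by (intro borel_measurable_times m2) measurable
  have "(\<lambda>i. \<integral>\<^sup>+r. ennreal (q i r) \<partial>lborel) \<longlonglongrightarrow> (\<integral>\<^sup>+r. ennreal 0 \<partial>(lborel :: real measure))"
  proof (rule nn_integral_dominated_convergence[where w="\<lambda>r. ennreal (w r)"])
    show "AE r in lborel. ennreal (q i r) \<le> ennreal (w r)" for i
    proof (intro AE_I2 ennreal_leI)
      fix r
      show "q i r \<le> w r"
        using G_bounded[of "2 * (\<mu> * r)" "h i"] \<mu> by (auto simp: q_def w_def indicator_def abs_le_iff)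
    qed
    show "(\<integral>\<^sup>+r. ennreal (w r) \<partial>lborel) < \<infinity>"
    proof -
      have "((\<lambda>r. r powr (- 1 / \<alpha>)) has_integral (T powr (- 1 / \<alpha> + 1) / (- 1 / \<alpha> + 1))) {0..T}"
        using alpha T by (intro has_integral_powr_from_0) (auto simp: field_simps)
      then have f: "(\<integral>\<^sup>+r. ennreal (r powr (- 1 / \<alpha>)) * indicator {0..T} r \<partial>lborel) < \<infinity>"
        by (subst nn_integral_has_integral_lebesgue') auto
      define k where "k = 4 * (Gamma (1 / \<alpha>) / (pi * \<alpha>) * (2 * \<mu>) powr (- 1 / \<alpha>))"
      have "ennreal (w r) \<le> ennreal k * (ennreal (r powr (- 1 / \<alpha>)) * indicator {0..T} r)" for r
      proof (cases "r \<in> {0<..T}")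
        case True
        then have "w r = k * r powr (- 1 / \<alpha>)" using \<mu> G_zero[of "2 * (\<mu> * r)"] by (simp add: w_def k_def powr_mult)
        then show ?thesis using True by (simp add: ennreal_mult'')
      qed (simp add: w_def)
      then have "(\<integral>\<^sup>+r. ennreal (w r) \<partial>lborel) \<le> ennreal k * (\<integral>\<^sup>+r. ennreal (r powr (- 1 / \<alpha>)) * indicator {0..T} r \<partial>lborel)"
        by (subst nn_integral_cmult[symmetric]) (auto intro!: nn_integral_mono)
      also have "\<dots> < \<infinity>" using f by (simp add: ennreal_mult_less_top)
      finally show ?thesis .
    qed
    show "AE r in lborel. (\<lambda>i. ennreal (q i r)) \<longlonglongrightarrow> ennreal 0"
    proof (intro AE_I2 tendsto_ennrealI)
      fix r
      show "(\<lambda>i. q i r) \<longlonglongrightarrow> 0"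
      proof (cases "r \<in> {0<..T}")
        case True
        then have p: "0 < 2 * (\<mu> * r)" using \<mu> by simp
        have "(\<lambda>i. G (2 * (\<mu> * r)) (h i)) \<longlonglongrightarrow> G (2 * (\<mu> * r)) 0"
          by (rule isCont_tendsto_compose[OF G_isCont[OF p] h(2)])
        then have "(\<lambda>i. 2 * G (2 * (\<mu> * r)) 0 - 2 * G (2 * (\<mu> * r)) (h i)) \<longlonglongrightarrow> 2 * G (2 * (\<mu> * r)) 0 - 2 * G (2 * (\<mu> * r)) 0"
          by (intro tendsto_intros)
        then show ?thesis using True by (simp add: q_def)
      qed (simp add: q_def)
    qed
  qed measurable
  then show "((\<lambda>h. \<integral>\<^sup>+r\<in>{0<..T}. (\<integral>\<^sup>+y. ennreal ((G (\<mu> * r) (x - y) - G (\<mu> * r) (x + h - y))\<^sup>2) \<partial>lborel) \<partial>lborel) \<circ> h) \<longlonglongrightarrow> 0"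
    by (simp add: comp_def e)
qed

text \<open>The identity is exact: one function serves all step sizes, so an approximation of
  \<open>increment_kernel \<mu>\<close> chosen once yields a memory length independent of
  \<delta>.\<close>

lemma increment_kernel_scale:
  assumes \<mu>: "0 < \<mu>" and \<delta>: "0 < \<delta>"
  shows "indicator {..<t} s * G (\<mu> * (t - s)) (x - z) - indicator {..<t - \<delta>} s * G (\<mu> * (t - \<delta> - s)) (x - z) =
     \<delta> powr (- 1 / \<alpha>) * increment_kernel \<mu> ((t - s) / \<delta>, \<delta> powr (- 1 / \<alpha>) * (x - z))"
proof -
  have 1: "G (\<mu> * (t - s)) (x - z) = \<delta> powr (- 1 / \<alpha>) * G (\<mu> * ((t - s) / \<delta>)) (\<delta> powr (- 1 / \<alpha>) * (x - z))" if "s < t"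
    using G_scale[OF \<delta>, of "\<mu> * ((t - s) / \<delta>)" "x - z"] that \<mu> \<delta> by simp
  have 2: "G (\<mu> * (t - \<delta> - s)) (x - z) = \<delta> powr (- 1 / \<alpha>) * G (\<mu> * ((t - s) / \<delta> - 1)) (\<delta> powr (- 1 / \<alpha>) * (x - z))" if "s < t - \<delta>"
  proof -
    have e: "\<delta> * (\<mu> * ((t - s) / \<delta> - 1)) = \<mu> * (t - \<delta> - s)" using \<delta> by (simp add: field_simps)
    have "1 < (t - s) / \<delta>" using that \<delta> by (simp add: field_simps)
    then have "0 < \<mu> * ((t - s) / \<delta> - 1)" using \<mu> by simp
    from G_scale[OF \<delta> this, of "x - z"] show ?thesis unfolding e .
  qed
  have "0 < (t - s) / \<delta> \<longleftrightarrow> s < t" "1 < (t - s) / \<delta> \<longleftrightarrow> s < t - \<delta>"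
    using \<delta> by (auto simp: field_simps)
  then show ?thesis using 1 2 \<delta>
    by (auto simp: increment_kernel_def indicator_def right_diff_distrib)
qed

end

text \<open>Simple functions bounded by \<open>2 * \<bar>f p\<bar>\<close> and cut off to growing
  boxes converge in L2 by dominated convergence. \<open>S\<close> holds the values and
  \<open>B\<close> the level sets; since \<open>f\<close> vanishes at non-positive times, boxes in
  positive time exhaust its support.\<close>

lemma L2_step_approximation:
  fixes f :: "real \<times> real \<Rightarrow> real"
  assumes [measurable]: "f \<in> borel_measurable borel" and fin: "(\<integral>\<^sup>+p. ennreal ((f p)\<^sup>2) \<partial>lborel) < \<infinity>"
    and supp: "\<And>p. fst p \<le> 0 \<Longrightarrow> f p = 0" and \<epsilon>: "0 < \<epsilon>"
  obtains S :: "real set" and B :: "real \<Rightarrow> (real \<times> real) set" and K :: nat where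
    "finite S" "\<And>c. c \<in> S \<Longrightarrow> B c \<in> sets borel" "\<And>c. c \<in> S \<Longrightarrow> B c \<subseteq> {0<..<real K} \<times> {- real K..real K}"
    "(\<integral>\<^sup>+p. ennreal ((f p - (\<Sum>c\<in>S. c * indicator (B c) p))\<^sup>2) \<partial>lborel) < ennreal \<epsilon>"
proof -
  obtain F where F: "\<And>i. simple_function borel (F i)" "\<And>p. (\<lambda>i. F i p) \<longlonglongrightarrow> f p"
    and F2: "\<And>i p. dist (F i p) 0 \<le> 2 * dist (f p) 0"
    using borel_measurable_implies_sequence_metric[of f borel 0] by auto
  define D where "D i = {0<..<real i} \<times> {- real i..real i}" for i
  have D[measurable]: "D i \<in> sets borel" for i by (simp add: D_def borel_Times)
  have [measurable]: "F i \<in> borel_measurable borel" for i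
    using F(1) by (rule borel_measurable_simple_function)
  have "(\<lambda>i. \<integral>\<^sup>+p. ennreal ((f p - F i p * indicator (D i) p)\<^sup>2) \<partial>lborel) \<longlonglongrightarrow> (\<integral>\<^sup>+p. ennreal 0 \<partial>(lborel :: (real \<times> real) measure))"
  \<comment> \<open>The approximant is at most twice \<open>\<bar>f p\<bar>\<close>, so the error is
    at most three times \<open>\<bar>f p\<bar>\<close>; hence the factor 9.\<close>
  proof (rule nn_integral_dominated_convergence[where w="\<lambda>p. 9 * ennreal ((f p)\<^sup>2)"])
    show "AE p in lborel. ennreal ((f p - F i p * indicator (D i) p)\<^sup>2) \<le> 9 * ennreal ((f p)\<^sup>2)" for i
    proof (rule AE_I2)
      fix p
      have "\<bar>f p - F i p * indicator (D i) p\<bar> \<le> 3 * \<bar>f p\<bar>"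
        using F2[of i p] by (auto simp: indicator_def)
      then have "(f p - F i p * indicator (D i) p)\<^sup>2 \<le> (3 * \<bar>f p\<bar>)\<^sup>2"
        by (metis abs_ge_zero power2_abs power_mono)
      then have "ennreal ((f p - F i p * indicator (D i) p)\<^sup>2) \<le> ennreal (9 * (f p)\<^sup>2)"
        by (intro ennreal_leI) (simp add: power_mult_distrib)
      then show "ennreal ((f p - F i p * indicator (D i) p)\<^sup>2) \<le> 9 * ennreal ((f p)\<^sup>2)"
        by (simp add: ennreal_mult)
    qed
    show "(\<integral>\<^sup>+p. 9 * ennreal ((f p)\<^sup>2) \<partial>lborel) < \<infinity>"
      using fin by (subst nn_integral_cmult) (auto simp: ennreal_mult_less_top)
    show "AE p in lborel. (\<lambda>i. ennreal ((f p - F i p * indicator (D i) p)\<^sup>2)) \<longlonglongrightarrow> ennreal 0"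
    proof (intro AE_I2 tendsto_ennrealI)
      fix p :: "real \<times> real"
      show "(\<lambda>i. (f p - F i p * indicator (D i) p)\<^sup>2) \<longlonglongrightarrow> 0"
      proof (cases "fst p \<le> 0")
        case True
        then have "f p = 0" by (rule supp)
        then have "F i p = 0" for i using F2[of i p] by simp
        with \<open>f p = 0\<close> show ?thesis by simp
      next
        case False
        obtain N :: nat where N: "max (fst p) \<bar>snd p\<bar> < real N" using reals_Archimedean2 by blast
        have "p \<in> D i" if "N \<le> i" for i
        proof -
          have "real N \<le> real i" using that by simp
          then show ?thesis using N False by (cases p) (auto simp: D_def)
        qed
        then have "\<forall>\<^sub>F i in sequentially. (f p - F i p)\<^sup>2 = (f p - F i p * indicator (D i) p)\<^sup>2"
          unfolding eventually_sequentially by (intro exI[of _ N]) auto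
        moreover have "(\<lambda>i. (f p - F i p)\<^sup>2) \<longlonglongrightarrow> (f p - f p)\<^sup>2" by (intro tendsto_intros F)
        then have "(\<lambda>i. (f p - F i p)\<^sup>2) \<longlonglongrightarrow> 0" by simp
        ultimately show ?thesis by (rule Lim_transform_eventually[rotated])
      qed
    qed
  qed measurable
  then have "\<forall>\<^sub>F i in sequentially. (\<integral>\<^sup>+p. ennreal ((f p - F i p * indicator (D i) p)\<^sup>2) \<partial>lborel) < ennreal \<epsilon>"
    using \<epsilon> by (intro order_tendstoD) auto
  then obtain K where K: "(\<integral>\<^sup>+p. ennreal ((f p - F K p * indicator (D K) p)\<^sup>2) \<partial>lborel) < ennreal \<epsilon>"
    by (auto simp: eventually_sequentially)
  define S where "S = range (F K)"
  define B where "B c = F K -` {c} \<inter> D K" for c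
  have S: "finite S" using simple_functionD(1)[OF F(1)[of K]] by (simp add: S_def)
  have "F K p * indicator (D K) p = (\<Sum>c\<in>S. c * indicator (B c) p)" for p
  proof -
    have "(\<Sum>c\<in>S. c * indicator (B c) p) = (\<Sum>c\<in>S. if c = F K p then F K p * indicator (D K) p else 0)"
      by (intro sum.cong) (auto simp: B_def indicator_def)
    also have "\<dots> = F K p * indicator (D K) p" using S by (simp add: S_def)
    finally show ?thesis by simp
  qed
  with K have "(\<integral>\<^sup>+p. ennreal ((f p - (\<Sum>c\<in>S. c * indicator (B c) p))\<^sup>2) \<partial>lborel) < ennreal \<epsilon>" by simp
  moreover have "B c \<in> sets borel" for c
    unfolding B_def using measurable_sets[of "F K" borel borel "{c}"] by auto
  ultimately show ?thesis using S by (intro that[of S B K]) (auto simp: B_def D_def)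
qed

section \<open>Moduli of continuity of the mild solution\<close>

text \<open>Time is stretched by \<open>h\<close> and space by \<open>1 / k\<close>, which gives the
  Jacobian \<open>h / k\<close>; the reflections about \<open>(t, x)\<close> do not change the
  measure.\<close>

lemma nn_integral_parabolic_scale:
  fixes F :: "real \<times> real \<Rightarrow> ennreal"
  assumes [measurable]: "F \<in> borel_measurable borel" and h: "0 < h" and k: "0 < k"
  shows "(\<integral>\<^sup>+p. F ((t - fst p) / h, k * (x - snd p)) \<partial>lborel) = ennreal (h / k) * (\<integral>\<^sup>+p. F p \<partial>lborel)"
proof -
  have F2[measurable]: "F \<in> borel_measurable (borel \<Otimes>\<^sub>M borel)" by (simp add: borel_prod)
  then have F3: "F \<in> borel_measurable (lborel \<Otimes>\<^sub>M lborel)" by (simp cong: measurable_cong_sets)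
  have G3: "(\<lambda>p. F ((t - fst p) / h, k * (x - snd p))) \<in> borel_measurable (lborel \<Otimes>\<^sub>M lborel)"
    by measurable
  have inner: "(\<integral>\<^sup>+y. F (a, k * (x - y)) \<partial>lborel) = ennreal (1 / k) * (\<integral>\<^sup>+y. F (a, y) \<partial>lborel)" for a
  proof -
    have "(\<integral>\<^sup>+y. F (a, y) \<partial>lborel) = ennreal k * (\<integral>\<^sup>+y. F (a, k * (x - y)) \<partial>lborel)"
      using nn_integral_real_affine[of "\<lambda>y. F (a, y)" "- k" "k * x"] k by (simp add: right_diff_distrib)
    then show ?thesis using k by (simp add: mult.assoc[symmetric] ennreal_mult[symmetric])
  qed
  have [measurable]: "(\<lambda>a. \<integral>\<^sup>+y. F (a, y) \<partial>lborel) \<in> borel_measurable borel" by measurable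
  have outer: "(\<integral>\<^sup>+s. (\<integral>\<^sup>+y. F ((t - s) / h, y) \<partial>lborel) \<partial>lborel) = ennreal h * (\<integral>\<^sup>+r. (\<integral>\<^sup>+y. F (r, y) \<partial>lborel) \<partial>lborel)"
  proof -
    have "(\<integral>\<^sup>+r. (\<integral>\<^sup>+y. F (r, y) \<partial>lborel) \<partial>lborel) = ennreal (1 / h) * (\<integral>\<^sup>+s. (\<integral>\<^sup>+y. F ((t - s) / h, y) \<partial>lborel) \<partial>lborel)"
      using nn_integral_real_affine[of "\<lambda>r. \<integral>\<^sup>+y. F (r, y) \<partial>lborel" "- (1 / h)" "t / h"] h by (simp add: diff_divide_distrib)
    then show ?thesis using h by (simp add: mult.assoc[symmetric] ennreal_mult[symmetric])
  qed
  have "(\<integral>\<^sup>+p. F ((t - fst p) / h, k * (x - snd p)) \<partial>lborel) = (\<integral>\<^sup>+s. (\<integral>\<^sup>+y. F ((t - s) / h, k * (x - y)) \<partial>lborel) \<partial>lborel)"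
    unfolding lborel_prod[symmetric] by (subst lborel.nn_integral_fst[OF G3, symmetric]) simp
  also have "\<dots> = ennreal (1 / k) * (ennreal h * (\<integral>\<^sup>+r. (\<integral>\<^sup>+y. F (r, y) \<partial>lborel) \<partial>lborel))"
    unfolding inner outer[symmetric] by (rule nn_integral_cmult) measurable
  also have "(\<integral>\<^sup>+r. (\<integral>\<^sup>+y. F (r, y) \<partial>lborel) \<partial>lborel) = (\<integral>\<^sup>+p. F p \<partial>lborel)"
    unfolding lborel_prod[symmetric] by (rule lborel.nn_integral_fst[OF F3])
  finally show ?thesis using h k by (simp add: mult.assoc[symmetric] ennreal_mult[symmetric])
qed

lemma square_bound_expectation:
  fixes f :: "'a \<Rightarrow> real"
  assumes [measurable]: "f \<in> borel_measurable N" and b: "(\<integral>\<^sup>+x. ennreal ((f x)\<^sup>2) \<partial>N) \<le> ennreal c" and c: "0 \<le> c"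
  shows "integrable N (\<lambda>x. (f x)\<^sup>2)" and "(\<integral>x. (f x)\<^sup>2 \<partial>N) \<le> c"
proof -
  show "integrable N (\<lambda>x. (f x)\<^sup>2)"
    using b by (intro integrableI_bounded) (auto simp: top.not_eq_extremum[symmetric] top_unique le_less_trans[OF b])
  show "(\<integral>x. (f x)\<^sup>2 \<partial>N) \<le> c"
    by (rule integral_real_bounded[OF c b])
qed

text \<open>Young's inequality for the mixed term 2 a (a - b). With \<theta> = \<eta> and a - b of
  order \<eta> in L2 both terms are of order \<eta>; this is how L2 errors of increments become L1
  errors of their squares.\<close>

lemma square_diff_bound:
  fixes a b \<theta> :: real
  assumes "0 < \<theta>"
  shows "\<bar>a\<^sup>2 - b\<^sup>2\<bar> \<le> \<theta> * a\<^sup>2 + (1 + 1 / \<theta>) * (a - b)\<^sup>2"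
proof -
  define d where "d = a - b"
  have e: "a\<^sup>2 - b\<^sup>2 = 2 * (a * d) - d\<^sup>2" by (simp add: d_def power2_eq_square algebra_simps)
  have "0 \<le> (sqrt \<theta> * \<bar>a\<bar> - \<bar>d\<bar> / sqrt \<theta>)\<^sup>2" by simp
  also have "\<dots> = \<theta> * a\<^sup>2 + d\<^sup>2 / \<theta> - 2 * \<bar>a * d\<bar>"
    using assms by (simp add: power2_diff power_mult_distrib power_divide abs_mult field_simps power2_eq_square[of \<theta>])
  finally have "2 * \<bar>a * d\<bar> \<le> \<theta> * a\<^sup>2 + d\<^sup>2 / \<theta>" by simp
  moreover have "\<bar>a\<^sup>2 - b\<^sup>2\<bar> \<le> 2 * \<bar>a * d\<bar> + d\<^sup>2"
    unfolding e using abs_triangle_ineq4[of "2 * (a * d)" "d\<^sup>2"] by (simp add: abs_mult)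
  ultimately show ?thesis by (simp add: d_def algebra_simps)
qed

lemma L1_square_diff_bound:
  fixes f g :: "'a \<Rightarrow> real"
  assumes [measurable]: "f \<in> borel_measurable N" "g \<in> borel_measurable N"
    and f: "integrable N (\<lambda>x. (f x)\<^sup>2)" and d: "integrable N (\<lambda>x. (f x - g x)\<^sup>2)" and \<theta>: "0 < \<theta>"
  shows "integrable N (\<lambda>x. (g x)\<^sup>2)"
    and "(\<integral>x. \<bar>(f x)\<^sup>2 - (g x)\<^sup>2\<bar> \<partial>N) \<le> \<theta> * (\<integral>x. (f x)\<^sup>2 \<partial>N) + (1 + 1 / \<theta>) * (\<integral>x. (f x - g x)\<^sup>2 \<partial>N)"
proof -
  have i: "integrable N (\<lambda>x. \<theta> * (f x)\<^sup>2 + (1 + 1 / \<theta>) * (f x - g x)\<^sup>2)" using f d by simp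
  have i2: "integrable N (\<lambda>x. (f x)\<^sup>2 - (g x)\<^sup>2)"
  proof (rule Bochner_Integration.integrable_bound[OF i])
    show "AE x in N. norm ((f x)\<^sup>2 - (g x)\<^sup>2) \<le> norm (\<theta> * (f x)\<^sup>2 + (1 + 1 / \<theta>) * (f x - g x)\<^sup>2)"
      by (intro AE_I2) (metis square_diff_bound[OF \<theta>] abs_ge_self order_trans real_norm_def)
  qed measurable
  have "integrable N (\<lambda>x. (f x)\<^sup>2 - ((f x)\<^sup>2 - (g x)\<^sup>2))" by (rule Bochner_Integration.integrable_diff[OF f i2])
  then show "integrable N (\<lambda>x. (g x)\<^sup>2)" by simp
  have "(\<integral>x. \<bar>(f x)\<^sup>2 - (g x)\<^sup>2\<bar> \<partial>N) \<le> (\<integral>x. \<theta> * (f x)\<^sup>2 + (1 + 1 / \<theta>) * (f x - g x)\<^sup>2 \<partial>N)"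
    by (intro integral_mono integrable_abs i2 i square_diff_bound \<theta>)
  then show "(\<integral>x. \<bar>(f x)\<^sup>2 - (g x)\<^sup>2\<bar> \<partial>N) \<le> \<theta> * (\<integral>x. (f x)\<^sup>2 \<partial>N) + (1 + 1 / \<theta>) * (\<integral>x. (f x - g x)\<^sup>2 \<partial>N)"
    using f d by simp
qed

locale heat_spde = white_noise M W + fractional_kernel \<alpha> G
  for M :: "'w measure" and W :: "(real \<times> real) set \<Rightarrow> 'w \<Rightarrow> real" and \<alpha> :: real and G :: "real \<Rightarrow> real \<Rightarrow> real" +
  fixes \<sigma> :: "real \<Rightarrow> real" and \<mu> :: real and u :: "real \<Rightarrow> real \<Rightarrow> 'w \<Rightarrow> real"
  assumes lipschitz: "\<exists>L. L-lipschitz_on UNIV \<sigma>"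
    and \<mu>_pos: "0 < \<mu>"
    and mild: "mild_solution M W G \<mu> \<sigma> u"
begin

lemma lipschitz_bound: obtains L where "0 < L" "\<And>a b. \<bar>\<sigma> a - \<sigma> b\<bar> \<le> L * \<bar>a - b\<bar>"
proof -
  obtain L where L: "L-lipschitz_on UNIV \<sigma>" using lipschitz by blast
  \<comment> \<open>\<open>\<bar>L\<bar> + 1\<close> makes the constant strictly positive, since
    later tolerances are divided by its square.\<close>
  have "\<bar>\<sigma> a - \<sigma> b\<bar> \<le> (\<bar>L\<bar> + 1) * \<bar>a - b\<bar>" for a b
  proof -
    have "\<bar>\<sigma> a - \<sigma> b\<bar> \<le> L * \<bar>a - b\<bar>" using lipschitz_onD[OF L, of a b] by (simp add: dist_real_def)
    also have "\<dots> \<le> (\<bar>L\<bar> + 1) * \<bar>a - b\<bar>" by (intro mult_right_mono) auto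
    finally show ?thesis .
  qed
  then show ?thesis by (intro that[of "\<bar>L\<bar> + 1"]) auto
qed

lemma \<sigma>_measurable[measurable]: "\<sigma> \<in> borel_measurable borel"
proof -
  obtain L where "L-lipschitz_on UNIV \<sigma>" using lipschitz by blast
  then show ?thesis by (intro borel_measurable_continuous_onI) (rule lipschitz_on_continuous_on)
qed

lemma predictable_u: "predictable_field M W u"
  using mild by (simp add: mild_solution_def)

lemma u_adapted: "0 < t \<Longrightarrow> u t x \<in> borel_measurable (full_filtration M W t)"
  by (rule predictable_field_section[OF predictable_u])

lemma u_measurable[measurable]: "0 < t \<Longrightarrow> u t x \<in> borel_measurable M"
  by (rule full_filtration_measurable_sub[OF u_adapted])

text \<open>The coefficient field on the product space, with negative times clamped as in
  \<open>predictable_field_measurable\<close>; \<open>mild_kernel\<close> vanishes there.\<close>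

definition source :: "'w \<times> (real \<times> real) \<Rightarrow> real" where
  "source z = \<sigma> (u (max 0 (fst (snd z))) (snd (snd z)) (fst z))"

definition mild_kernel :: "real \<Rightarrow> real \<Rightarrow> real \<times> real \<Rightarrow> real" where
  "mild_kernel t x p = indicator {0..<t} (fst p) * G (\<mu> * (t - fst p)) (x - snd p)"

lemma source_measurable[measurable]: "source \<in> borel_measurable (M \<Otimes>\<^sub>M lborel)"
  unfolding source_def[abs_def]
  by (rule measurable_compose[OF predictable_field_measurable[OF predictable_u] \<sigma>_measurable])

lemma fst_snd_borel[measurable]:
  "fst \<in> borel_measurable (borel :: (real \<times> real) measure)" "snd \<in> borel_measurable (borel :: (real \<times> real) measure)"
  by (auto simp: borel_prod[symmetric])

lemma mild_kernel_measurable[measurable]: "mild_kernel t x \<in> borel_measurable borel"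
proof -
  have "(\<lambda>p :: real \<times> real. indicator {0..} (fst p) * (indicator {0<..} (t - fst p) * G (\<mu> * (t - fst p)) (x - snd p))) \<in> borel_measurable borel"
    by (intro borel_measurable_times G_measurable_shift \<mu>_pos) measurable
  moreover have "mild_kernel t x = (\<lambda>p. indicator {0..} (fst p) * (indicator {0<..} (t - fst p) * G (\<mu> * (t - fst p)) (x - snd p)))"
    by (auto simp: fun_eq_iff mild_kernel_def indicator_def)
  ultimately show ?thesis by simp
qed

lemma noise_integral_u:
  assumes t: "0 < t"
  shows "noise_integral (\<lambda>z. mild_kernel t x (snd z) * source z) (u t x)"
proof -
  have "has_walsh_integral M W t (\<lambda>s z \<omega>. indicator {0..<t} s * (G (\<mu> * (t - s)) (x - z) * \<sigma> (u s z \<omega>))) (u t x)"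
    using mild t by (simp add: mild_solution_def)
  from has_walsh_integral_noise_integral[OF this] t
  have "noise_integral (\<lambda>z. indicator {0..t} (fst (snd z)) * (indicator {0..<t} (fst (snd z)) *
     (G (\<mu> * (t - fst (snd z))) (x - snd (snd z)) * \<sigma> (u (fst (snd z)) (snd (snd z)) (fst z))))) (u t x)" by simp
  also have "(\<lambda>z. indicator {0..t} (fst (snd z)) * (indicator {0..<t} (fst (snd z)) *
     (G (\<mu> * (t - fst (snd z))) (x - snd (snd z)) * \<sigma> (u (fst (snd z)) (snd (snd z)) (fst z))))) = (\<lambda>z. mild_kernel t x (snd z) * source z)"
    by (auto simp: fun_eq_iff mild_kernel_def source_def indicator_def)
  finally show ?thesis .
qed

lemma u_second_moment:
  assumes T: "0 < T"
  obtains C where "0 < C" "\<And>t x. 0 \<le> t \<Longrightarrow> t \<le> T \<Longrightarrow> (\<integral>\<^sup>+\<omega>. ennreal ((u t x \<omega>)\<^sup>2) \<partial>M) \<le> ennreal C"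
proof -
  let ?S = "SUP (t, x) \<in> {0..T} \<times> UNIV. \<integral>\<^sup>+\<omega>. ennreal (\<bar>u t x \<omega>\<bar>\<^sup>2) \<partial>M"
  have fin: "?S < \<infinity>" using mild T by (simp add: mild_solution_def)
  define C where "C = enn2real ?S + 1"
  have "(\<integral>\<^sup>+\<omega>. ennreal ((u t x \<omega>)\<^sup>2) \<partial>M) \<le> ennreal C" if "0 \<le> t" "t \<le> T" for t x
  proof -
    have "(\<integral>\<^sup>+\<omega>. ennreal (\<bar>u t x \<omega>\<bar>\<^sup>2) \<partial>M) \<le> ?S"
      using that by (intro SUP_upper2[of "(t, x)"]) auto
    also have "?S = ennreal (enn2real ?S)" using fin by (simp add: less_top)
    also have "\<dots> \<le> ennreal C" by (intro ennreal_leI) (simp add: C_def)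
    finally show ?thesis by simp
  qed
  moreover have "0 < C" by (simp add: C_def add_nonneg_pos)
  ultimately show ?thesis by (rule that[rotated])
qed

lemma source_second_moment:
  assumes T: "0 < T"
  obtains C where "0 < C" "\<And>t x. 0 < t \<Longrightarrow> t \<le> T \<Longrightarrow> (\<integral>\<^sup>+\<omega>. ennreal ((\<sigma> (u t x \<omega>))\<^sup>2) \<partial>M) \<le> ennreal C"
proof -
  obtain L where L: "0 < L" "\<And>a b. \<bar>\<sigma> a - \<sigma> b\<bar> \<le> L * \<bar>a - b\<bar>" by (rule lipschitz_bound) blast
  obtain C where C: "0 < C" "\<And>t x. 0 \<le> t \<Longrightarrow> t \<le> T \<Longrightarrow> (\<integral>\<^sup>+\<omega>. ennreal ((u t x \<omega>)\<^sup>2) \<partial>M) \<le> ennreal C"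
    by (rule u_second_moment[OF T]) blast
  define D where "D = 2 * (\<sigma> 0)\<^sup>2 + 2 * L\<^sup>2 * C"
  have "(\<integral>\<^sup>+\<omega>. ennreal ((\<sigma> (u t x \<omega>))\<^sup>2) \<partial>M) \<le> ennreal D" if t: "0 < t" "t \<le> T" for t x
  proof -
    note [measurable] = u_measurable[OF t(1)]
    have p: "(\<sigma> a)\<^sup>2 \<le> 2 * (\<sigma> 0)\<^sup>2 + 2 * L\<^sup>2 * a\<^sup>2" for a
    proof -
      have "(\<sigma> a - \<sigma> 0)\<^sup>2 \<le> (L * \<bar>a\<bar>)\<^sup>2" using power_mono[OF L(2)[of a 0], of 2] by simp
      \<comment> \<open>This is 0 \<le> (\<sigma> a - 2 \<sigma> 0)^2 rearranged.\<close>
      moreover have "(\<sigma> a)\<^sup>2 \<le> 2 * (\<sigma> 0)\<^sup>2 + 2 * (\<sigma> a - \<sigma> 0)\<^sup>2"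
        using zero_le_power2[of "\<sigma> a - 2 * \<sigma> 0"] by (simp add: power2_eq_square algebra_simps)
      ultimately show ?thesis by (simp add: power_mult_distrib)
    qed
    have "(\<integral>\<^sup>+\<omega>. ennreal ((\<sigma> (u t x \<omega>))\<^sup>2) \<partial>M) \<le> (\<integral>\<^sup>+\<omega>. ennreal (2 * (\<sigma> 0)\<^sup>2) + ennreal (2 * L\<^sup>2) * ennreal ((u t x \<omega>)\<^sup>2) \<partial>M)"
      using p by (intro nn_integral_mono) (simp add: ennreal_mult[symmetric] ennreal_plus[symmetric] ennreal_leI del: ennreal_plus)
    also have "\<dots> = ennreal (2 * (\<sigma> 0)\<^sup>2) + ennreal (2 * L\<^sup>2) * (\<integral>\<^sup>+\<omega>. ennreal ((u t x \<omega>)\<^sup>2) \<partial>M)"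
      by (subst nn_integral_add) (auto simp: nn_integral_cmult emeasure_space_1)
    also have "\<dots> \<le> ennreal (2 * (\<sigma> 0)\<^sup>2) + ennreal (2 * L\<^sup>2) * ennreal C"
      using C t by (intro add_left_mono mult_left_mono) auto
    also have "\<dots> = ennreal D" using C by (simp add: D_def ennreal_mult[symmetric] ennreal_plus[symmetric] del: ennreal_plus)
    finally show ?thesis .
  qed
  moreover have "0 < D" using L C by (simp add: D_def add_nonneg_pos)
  ultimately show ?thesis by (rule that[rotated])
qed

text \<open>The weight \<open>k\<close> is deterministic, so Tonelli leaves the second moments of
  \<open>f\<close> at fixed points. They are asked for only where \<open>k\<close> is non-zero,
  since moment bounds reach only up to a finite time horizon.\<close>

lemma weighted_second_moment:
  fixes k :: "real \<times> real \<Rightarrow> real" and f :: "'w \<times> (real \<times> real) \<Rightarrow> real"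
  assumes [measurable]: "k \<in> borel_measurable borel" "f \<in> borel_measurable (M \<Otimes>\<^sub>M lborel)"
    and b: "AE p in lborel. k p \<noteq> 0 \<longrightarrow> (\<integral>\<^sup>+\<omega>. ennreal ((f (\<omega>, p))\<^sup>2) \<partial>M) \<le> ennreal C"
  shows "(\<integral>\<^sup>+z. ennreal ((k (snd z) * f z)\<^sup>2) \<partial>(M \<Otimes>\<^sub>M lborel)) \<le> ennreal C * (\<integral>\<^sup>+p. ennreal ((k p)\<^sup>2) \<partial>lborel)"
proof -
  have [measurable]: "k \<in> borel_measurable lborel" by simp
  have sec[measurable]: "(\<lambda>\<omega>. f (\<omega>, p)) \<in> borel_measurable M" for p
    using measurable_compose[OF measurable_Pair2'[of p lborel M] assms(2)] by simp
  have "(\<integral>\<^sup>+z. ennreal ((k (snd z) * f z)\<^sup>2) \<partial>(M \<Otimes>\<^sub>M lborel)) = (\<integral>\<^sup>+p. (\<integral>\<^sup>+\<omega>. ennreal ((k p * f (\<omega>, p))\<^sup>2) \<partial>M) \<partial>lborel)"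
    by (subst noise_product.nn_integral_snd[symmetric]) (auto simp: case_prod_beta')
  also have "\<dots> \<le> (\<integral>\<^sup>+p. ennreal C * ennreal ((k p)\<^sup>2) \<partial>lborel)"
  proof (rule nn_integral_mono_AE)
    show "AE p in lborel. (\<integral>\<^sup>+\<omega>. ennreal ((k p * f (\<omega>, p))\<^sup>2) \<partial>M) \<le> ennreal C * ennreal ((k p)\<^sup>2)"
      using b
    proof eventually_elim
      case (elim p)
      have "(\<integral>\<^sup>+\<omega>. ennreal ((k p * f (\<omega>, p))\<^sup>2) \<partial>M) = ennreal ((k p)\<^sup>2) * (\<integral>\<^sup>+\<omega>. ennreal ((f (\<omega>, p))\<^sup>2) \<partial>M)"
        by (subst nn_integral_cmult[symmetric]) (auto simp: power_mult_distrib ennreal_mult)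
      also have "\<dots> \<le> ennreal ((k p)\<^sup>2) * ennreal C"
        using elim by (cases "k p = 0") (auto intro!: mult_left_mono)
      finally show ?case by (simp add: mult.commute)
    qed
  qed
  also have "\<dots> = ennreal C * (\<integral>\<^sup>+p. ennreal ((k p)\<^sup>2) \<partial>lborel)"
    by (rule nn_integral_cmult) measurable
  finally show ?thesis .
qed

text \<open>The moment bounds of the coefficient are stated for strictly positive times, whereas
  \<open>mild_kernel\<close> is also supported at time 0; the exceptional line is a null
  set.\<close>

lemma AE_time_nonzero: "AE p in (lborel :: (real \<times> real) measure). fst p \<noteq> 0"
proof -
  have "{p :: real \<times> real. fst p = 0} = {0} \<times> UNIV" by auto
  moreover have "emeasure (lborel \<Otimes>\<^sub>M lborel) ({0 :: real} \<times> (UNIV :: real set)) = 0"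
    by (subst lborel.emeasure_pair_measure_Times) auto
  ultimately show ?thesis
    by (intro AE_I[of _ _ "{0} \<times> UNIV"]) (auto simp: lborel_prod borel_Times)
qed

text \<open>Every modulus of continuity of \<open>u\<close> reduces to a deterministic norm of a
  kernel difference: randomness enters only through the uniform second moment of the
  coefficient.\<close>

lemma u_diff_bound:
  assumes T: "0 < T" and C: "\<And>t x. 0 < t \<Longrightarrow> t \<le> T \<Longrightarrow> (\<integral>\<^sup>+\<omega>. ennreal ((\<sigma> (u t x \<omega>))\<^sup>2) \<partial>M) \<le> ennreal C"
    and t: "0 < t" "t \<le> T" and t': "0 < t'" "t' \<le> T"
  shows "(\<integral>\<^sup>+\<omega>. ennreal ((u t x \<omega> - u t' x' \<omega>)\<^sup>2) \<partial>M) \<le>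
     4 * (ennreal C * (\<integral>\<^sup>+p. ennreal ((mild_kernel t x p - mild_kernel t' x' p)\<^sup>2) \<partial>lborel))"
proof -
  have "noise_integral (\<lambda>z. mild_kernel t x (snd z) * source z - mild_kernel t' x' (snd z) * source z) (\<lambda>\<omega>. u t x \<omega> - u t' x' \<omega>)"
    by (intro noise_integral_diff noise_integral_u t t')
  from noise_integral_bound[OF this]
  have "(\<integral>\<^sup>+\<omega>. ennreal ((u t x \<omega> - u t' x' \<omega>)\<^sup>2) \<partial>M) \<le>
    4 * (\<integral>\<^sup>+z. ennreal (((mild_kernel t x (snd z) - mild_kernel t' x' (snd z)) * source z)\<^sup>2) \<partial>(M \<Otimes>\<^sub>M lborel))"
    by (simp add: left_diff_distrib)
  also have "(\<integral>\<^sup>+z. ennreal (((mild_kernel t x (snd z) - mild_kernel t' x' (snd z)) * source z)\<^sup>2) \<partial>(M \<Otimes>\<^sub>M lborel)) \<le>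
     ennreal C * (\<integral>\<^sup>+p. ennreal ((mild_kernel t x p - mild_kernel t' x' p)\<^sup>2) \<partial>lborel)"
  proof (rule weighted_second_moment[where k="\<lambda>p. mild_kernel t x p - mild_kernel t' x' p"])
    show "AE p in lborel. mild_kernel t x p - mild_kernel t' x' p \<noteq> 0 \<longrightarrow> (\<integral>\<^sup>+\<omega>. ennreal ((source (\<omega>, p))\<^sup>2) \<partial>M) \<le> ennreal C"
      using AE_time_nonzero
    proof eventually_elim
      case (elim p)
      show ?case
      proof
        assume "mild_kernel t x p - mild_kernel t' x' p \<noteq> 0"
        then have "0 \<le> fst p \<and> fst p \<le> T"
          by (rule contrapos_np) (use t t' in \<open>auto simp: mild_kernel_def indicator_def\<close>)
        then show "(\<integral>\<^sup>+\<omega>. ennreal ((source (\<omega>, p))\<^sup>2) \<partial>M) \<le> ennreal C"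
          using C[of "fst p" "snd p"] elim by (simp add: source_def max_def)
      qed
    qed
  qed measurable
  finally show ?thesis by (simp add: mult_left_mono)
qed

text \<open>The start of the equation at time 0 survives only as an indicator. For upper bounds it
  is dropped, and on the support of the approximate kernel it is 1.\<close>

lemma mild_kernel_increment:
  assumes h: "0 < h" "h < t"
  shows "mild_kernel t x p - mild_kernel (t - h) x p = indicator {0..} (fst p) *
     (h powr (- 1 / \<alpha>) * increment_kernel \<mu> ((t - fst p) / h, h powr (- 1 / \<alpha>) * (x - snd p)))"
proof -
  have "mild_kernel t x p - mild_kernel (t - h) x p = indicator {0..} (fst p) *
    (indicator {..<t} (fst p) * G (\<mu> * (t - fst p)) (x - snd p) - indicator {..<t - h} (fst p) * G (\<mu> * (t - h - fst p)) (x - snd p))"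
    using h by (auto simp: mild_kernel_def indicator_def)
  then show ?thesis unfolding increment_kernel_scale[OF \<mu>_pos h(1)] .
qed

text \<open>With k = h^(-1/\<alpha>) the square contributes k^2 and the Jacobian h / k, together h k
  = h^(1 - 1/\<alpha>), the order of the variance of an increment.\<close>

lemma scaled_square_integral:
  fixes F :: "real \<times> real \<Rightarrow> real"
  assumes [measurable]: "F \<in> borel_measurable borel" and h: "0 < h"
  shows "(\<integral>\<^sup>+p. ennreal ((h powr (- 1 / \<alpha>) * F ((t - fst p) / h, h powr (- 1 / \<alpha>) * (x - snd p)))\<^sup>2) \<partial>lborel) =
     ennreal (h powr (1 - 1 / \<alpha>)) * (\<integral>\<^sup>+p. ennreal ((F p)\<^sup>2) \<partial>lborel)"
proof -
  define k where "k = h powr (- 1 / \<alpha>)"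
  have k: "0 < k" using h by (simp add: k_def)
  have "(\<integral>\<^sup>+p. ennreal ((k * F ((t - fst p) / h, k * (x - snd p)))\<^sup>2) \<partial>lborel) =
      (\<integral>\<^sup>+p. ennreal ((k * F p)\<^sup>2) \<partial>lborel) * ennreal (h / k)"
    using nn_integral_parabolic_scale[of "\<lambda>p. ennreal ((k * F p)\<^sup>2)" h k t x] h k by (simp add: mult.commute)
  also have "(\<integral>\<^sup>+p. ennreal ((k * F p)\<^sup>2) \<partial>lborel) = ennreal (k\<^sup>2) * (\<integral>\<^sup>+p. ennreal ((F p)\<^sup>2) \<partial>lborel)"
    by (subst nn_integral_cmult[symmetric]) (auto simp: power_mult_distrib ennreal_mult)
  also have "ennreal (k\<^sup>2) * (\<integral>\<^sup>+p. ennreal ((F p)\<^sup>2) \<partial>lborel) * ennreal (h / k) = ennreal (k\<^sup>2 * (h / k)) * (\<integral>\<^sup>+p. ennreal ((F p)\<^sup>2) \<partial>lborel)"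
    using h k by (subst ennreal_mult) (auto simp: mult_ac)
  also have "k\<^sup>2 * (h / k) = h powr (1 - 1 / \<alpha>)"
    using h k by (simp add: power2_eq_square) (simp add: k_def powr_diff powr_minus field_simps)
  finally show ?thesis by (simp add: k_def)
qed

lemma mild_kernel_time_bound:
  assumes h: "0 < h" "h < t"
  shows "(\<integral>\<^sup>+p. ennreal ((mild_kernel t x p - mild_kernel (t - h) x p)\<^sup>2) \<partial>lborel) \<le> ennreal (h powr (1 - 1 / \<alpha>) * (c_const \<alpha> / \<mu> powr (1 / \<alpha>)))"
proof -
  note [measurable] = increment_kernel_measurable[OF \<mu>_pos]
  have "(\<integral>\<^sup>+p. ennreal ((mild_kernel t x p - mild_kernel (t - h) x p)\<^sup>2) \<partial>lborel) \<le>
     (\<integral>\<^sup>+p. ennreal ((h powr (- 1 / \<alpha>) * increment_kernel \<mu> ((t - fst p) / h, h powr (- 1 / \<alpha>) * (x - snd p)))\<^sup>2) \<partial>lborel)"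
    unfolding mild_kernel_increment[OF h] by (intro nn_integral_mono ennreal_leI) (auto simp: indicator_def)
  also have "\<dots> = ennreal (h powr (1 - 1 / \<alpha>)) * ennreal (c_const \<alpha> / \<mu> powr (1 / \<alpha>))"
    using scaled_square_integral[OF _ h(1), of "increment_kernel \<mu>"] by (simp add: increment_kernel_square_integral[OF \<mu>_pos])
  also have "\<dots> = ennreal (h powr (1 - 1 / \<alpha>) * (c_const \<alpha> / \<mu> powr (1 / \<alpha>)))"
    by (rule ennreal_mult'[symmetric]) simp
  finally show ?thesis .
qed

text \<open>Time reversal r = t - s and enlargement of the time interval to (0, T] give a bound that
  does not depend on t, as a modulus uniform in time requires.\<close>

lemma mild_kernel_space_bound:
  assumes t: "0 < t" "t \<le> T"
  shows "(\<integral>\<^sup>+p. ennreal ((mild_kernel t x p - mild_kernel t x' p)\<^sup>2) \<partial>lborel) \<le>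
    (\<integral>\<^sup>+r\<in>{0<..T}. (\<integral>\<^sup>+y. ennreal ((G (\<mu> * r) (x - y) - G (\<mu> * r) (x' - y))\<^sup>2) \<partial>lborel) \<partial>lborel)"
proof -
  define H where "H r = (\<integral>\<^sup>+y. ennreal ((indicator {0<..T} r * (G (\<mu> * r) (x - y) - G (\<mu> * r) (x' - y)))\<^sup>2) \<partial>lborel)" for r
  have "(\<lambda>p :: real \<times> real. indicator {..T} (fst p) * (indicator {0<..} (fst p) * G (\<mu> * fst p) (x - snd p) - indicator {0<..} (fst p) * G (\<mu> * fst p) (x' - snd p))) \<in> borel_measurable borel"
    by (intro borel_measurable_times borel_measurable_diff G_measurable_shift \<mu>_pos) measurable
  also have "(\<lambda>p :: real \<times> real. indicator {..T} (fst p) * (indicator {0<..} (fst p) * G (\<mu> * fst p) (x - snd p) - indicator {0<..} (fst p) * G (\<mu> * fst p) (x' - snd p))) =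
     (\<lambda>p. indicator {0<..T} (fst p) * (G (\<mu> * fst p) (x - snd p) - G (\<mu> * fst p) (x' - snd p)))"
    by (auto simp: fun_eq_iff indicator_def)
  finally have [measurable]: "(\<lambda>p. indicator {0<..T} (fst p) * (G (\<mu> * fst p) (x - snd p) - G (\<mu> * fst p) (x' - snd p))) \<in> borel_measurable (borel \<Otimes>\<^sub>M borel)"
    by (simp add: borel_prod)
  have Hm[measurable]: "H \<in> borel_measurable borel"
  proof -
    have "(\<lambda>p. ennreal ((indicator {0<..T} (fst p) * (G (\<mu> * fst p) (x - snd p) - G (\<mu> * fst p) (x' - snd p)))\<^sup>2)) \<in> borel_measurable (borel \<Otimes>\<^sub>M lborel)"
      by (subst measurable_cong_sets[OF sets_pair_measure_cong[OF refl sets_lborel] refl]) measurable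
    from lborel.borel_measurable_nn_integral_fst[OF this] show ?thesis by (simp add: H_def[abs_def])
  qed
  have m: "(\<lambda>p. ennreal ((mild_kernel t x p - mild_kernel t x' p)\<^sup>2)) \<in> borel_measurable (lborel \<Otimes>\<^sub>M lborel)"
    by (simp add: lborel_prod)
  have "(\<integral>\<^sup>+p. ennreal ((mild_kernel t x p - mild_kernel t x' p)\<^sup>2) \<partial>lborel) =
     (\<integral>\<^sup>+s. (\<integral>\<^sup>+y. ennreal ((mild_kernel t x (s, y) - mild_kernel t x' (s, y))\<^sup>2) \<partial>lborel) \<partial>lborel)"
    unfolding lborel_prod[symmetric] by (subst lborel.nn_integral_fst[OF m, symmetric]) simp
  also have "\<dots> \<le> (\<integral>\<^sup>+s. H (t - s) \<partial>lborel)"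
    unfolding H_def using t by (intro nn_integral_mono ennreal_leI) (auto simp: mild_kernel_def indicator_def)
  also have "\<dots> = (\<integral>\<^sup>+r. H r \<partial>lborel)"
    using nn_integral_real_affine[of H "-1" t] by simp
  also have "\<dots> = (\<integral>\<^sup>+r\<in>{0<..T}. (\<integral>\<^sup>+y. ennreal ((G (\<mu> * r) (x - y) - G (\<mu> * r) (x' - y))\<^sup>2) \<partial>lborel) \<partial>lborel)"
    by (intro nn_integral_cong) (auto simp: H_def indicator_def)
  finally show ?thesis .
qed

lemma u_L2_continuous:
  assumes T: "0 < T0" "T0 < T" and e: "0 < e"
  obtains \<eta> where "0 < \<eta>" "\<And>t t' x'. T0 \<le> t \<Longrightarrow> t \<le> T \<Longrightarrow> T0 \<le> t' \<Longrightarrow> t' \<le> T \<Longrightarrow> \<bar>t - t'\<bar> < \<eta> \<Longrightarrow> \<bar>x' - x\<bar> < \<eta> \<Longrightarrow>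
     (\<integral>\<^sup>+\<omega>. ennreal ((u t' x' \<omega> - u t x \<omega>)\<^sup>2) \<partial>M) \<le> ennreal e"
proof -
  have T': "0 < T" using T by simp
  have h4: "4 * ennreal a = ennreal (4 * a)" and h2: "2 * ennreal a = ennreal (2 * a)" if "0 \<le> a" for a
    using that by (simp_all add: ennreal_mult)
  obtain C where C: "0 < C" "\<And>t x. 0 < t \<Longrightarrow> t \<le> T \<Longrightarrow> (\<integral>\<^sup>+\<omega>. ennreal ((\<sigma> (u t x \<omega>))\<^sup>2) \<partial>M) \<le> ennreal C"
    by (rule source_second_moment[OF T']) blast
  define c where "c = c_const \<alpha> / \<mu> powr (1 / \<alpha>)"
  have c: "0 < c" using alpha \<mu>_pos by (auto simp: c_def c_const_def intro!: divide_pos_pos mult_pos_pos Gamma_real_pos)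
  let ?R = "\<lambda>h. \<integral>\<^sup>+r\<in>{0<..T}. (\<integral>\<^sup>+y. ennreal ((G (\<mu> * r) (x - y) - G (\<mu> * r) (x + h - y))\<^sup>2) \<partial>lborel) \<partial>lborel"
  \<comment> \<open>With e / (16 C) the factors 4 and C of \<open>u_diff_bound\<close> leave e / 4;
    two such errors, each doubled by the square inequality, add up to e.\<close>
  have "\<forall>\<^sub>F h in at 0. ?R h < ennreal (e / (16 * C))"
    using kernel_shift_continuous[OF \<mu>_pos T'] e C by (intro order_tendstoD) auto
  then obtain \<eta>1 where \<eta>1: "0 < \<eta>1" "\<And>h. h \<noteq> 0 \<Longrightarrow> \<bar>h\<bar> < \<eta>1 \<Longrightarrow> ?R h < ennreal (e / (16 * C))"
    by (auto simp: eventually_at dist_real_def)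
  have \<eta>1': "?R h \<le> ennreal (e / (16 * C))" if "\<bar>h\<bar> < \<eta>1" for h
    using \<eta>1(2)[of h] that by (cases "h = 0") auto
  define H where "H = 1 - 1 / \<alpha>"
  have H: "0 < H" using alpha by (simp add: H_def)
  \<comment> \<open>The root of c * \<eta>^H = e / (16 C), with the exponent H = 1 - 1/\<alpha> of
    the time modulus.\<close>
  define \<eta>2 where "\<eta>2 = (e / (16 * C * c)) powr (1 / H)"
  have \<eta>2: "0 < \<eta>2" using e C c by (simp add: \<eta>2_def)
  have time: "(\<integral>\<^sup>+\<omega>. ennreal ((u t x \<omega> - u t' x \<omega>)\<^sup>2) \<partial>M) \<le> ennreal (e / 4)"
    if "T0 \<le> t'" "t' < t" "t \<le> T" "t - t' < \<eta>2" for t t'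
  proof -
    have "(t - t') powr H \<le> \<eta>2 powr H" using that H by (intro powr_mono2) auto
    also have "\<dots> = e / (16 * C * c)" using H e C c by (simp add: \<eta>2_def powr_powr)
    finally have "(t - t') powr H * c \<le> e / (16 * C)" using C c by (simp add: field_simps)
    moreover have "(\<integral>\<^sup>+p. ennreal ((mild_kernel t x p - mild_kernel t' x p)\<^sup>2) \<partial>lborel) \<le> ennreal ((t - t') powr H * c)"
      using mild_kernel_time_bound[of "t - t'" t x] that T by (simp add: H_def c_def)
    ultimately have "(\<integral>\<^sup>+p. ennreal ((mild_kernel t x p - mild_kernel t' x p)\<^sup>2) \<partial>lborel) \<le> ennreal (e / (16 * C))"
      by (meson ennreal_leI order_trans)
    then have "4 * (ennreal C * (\<integral>\<^sup>+p. ennreal ((mild_kernel t x p - mild_kernel t' x p)\<^sup>2) \<partial>lborel)) \<le> 4 * (ennreal C * ennreal (e / (16 * C)))"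
      by (intro mult_left_mono) auto
    also have "\<dots> = ennreal (4 * (C * (e / (16 * C))))" using C e by (simp add: h4 ennreal_mult[symmetric])
    also have "4 * (C * (e / (16 * C))) = e / 4" using C by simp
    finally show ?thesis
      using u_diff_bound[OF T' C(2), of t t' x x] that T by (meson less_le_trans less_trans order_trans less_imp_le)
  qed
  have space: "(\<integral>\<^sup>+\<omega>. ennreal ((u t x' \<omega> - u t x \<omega>)\<^sup>2) \<partial>M) \<le> ennreal (e / 4)"
    if "T0 \<le> t" "t \<le> T" "\<bar>x' - x\<bar> < \<eta>1" for t x'
  proof -
    have t0: "0 < t" using that T by simp
    have "(\<integral>\<^sup>+p. ennreal ((mild_kernel t x p - mild_kernel t x' p)\<^sup>2) \<partial>lborel) \<le> ?R (x' - x)"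
      using mild_kernel_space_bound[OF t0 that(2), of x x'] by simp
    also have "\<dots> \<le> ennreal (e / (16 * C))" by (rule \<eta>1') (use that in auto)
    finally have "4 * (ennreal C * (\<integral>\<^sup>+p. ennreal ((mild_kernel t x p - mild_kernel t x' p)\<^sup>2) \<partial>lborel)) \<le> 4 * (ennreal C * ennreal (e / (16 * C)))"
      by (intro mult_left_mono) auto
    also have "\<dots> = ennreal (4 * (C * (e / (16 * C))))" using C e by (simp add: h4 ennreal_mult[symmetric])
    also have "4 * (C * (e / (16 * C))) = e / 4" using C by simp
    finally have "(\<integral>\<^sup>+\<omega>. ennreal ((u t x \<omega> - u t x' \<omega>)\<^sup>2) \<partial>M) \<le> ennreal (e / 4)"
      using u_diff_bound[OF T' C(2) t0 that(2) t0 that(2), of x x'] by (rule order_trans[rotated])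
    then show ?thesis by (simp add: power2_commute)
  qed
  show ?thesis
  proof (rule that[of "min \<eta>1 \<eta>2"])
    show "0 < min \<eta>1 \<eta>2" using \<eta>1 \<eta>2 by simp
    fix t t' x' assume a: "T0 \<le> t" "t \<le> T" "T0 \<le> t'" "t' \<le> T" "\<bar>t - t'\<bar> < min \<eta>1 \<eta>2" "\<bar>x' - x\<bar> < min \<eta>1 \<eta>2"
    have p: "0 < t" "0 < t'" using a T by auto
    note [measurable] = u_measurable[OF p(1)] u_measurable[OF p(2)]
    have tm: "(\<integral>\<^sup>+\<omega>. ennreal ((u t' x \<omega> - u t x \<omega>)\<^sup>2) \<partial>M) \<le> ennreal (e / 4)"
    proof -
      consider "t' < t" | "t < t'" | "t = t'" by linarith
      then show ?thesis
      proof cases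
        case 1 then show ?thesis using time[of t' t] a by (simp add: power2_commute)
      next
        case 2 then show ?thesis using time[of t t'] a by simp
      qed simp
    qed
    have "(\<integral>\<^sup>+\<omega>. ennreal ((u t' x' \<omega> - u t x \<omega>)\<^sup>2) \<partial>M) \<le>
       2 * (\<integral>\<^sup>+\<omega>. ennreal ((u t' x' \<omega> - u t' x \<omega>)\<^sup>2) \<partial>M) + 2 * (\<integral>\<^sup>+\<omega>. ennreal ((u t' x \<omega> - u t x \<omega>)\<^sup>2) \<partial>M)"
      by (rule nn_integral_square_add) auto
    also have "\<dots> \<le> 2 * ennreal (e / 4) + 2 * ennreal (e / 4)"
      using space[of t' x'] a tm by (intro add_mono mult_left_mono) auto
    also have "\<dots> = ennreal (2 * (e / 4) + 2 * (e / 4))"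
      using e by (simp add: h2 ennreal_plus[symmetric] del: ennreal_plus)
    finally show "(\<integral>\<^sup>+\<omega>. ennreal ((u t' x' \<omega> - u t x \<omega>)\<^sup>2) \<partial>M) \<le> ennreal e" by simp
  qed
qed

end

section \<open>Local approximation of increments\<close>

lemma ennreal_numeral_mult: "0 \<le> a \<Longrightarrow> numeral n * ennreal a = ennreal (numeral n * a)"
  by (simp add: ennreal_mult)

section \<open>Truncation of the coefficient, uniformly in time\<close>

definition trunc :: "real \<Rightarrow> real \<Rightarrow> real" where
  "trunc N y = max (- N) (min N y)"

lemma trunc_bounded: "0 \<le> N \<Longrightarrow> \<bar>trunc N y\<bar> \<le> N"
  by (auto simp: trunc_def)

lemma trunc_measurable[measurable]: "trunc N \<in> borel_measurable borel"
  unfolding trunc_def[abs_def] by measurable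

text \<open>The remainder \<open>a - trunc N a\<close> is soft thresholding, a 1-Lipschitz map
  whatever \<open>N\<close> is. Hence L2 continuity of the coefficient passes to the remainders
  uniformly in \<open>N\<close>.\<close>

lemma trunc_remainder_lipschitz: "0 \<le> N \<Longrightarrow> \<bar>(a - trunc N a) - (b - trunc N b)\<bar> \<le> \<bar>a - b\<bar>"
  by (auto simp: trunc_def max_def min_def)

context white_noise begin

lemma truncation_null:
  assumes [measurable]: "f \<in> borel_measurable M" and fin: "(\<integral>\<^sup>+\<omega>. ennreal ((f \<omega>)\<^sup>2) \<partial>M) < \<infinity>"
  shows "(\<lambda>n. \<integral>\<^sup>+\<omega>. ennreal ((f \<omega> - trunc (real n) (f \<omega>))\<^sup>2) \<partial>M) \<longlonglongrightarrow> 0"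
proof -
  have "(\<lambda>n. \<integral>\<^sup>+\<omega>. ennreal ((f \<omega> - trunc (real n) (f \<omega>))\<^sup>2) \<partial>M) \<longlonglongrightarrow> (\<integral>\<^sup>+\<omega>. ennreal 0 \<partial>M)"
  proof (rule nn_integral_dominated_convergence[where w="\<lambda>\<omega>. ennreal ((f \<omega>)\<^sup>2)"])
    show "AE \<omega> in M. ennreal ((f \<omega> - trunc (real n) (f \<omega>))\<^sup>2) \<le> ennreal ((f \<omega>)\<^sup>2)" for n
    proof (intro AE_I2 ennreal_leI)
      fix \<omega>
      show "(f \<omega> - trunc (real n) (f \<omega>))\<^sup>2 \<le> (f \<omega>)\<^sup>2"
        unfolding abs_le_square_iff[symmetric] by (auto simp: trunc_def max_def min_def)
    qed
    show "AE \<omega> in M. (\<lambda>n. ennreal ((f \<omega> - trunc (real n) (f \<omega>))\<^sup>2)) \<longlonglongrightarrow> ennreal 0"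
    proof (intro AE_I2 tendsto_ennrealI)
      fix \<omega>
      obtain k :: nat where k: "\<bar>f \<omega>\<bar> < real k" using reals_Archimedean2 by blast
      have "(f \<omega> - trunc (real n) (f \<omega>))\<^sup>2 = 0" if "k \<le> n" for n
      proof -
        have "\<bar>f \<omega>\<bar> < real n" using k that by (meson less_le_trans of_nat_le_iff)
        then have "- real n \<le> f \<omega>" "f \<omega> \<le> real n" by auto
        then show ?thesis by (simp add: trunc_def min_absorb2 max_absorb2)
      qed
      then have "\<forall>\<^sub>F n in sequentially. (f \<omega> - trunc (real n) (f \<omega>))\<^sup>2 = 0"
        unfolding eventually_sequentially by blast
      then show "(\<lambda>n. (f \<omega> - trunc (real n) (f \<omega>))\<^sup>2) \<longlonglongrightarrow> 0" by (rule tendsto_eventually)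
    qed
  qed (use fin in auto)
  then show ?thesis by simp
qed

end

context heat_spde begin

text \<open>At a single time the remainder tends to 0 by dominated convergence. For one
  \<open>N\<close> at all times, finitely many times form a net for the L2 modulus of
  \<open>u\<close>, and remainders at nearby times differ by no more than the coefficients
  do.\<close>

lemma truncation_uniform:
  assumes T: "0 < T0" "T0 < T" and e: "0 < e"
  obtains N where "0 < N" "\<And>t. T0 \<le> t \<Longrightarrow> t \<le> T \<Longrightarrow>
     (\<integral>\<^sup>+\<omega>. ennreal ((\<sigma> (u t x \<omega>) - trunc N (\<sigma> (u t x \<omega>)))\<^sup>2) \<partial>M) \<le> ennreal e"
proof -
  obtain L where L: "0 < L" "\<And>a b. \<bar>\<sigma> a - \<sigma> b\<bar> \<le> L * \<bar>a - b\<bar>" by (rule lipschitz_bound) blast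
  have T': "0 < T" using T by simp
  obtain C where C: "0 < C" "\<And>t x. 0 < t \<Longrightarrow> t \<le> T \<Longrightarrow> (\<integral>\<^sup>+\<omega>. ennreal ((\<sigma> (u t x \<omega>))\<^sup>2) \<partial>M) \<le> ennreal C"
    by (rule source_second_moment[OF T']) blast
  have e': "0 < e / (4 * L\<^sup>2)" using e L by simp
  obtain \<eta> where \<eta>: "0 < \<eta>" "\<And>t t' x'. T0 \<le> t \<Longrightarrow> t \<le> T \<Longrightarrow> T0 \<le> t' \<Longrightarrow> t' \<le> T \<Longrightarrow> \<bar>t - t'\<bar> < \<eta> \<Longrightarrow> \<bar>x' - x\<bar> < \<eta> \<Longrightarrow>
     (\<integral>\<^sup>+\<omega>. ennreal ((u t' x' \<omega> - u t x \<omega>)\<^sup>2) \<partial>M) \<le> ennreal (e / (4 * L\<^sup>2))"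
    by (rule u_L2_continuous[OF T e', of x]) blast
  from seq_compact_imp_totally_bounded[OF compact_imp_seq_compact[OF compact_Icc[of T0 T]], rule_format, OF \<eta>(1)]
  obtain P where P: "finite P" "P \<subseteq> {T0..T}" "{T0..T} \<subseteq> (\<Union>p\<in>P. ball p \<eta>)"
    by blast
  have "\<forall>\<^sub>F n in sequentially. (\<integral>\<^sup>+\<omega>. ennreal ((\<sigma> (u p x \<omega>) - trunc (real n) (\<sigma> (u p x \<omega>)))\<^sup>2) \<partial>M) < ennreal (e / 4)"
    if "p \<in> P" for p
  proof -
    have p: "0 < p" "p \<le> T" using that P(2) T by auto
    note [measurable] = u_measurable[OF p(1)]
    have "(\<integral>\<^sup>+\<omega>. ennreal ((\<sigma> (u p x \<omega>))\<^sup>2) \<partial>M) < \<infinity>" using C(2)[OF p, of x] by (auto intro: le_less_trans)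
    from truncation_null[OF _ this] show ?thesis using e by (intro order_tendstoD) auto
  qed
  then have "\<forall>\<^sub>F n in sequentially. \<forall>p\<in>P. (\<integral>\<^sup>+\<omega>. ennreal ((\<sigma> (u p x \<omega>) - trunc (real n) (\<sigma> (u p x \<omega>)))\<^sup>2) \<partial>M) < ennreal (e / 4)"
    by (intro eventually_ball_finite P(1)) auto
  then have "\<forall>\<^sub>F n in sequentially. 0 < n \<and> (\<forall>p\<in>P. (\<integral>\<^sup>+\<omega>. ennreal ((\<sigma> (u p x \<omega>) - trunc (real n) (\<sigma> (u p x \<omega>)))\<^sup>2) \<partial>M) < ennreal (e / 4))"
    using eventually_gt_at_top[of 0] by eventually_elim simp
  then obtain n where n: "0 < n" "\<And>p. p \<in> P \<Longrightarrow> (\<integral>\<^sup>+\<omega>. ennreal ((\<sigma> (u p x \<omega>) - trunc (real n) (\<sigma> (u p x \<omega>)))\<^sup>2) \<partial>M) < ennreal (e / 4)"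
    by (auto simp: eventually_sequentially)
  have "(\<integral>\<^sup>+\<omega>. ennreal ((\<sigma> (u t x \<omega>) - trunc (real n) (\<sigma> (u t x \<omega>)))\<^sup>2) \<partial>M) \<le> ennreal e" if t: "T0 \<le> t" "t \<le> T" for t
  proof -
    obtain p where p: "p \<in> P" "\<bar>p - t\<bar> < \<eta>" using P(3) t by (force simp: dist_real_def)
    have pT: "T0 \<le> p" "p \<le> T" using p P(2) by auto
    have p0: "0 < p" "0 < t" using pT t T by auto
    note [measurable] = u_measurable[OF p0(1)] u_measurable[OF p0(2)]
    let ?r = "\<lambda>t \<omega>. \<sigma> (u t x \<omega>) - trunc (real n) (\<sigma> (u t x \<omega>))"
    have "(\<integral>\<^sup>+\<omega>. ennreal ((?r t \<omega>)\<^sup>2) \<partial>M) \<le> 2 * (\<integral>\<^sup>+\<omega>. ennreal ((?r p \<omega>)\<^sup>2) \<partial>M) + 2 * (\<integral>\<^sup>+\<omega>. ennreal ((?r t \<omega> - ?r p \<omega>)\<^sup>2) \<partial>M)"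
      by (rule nn_integral_square_add) auto
    also have "(\<integral>\<^sup>+\<omega>. ennreal ((?r t \<omega> - ?r p \<omega>)\<^sup>2) \<partial>M) \<le> (\<integral>\<^sup>+\<omega>. ennreal (L\<^sup>2) * ennreal ((u t x \<omega> - u p x \<omega>)\<^sup>2) \<partial>M)"
    proof (rule nn_integral_mono)
      fix \<omega>
      have "\<bar>?r t \<omega> - ?r p \<omega>\<bar> \<le> L * \<bar>u t x \<omega> - u p x \<omega>\<bar>"
        by (rule order_trans[OF trunc_remainder_lipschitz L(2)]) simp
      then have "(?r t \<omega> - ?r p \<omega>)\<^sup>2 \<le> (L * \<bar>u t x \<omega> - u p x \<omega>\<bar>)\<^sup>2"
        by (metis abs_ge_zero power2_abs power_mono)
      then show "ennreal ((?r t \<omega> - ?r p \<omega>)\<^sup>2) \<le> ennreal (L\<^sup>2) * ennreal ((u t x \<omega> - u p x \<omega>)\<^sup>2)"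
        by (simp add: ennreal_mult[symmetric] power_mult_distrib ennreal_leI)
    qed
    also have "\<dots> = ennreal (L\<^sup>2) * (\<integral>\<^sup>+\<omega>. ennreal ((u t x \<omega> - u p x \<omega>)\<^sup>2) \<partial>M)"
      by (rule nn_integral_cmult) measurable
    also have "(\<integral>\<^sup>+\<omega>. ennreal ((u t x \<omega> - u p x \<omega>)\<^sup>2) \<partial>M) \<le> ennreal (e / (4 * L\<^sup>2))"
      by (rule \<eta>(2)[OF pT t p(2)]) (use \<eta>(1) in simp)
    also have "(\<integral>\<^sup>+\<omega>. ennreal ((?r p \<omega>)\<^sup>2) \<partial>M) \<le> ennreal (e / 4)" using n(2)[OF p(1)] by simp
    also have "2 * ennreal (e / 4) + 2 * (ennreal (L\<^sup>2) * ennreal (e / (4 * L\<^sup>2))) = ennreal (2 * (e / 4) + 2 * (L\<^sup>2 * (e / (4 * L\<^sup>2))))"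
      using e by (simp add: ennreal_numeral_mult ennreal_mult[symmetric] ennreal_plus[symmetric] del: ennreal_plus)
    also have "2 * (e / 4) + 2 * (L\<^sup>2 * (e / (4 * L\<^sup>2))) = e" using L by simp
    finally show ?thesis by (simp add: add_mono mult_left_mono)
  qed
  then show ?thesis using n(1) by (intro that[of "real n"]) auto
qed

text \<open>The step function is pulled back by the rescaling around (t, x): its level sets become
  bounded sets strictly between the times t - K \<delta> and t. They are thus future for the
  coefficient \<open>X\<close> and past for everything after \<open>t\<close>, and
  \<open>X Z\<close> is the integral of an elementary integrand.\<close>

lemma step_elementary:
  fixes S :: "real set" and B :: "real \<Rightarrow> (real \<times> real) set" and K :: nat and X :: "'w \<Rightarrow> real" and x t \<delta> N :: real
  assumes S: "finite S" and B': "\<forall>c\<in>S. B c \<in> sets borel \<and> B c \<subseteq> {0<..<real K} \<times> {- real K..real K}"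
    and \<delta>: "0 < \<delta>" "real K * \<delta> \<le> t"
    and X: "X \<in> borel_measurable (full_filtration M W (t - real K * \<delta>))" "\<And>\<omega>. \<bar>X \<omega>\<bar> \<le> N"
  defines "k \<equiv> \<delta> powr (- 1 / \<alpha>)"
  defines "D \<equiv> \<lambda>c. (\<lambda>p. ((t - fst p) / \<delta>, k * (x - snd p))) -` B c"
  defines "Z \<equiv> \<lambda>\<omega>. \<Sum>c\<in>S. k * c * W (D c) \<omega>"
  shows "Z \<in> gspan W (future (t - real K * \<delta>))" "Z \<in> gspan W (past t)"
    and "\<exists>gs. elementary gs \<and> (\<forall>\<omega>. elementary_integral gs \<omega> = X \<omega> * Z \<omega>) \<and>
     (\<forall>\<omega> p. elementary_eval gs \<omega> p = X \<omega> * (k * (\<Sum>c\<in>S. c * indicator (B c) ((t - fst p) / \<delta>, k * (x - snd p)))))"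
proof -
  have B: "B c \<in> sets borel" "B c \<subseteq> {0<..<real K} \<times> {- real K..real K}" if "c \<in> S" for c
    using B' that by auto
  have k: "0 < k" using \<delta> by (simp add: k_def)
  have Dp: "t - real K * \<delta> < fst p \<and> fst p < t \<and> \<bar>snd p - x\<bar> \<le> real K / k" if "c \<in> S" "p \<in> D c" for c p
  proof -
    have "0 < (t - fst p) / \<delta>" "(t - fst p) / \<delta> < real K" "- real K \<le> k * (x - snd p)" "k * (x - snd p) \<le> real K"
      using that B(2)[OF that(1)] by (auto simp: D_def)
    then have "k * \<bar>snd p - x\<bar> \<le> real K" using k by (auto simp: abs_if algebra_simps)
    then have "\<bar>snd p - x\<bar> \<le> real K / k" using k by (simp add: field_simps)
    then show ?thesis using \<open>0 < (t - fst p) / \<delta>\<close> \<open>(t - fst p) / \<delta> < real K\<close> \<delta> by (simp add: field_simps)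
  qed
  have Dn: "D c \<in> noise_sets" if "c \<in> S" for c
  proof -
    have "(\<lambda>p. ((t - fst p) / \<delta>, k * (x - snd p))) \<in> borel_measurable borel"
      unfolding borel_prod[symmetric] by measurable
    from measurable_sets[OF this B(1)[OF that]] have "D c \<in> sets borel" by (simp add: D_def)
    moreover have "D c \<subseteq> {0..t} \<times> {x - real K / k..x + real K / k}"
      using Dp[OF that] \<delta>(2) by (fastforce simp: abs_le_iff)
    then have "bounded (D c)" by (rule bounded_subset[rotated]) (intro bounded_Times bounded_closed_interval)
    ultimately show ?thesis using \<open>D c \<subseteq> _\<close> by (auto simp: noise_sets_def bounded_borel_sets_def)
  qed
  have Df: "D c \<in> future (t - real K * \<delta>)" if "c \<in> S" for c
    using Dn[OF that] Dp[OF that] by auto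
  have Dpa: "D c \<in> past t" if "c \<in> S" for c
    using Dn[OF that] Dp[OF that] by (force simp: noise_sets_def)
  show "Z \<in> gspan W (future (t - real K * \<delta>))" "Z \<in> gspan W (past t)"
    unfolding Z_def using Df Dpa by (auto intro!: gspan_sum gspan_scale gspan_base)
  obtain xs where xs: "set xs = S" "distinct xs" using finite_distinct_list[OF S] by blast
  define gs where "gs = map (\<lambda>c. (\<lambda>\<omega>. X \<omega> * (k * c), t - real K * \<delta>, D c)) xs"
  have "elementary gs"
    unfolding elementary_def
  proof (intro ballI, clarify)
    fix Y a A assume "(Y, a, A) \<in> set gs"
    then obtain c where c: "c \<in> S" "Y = (\<lambda>\<omega>. X \<omega> * (k * c))" "a = t - real K * \<delta>" "A = D c" by (auto simp: gs_def xs)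
    have "Y \<in> borel_measurable (full_filtration M W a)" unfolding c using X(1) by measurable
    moreover have "\<bar>Y \<omega>\<bar> \<le> N * \<bar>k * c\<bar>" for \<omega> unfolding c abs_mult[of "X \<omega>"] by (intro mult_right_mono X) auto
    ultimately show "Y \<in> borel_measurable (full_filtration M W a) \<and> (\<exists>K. \<forall>\<omega>\<in>space M. \<bar>Y \<omega>\<bar> \<le> K) \<and> A \<in> future a"
      using Df[OF c(1)] unfolding c by blast
  qed
  moreover have "elementary_integral gs \<omega> = X \<omega> * Z \<omega>" for \<omega>
    unfolding elementary_integral_def gs_def Z_def xs(1)[symmetric] sum.distinct_set_conv_list[OF xs(2)]
    by (simp add: comp_def sum_list_const_mult[symmetric] mult_ac)
  moreover have "elementary_eval gs \<omega> p = X \<omega> * (k * (\<Sum>c\<in>S. c * indicator (B c) ((t - fst p) / \<delta>, k * (x - snd p))))" for \<omega> p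
  proof -
    have "indicator (D c) p = (indicator (B c) ((t - fst p) / \<delta>, k * (x - snd p)) :: real)" for c
      by (simp add: D_def indicator_def)
    then show ?thesis
      unfolding elementary_eval_def gs_def xs(1)[symmetric] sum.distinct_set_conv_list[OF xs(2)]
      by (simp add: comp_def sum_list_const_mult[symmetric] mult_ac)
  qed
  ultimately show "\<exists>gs. elementary gs \<and> (\<forall>\<omega>. elementary_integral gs \<omega> = X \<omega> * Z \<omega>) \<and>
     (\<forall>\<omega> p. elementary_eval gs \<omega> p = X \<omega> * (k * (\<Sum>c\<in>S. c * indicator (B c) ((t - fst p) / \<delta>, k * (x - snd p)))))"
    by blast
qed

definition variance_const :: real where
  "variance_const = c_const \<alpha> / \<mu> powr (1 / \<alpha>)"

lemma variance_const_pos: "0 < variance_const"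
  using alpha \<mu>_pos by (auto simp: variance_const_def c_const_def intro!: divide_pos_pos mult_pos_pos Gamma_real_pos)

text \<open>On short time scales \<open>u\<close> behaves like a Gaussian field with frozen coefficient: the
  increment over \<open>[t - \<delta>, t]\<close> is close to \<open>X Z\<close>, where the truncated coefficient \<open>X\<close> is known at time
  \<open>t - K \<delta>\<close> and the Gaussian variable \<open>Z\<close> only involves the noise between \<open>t - K \<delta>\<close> and \<open>t\<close>.\<close>

lemma increment_approximation:
  assumes T: "0 < T1" "T1 < T2" and \<eta>: "0 < \<eta>"
  obtains K :: nat and N v \<delta>0 :: real and X Z :: "real \<Rightarrow> real \<Rightarrow> 'w \<Rightarrow> real"
  where "0 < \<delta>0" "0 \<le> v" "\<bar>v - variance_const\<bar> \<le> \<eta>" "0 < N"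
    "\<And>\<delta> t. 0 < \<delta> \<Longrightarrow> \<delta> < \<delta>0 \<Longrightarrow> T1 \<le> t \<Longrightarrow> t \<le> T2 \<Longrightarrow>
       X \<delta> t \<in> borel_measurable (full_filtration M W (t - real K * \<delta>)) \<and> (\<forall>\<omega>. \<bar>X \<delta> t \<omega>\<bar> \<le> N) \<and>
       Z \<delta> t \<in> gspan W (future (t - real K * \<delta>)) \<and> Z \<delta> t \<in> gspan W (past t) \<and>
       expectation (\<lambda>\<omega>. (Z \<delta> t \<omega>)\<^sup>2) = \<delta> powr (1 - 1 / \<alpha>) * v \<and>
       (\<integral>\<^sup>+\<omega>. ennreal ((u t x \<omega> - u (t - \<delta>) x \<omega> - X \<delta> t \<omega> * Z \<delta> t \<omega>)\<^sup>2) \<partial>M) \<le> ennreal (\<delta> powr (1 - 1 / \<alpha>) * \<eta>\<^sup>2) \<and>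
       (\<forall>r\<in>{t - \<delta>..t}. (\<integral>\<^sup>+\<omega>. ennreal ((\<sigma> (u r x \<omega>) - X \<delta> t \<omega>)\<^sup>2) \<partial>M) \<le> ennreal (\<eta>\<^sup>2))"
proof -
  \<comment> \<open>Half of \<open>T1\<close> leaves room for the window of length (K + 1) \<delta>
    before \<open>t\<close> to stay at times where the moduli are uniform.\<close>
  define T0 where "T0 = T1 / 2"
  define c where "c = variance_const"
  have c: "0 < c" using variance_const_pos by (simp add: c_def)
  have T0: "0 < T0" "T0 < T2" "0 < T2" using T by (auto simp: T0_def)
  obtain L where L: "0 < L" "\<And>a b. \<bar>\<sigma> a - \<sigma> b\<bar> \<le> L * \<bar>a - b\<bar>" by (rule lipschitz_bound) blast
  obtain C where C: "0 < C" "\<And>t x. 0 < t \<Longrightarrow> t \<le> T2 \<Longrightarrow> (\<integral>\<^sup>+\<omega>. ennreal ((\<sigma> (u t x \<omega>))\<^sup>2) \<partial>M) \<le> ennreal C"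
    by (rule source_second_moment[OF T0(3)]) blast
  \<comment> \<open>Tolerance for freezing the coefficient. The second entry anticipates the error 8
    D v with v \<le> c + \<eta>; the first is the last clause of the claim.\<close>
  define D where "D = min (\<eta>\<^sup>2) (\<eta>\<^sup>2 / (16 * (c + \<eta>)))"
  have D: "0 < D" "D \<le> \<eta>\<^sup>2" "16 * (c + \<eta>) * D \<le> \<eta>\<^sup>2"
  proof -
    show "0 < D" using \<eta> c by (simp add: D_def)
    show "D \<le> \<eta>\<^sup>2" by (simp add: D_def)
    have "D \<le> \<eta>\<^sup>2 / (16 * (c + \<eta>))" by (simp add: D_def)
    then show "16 * (c + \<eta>) * D \<le> \<eta>\<^sup>2" using \<eta> c by (simp add: field_simps)
  qed
  \<comment> \<open>Gives \<open>\<theta> * c = \<eta> / 2\<close>, half of the admissible error of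
    the variance. The second entry of \<epsilon> takes care of the other half, its first entry of
    the kernel error 8 C \<epsilon>.\<close>
  define \<theta> where "\<theta> = \<eta> / (2 * c)"
  have \<theta>: "0 < \<theta>" using \<eta> c by (simp add: \<theta>_def)
  define \<epsilon> where "\<epsilon> = min (\<eta>\<^sup>2 / (16 * C)) (\<eta> / 2 / (1 + 1 / \<theta>))"
  have \<epsilon>: "0 < \<epsilon>" "16 * C * \<epsilon> \<le> \<eta>\<^sup>2" "(1 + 1 / \<theta>) * \<epsilon> \<le> \<eta> / 2"
  proof -
    have p: "0 < 1 + 1 / \<theta>" using \<theta> by (simp add: add_pos_pos)
    show "0 < \<epsilon>" using \<eta> C p by (simp add: \<epsilon>_def)
    have "\<epsilon> \<le> \<eta>\<^sup>2 / (16 * C)" by (simp add: \<epsilon>_def)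
    then show "16 * C * \<epsilon> \<le> \<eta>\<^sup>2" using C by (simp add: field_simps)
    have "\<epsilon> \<le> \<eta> / 2 / (1 + 1 / \<theta>)" by (simp add: \<epsilon>_def)
    from iffD1[OF pos_le_divide_eq[OF p] this] show "(1 + 1 / \<theta>) * \<epsilon> \<le> \<eta> / 2" by (simp only: mult.commute)
  qed
  let ?dk = "increment_kernel \<mu>"
  note dkm[measurable] = increment_kernel_measurable[OF \<mu>_pos]
  have dkI: "(\<integral>\<^sup>+p. ennreal ((?dk p)\<^sup>2) \<partial>lborel) = ennreal c"
    using increment_kernel_square_integral[OF \<mu>_pos] by (simp add: c_def variance_const_def)
  obtain S B K where S: "finite S" and B: "\<And>c. c \<in> S \<Longrightarrow> B c \<in> sets borel" "\<And>c. c \<in> S \<Longrightarrow> B c \<subseteq> {0<..<real K} \<times> {- real K..real K}"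
    and st: "(\<integral>\<^sup>+p. ennreal ((?dk p - (\<Sum>c\<in>S. c * indicator (B c) p))\<^sup>2) \<partial>lborel) < ennreal \<epsilon>"
    by (rule L2_step_approximation[of ?dk \<epsilon>]) (use dkI \<epsilon> in \<open>auto simp: increment_kernel_def\<close>)
  define step where "step p = (\<Sum>c\<in>S. c * indicator (B c) p)" for p
  have stepm[measurable]: "step \<in> borel_measurable borel"
    unfolding step_def[abs_def] using B(1) by (intro borel_measurable_sum borel_measurable_times) auto
  have step_supp: "0 < fst p \<and> fst p < real K \<and> \<bar>snd p\<bar> \<le> real K" if "step p \<noteq> 0" for p
  proof -
    have "\<exists>a\<in>S. p \<in> B a"
    proof (rule ccontr)
      assume "\<not> (\<exists>a\<in>S. p \<in> B a)"
      then have "step p = 0" unfolding step_def by (intro sum.neutral) auto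
      with that show False by simp
    qed
    then obtain a where "a \<in> S" "p \<in> B a" by blast
    then show ?thesis using B(2) by fastforce
  qed
  define v where "v = (LBINT p. (step p)\<^sup>2)"
  have d2: "integrable lborel (\<lambda>p. (?dk p)\<^sup>2)" "integrable lborel (\<lambda>p. (?dk p - step p)\<^sup>2)" "(LBINT p. (?dk p - step p)\<^sup>2) \<le> \<epsilon>"
  proof -
    have st': "(\<integral>\<^sup>+p. ennreal ((?dk p - step p)\<^sup>2) \<partial>lborel) \<le> ennreal \<epsilon>" using st by (simp add: step_def)
    have m: "(\<lambda>p. ?dk p - step p) \<in> borel_measurable lborel" by measurable
    show "integrable lborel (\<lambda>p. (?dk p)\<^sup>2)"
      by (rule square_bound_expectation(1)[of _ _ c]) (use dkI c in auto)
    show "integrable lborel (\<lambda>p. (?dk p - step p)\<^sup>2)" "(LBINT p. (?dk p - step p)\<^sup>2) \<le> \<epsilon>"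
      using square_bound_expectation[OF m st'] \<epsilon>(1) by auto
  qed
  have dkc: "(LBINT p. (?dk p)\<^sup>2) = c"
    using dkI c by (subst integral_eq_nn_integral) auto
  have s2: "integrable lborel (\<lambda>p. (step p)\<^sup>2)" "(LBINT p. \<bar>(?dk p)\<^sup>2 - (step p)\<^sup>2\<bar>) \<le> \<theta> * c + (1 + 1 / \<theta>) * \<epsilon>"
  proof -
    have m: "?dk \<in> borel_measurable lborel" "step \<in> borel_measurable lborel" by auto
    show "integrable lborel (\<lambda>p. (step p)\<^sup>2)" by (rule L1_square_diff_bound(1)[OF m d2(1,2) \<theta>])
    have "(LBINT p. \<bar>(?dk p)\<^sup>2 - (step p)\<^sup>2\<bar>) \<le> \<theta> * (LBINT p. (?dk p)\<^sup>2) + (1 + 1 / \<theta>) * (LBINT p. (?dk p - step p)\<^sup>2)"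
      by (rule L1_square_diff_bound(2)[OF m d2(1,2) \<theta>])
    also have "\<dots> \<le> \<theta> * c + (1 + 1 / \<theta>) * \<epsilon>"
      unfolding dkc using d2(3) \<theta> by (intro add_left_mono mult_left_mono) auto
    finally show "(LBINT p. \<bar>(?dk p)\<^sup>2 - (step p)\<^sup>2\<bar>) \<le> \<theta> * c + (1 + 1 / \<theta>) * \<epsilon>" .
  qed
  have v0: "0 \<le> v" by (simp add: v_def)
  have vc: "\<bar>v - c\<bar> \<le> \<eta>"
  proof -
    have "\<bar>c - v\<bar> = \<bar>LBINT p. (?dk p)\<^sup>2 - (step p)\<^sup>2\<bar>" using d2(1) s2(1) by (simp add: dkc v_def)
    also have "\<dots> \<le> (LBINT p. \<bar>(?dk p)\<^sup>2 - (step p)\<^sup>2\<bar>)" by (rule integral_abs_bound)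
    also have "\<dots> \<le> \<theta> * c + (1 + 1 / \<theta>) * \<epsilon>" by (rule s2)
    also have "\<theta> * c = \<eta> / 2" using c by (simp add: \<theta>_def)
    finally have "\<bar>c - v\<bar> \<le> \<eta>" using \<epsilon>(3) by linarith
    then show ?thesis by (simp add: abs_minus_commute)
  qed
  have stepI: "(\<integral>\<^sup>+p. ennreal ((step p)\<^sup>2) \<partial>lborel) = ennreal v"
    unfolding v_def by (rule nn_integral_eq_integral[OF s2(1)]) auto
  have D4: "0 < D / 4" "0 < D / (4 * L\<^sup>2)" using D L by auto
  obtain N where N: "0 < N" "\<And>t. T0 \<le> t \<Longrightarrow> t \<le> T2 \<Longrightarrow>
     (\<integral>\<^sup>+\<omega>. ennreal ((\<sigma> (u t x \<omega>) - trunc N (\<sigma> (u t x \<omega>)))\<^sup>2) \<partial>M) \<le> ennreal (D / 4)"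
    by (rule truncation_uniform[OF T0(1,2) D4(1), of x]) blast
  obtain m where m: "0 < m" "\<And>t t' x'. T0 \<le> t \<Longrightarrow> t \<le> T2 \<Longrightarrow> T0 \<le> t' \<Longrightarrow> t' \<le> T2 \<Longrightarrow> \<bar>t - t'\<bar> < m \<Longrightarrow> \<bar>x' - x\<bar> < m \<Longrightarrow>
     (\<integral>\<^sup>+\<omega>. ennreal ((u t' x' \<omega> - u t x \<omega>)\<^sup>2) \<partial>M) \<le> ennreal (D / (4 * L\<^sup>2))"
    by (rule u_L2_continuous[OF T0(1,2) D4(2), of x]) blast
  \<comment> \<open>One step more than the window, because the last clause compares with times back
    to t - \<delta> even if K = 0; it also keeps the divisor positive.\<close>
  define K1 where "K1 = real K + 1"
  have K1: "1 \<le> K1" "real K < K1" by (auto simp: K1_def)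
  \<comment> \<open>Three requirements: the window stays after \<open>T0\<close>, its length is
    below the modulus \<open>m\<close>, and so is its spatial radius K
    \<delta>^(1/\<alpha>).\<close>
  define \<delta>0 where "\<delta>0 = min (min (T0 / K1) (m / K1)) ((m / K1) powr \<alpha>)"
  have \<delta>0: "0 < \<delta>0" using T0 m K1 by (simp add: \<delta>0_def)
  define X where "X \<delta> t \<omega> = trunc N (\<sigma> (u (t - real K * \<delta>) x \<omega>))" for \<delta> t \<omega>
  define Z where "Z \<delta> t \<omega> = (\<Sum>c\<in>S. \<delta> powr (- 1 / \<alpha>) * c * W ((\<lambda>p. ((t - fst p) / \<delta>, \<delta> powr (- 1 / \<alpha>) * (x - snd p))) -` B c) \<omega>)" for \<delta> t \<omega>
  show ?thesis
  proof (rule that[of \<delta>0 v N X K Z])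
    show "0 < \<delta>0" "0 \<le> v" "\<bar>v - variance_const\<bar> \<le> \<eta>" "0 < N" using \<delta>0 v0 vc N by (auto simp: c_def)
    fix \<delta> t assume \<delta>: "0 < \<delta>" "\<delta> < \<delta>0" and t: "T1 \<le> t" "t \<le> T2"
    define \<tau> where "\<tau> = t - real K * \<delta>"
    define k where "k = \<delta> powr (- 1 / \<alpha>)"
    have k: "0 < k" using \<delta> by (simp add: k_def)
    have K1\<delta>: "K1 * \<delta> < T0" "K1 * \<delta> < m" "\<delta> < (m / K1) powr \<alpha>"
      using \<delta> K1 by (auto simp: \<delta>0_def field_simps)
    have K\<delta>: "real K * \<delta> \<le> K1 * \<delta>" "real K * \<delta> + \<delta> = K1 * \<delta>" using \<delta> by (auto simp: K1_def algebra_simps)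
    have \<tau>: "T0 \<le> \<tau>" "\<tau> \<le> T2" "0 < \<tau>" "\<tau> \<le> t"
    proof -
      have a: "T0 + T0 \<le> t" "0 \<le> real K * \<delta>" using t \<delta> by (auto simp: T0_def)
      then show "T0 \<le> \<tau>" "\<tau> \<le> T2" "\<tau> \<le> t" using K1\<delta>(1) K\<delta>(1) t unfolding \<tau>_def by linarith+
      then show "0 < \<tau>" using T0 by simp
    qed
    have t\<delta>: "0 < t" "\<delta> < t" "T0 \<le> t - \<delta>" "real K * \<delta> \<le> t"
    proof -
      have a: "T0 + T0 \<le> t" "0 \<le> real K * \<delta>" using t \<delta> by (auto simp: T0_def)
      then show "0 < t" "\<delta> < t" "T0 \<le> t - \<delta>" "real K * \<delta> \<le> t" using K1\<delta>(1) K\<delta> t \<delta>(1) T0(1) by linarith+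
    qed
    have td0: "0 < t - \<delta>" "t - \<delta> \<le> T2" using t\<delta> t T0 \<delta> by auto
    have Kk: "real K / k < m"
    proof -
      have "1 / k = \<delta> powr (1 / \<alpha>)" using \<delta> by (simp add: k_def powr_minus divide_inverse)
      also have "\<dots> < ((m / K1) powr \<alpha>) powr (1 / \<alpha>)" using K1\<delta>(3) \<delta> alpha by (intro powr_less_mono2) auto
      also have "\<dots> = m / K1" using alpha m K1 by (simp add: powr_powr)
      finally have "1 / k < m / K1" .
      then have "real K * (1 / k) \<le> real K * (m / K1)" by (intro mult_left_mono) auto
      also have "\<dots> < m" using K1 m by (simp add: field_simps)
      finally show ?thesis by simp
    qed
    have Xm: "X \<delta> t \<in> borel_measurable (full_filtration M W \<tau>)"
      unfolding X_def[abs_def] \<tau>_def[symmetric] using u_adapted[OF \<tau>(3), of x] by measurable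
    have Xb: "\<bar>X \<delta> t \<omega>\<bar> \<le> N" for \<omega> unfolding X_def using N by (intro trunc_bounded) simp
    note [measurable] = full_filtration_measurable_sub[OF Xm] u_measurable[OF \<tau>(3)] u_measurable[OF t\<delta>(1)] u_measurable[OF td0(1)]
    have B': "\<forall>c\<in>S. B c \<in> sets borel \<and> B c \<subseteq> {0<..<real K} \<times> {- real K..real K}" using B by blast
    note se = step_elementary[OF S B' \<delta>(1) t\<delta>(4), where x=x, folded Z_def[abs_def] k_def \<tau>_def]
    \<comment> \<open>\<open>Z\<close> does not depend on the coefficient, so its span memberships
      are read off with the trivial coefficient 0.\<close>
    have Zs: "Z \<delta> t \<in> gspan W (future \<tau>)" "Z \<delta> t \<in> gspan W (past t)"
      using se(1,2)[where X="\<lambda>_. 0" and N=0] by (auto simp: Z_def[abs_def] k_def)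
    obtain gs where gs: "elementary gs" "\<And>\<omega>. elementary_integral gs \<omega> = X \<delta> t \<omega> * Z \<delta> t \<omega>"
      "\<And>\<omega> p. elementary_eval gs \<omega> p = X \<delta> t \<omega> * (k * step ((t - fst p) / \<delta>, k * (x - snd p)))"
      using se(3)[OF Xm Xb] unfolding step_def Z_def[abs_def] k_def by blast
    \<comment> \<open>With coefficient 1 the isometry computes the variance of
      \<open>Z\<close>.\<close>
    obtain hs where hs: "elementary hs" "\<And>\<omega>. elementary_integral hs \<omega> = Z \<delta> t \<omega>"
      "\<And>\<omega> p. elementary_eval hs \<omega> p = k * step ((t - fst p) / \<delta>, k * (x - snd p))"
      using se(3)[where X="\<lambda>_. 1" and N=1] unfolding step_def Z_def[abs_def] k_def by auto
    define s where "s p = k * step ((t - fst p) / \<delta>, k * (x - snd p))" for p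
    have sm[measurable]: "s \<in> borel_measurable borel"
    proof -
      have "(\<lambda>p. ((t - fst p) / \<delta>, k * (x - snd p))) \<in> borel_measurable borel"
        unfolding borel_prod[symmetric] by measurable
      from measurable_compose[OF this stepm] show ?thesis unfolding s_def[abs_def] by measurable
    qed
    have sI: "(\<integral>\<^sup>+p. ennreal ((s p)\<^sup>2) \<partial>lborel) = ennreal (\<delta> powr (1 - 1 / \<alpha>) * v)"
      using scaled_square_integral[OF stepm \<delta>(1), of t x] v0 by (simp add: s_def k_def stepI ennreal_mult)
    have s_supp: "\<tau> < fst p \<and> fst p < t \<and> \<bar>snd p - x\<bar> < m" if "s p \<noteq> 0" for p
    proof -
      have "step ((t - fst p) / \<delta>, k * (x - snd p)) \<noteq> 0" using that by (auto simp: s_def)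
      from step_supp[OF this] have q: "0 < (t - fst p) / \<delta>" "(t - fst p) / \<delta> < real K" "\<bar>k * (x - snd p)\<bar> \<le> real K" by auto
      have "k * \<bar>snd p - x\<bar> \<le> real K" using q(3) k by (simp add: abs_mult abs_minus_commute)
      then have "\<bar>snd p - x\<bar> \<le> real K / k" using k by (simp add: pos_le_divide_eq mult.commute)
      then show ?thesis using q Kk \<delta> by (simp add: \<tau>_def field_simps)
    qed
    have Zvar: "expectation (\<lambda>\<omega>. (Z \<delta> t \<omega>)\<^sup>2) = \<delta> powr (1 - 1 / \<alpha>) * v"
    proof -
      have Zm: "Z \<delta> t \<in> borel_measurable M" using elementary_measurable(1)[OF hs(1)] hs(2) by (simp cong: measurable_cong)
      have "(\<integral>\<^sup>+\<omega>. ennreal ((Z \<delta> t \<omega>)\<^sup>2) \<partial>M) = (\<integral>\<^sup>+z. ennreal ((s (snd z))\<^sup>2) \<partial>(M \<Otimes>\<^sub>M lborel))"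
        using elementary_isometry[OF hs(1)] by (simp add: hs s_def)
      also have "\<dots> = (\<integral>\<^sup>+\<omega>. (\<integral>\<^sup>+p. ennreal ((s p)\<^sup>2) \<partial>lborel) \<partial>M)"
        by (subst lborel.nn_integral_fst[symmetric]) auto
      also have "\<dots> = ennreal (\<delta> powr (1 - 1 / \<alpha>) * v)" by (simp add: sI emeasure_space_1)
      finally show ?thesis using Zm v0 by (subst integral_eq_nn_integral) auto
    qed
    have near: "(\<integral>\<^sup>+\<omega>. ennreal ((\<sigma> (u r y \<omega>) - X \<delta> t \<omega>)\<^sup>2) \<partial>M) \<le> ennreal D"
      if r: "T0 \<le> r" "r \<le> T2" "\<bar>\<tau> - r\<bar> < m" "\<bar>y - x\<bar> < m" for r y
    proof -
      have r0: "0 < r" using r T0 by simp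
      note [measurable] = u_measurable[OF r0]
      have "(\<integral>\<^sup>+\<omega>. ennreal ((\<sigma> (u r y \<omega>) - X \<delta> t \<omega>)\<^sup>2) \<partial>M) \<le>
         2 * (\<integral>\<^sup>+\<omega>. ennreal ((\<sigma> (u r y \<omega>) - \<sigma> (u \<tau> x \<omega>))\<^sup>2) \<partial>M) + 2 * (\<integral>\<^sup>+\<omega>. ennreal ((\<sigma> (u \<tau> x \<omega>) - X \<delta> t \<omega>)\<^sup>2) \<partial>M)"
        by (rule nn_integral_square_add) auto
      also have "(\<integral>\<^sup>+\<omega>. ennreal ((\<sigma> (u \<tau> x \<omega>) - X \<delta> t \<omega>)\<^sup>2) \<partial>M) \<le> ennreal (D / 4)"
        using N(2)[OF \<tau>(1,2)] by (simp add: X_def \<tau>_def)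
      also have "(\<integral>\<^sup>+\<omega>. ennreal ((\<sigma> (u r y \<omega>) - \<sigma> (u \<tau> x \<omega>))\<^sup>2) \<partial>M) \<le> (\<integral>\<^sup>+\<omega>. ennreal (L\<^sup>2) * ennreal ((u r y \<omega> - u \<tau> x \<omega>)\<^sup>2) \<partial>M)"
      proof (rule nn_integral_mono)
        fix \<omega>
        have "(\<sigma> (u r y \<omega>) - \<sigma> (u \<tau> x \<omega>))\<^sup>2 \<le> (L * \<bar>u r y \<omega> - u \<tau> x \<omega>\<bar>)\<^sup>2"
          using L(2)[of "u r y \<omega>" "u \<tau> x \<omega>"] by (metis abs_ge_zero power2_abs power_mono)
        then show "ennreal ((\<sigma> (u r y \<omega>) - \<sigma> (u \<tau> x \<omega>))\<^sup>2) \<le> ennreal (L\<^sup>2) * ennreal ((u r y \<omega> - u \<tau> x \<omega>)\<^sup>2)"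
          by (simp add: ennreal_mult[symmetric] power_mult_distrib ennreal_leI)
      qed
      also have "\<dots> = ennreal (L\<^sup>2) * (\<integral>\<^sup>+\<omega>. ennreal ((u r y \<omega> - u \<tau> x \<omega>)\<^sup>2) \<partial>M)"
        by (rule nn_integral_cmult) measurable
      also have "(\<integral>\<^sup>+\<omega>. ennreal ((u r y \<omega> - u \<tau> x \<omega>)\<^sup>2) \<partial>M) \<le> ennreal (D / (4 * L\<^sup>2))"
        by (rule m(2)[OF \<tau>(1,2) r])
      also have "2 * (ennreal (L\<^sup>2) * ennreal (D / (4 * L\<^sup>2))) + 2 * ennreal (D / 4) = ennreal (2 * (L\<^sup>2 * (D / (4 * L\<^sup>2))) + 2 * (D / 4))"
        using D by (simp add: ennreal_numeral_mult ennreal_mult[symmetric] ennreal_plus[symmetric] del: ennreal_plus)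
      also have "2 * (L\<^sup>2 * (D / (4 * L\<^sup>2))) + 2 * (D / 4) = D" using L by simp
      finally show ?thesis by (simp add: add_mono mult_left_mono)
    qed
    define dk where "dk p = mild_kernel t x p - mild_kernel (t - \<delta>) x p" for p
    have dkm'[measurable]: "dk \<in> borel_measurable borel" unfolding dk_def[abs_def] by measurable
    \<comment> \<open>The error is itself an integral against the noise, with integrand
      \<open>dk * source - s * X\<close>.\<close>
    have ni: "noise_integral (\<lambda>z. dk (snd z) * source z - elementary_eval gs (fst z) (snd z))
       (\<lambda>\<omega>. u t x \<omega> - u (t - \<delta>) x \<omega> - X \<delta> t \<omega> * Z \<delta> t \<omega>)"
      using noise_integral_diff[OF noise_integral_diff[OF noise_integral_u[OF t\<delta>(1), of x] noise_integral_u[OF td0(1), of x]] noise_integral_elementary[OF gs(1)]]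
      by (simp add: dk_def left_diff_distrib gs(2))
    have "(\<integral>\<^sup>+\<omega>. ennreal ((u t x \<omega> - u (t - \<delta>) x \<omega> - X \<delta> t \<omega> * Z \<delta> t \<omega>)\<^sup>2) \<partial>M) \<le>
        4 * (\<integral>\<^sup>+z. ennreal ((dk (snd z) * source z - elementary_eval gs (fst z) (snd z))\<^sup>2) \<partial>(M \<Otimes>\<^sub>M lborel))"
      by (rule noise_integral_bound[OF ni])
    \<comment> \<open>The integrand is split as (dk - s) * source + s * (source - X): the kernel
      error meets the full coefficient, and the freezing error is confined to the support of the
      approximate kernel.\<close>
    also have "(\<integral>\<^sup>+z. ennreal ((dk (snd z) * source z - elementary_eval gs (fst z) (snd z))\<^sup>2) \<partial>(M \<Otimes>\<^sub>M lborel)) \<le>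
        2 * (\<integral>\<^sup>+z. ennreal (((dk (snd z) - s (snd z)) * source z)\<^sup>2) \<partial>(M \<Otimes>\<^sub>M lborel)) +
        2 * (\<integral>\<^sup>+z. ennreal ((s (snd z) * (source z - X \<delta> t (fst z)))\<^sup>2) \<partial>(M \<Otimes>\<^sub>M lborel))"
      by (rule nn_integral_square_add) (auto simp: gs(3) s_def algebra_simps)
    also have "(\<integral>\<^sup>+z. ennreal (((dk (snd z) - s (snd z)) * source z)\<^sup>2) \<partial>(M \<Otimes>\<^sub>M lborel)) \<le> ennreal C * (\<integral>\<^sup>+p. ennreal ((dk p - s p)\<^sup>2) \<partial>lborel)"
    proof (rule weighted_second_moment[where k="\<lambda>p. dk p - s p"])
      show "AE p in lborel. dk p - s p \<noteq> 0 \<longrightarrow> (\<integral>\<^sup>+\<omega>. ennreal ((source (\<omega>, p))\<^sup>2) \<partial>M) \<le> ennreal C"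
        using AE_time_nonzero
      proof eventually_elim
        case (elim p)
        show ?case
        proof
          assume "dk p - s p \<noteq> 0"
          then have "0 \<le> fst p \<and> fst p \<le> T2"
            by (rule contrapos_np) (use t\<delta> t \<delta> \<tau> s_supp[of p] in \<open>auto simp: dk_def mild_kernel_def indicator_def\<close>)
          then show "(\<integral>\<^sup>+\<omega>. ennreal ((source (\<omega>, p))\<^sup>2) \<partial>M) \<le> ennreal C"
            using C(2)[of "fst p" "snd p"] elim by (simp add: source_def max_def)
        qed
      qed
    qed measurable
    also have "(\<integral>\<^sup>+p. ennreal ((dk p - s p)\<^sup>2) \<partial>lborel) \<le> ennreal (\<delta> powr (1 - 1 / \<alpha>) * \<epsilon>)"
    proof -
      have "(dk p - s p)\<^sup>2 \<le> (k * (?dk ((t - fst p) / \<delta>, k * (x - snd p)) - step ((t - fst p) / \<delta>, k * (x - snd p))))\<^sup>2" for p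
      proof (cases "0 \<le> fst p")
        case True
        then show ?thesis
          using mild_kernel_increment[OF \<delta>(1) t\<delta>(2), of x p] by (simp add: dk_def s_def k_def right_diff_distrib)
      next
        \<comment> \<open>Before time 0 the true kernel is absent; the approximate one vanishes too,
          since its support starts after \<tau> > 0.\<close>
        case False
        then have "dk p = 0" by (simp add: dk_def mild_kernel_def)
        moreover have "s p = 0" using s_supp[of p] False \<tau>(3) by force
        ultimately show ?thesis by simp
      qed
      then have "(\<integral>\<^sup>+p. ennreal ((dk p - s p)\<^sup>2) \<partial>lborel) \<le>
         (\<integral>\<^sup>+p. ennreal ((k * (?dk ((t - fst p) / \<delta>, k * (x - snd p)) - step ((t - fst p) / \<delta>, k * (x - snd p))))\<^sup>2) \<partial>lborel)"
        by (intro nn_integral_mono ennreal_leI)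
      also have "\<dots> = ennreal (\<delta> powr (1 - 1 / \<alpha>)) * (\<integral>\<^sup>+p. ennreal ((?dk p - step p)\<^sup>2) \<partial>lborel)"
        unfolding k_def by (rule scaled_square_integral[OF _ \<delta>(1), of "\<lambda>p. ?dk p - step p"]) measurable
      also have "\<dots> \<le> ennreal (\<delta> powr (1 - 1 / \<alpha>)) * ennreal \<epsilon>"
        using st by (intro mult_left_mono) (auto simp: step_def)
      finally show ?thesis using \<epsilon> by (simp add: ennreal_mult)
    qed
    also have "(\<integral>\<^sup>+z. ennreal ((s (snd z) * (source z - X \<delta> t (fst z)))\<^sup>2) \<partial>(M \<Otimes>\<^sub>M lborel)) \<le> ennreal D * (\<integral>\<^sup>+p. ennreal ((s p)\<^sup>2) \<partial>lborel)"
    proof (rule weighted_second_moment[where k=s])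
      show "AE p in lborel. s p \<noteq> 0 \<longrightarrow> (\<integral>\<^sup>+\<omega>. ennreal ((source (\<omega>, p) - X \<delta> t (fst (\<omega>, p)))\<^sup>2) \<partial>M) \<le> ennreal D"
      proof (intro AE_I2 impI)
        fix p assume "s p \<noteq> 0"
        from s_supp[OF this] have q: "\<tau> < fst p" "fst p < t" "\<bar>snd p - x\<bar> < m" by auto
        have "(\<integral>\<^sup>+\<omega>. ennreal ((\<sigma> (u (fst p) (snd p) \<omega>) - X \<delta> t \<omega>)\<^sup>2) \<partial>M) \<le> ennreal D"
          using q \<tau> t K1\<delta> K\<delta> by (intro near) (auto simp: \<tau>_def)
        then show "(\<integral>\<^sup>+\<omega>. ennreal ((source (\<omega>, p) - X \<delta> t (fst (\<omega>, p)))\<^sup>2) \<partial>M) \<le> ennreal D"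
          using q \<tau> by (simp add: source_def max_def)
      qed
    qed measurable
    also have "4 * (2 * (ennreal C * ennreal (\<delta> powr (1 - 1 / \<alpha>) * \<epsilon>)) + 2 * (ennreal D * (\<integral>\<^sup>+p. ennreal ((s p)\<^sup>2) \<partial>lborel))) =
      ennreal (4 * (2 * (C * (\<delta> powr (1 - 1 / \<alpha>) * \<epsilon>)) + 2 * (D * (\<delta> powr (1 - 1 / \<alpha>) * v))))"
      unfolding sI using C(1) D(1) \<epsilon>(1) v0
      by (simp add: ennreal_numeral_mult ennreal_mult[symmetric] ennreal_plus[symmetric] del: ennreal_plus)
    also have "\<dots> \<le> ennreal (\<delta> powr (1 - 1 / \<alpha>) * \<eta>\<^sup>2)"
    \<comment> \<open>Each of the terms 8 C \<epsilon> and 8 D v is at most \<eta>^2 / 2 by the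
      choice of \<epsilon> and D.\<close>
    proof (rule ennreal_leI)
      have "v \<le> c + \<eta>" using vc by simp
      then have "16 * v * D \<le> \<eta>\<^sup>2" using D by (meson mult_left_mono mult_right_mono order_trans less_imp_le zero_le_numeral)
      then have "8 * C * \<epsilon> + 8 * D * v \<le> \<eta>\<^sup>2" using \<epsilon>(2) by (simp add: mult_ac)
      then have "\<delta> powr (1 - 1 / \<alpha>) * (8 * C * \<epsilon> + 8 * D * v) \<le> \<delta> powr (1 - 1 / \<alpha>) * \<eta>\<^sup>2" by (intro mult_left_mono) auto
      then show "4 * (2 * (C * (\<delta> powr (1 - 1 / \<alpha>) * \<epsilon>)) + 2 * (D * (\<delta> powr (1 - 1 / \<alpha>) * v))) \<le> \<delta> powr (1 - 1 / \<alpha>) * \<eta>\<^sup>2"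
        by (simp add: algebra_simps)
    qed
    finally have main: "(\<integral>\<^sup>+\<omega>. ennreal ((u t x \<omega> - u (t - \<delta>) x \<omega> - X \<delta> t \<omega> * Z \<delta> t \<omega>)\<^sup>2) \<partial>M) \<le> ennreal (\<delta> powr (1 - 1 / \<alpha>) * \<eta>\<^sup>2)"
      by (simp add: add_mono mult_left_mono)
    have "(\<integral>\<^sup>+\<omega>. ennreal ((\<sigma> (u r x \<omega>) - X \<delta> t \<omega>)\<^sup>2) \<partial>M) \<le> ennreal (\<eta>\<^sup>2)" if r: "r \<in> {t - \<delta>..t}" for r
    proof -
      have "0 \<le> real K * \<delta>" using \<delta> by simp
      moreover have "t - \<delta> \<le> r" "r \<le> t" using r by auto
      ultimately have "\<bar>\<tau> - r\<bar> < m"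
        using K1\<delta>(2) K\<delta> \<delta>(1) unfolding abs_less_iff \<tau>_def by (intro conjI; linarith)
      then have "(\<integral>\<^sup>+\<omega>. ennreal ((\<sigma> (u r x \<omega>) - X \<delta> t \<omega>)\<^sup>2) \<partial>M) \<le> ennreal D"
        using r t\<delta> t m(1) by (intro near) auto
      also have "\<dots> \<le> ennreal (\<eta>\<^sup>2)" by (rule ennreal_leI[OF D(2)])
      finally show ?thesis .
    qed
    then show "X \<delta> t \<in> borel_measurable (full_filtration M W (t - real K * \<delta>)) \<and> (\<forall>\<omega>. \<bar>X \<delta> t \<omega>\<bar> \<le> N) \<and>
       Z \<delta> t \<in> gspan W (future (t - real K * \<delta>)) \<and> Z \<delta> t \<in> gspan W (past t) \<and>
       expectation (\<lambda>\<omega>. (Z \<delta> t \<omega>)\<^sup>2) = \<delta> powr (1 - 1 / \<alpha>) * v \<and>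
       (\<integral>\<^sup>+\<omega>. ennreal ((u t x \<omega> - u (t - \<delta>) x \<omega> - X \<delta> t \<omega> * Z \<delta> t \<omega>)\<^sup>2) \<partial>M) \<le> ennreal (\<delta> powr (1 - 1 / \<alpha>) * \<eta>\<^sup>2) \<and>
       (\<forall>r\<in>{t - \<delta>..t}. (\<integral>\<^sup>+\<omega>. ennreal ((\<sigma> (u r x \<omega>) - X \<delta> t \<omega>)\<^sup>2) \<partial>M) \<le> ennreal (\<eta>\<^sup>2))"
      using Xm Xb Zs Zvar main by (simp add: \<tau>_def)
  qed
qed

end

section \<open>Riemann sums and sums of squares\<close>

text \<open>Cells are open on the left and closed on the right, so the index is the ceiling of (r -
  T1) / \<delta>; the point T1 lies in none of the cells 1 to n.\<close>

lemma grid_cell_exists: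
  assumes T: "T1 < T2" and n: "0 < n" and r: "T1 < r" "r \<le> T2"
  obtains j where "j \<in> {1..n}" "\<And>i. r \<in> {grid_time T1 T2 n i - (T2 - T1) / real n<..grid_time T1 T2 n i} \<longleftrightarrow> i = j"
proof -
  define \<delta> where "\<delta> = (T2 - T1) / real n"
  have \<delta>: "0 < \<delta>" using T n by (simp add: \<delta>_def)
  define q where "q = (r - T1) / \<delta>"
  have q: "0 < q" "q \<le> real n" using r T n \<delta> by (auto simp: q_def \<delta>_def field_simps)
  define j where "j = nat \<lceil>q\<rceil>"
  have j: "j \<in> {1..n}" using q by (auto simp: j_def ceiling_le_iff le_nat_iff)
  have "r \<in> {grid_time T1 T2 n i - \<delta><..grid_time T1 T2 n i} \<longleftrightarrow> i = j" for i
  proof -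
    have "r \<in> {grid_time T1 T2 n i - \<delta><..grid_time T1 T2 n i} \<longleftrightarrow> real i - 1 < q \<and> q \<le> real i"
      using \<delta> by (simp add: grid_time_def q_def \<delta>_def[symmetric] field_simps)
    also have "\<dots> \<longleftrightarrow> \<lceil>q\<rceil> = int i" by (auto simp: ceiling_eq_iff)
    also have "\<dots> \<longleftrightarrow> i = j" using q by (auto simp: j_def)
    finally show ?thesis .
  qed
  then show ?thesis using j by (intro that[of j]) (auto simp: \<delta>_def)
qed

context white_noise begin

text \<open>The weighted sum is the time integral of a step function on the cells, so Tonelli
  reduces the claim to an L1 distance at a single time. The weights \<open>v\<close> and
  \<open>c\<close> let it serve both for frozen coefficients, whose variance factor is only close to
  \<open>c\<close>, and for grid values with weights 1.\<close>

lemma Riemann_sum_L1: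
  fixes f :: "'w \<times> real \<Rightarrow> real" and X :: "nat \<Rightarrow> 'w \<Rightarrow> real"
  assumes [measurable]: "f \<in> borel_measurable (M \<Otimes>\<^sub>M lborel)" "\<And>i. i \<in> {1..n} \<Longrightarrow> X i \<in> borel_measurable M"
    and T: "T1 < T2" and n: "0 < n" and b: "0 \<le> b"
    and fin: "(\<integral>\<^sup>+r\<in>{T1<..T2}. (\<integral>\<^sup>+\<omega>. ennreal ((f (\<omega>, r))\<^sup>2) \<partial>M) \<partial>lborel) < \<infinity>"
    and cell: "\<And>i r. i \<in> {1..n} \<Longrightarrow> r \<in> {grid_time T1 T2 n i - (T2 - T1) / real n<..grid_time T1 T2 n i} \<Longrightarrow>
       (\<integral>\<^sup>+\<omega>. ennreal \<bar>v * (X i \<omega>)\<^sup>2 - c * (f (\<omega>, r))\<^sup>2\<bar> \<partial>M) \<le> ennreal b"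
  shows "(\<integral>\<^sup>+\<omega>. ennreal \<bar>v * ((T2 - T1) / real n) * (\<Sum>i=1..n. (X i \<omega>)\<^sup>2) - c * (LBINT r:{T1..T2}. (f (\<omega>, r))\<^sup>2)\<bar> \<partial>M) \<le> ennreal ((T2 - T1) * b)"
proof -
  interpret P: pair_sigma_finite M "lborel :: real measure" ..
  define \<delta> where "\<delta> = (T2 - T1) / real n"
  have \<delta>: "0 < \<delta>" using T n by (simp add: \<delta>_def)
  define I where "I i = {grid_time T1 T2 n i - \<delta><..grid_time T1 T2 n i}" for i
  define w where "w \<omega> r = (\<Sum>i=1..n. (X i \<omega>)\<^sup>2 * indicator (I i) r)" for \<omega> r
  have wm[measurable]: "(\<lambda>z. w (fst z) (snd z)) \<in> borel_measurable (M \<Otimes>\<^sub>M lborel)"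
    unfolding w_def I_def by (intro borel_measurable_sum borel_measurable_times borel_measurable_power) measurable
  define g where "g z = indicator {T1<..T2} (snd z) * \<bar>v * w (fst z) (snd z) - c * (f z)\<^sup>2\<bar>" for z
  have gm[measurable]: "g \<in> borel_measurable (M \<Otimes>\<^sub>M lborel)" unfolding g_def[abs_def] by measurable
  have wj: "\<exists>j\<in>{1..n}. r \<in> I j \<and> (\<forall>\<omega>. w \<omega> r = (X j \<omega>)\<^sup>2)" if r: "r \<in> {T1<..T2}" for r
  proof -
    obtain j where j: "j \<in> {1..n}" "\<And>i. r \<in> I i \<longleftrightarrow> i = j"
      using grid_cell_exists[OF T n, of r] r unfolding I_def \<delta>_def by (metis greaterThanAtMost_iff)
    have "w \<omega> r = (\<Sum>i=1..n. if i = j then (X j \<omega>)\<^sup>2 else 0)" for \<omega>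
      unfolding w_def using j(2) by (intro sum.cong) (auto simp: indicator_def)
    then show ?thesis using j by (intro bexI[of _ j]) auto
  qed
  have Isub: "I i \<subseteq> {T1<..T2}" if "i \<in> {1..n}" for i
  proof -
    have a: "real i * \<delta> \<le> real n * \<delta>" "1 * \<delta> \<le> real i * \<delta>" using that \<delta> by (intro mult_right_mono; simp)+
    have c: "real n * \<delta> = T2 - T1" using n by (simp add: \<delta>_def)
    show ?thesis
    proof
      fix r assume "r \<in> I i"
      then have "T1 + real i * \<delta> - \<delta> < r" "r \<le> T1 + real i * \<delta>"
        by (auto simp: I_def grid_time_def \<delta>_def)
      then show "r \<in> {T1<..T2}" using a c unfolding greaterThanAtMost_iff by linarith
    qed
  qed
  have fm2: "(\<lambda>\<omega>. f (\<omega>, r)) \<in> borel_measurable M" for r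
    using measurable_compose[OF measurable_Pair2'[of r lborel M] assms(1)] by simp
  have fm3: "(\<lambda>r. f (\<omega>, r)) \<in> borel_measurable lborel" if "\<omega> \<in> space M" for \<omega>
    using measurable_compose[OF measurable_Pair1'[OF that] assms(1)] by simp
  have wint: "integrable lborel (\<lambda>r. w \<omega> r)" "(LBINT r. w \<omega> r) = \<delta> * (\<Sum>i=1..n. (X i \<omega>)\<^sup>2)" for \<omega>
  proof -
    have m: "measure lborel (I i) = \<delta>" for i using \<delta> by (simp add: I_def)
    have i: "integrable lborel (\<lambda>r. (X i \<omega>)\<^sup>2 * indicator (I i) r)" for i
      using \<delta> by (intro integrable_mult_right integrable_real_indicator) (auto simp: I_def)
    show "integrable lborel (\<lambda>r. w \<omega> r)" unfolding w_def by (intro Bochner_Integration.integrable_sum i)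
    have "(LBINT r. w \<omega> r) = (\<Sum>i=1..n. (LBINT r. (X i \<omega>)\<^sup>2 * indicator (I i) r))"
      unfolding w_def by (intro Bochner_Integration.integral_sum i)
    then show "(LBINT r. w \<omega> r) = \<delta> * (\<Sum>i=1..n. (X i \<omega>)\<^sup>2)"
      by (simp add: m sum_distrib_left mult.commute)
  qed
  have w0: "w \<omega> r = indicator {T1<..T2} r * w \<omega> r" for \<omega> r
  proof (cases "r \<in> {T1<..T2}")
    case False
    have "w \<omega> r = 0" unfolding w_def
    proof (intro sum.neutral ballI)
      fix i assume "i \<in> {1..n}"
      then have "r \<notin> I i" using Isub[of i] False by blast
      then show "(X i \<omega>)\<^sup>2 * indicator (I i) r = 0" by simp
    qed
    then show ?thesis by simp
  qed simp
  have "(\<integral>\<^sup>+\<omega>. (\<integral>\<^sup>+r. ennreal (indicator {T1<..T2} r * (f (\<omega>, r))\<^sup>2) \<partial>lborel) \<partial>M) =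
     (\<integral>\<^sup>+r. (\<integral>\<^sup>+\<omega>. ennreal (indicator {T1<..T2} r * (f (\<omega>, r))\<^sup>2) \<partial>M) \<partial>lborel)"
    by (rule P.Fubini'[symmetric]) measurable
  also have "\<dots> = (\<integral>\<^sup>+r\<in>{T1<..T2}. (\<integral>\<^sup>+\<omega>. ennreal ((f (\<omega>, r))\<^sup>2) \<partial>M) \<partial>lborel)"
    by (intro nn_integral_cong) (auto simp: indicator_def)
  finally have fin2: "(\<integral>\<^sup>+\<omega>. (\<integral>\<^sup>+r. ennreal (indicator {T1<..T2} r * (f (\<omega>, r))\<^sup>2) \<partial>lborel) \<partial>M) < \<infinity>" using fin by simp
  \<comment> \<open>For almost every path the square is integrable in time; otherwise the Bochner
    integral would be 0 and could not be compared with the step function.\<close>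
  have "AE \<omega> in M. (\<integral>\<^sup>+r. ennreal (indicator {T1<..T2} r * (f (\<omega>, r))\<^sup>2) \<partial>lborel) \<noteq> \<infinity>"
    by (rule nn_integral_noteq_infinite) (use fin2 in \<open>auto intro!: lborel.borel_measurable_nn_integral\<close>)
  then have "AE \<omega> in M. ennreal \<bar>v * \<delta> * (\<Sum>i=1..n. (X i \<omega>)\<^sup>2) - c * (LBINT r:{T1..T2}. (f (\<omega>, r))\<^sup>2)\<bar> \<le> (\<integral>\<^sup>+r. ennreal (g (\<omega>, r)) \<partial>lborel)"
    using AE_space
  proof eventually_elim
    case (elim \<omega>)
    note [measurable] = fm3[OF elim(2)]
    have fi: "integrable lborel (\<lambda>r. indicator {T1<..T2} r * (f (\<omega>, r))\<^sup>2)"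
      by (rule integrableI_bounded) (use elim(1) in \<open>auto simp: less_top\<close>)
    have "(LBINT r:{T1..T2}. (f (\<omega>, r))\<^sup>2) = (LBINT r. indicator {T1<..T2} r * (f (\<omega>, r))\<^sup>2)"
      unfolding set_lebesgue_integral_def
    proof (rule integral_cong_AE)
      show "AE r in lborel. indicator {T1..T2} r *\<^sub>R (f (\<omega>, r))\<^sup>2 = indicator {T1<..T2} r * (f (\<omega>, r))\<^sup>2"
        using AE_lborel_singleton[of T1] by eventually_elim (auto simp: indicator_def)
    qed measurable
    then have "v * \<delta> * (\<Sum>i=1..n. (X i \<omega>)\<^sup>2) - c * (LBINT r:{T1..T2}. (f (\<omega>, r))\<^sup>2) =
       (LBINT r. v * w \<omega> r - c * (indicator {T1<..T2} r * (f (\<omega>, r))\<^sup>2))"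
      using wint[of \<omega>] fi by simp
    also have "\<bar>\<dots>\<bar> \<le> (LBINT r. \<bar>v * w \<omega> r - c * (indicator {T1<..T2} r * (f (\<omega>, r))\<^sup>2)\<bar>)"
      by (rule integral_abs_bound)
    also have "(\<lambda>r. \<bar>v * w \<omega> r - c * (indicator {T1<..T2} r * (f (\<omega>, r))\<^sup>2)\<bar>) = (\<lambda>r. g (\<omega>, r))"
      using w0[of \<omega>] by (auto simp: g_def fun_eq_iff indicator_def split: if_splits)
    finally have "ennreal \<bar>v * \<delta> * (\<Sum>i=1..n. (X i \<omega>)\<^sup>2) - c * (LBINT r:{T1..T2}. (f (\<omega>, r))\<^sup>2)\<bar> \<le> ennreal (LBINT r. g (\<omega>, r))"
      by (rule ennreal_leI)
    also have "\<dots> = (\<integral>\<^sup>+r. ennreal (g (\<omega>, r)) \<partial>lborel)"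
    proof (rule nn_integral_eq_integral[symmetric])
      have "(\<lambda>r. g (\<omega>, r)) = (\<lambda>r. \<bar>v * w \<omega> r - c * (indicator {T1<..T2} r * (f (\<omega>, r))\<^sup>2)\<bar>)"
        using w0[of \<omega>] by (auto simp: g_def fun_eq_iff indicator_def split: if_splits)
      then show "integrable lborel (\<lambda>r. g (\<omega>, r))" using wint[of \<omega>] fi by simp
    qed (auto simp: g_def)
    finally show ?case .
  qed
  then have "(\<integral>\<^sup>+\<omega>. ennreal \<bar>v * \<delta> * (\<Sum>i=1..n. (X i \<omega>)\<^sup>2) - c * (LBINT r:{T1..T2}. (f (\<omega>, r))\<^sup>2)\<bar> \<partial>M) \<le> (\<integral>\<^sup>+\<omega>. (\<integral>\<^sup>+r. ennreal (g (\<omega>, r)) \<partial>lborel) \<partial>M)"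
    by (rule nn_integral_mono_AE)
  also have "\<dots> = (\<integral>\<^sup>+r. (\<integral>\<^sup>+\<omega>. ennreal (g (\<omega>, r)) \<partial>M) \<partial>lborel)"
    by (rule P.Fubini'[symmetric]) measurable
  also have "\<dots> \<le> (\<integral>\<^sup>+r. ennreal b * indicator {T1<..T2} r \<partial>lborel)"
  proof (rule nn_integral_mono)
    fix r
    show "(\<integral>\<^sup>+\<omega>. ennreal (g (\<omega>, r)) \<partial>M) \<le> ennreal b * indicator {T1<..T2} r"
    proof (cases "r \<in> {T1<..T2}")
      case True
      then obtain j where j: "j \<in> {1..n}" "r \<in> I j" "\<And>\<omega>. w \<omega> r = (X j \<omega>)\<^sup>2" using wj by blast
      have "(\<integral>\<^sup>+\<omega>. ennreal (g (\<omega>, r)) \<partial>M) = (\<integral>\<^sup>+\<omega>. ennreal \<bar>v * (X j \<omega>)\<^sup>2 - c * (f (\<omega>, r))\<^sup>2\<bar> \<partial>M)"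
        using True by (simp add: g_def j(3))
      also have "\<dots> \<le> ennreal b" using cell[OF j(1)] j(2) by (simp add: I_def \<delta>_def)
      finally show ?thesis using True by simp
    qed (simp add: g_def)
  qed
  also have "\<dots> = ennreal b * ennreal (T2 - T1)" using T by (simp add: nn_integral_cmult)
  also have "\<dots> = ennreal ((T2 - T1) * b)" using b T by (simp add: ennreal_mult[symmetric] mult.commute)
  finally show ?thesis unfolding \<delta>_def .
qed

text \<open>Each index interacts with at most 2 K indices, so the second moment grows like n rather
  than n^2. Interacting pairs are bounded by the mean of the two squares.\<close>

lemma finite_range_orthogonal_sum:
  fixes Y :: "nat \<Rightarrow> 'w \<Rightarrow> real"
  assumes Ym[measurable]: "\<And>i. i \<in> {1..n} \<Longrightarrow> Y i \<in> borel_measurable M"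
    and Yi: "\<And>i. i \<in> {1..n} \<Longrightarrow> integrable M (\<lambda>\<omega>. (Y i \<omega>)\<^sup>2)"
    and Yb: "\<And>i. i \<in> {1..n} \<Longrightarrow> expectation (\<lambda>\<omega>. (Y i \<omega>)\<^sup>2) \<le> b"
    and orth: "\<And>i j. i \<in> {1..n} \<Longrightarrow> j \<in> {1..n} \<Longrightarrow> i + K \<le> j \<Longrightarrow> expectation (\<lambda>\<omega>. Y i \<omega> * Y j \<omega>) = 0"
    and b: "0 \<le> b"
  shows "integrable M (\<lambda>\<omega>. (\<Sum>i=1..n. Y i \<omega>)\<^sup>2)"
    and "expectation (\<lambda>\<omega>. (\<Sum>i=1..n. Y i \<omega>)\<^sup>2) \<le> real n * (2 * real K * b)"
proof -
  have ij: "integrable M (\<lambda>\<omega>. Y i \<omega> * Y j \<omega>)" if "i \<in> {1..n}" "j \<in> {1..n}" for i j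
    using that by (intro integrable_mult_square Ym Yi)
  have e: "(\<Sum>i=1..n. Y i \<omega>)\<^sup>2 = (\<Sum>i=1..n. \<Sum>j=1..n. Y i \<omega> * Y j \<omega>)" for \<omega>
    unfolding power2_eq_square by (rule sum_product)
  show "integrable M (\<lambda>\<omega>. (\<Sum>i=1..n. Y i \<omega>)\<^sup>2)"
    unfolding e by (intro Bochner_Integration.integrable_sum ij)
  have le: "expectation (\<lambda>\<omega>. Y i \<omega> * Y j \<omega>) \<le> (if i < j + K \<and> j < i + K then b else 0)"
    if "i \<in> {1..n}" "j \<in> {1..n}" for i j
  proof -
    consider "i + K \<le> j" | "j + K \<le> i" | "i < j + K" "j < i + K" by linarith
    then show ?thesis
    proof cases
      case 1 then show ?thesis using orth[OF that] b by simp
    next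
      case 2 then show ?thesis using orth[OF that(2,1)] b by (simp add: mult.commute)
    next
      case 3
      have "expectation (\<lambda>\<omega>. Y i \<omega> * Y j \<omega>) \<le> expectation (\<lambda>\<omega>. ((Y i \<omega>)\<^sup>2 + (Y j \<omega>)\<^sup>2) / 2)"
      proof (rule integral_mono[OF ij[OF that]])
        show "integrable M (\<lambda>\<omega>. ((Y i \<omega>)\<^sup>2 + (Y j \<omega>)\<^sup>2) / 2)" using Yi that by simp
        show "Y i \<omega> * Y j \<omega> \<le> ((Y i \<omega>)\<^sup>2 + (Y j \<omega>)\<^sup>2) / 2" for \<omega>
          using sum_squares_bound[of "Y i \<omega>" "Y j \<omega>"] by simp
      qed
      also have "\<dots> = (expectation (\<lambda>\<omega>. (Y i \<omega>)\<^sup>2) + expectation (\<lambda>\<omega>. (Y j \<omega>)\<^sup>2)) / 2"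
        using Yi that by simp
      also have "\<dots> \<le> b" using Yb[OF that(1)] Yb[OF that(2)] by simp
      finally show ?thesis using 3 by simp
    qed
  qed
  have "expectation (\<lambda>\<omega>. (\<Sum>i=1..n. Y i \<omega>)\<^sup>2) = (\<Sum>i=1..n. \<Sum>j=1..n. expectation (\<lambda>\<omega>. Y i \<omega> * Y j \<omega>))"
  proof -
    have "expectation (\<lambda>\<omega>. \<Sum>j=1..n. Y i \<omega> * Y j \<omega>) = (\<Sum>j=1..n. expectation (\<lambda>\<omega>. Y i \<omega> * Y j \<omega>))" if "i \<in> {1..n}" for i
      by (intro Bochner_Integration.integral_sum ij that)
    moreover have "expectation (\<lambda>\<omega>. \<Sum>i=1..n. \<Sum>j=1..n. Y i \<omega> * Y j \<omega>) = (\<Sum>i=1..n. expectation (\<lambda>\<omega>. \<Sum>j=1..n. Y i \<omega> * Y j \<omega>))"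
      by (intro Bochner_Integration.integral_sum Bochner_Integration.integrable_sum ij)
    ultimately show ?thesis unfolding e by (simp cong: sum.cong_simp)
  qed
  also have "\<dots> \<le> (\<Sum>i=1..n. 2 * real K * b)"
  proof (rule sum_mono)
    fix i assume i: "i \<in> {1..n}"
    have "(\<Sum>j=1..n. expectation (\<lambda>\<omega>. Y i \<omega> * Y j \<omega>)) \<le> (\<Sum>j=1..n. if i < j + K \<and> j < i + K then b else 0)"
      by (intro sum_mono le i)
    also have "\<dots> = real (card {j \<in> {1..n}. i < j + K \<and> j < i + K}) * b"
      by (simp add: sum.If_cases Int_def)
    also have "\<dots> \<le> 2 * real K * b"
    proof (intro mult_right_mono b)
      have "{j \<in> {1..n}. i < j + K \<and> j < i + K} \<subseteq> {i + 1 - K..<i + K}" by auto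
      then have "card {j \<in> {1..n}. i < j + K \<and> j < i + K} \<le> card {i + 1 - K..<i + K}" by (intro card_mono) auto
      also have "\<dots> \<le> 2 * K" by simp
      finally show "real (card {j \<in> {1..n}. i < j + K \<and> j < i + K}) \<le> 2 * real K" by simp
    qed
    finally show "(\<Sum>j=1..n. expectation (\<lambda>\<omega>. Y i \<omega> * Y j \<omega>)) \<le> 2 * real K * b" .
  qed
  finally show "expectation (\<lambda>\<omega>. (\<Sum>i=1..n. Y i \<omega>)\<^sup>2) \<le> real n * (2 * real K * b)" by simp
qed

text \<open>Pointwise \<open>\<bar>s\<bar> \<le> \<rho> + s\<^sup>2 / \<rho>\<close>, according to
  whether \<open>\<bar>s\<bar>\<close> exceeds \<rho>. With \<rho> = \<eta> and a second moment of
  at most \<eta>^2 the bound is 2 \<eta>.\<close>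

lemma L1_le_L2:
  fixes S :: "'w \<Rightarrow> real"
  assumes [measurable]: "S \<in> borel_measurable M" and S: "integrable M (\<lambda>\<omega>. (S \<omega>)\<^sup>2)" and \<rho>: "0 < \<rho>"
  shows "(\<integral>\<^sup>+\<omega>. ennreal \<bar>S \<omega>\<bar> \<partial>M) \<le> ennreal (\<rho> + expectation (\<lambda>\<omega>. (S \<omega>)\<^sup>2) / \<rho>)"
proof -
  have "\<bar>s\<bar> \<le> \<rho> + s\<^sup>2 / \<rho>" for s :: real
  proof (cases "\<bar>s\<bar> \<le> \<rho>")
    case True
    then show ?thesis using \<rho> by (simp add: add_increasing2)
  next
    case False
    then have "\<rho> * \<bar>s\<bar> \<le> \<bar>s\<bar> * \<bar>s\<bar>" by (intro mult_right_mono) auto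
    then have "\<bar>s\<bar> \<le> s\<^sup>2 / \<rho>" using \<rho> by (simp add: field_simps power2_eq_square abs_mult_self_eq)
    then show ?thesis using \<rho> by simp
  qed
  then have "(\<integral>\<^sup>+\<omega>. ennreal \<bar>S \<omega>\<bar> \<partial>M) \<le> (\<integral>\<^sup>+\<omega>. ennreal (\<rho> + (S \<omega>)\<^sup>2 / \<rho>) \<partial>M)"
    by (intro nn_integral_mono ennreal_leI)
  also have "\<dots> = ennreal (expectation (\<lambda>\<omega>. \<rho> + (S \<omega>)\<^sup>2 / \<rho>))"
    using S \<rho> by (intro nn_integral_eq_integral) auto
  also have "expectation (\<lambda>\<omega>. \<rho> + (S \<omega>)\<^sup>2 / \<rho>) = \<rho> + expectation (\<lambda>\<omega>. (S \<omega>)\<^sup>2) / \<rho>"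
    using S by (simp add: prob_space)
  finally show ?thesis .
qed

lemma nn_integral_abs_triangle:
  fixes f g h :: "'w \<Rightarrow> real"
  assumes [measurable]: "f \<in> borel_measurable M" "g \<in> borel_measurable M" "h \<in> borel_measurable M"
  shows "(\<integral>\<^sup>+\<omega>. ennreal \<bar>f \<omega> - h \<omega>\<bar> \<partial>M) \<le> (\<integral>\<^sup>+\<omega>. ennreal \<bar>f \<omega> - g \<omega>\<bar> \<partial>M) + (\<integral>\<^sup>+\<omega>. ennreal \<bar>g \<omega> - h \<omega>\<bar> \<partial>M)"
proof -
  have "(\<integral>\<^sup>+\<omega>. ennreal \<bar>f \<omega> - h \<omega>\<bar> \<partial>M) \<le> (\<integral>\<^sup>+\<omega>. ennreal \<bar>f \<omega> - g \<omega>\<bar> + ennreal \<bar>g \<omega> - h \<omega>\<bar> \<partial>M)"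
    by (intro nn_integral_mono) (simp add: ennreal_plus[symmetric] ennreal_leI del: ennreal_plus)
  then show ?thesis by (simp add: nn_integral_add)
qed

text \<open>A law of large numbers by second moments. The fourth moment 3 s^2 of a Gaussian variable
  gives variance 2 s^2 of its square, and boundedness of the coefficients bounds the remaining
  factor by N^4.\<close>

lemma gaussian_squares_law_of_large_numbers:
  fixes X Z :: "nat \<Rightarrow> 'w \<Rightarrow> real" and t :: "nat \<Rightarrow> real"
  assumes X: "\<And>i. i \<in> {1..n} \<Longrightarrow> X i \<in> borel_measurable (full_filtration M W (t i - real K * \<delta>))"
    and Xb: "\<And>i \<omega>. i \<in> {1..n} \<Longrightarrow> \<bar>X i \<omega>\<bar> \<le> N"
    and Zf: "\<And>i. i \<in> {1..n} \<Longrightarrow> Z i \<in> gspan W (future (t i - real K * \<delta>))"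
    and Zp: "\<And>i. i \<in> {1..n} \<Longrightarrow> Z i \<in> gspan W (past (t i))"
    and Zs: "\<And>i. i \<in> {1..n} \<Longrightarrow> expectation (\<lambda>\<omega>. (Z i \<omega>)\<^sup>2) = s"
    and t: "\<And>i j. i + K \<le> j \<Longrightarrow> t i \<le> t j - real K * \<delta>" and \<delta>: "0 \<le> \<delta>"
  shows "integrable M (\<lambda>\<omega>. (\<Sum>i=1..n. (X i \<omega>)\<^sup>2 * ((Z i \<omega>)\<^sup>2 - s))\<^sup>2)"
    and "expectation (\<lambda>\<omega>. (\<Sum>i=1..n. (X i \<omega>)\<^sup>2 * ((Z i \<omega>)\<^sup>2 - s))\<^sup>2) \<le> real n * (2 * real K * (N ^ 4 * (2 * s\<^sup>2)))"
proof -
  have Xm: "X i \<in> borel_measurable M" if "i \<in> {1..n}" for i by (rule full_filtration_measurable_sub[OF X[OF that]])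
  have Zg: "Z i \<in> gspan W noise_sets" if "i \<in> {1..n}" for i
    using Zp[OF that] gspan_mono[OF past_noise] by blast
  have Zm: "Z i \<in> borel_measurable M" if "i \<in> {1..n}" for i by (rule gspan_measurable[OF Zg[OF that]])
  have ZG: "centered_gaussian M (Z i)" if "i \<in> {1..n}" for i by (rule gaussian_gspan[OF Zg[OF that]])
  define Y where "Y i \<omega> = (X i \<omega>)\<^sup>2 * ((Z i \<omega>)\<^sup>2 - s)" for i \<omega>
  have Ym: "Y i \<in> borel_measurable M" if "i \<in> {1..n}" for i
    unfolding Y_def[abs_def] using Xm[OF that] Zm[OF that] by measurable
  have Z2: "integrable M (\<lambda>\<omega>. (Z i \<omega>)\<^sup>2)" "integrable M (\<lambda>\<omega>. (Z i \<omega>) ^ 4)" if "i \<in> {1..n}" for i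
    using centered_gaussian_integrable_power[OF ZG[OF that]] by auto
  have sq: "((z :: real)\<^sup>2 - s)\<^sup>2 = z ^ 4 - 2 * s * z\<^sup>2 + s\<^sup>2" for z
    by (simp add: power2_eq_square power4_eq_xxxx algebra_simps)
  have Zi: "integrable M (\<lambda>\<omega>. ((Z i \<omega>)\<^sup>2 - s)\<^sup>2)" if "i \<in> {1..n}" for i
    unfolding sq using Z2[OF that] by simp
  have Zv: "expectation (\<lambda>\<omega>. ((Z i \<omega>)\<^sup>2 - s)\<^sup>2) = 2 * s\<^sup>2" if "i \<in> {1..n}" for i
    unfolding sq using Z2[OF that] Zs[OF that] centered_gaussian_fourth_moment[OF ZG[OF that]]
    by (simp add: prob_space power2_eq_square)
  have Xb4: "(X i \<omega>) ^ 4 \<le> N ^ 4" if "i \<in> {1..n}" for i \<omega>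
    using power_mono[OF Xb[OF that], of \<omega> 4] by simp
  have Y2: "(Y i \<omega>)\<^sup>2 \<le> N ^ 4 * ((Z i \<omega>)\<^sup>2 - s)\<^sup>2" if "i \<in> {1..n}" for i \<omega>
  proof -
    have "(Y i \<omega>)\<^sup>2 = (X i \<omega>) ^ 4 * ((Z i \<omega>)\<^sup>2 - s)\<^sup>2" by (simp add: Y_def power_mult_distrib flip: power_mult)
    also have "\<dots> \<le> N ^ 4 * ((Z i \<omega>)\<^sup>2 - s)\<^sup>2" by (intro mult_right_mono Xb4 that) simp
    finally show ?thesis .
  qed
  have Yi: "integrable M (\<lambda>\<omega>. (Y i \<omega>)\<^sup>2)" if "i \<in> {1..n}" for i
  proof (rule Bochner_Integration.integrable_bound[of _ "\<lambda>\<omega>. N ^ 4 * ((Z i \<omega>)\<^sup>2 - s)\<^sup>2"])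
    show "AE \<omega> in M. norm ((Y i \<omega>)\<^sup>2) \<le> norm (N ^ 4 * ((Z i \<omega>)\<^sup>2 - s)\<^sup>2)"
      using Y2[OF that] by (intro AE_I2) (simp add: abs_mult)
  qed (use Zi[OF that] Ym[OF that] in auto)
  have Yb: "expectation (\<lambda>\<omega>. (Y i \<omega>)\<^sup>2) \<le> N ^ 4 * (2 * s\<^sup>2)" if "i \<in> {1..n}" for i
  proof -
    have "expectation (\<lambda>\<omega>. (Y i \<omega>)\<^sup>2) \<le> expectation (\<lambda>\<omega>. N ^ 4 * ((Z i \<omega>)\<^sup>2 - s)\<^sup>2)"
      using Yi[OF that] Zi[OF that] Y2[OF that] by (intro integral_mono) auto
    then show ?thesis using Zv[OF that] by simp
  qed
  \<comment> \<open>At index distance K everything except \<open>Z j\<close> is known at the start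
    of the window of \<open>j\<close>, and \<open>(Z j)\<^sup>2 - s\<close> is centred and
    independent of it.\<close>
  have orth: "expectation (\<lambda>\<omega>. Y i \<omega> * Y j \<omega>) = 0" if ij: "i \<in> {1..n}" "j \<in> {1..n}" "i + K \<le> j" for i j
  proof -
    let ?F = "full_filtration M W (t j - real K * \<delta>)"
    have le: "t i \<le> t j - real K * \<delta>" "t i - real K * \<delta> \<le> t j - real K * \<delta>"
      using t[OF ij(3)] \<delta> mult_nonneg_nonneg[of "real K" \<delta>] by linarith+
    have [measurable]: "X i \<in> borel_measurable ?F" by (rule full_filtration_measurable_mono[OF X[OF ij(1)] le(2)])
    have [measurable]: "Z i \<in> borel_measurable ?F" by (rule full_filtration_measurable_mono[OF gspan_full_filtration[OF Zp[OF ij(1)]] le(1)])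
    have [measurable]: "X j \<in> borel_measurable ?F" by (rule X[OF ij(2)])
    have Vm: "(\<lambda>\<omega>. Y i \<omega> * (X j \<omega>)\<^sup>2) \<in> borel_measurable ?F" unfolding Y_def by measurable
    have Y1: "integrable M (Y i)"
      using integrable_mult_square[OF Ym[OF ij(1)] _ Yi[OF ij(1)], of "\<lambda>_. 1"] by simp
    have Vi: "integrable M (\<lambda>\<omega>. (X j \<omega>)\<^sup>2 * Y i \<omega>)"
    proof (rule integrable_bounded_mult[of _ "N\<^sup>2"])
      show "\<bar>(X j \<omega>)\<^sup>2\<bar> \<le> N\<^sup>2" for \<omega> using power_mono[OF Xb[OF ij(2)], of \<omega> 2] by simp
    qed (use Xm[OF ij(2)] Y1 in auto)
    have "expectation (\<lambda>\<omega>. (Y i \<omega> * (X j \<omega>)\<^sup>2) * ((Z j \<omega>)\<^sup>2 - s)) = expectation (\<lambda>\<omega>. Y i \<omega> * (X j \<omega>)\<^sup>2) * expectation (\<lambda>\<omega>. (Z j \<omega>)\<^sup>2 - s)"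
      by (rule expectation_past_future(2)[OF Vm Zf[OF ij(2)], of "\<lambda>z. z\<^sup>2 - s"]) (use Vi Z2[OF ij(2)] in \<open>auto simp: mult.commute\<close>)
    also have "expectation (\<lambda>\<omega>. (Z j \<omega>)\<^sup>2 - s) = 0" using Z2[OF ij(2)] Zs[OF ij(2)] by (simp add: prob_space)
    finally show ?thesis by (simp add: Y_def[of j] mult.assoc)
  qed
  have "0 \<le> N ^ 4 * (2 * s\<^sup>2)" by simp
  from finite_range_orthogonal_sum[of n Y, OF Ym Yi Yb orth this]
  show "integrable M (\<lambda>\<omega>. (\<Sum>i=1..n. (X i \<omega>)\<^sup>2 * ((Z i \<omega>)\<^sup>2 - s))\<^sup>2)"
    "expectation (\<lambda>\<omega>. (\<Sum>i=1..n. (X i \<omega>)\<^sup>2 * ((Z i \<omega>)\<^sup>2 - s))\<^sup>2) \<le> real n * (2 * real K * (N ^ 4 * (2 * s\<^sup>2)))"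
    by (simp_all add: Y_def)
qed

end

section \<open>Convergence of the quadratic variation\<close>

text \<open>Only \<eta> \<le> 1 has to be considered, which lets terms of order \<eta>^2 be absorbed
  into the linear bound.\<close>

lemma ennreal_tendsto_zero_linear:
  fixes f :: "nat \<Rightarrow> ennreal" and C :: real
  assumes C: "0 < C" and f: "\<And>\<eta>. 0 < \<eta> \<Longrightarrow> \<eta> \<le> 1 \<Longrightarrow> \<forall>\<^sub>F n in sequentially. f n \<le> ennreal (\<eta> * C)"
  shows "f \<longlonglongrightarrow> 0"
proof (rule order_tendstoI)
  fix a :: ennreal assume "0 < a"
  then obtain e where e: "0 < e" "ennreal e < a"
    by (metis dense ennreal_cases ennreal_less_zero_iff less_top_ennreal not_less_iff_gr_or_eq top.not_eq_extremum ennreal_neg less_le_not_le linorder_not_less)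
  define \<eta> where "\<eta> = min 1 (e / C)"
  have \<eta>: "0 < \<eta>" "\<eta> \<le> 1" "\<eta> * C \<le> e"
  proof -
    show "0 < \<eta>" "\<eta> \<le> 1" using e C by (auto simp: \<eta>_def)
    have "\<eta> \<le> e / C" by (simp add: \<eta>_def)
    then show "\<eta> * C \<le> e" using C by (simp add: pos_le_divide_eq)
  qed
  show "\<forall>\<^sub>F n in sequentially. f n < a"
    using f[OF \<eta>(1,2)]
  proof eventually_elim
    case (elim n)
    also have "ennreal (\<eta> * C) \<le> ennreal e" by (rule ennreal_leI[OF \<eta>(3)])
    also note e(2)
    finally show ?case .
  qed
qed auto

context heat_spde begin

lemma path_source_measurable[measurable]: "(\<lambda>z. source (fst z, (snd z, x))) \<in> borel_measurable (M \<Otimes>\<^sub>M lborel)"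
proof -
  have "(\<lambda>z. (fst z, (snd z, x))) \<in> measurable (M \<Otimes>\<^sub>M (lborel :: real measure)) (M \<Otimes>\<^sub>M (borel \<Otimes>\<^sub>M borel))"
    by measurable
  then have "(\<lambda>z. (fst z, (snd z, x))) \<in> measurable (M \<Otimes>\<^sub>M (lborel :: real measure)) (M \<Otimes>\<^sub>M lborel)"
    by (simp add: borel_prod cong: measurable_cong_sets sets_pair_measure_cong)
  from measurable_compose[OF this source_measurable] show ?thesis .
qed

lemma occupation_integral_measurable:
  assumes "0 < T1"
  shows "(\<lambda>\<omega>. LBINT r:{T1..T2}. (\<sigma> (u r x \<omega>))\<^sup>2) \<in> borel_measurable M"
proof -
  have "(\<lambda>\<omega>. LBINT r. indicator {T1..T2} r * (source (\<omega>, (r, x)))\<^sup>2) \<in> borel_measurable M"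
  proof (rule lborel.borel_measurable_lebesgue_integral)
    have "(\<lambda>z. indicator {T1..T2} (snd z) * (source (fst z, (snd z, x)))\<^sup>2) \<in> borel_measurable (M \<Otimes>\<^sub>M lborel)"
      by measurable
    then show "(\<lambda>(\<omega>, r). indicator {T1..T2} r * (source (\<omega>, (r, x)))\<^sup>2) \<in> borel_measurable (M \<Otimes>\<^sub>M lborel)"
      by (simp add: case_prod_beta)
  qed
  also have "(\<lambda>\<omega>. LBINT r. indicator {T1..T2} r * (source (\<omega>, (r, x)))\<^sup>2) = (\<lambda>\<omega>. LBINT r:{T1..T2}. (\<sigma> (u r x \<omega>))\<^sup>2)"
    unfolding set_lebesgue_integral_def using assms
    by (intro ext Bochner_Integration.integral_cong refl) (auto simp: indicator_def source_def max_def)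
  finally show ?thesis .
qed

lemma grid_time_bounds:
  assumes T: "T1 < T2" and n: "0 < n" and i: "i \<le> n"
  shows "T1 \<le> grid_time T1 T2 n i" "grid_time T1 T2 n i \<le> T2"
    and "1 \<le> i \<Longrightarrow> grid_time T1 T2 n (i - 1) = grid_time T1 T2 n i - (T2 - T1) / real n"
proof -
  have d: "0 < (T2 - T1) / real n" using T n by simp
  have "real i * ((T2 - T1) / real n) \<le> real n * ((T2 - T1) / real n)" using i d by (intro mult_right_mono) auto
  also have "\<dots> = T2 - T1" using n by simp
  finally show "grid_time T1 T2 n i \<le> T2" by (simp add: grid_time_def)
  have "0 \<le> real i * ((T2 - T1) / real n)" using d by (intro mult_nonneg_nonneg) auto
  then show "T1 \<le> grid_time T1 T2 n i" unfolding grid_time_def by linarith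
  show "1 \<le> i \<Longrightarrow> grid_time T1 T2 n (i - 1) = grid_time T1 T2 n i - (T2 - T1) / real n"
    by (simp add: grid_time_def of_nat_diff left_diff_distrib diff_divide_distrib)
qed

lemma quadratic_variation_measurable:
  assumes T: "0 < T1" "T1 < T2"
  shows "quadratic_variation_sum u x T1 T2 n \<in> borel_measurable M"
proof -
  have "u (grid_time T1 T2 n i) x \<in> borel_measurable M" for i
  proof (rule u_measurable)
    have "0 \<le> real i * ((T2 - T1) / real n)" using T by (intro mult_nonneg_nonneg divide_nonneg_nonneg) auto
    then show "0 < grid_time T1 T2 n i" using T unfolding grid_time_def by linarith
  qed
  note [measurable] = this
  show ?thesis unfolding quadratic_variation_sum_def[abs_def] by measurable
qed

lemma source_square_integrable_time:
  assumes T: "0 < T1" "T1 < T2"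
  shows "(\<integral>\<^sup>+r\<in>{T1<..T2}. (\<integral>\<^sup>+\<omega>. ennreal ((source (fst (\<omega>, r), (snd (\<omega>, r), x)))\<^sup>2) \<partial>M) \<partial>lborel) < \<infinity>"
proof -
  have T2: "0 < T2" using T by simp
  obtain C where C: "0 < C" "\<And>t x. 0 < t \<Longrightarrow> t \<le> T2 \<Longrightarrow> (\<integral>\<^sup>+\<omega>. ennreal ((\<sigma> (u t x \<omega>))\<^sup>2) \<partial>M) \<le> ennreal C"
    by (rule source_second_moment[OF T2]) blast
  have "(\<integral>\<^sup>+r\<in>{T1<..T2}. (\<integral>\<^sup>+\<omega>. ennreal ((source (fst (\<omega>, r), (snd (\<omega>, r), x)))\<^sup>2) \<partial>M) \<partial>lborel) \<le> (\<integral>\<^sup>+r. ennreal C * indicator {T1<..T2} r \<partial>lborel)"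
  proof (rule nn_integral_mono)
    fix r
    show "(\<integral>\<^sup>+\<omega>. ennreal ((source (fst (\<omega>, r), (snd (\<omega>, r), x)))\<^sup>2) \<partial>M) * indicator {T1<..T2} r \<le> ennreal C * indicator {T1<..T2} r"
    proof (cases "r \<in> {T1<..T2}")
      case True
      then show ?thesis using C(2)[of r x] T by (simp add: source_def max_def)
    qed simp
  qed
  also have "\<dots> < \<infinity>" using T by (simp add: nn_integral_cmult ennreal_mult_less_top)
  finally show ?thesis .
qed

theorem quadratic_variation_L1:
  assumes T: "0 < T1" "T1 < T2"
  shows "(\<lambda>n. \<integral>\<^sup>+\<omega>. ennreal \<bar>1 / real n powr (1 / \<alpha>) * quadratic_variation_sum u x T1 T2 n \<omega> -
      (T2 - T1) powr (- 1 / \<alpha>) * (variance_const * (LBINT r:{T1..T2}. (\<sigma> (u r x \<omega>))\<^sup>2))\<bar> \<partial>M) \<longlonglongrightarrow> 0"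
    (is "?E \<longlonglongrightarrow> 0")
proof -
  define \<beta> where "\<beta> = 1 / \<alpha>"
  have \<beta>: "0 < \<beta>" "\<beta> < 1" using alpha by (auto simp: \<beta>_def)
  define \<Delta> where "\<Delta> = T2 - T1"
  have \<Delta>: "0 < \<Delta>" using T by (simp add: \<Delta>_def)
  define c where "c = variance_const"
  have c: "0 < c" using variance_const_pos by (simp add: c_def)
  have T2: "0 < T2" using T by simp
  obtain C where C: "0 < C" "\<And>t x. 0 < t \<Longrightarrow> t \<le> T2 \<Longrightarrow> (\<integral>\<^sup>+\<omega>. ennreal ((\<sigma> (u t x \<omega>))\<^sup>2) \<partial>M) \<le> ennreal C"
    by (rule source_second_moment[OF T2]) blast
  \<comment> \<open>Bound for the second moment of an increment in units of \<delta>^(1 - \<beta>):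
    4 from \<open>noise_integral_bound\<close>, C from the coefficient, c from the kernel.\<close>
  define C' where "C' = 4 * (C * c)"
  have C': "0 < C'" using C c by (simp add: C'_def)
  define b where "b = C + (c + 1) * (C + 2)"
  have b: "0 \<le> b" using C c by (simp add: b_def)
  \<comment> \<open>The three contributions in order: from \<open>Q\<close> to \<open>A\<close>,
    from \<open>A\<close> to \<open>B\<close>, from \<open>B\<close> to \<open>R\<close>.\<close>
  define C0 where "C0 = \<Delta> powr (1 - \<beta>) * (C' + 2) + 2 + \<Delta> powr (1 - \<beta>) * b"
  have C0: "0 < C0" using C' b by (simp add: C0_def add_nonneg_pos add_pos_nonneg)
  define R where "R \<omega> = \<Delta> powr (- \<beta>) * (c * (LBINT r:{T1..T2}. (\<sigma> (u r x \<omega>))\<^sup>2))" for \<omega>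
  have Rm: "R \<in> borel_measurable M"
    unfolding R_def[abs_def] by (intro borel_measurable_times occupation_integral_measurable T borel_measurable_const)
  have key: "\<forall>\<^sub>F n in sequentially. ?E n \<le> ennreal (\<eta> * C0)" if \<eta>: "0 < \<eta>" "\<eta> \<le> 1" for \<eta>
  proof -
    obtain K N v \<delta>0 X Z where \<delta>0: "0 < \<delta>0" and v: "0 \<le> v" "\<bar>v - variance_const\<bar> \<le> \<eta>" and N: "0 < N"
    and XZ: "\<And>\<delta> t. 0 < \<delta> \<Longrightarrow> \<delta> < \<delta>0 \<Longrightarrow> T1 \<le> t \<Longrightarrow> t \<le> T2 \<Longrightarrow>
       X \<delta> t \<in> borel_measurable (full_filtration M W (t - real K * \<delta>)) \<and> (\<forall>\<omega>. \<bar>X \<delta> t \<omega>\<bar> \<le> N) \<and>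
       Z \<delta> t \<in> gspan W (future (t - real K * \<delta>)) \<and> Z \<delta> t \<in> gspan W (past t) \<and>
       expectation (\<lambda>\<omega>. (Z \<delta> t \<omega>)\<^sup>2) = \<delta> powr (1 - 1 / \<alpha>) * v \<and>
       (\<integral>\<^sup>+\<omega>. ennreal ((u t x \<omega> - u (t - \<delta>) x \<omega> - X \<delta> t \<omega> * Z \<delta> t \<omega>)\<^sup>2) \<partial>M) \<le> ennreal (\<delta> powr (1 - 1 / \<alpha>) * \<eta>\<^sup>2) \<and>
       (\<forall>r\<in>{t - \<delta>..t}. (\<integral>\<^sup>+\<omega>. ennreal ((\<sigma> (u r x \<omega>) - X \<delta> t \<omega>)\<^sup>2) \<partial>M) \<le> ennreal (\<eta>\<^sup>2))"
      by (rule increment_approximation[OF T \<eta>(1), of x]) blast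
    have vc: "\<bar>v - c\<bar> \<le> \<eta>" "v \<le> c + 1" using v \<eta> by (auto simp: c_def)
    \<comment> \<open>\<open>Q2 / n\<close> bounds the second moment of the difference of
      \<open>A\<close> and \<open>B\<close>; K, N and v are fixed together with \<eta> before n
      grows.\<close>
    define Q2 where "Q2 = 4 * real K * N ^ 4 * v\<^sup>2 * (\<Delta> powr (1 - \<beta>))\<^sup>2"
    have "(\<lambda>n. Q2 / real n) \<longlonglongrightarrow> 0" by (rule lim_const_over_n)
    then have "\<forall>\<^sub>F n in sequentially. Q2 / real n < \<eta>\<^sup>2" using \<eta> by (intro order_tendstoD) auto
    moreover have "(\<lambda>n. \<Delta> / real n) \<longlonglongrightarrow> 0" by (rule lim_const_over_n)
    then have "\<forall>\<^sub>F n in sequentially. \<Delta> / real n < \<delta>0" using \<delta>0 by (intro order_tendstoD) auto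
    ultimately show ?thesis using eventually_gt_at_top[of "0 :: nat"]
    proof eventually_elim
      case (elim n)
      define \<delta> where "\<delta> = \<Delta> / real n"
      have \<delta>: "0 < \<delta>" "\<delta> < \<delta>0" using elim \<Delta> by (auto simp: \<delta>_def)
      have n: "0 < n" "0 < real n" using elim by auto
      define t where "t i = grid_time T1 T2 n i" for i
      have t: "T1 \<le> t i" "t i \<le> T2" "grid_time T1 T2 n (i - 1) = t i - \<delta>" if "i \<in> {1..n}" for i
        using grid_time_bounds[OF T(2) n(1), of i] that by (auto simp: t_def \<delta>_def \<Delta>_def)
      have td: "0 < t i - \<delta>" "0 < t i" if "i \<in> {1..n}" for i
      proof -
        have "T1 \<le> grid_time T1 T2 n (i - 1)" using that by (intro grid_time_bounds[OF T(2) n(1)]) auto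
        then show "0 < t i - \<delta>" using t(3)[OF that] T by simp
        then show "0 < t i" using \<delta> by simp
      qed
      define x' where "x' i = X \<delta> (t i)" for i
      define z where "z i = Z \<delta> (t i)" for i
      define s where "s = \<delta> powr (1 - \<beta>) * v"
      define d where "d i \<omega> = u (t i) x \<omega> - u (t i - \<delta>) x \<omega>" for i \<omega>
      note XZi = XZ[OF \<delta> t(1,2)]
      have X1: "x' i \<in> borel_measurable (full_filtration M W (t i - real K * \<delta>))"
        and X2: "\<And>\<omega>. \<bar>x' i \<omega>\<bar> \<le> N"
        and Z1: "z i \<in> gspan W (future (t i - real K * \<delta>))" "z i \<in> gspan W (past (t i))"
        and Z2: "expectation (\<lambda>\<omega>. (z i \<omega>)\<^sup>2) = s"
        and D1: "(\<integral>\<^sup>+\<omega>. ennreal ((d i \<omega> - x' i \<omega> * z i \<omega>)\<^sup>2) \<partial>M) \<le> ennreal (\<delta> powr (1 - \<beta>) * \<eta>\<^sup>2)"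
        and F1: "\<And>r. r \<in> {t i - \<delta>..t i} \<Longrightarrow> (\<integral>\<^sup>+\<omega>. ennreal ((\<sigma> (u r x \<omega>) - x' i \<omega>)\<^sup>2) \<partial>M) \<le> ennreal (\<eta>\<^sup>2)"
        if "i \<in> {1..n}" for i
        using XZi[OF that that] by (auto simp: x'_def z_def s_def d_def \<beta>_def)
      have xm[measurable]: "x' i \<in> borel_measurable M" if "i \<in> {1..n}" for i by (rule full_filtration_measurable_sub[OF X1[OF that]])
      have zm[measurable]: "z i \<in> borel_measurable M" if "i \<in> {1..n}" for i
        by (rule full_filtration_measurable_sub[OF gspan_full_filtration[OF Z1(2)[OF that]]])
      have dm[measurable]: "d i \<in> borel_measurable M" if "i \<in> {1..n}" for i
        unfolding d_def[abs_def] using u_measurable[OF td(1)[OF that], of x] u_measurable[OF td(2)[OF that], of x] by measurable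
      define kn where "kn = 1 / real n powr \<beta>"
      have kn: "0 < kn" using n by (simp add: kn_def)
      \<comment> \<open>There are n squared increments of size \<delta>^(1 - \<beta>), so the factor
        n^(-\<beta>) is the one that leaves a quantity independent of n.\<close>
      have knd: "kn * real n * \<delta> powr (1 - \<beta>) = \<Delta> powr (1 - \<beta>)"
        using n \<Delta> by (simp add: kn_def \<delta>_def powr_divide powr_diff field_simps)
      have knb: "kn * \<delta> powr (1 - \<beta>) = \<Delta> powr (- \<beta>) * \<delta>"
        using n \<Delta> by (simp add: kn_def \<delta>_def powr_divide powr_diff powr_minus field_simps)
      \<comment> \<open>From the normalised sum \<open>Q\<close> of squared increments to the limit
        \<open>R\<close> in three L1 steps: \<open>A\<close> has X Z in place of the increments,
        \<open>B\<close> has the variance in place of the square of Z.\<close>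
      define A where "A \<omega> = kn * (\<Sum>i=1..n. (x' i \<omega> * z i \<omega>)\<^sup>2)" for \<omega>
      define B where "B \<omega> = \<Delta> powr (- \<beta>) * (v * \<delta> * (\<Sum>i=1..n. (x' i \<omega>)\<^sup>2))" for \<omega>
      define Q where "Q \<omega> = kn * (\<Sum>i=1..n. (d i \<omega>)\<^sup>2)" for \<omega>
      have ABQ[measurable]: "A \<in> borel_measurable M" "B \<in> borel_measurable M" "Q \<in> borel_measurable M"
        unfolding A_def[abs_def] B_def[abs_def] Q_def[abs_def] by measurable
      have Qe: "1 / real n powr (1 / \<alpha>) * quadratic_variation_sum u x T1 T2 n \<omega> = Q \<omega>" for \<omega>
      proof -
        have "(\<Sum>i=1..n. (u (grid_time T1 T2 n i) x \<omega> - u (grid_time T1 T2 n (i - 1)) x \<omega>)\<^sup>2) = (\<Sum>i=1..n. (d i \<omega>)\<^sup>2)"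
          by (intro sum.cong refl) (simp add: d_def t(3)[symmetric], simp add: t_def)
        then show ?thesis by (simp add: quadratic_variation_sum_def Q_def kn_def \<beta>_def)
      qed
      have QA: "(\<integral>\<^sup>+\<omega>. ennreal \<bar>Q \<omega> - A \<omega>\<bar> \<partial>M) \<le> ennreal (\<Delta> powr (1 - \<beta>) * (\<eta> * (C' + 2)))"
      proof -
        have one: "(\<integral>\<^sup>+\<omega>. ennreal \<bar>(d i \<omega>)\<^sup>2 - (x' i \<omega> * z i \<omega>)\<^sup>2\<bar> \<partial>M) \<le> ennreal (\<delta> powr (1 - \<beta>) * (\<eta> * (C' + 2)))"
          if i: "i \<in> {1..n}" for i
        proof -
          note [measurable] = xm[OF i] zm[OF i] dm[OF i]
          have "(\<integral>\<^sup>+\<omega>. ennreal ((d i \<omega>)\<^sup>2) \<partial>M) \<le> 4 * (ennreal C * (\<integral>\<^sup>+p. ennreal ((mild_kernel (t i) x p - mild_kernel (t i - \<delta>) x p)\<^sup>2) \<partial>lborel))"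
            unfolding d_def using t(2)[OF i] td[OF i] \<delta> by (intro u_diff_bound[OF T2 C(2)]) auto
          also have "\<dots> \<le> 4 * (ennreal C * ennreal (\<delta> powr (1 - \<beta>) * c))"
            using mild_kernel_time_bound[OF \<delta>(1), of "t i" x] td[OF i]
            by (intro mult_left_mono) (auto simp: \<beta>_def c_def variance_const_def)
          also have "\<dots> = ennreal (\<delta> powr (1 - \<beta>) * C')"
            using C c by (simp add: C'_def ennreal_numeral_mult ennreal_mult[symmetric] mult_ac)
          finally have "(\<integral>\<^sup>+\<omega>. ennreal ((d i \<omega>)\<^sup>2) \<partial>M) \<le> ennreal (\<delta> powr (1 - \<beta>) * C')" .
          from square_bound_expectation[OF _ this] C'
          have d2: "integrable M (\<lambda>\<omega>. (d i \<omega>)\<^sup>2)" "expectation (\<lambda>\<omega>. (d i \<omega>)\<^sup>2) \<le> \<delta> powr (1 - \<beta>) * C'" by auto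
          from square_bound_expectation[OF _ D1[OF i]]
          have e2: "integrable M (\<lambda>\<omega>. (d i \<omega> - x' i \<omega> * z i \<omega>)\<^sup>2)" "expectation (\<lambda>\<omega>. (d i \<omega> - x' i \<omega> * z i \<omega>)\<^sup>2) \<le> \<delta> powr (1 - \<beta>) * \<eta>\<^sup>2" by auto
          have xz[measurable]: "(\<lambda>\<omega>. x' i \<omega> * z i \<omega>) \<in> borel_measurable M" by measurable
          note L = L1_square_diff_bound[OF dm[OF i] xz d2(1) e2(1) \<eta>(1)]
          \<comment> \<open>Young's inequality with weight \<eta>; the squared L2 error is of order
            \<eta>^2, so the factor 1 + 1 / \<eta> leaves \<eta>^2 + \<eta>.\<close>
          have "expectation (\<lambda>\<omega>. \<bar>(d i \<omega>)\<^sup>2 - (x' i \<omega> * z i \<omega>)\<^sup>2\<bar>) \<le> \<eta> * (\<delta> powr (1 - \<beta>) * C') + (1 + 1 / \<eta>) * (\<delta> powr (1 - \<beta>) * \<eta>\<^sup>2)"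
            using \<eta> by (intro order_trans[OF L(2)] add_mono mult_left_mono d2 e2) (auto simp: add_nonneg_nonneg)
          also have "\<dots> = \<delta> powr (1 - \<beta>) * (\<eta> * (C' + 1 + \<eta>))" using \<eta> by (simp add: field_simps power2_eq_square)
          also have "\<dots> \<le> \<delta> powr (1 - \<beta>) * (\<eta> * (C' + 2))" using \<eta> by (intro mult_left_mono) auto
          finally have "expectation (\<lambda>\<omega>. \<bar>(d i \<omega>)\<^sup>2 - (x' i \<omega> * z i \<omega>)\<^sup>2\<bar>) \<le> \<delta> powr (1 - \<beta>) * (\<eta> * (C' + 2))" .
          moreover have "(\<integral>\<^sup>+\<omega>. ennreal \<bar>(d i \<omega>)\<^sup>2 - (x' i \<omega> * z i \<omega>)\<^sup>2\<bar> \<partial>M) = ennreal (expectation (\<lambda>\<omega>. \<bar>(d i \<omega>)\<^sup>2 - (x' i \<omega> * z i \<omega>)\<^sup>2\<bar>))"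
            using d2(1) L(1) by (intro nn_integral_eq_integral) auto
          ultimately show ?thesis by (simp add: ennreal_leI)
        qed
        have "(\<integral>\<^sup>+\<omega>. ennreal \<bar>Q \<omega> - A \<omega>\<bar> \<partial>M) \<le> (\<integral>\<^sup>+\<omega>. ennreal kn * (\<Sum>i=1..n. ennreal \<bar>(d i \<omega>)\<^sup>2 - (x' i \<omega> * z i \<omega>)\<^sup>2\<bar>) \<partial>M)"
        proof (rule nn_integral_mono)
          fix \<omega>
          have "\<bar>Q \<omega> - A \<omega>\<bar> = kn * \<bar>\<Sum>i=1..n. (d i \<omega>)\<^sup>2 - (x' i \<omega> * z i \<omega>)\<^sup>2\<bar>"
            using kn by (simp add: Q_def A_def sum_subtractf abs_mult flip: right_diff_distrib)
          also have "\<dots> \<le> kn * (\<Sum>i=1..n. \<bar>(d i \<omega>)\<^sup>2 - (x' i \<omega> * z i \<omega>)\<^sup>2\<bar>)"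
            using kn by (intro mult_left_mono sum_abs) auto
          finally show "ennreal \<bar>Q \<omega> - A \<omega>\<bar> \<le> ennreal kn * (\<Sum>i=1..n. ennreal \<bar>(d i \<omega>)\<^sup>2 - (x' i \<omega> * z i \<omega>)\<^sup>2\<bar>)"
            using kn by (simp add: ennreal_mult'[symmetric] sum_ennreal ennreal_leI)
        qed
        also have "\<dots> = ennreal kn * (\<Sum>i=1..n. (\<integral>\<^sup>+\<omega>. ennreal \<bar>(d i \<omega>)\<^sup>2 - (x' i \<omega> * z i \<omega>)\<^sup>2\<bar> \<partial>M))"
          by (subst nn_integral_cmult, measurable) (subst nn_integral_sum, measurable)
        also have "\<dots> \<le> ennreal kn * (\<Sum>i=1..n. ennreal (\<delta> powr (1 - \<beta>) * (\<eta> * (C' + 2))))"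
          by (intro mult_left_mono sum_mono one) auto
        also have "\<dots> = ennreal (kn * (\<Sum>i=1..n. \<delta> powr (1 - \<beta>) * (\<eta> * (C' + 2))))"
        proof -
          have "0 \<le> \<delta> powr (1 - \<beta>) * (\<eta> * (C' + 2))" using \<eta> C' by simp
          then show ?thesis by (simp only: sum_ennreal ennreal_mult'[OF less_imp_le[OF kn]])
        qed
        also have "kn * (\<Sum>i=1..n. \<delta> powr (1 - \<beta>) * (\<eta> * (C' + 2))) = (kn * real n * \<delta> powr (1 - \<beta>)) * (\<eta> * (C' + 2))"
          by simp
        finally show ?thesis unfolding knd .
      qed
      have AB: "(\<integral>\<^sup>+\<omega>. ennreal \<bar>A \<omega> - B \<omega>\<bar> \<partial>M) \<le> ennreal (2 * \<eta>)"
      proof -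
        define S where "S \<omega> = (\<Sum>i=1..n. (x' i \<omega>)\<^sup>2 * ((z i \<omega>)\<^sup>2 - s))" for \<omega>
        have [measurable]: "S \<in> borel_measurable M" unfolding S_def[abs_def] by measurable
        have ord: "t i \<le> t j - real K * \<delta>" if "i + K \<le> j" for i j
        proof -
          have "real i + real K \<le> real j" using that by linarith
          then have "(real i + real K) * \<delta> \<le> real j * \<delta>" using \<delta> by (intro mult_right_mono) auto
          then show ?thesis by (simp add: t_def grid_time_def \<delta>_def \<Delta>_def distrib_right add_divide_distrib)
        qed
        note L = gaussian_squares_law_of_large_numbers[where X=x' and Z=z and t=t and n=n and K=K and \<delta>=\<delta> and N=N and s=s,
          OF X1 X2 Z1 Z2 ord less_imp_le[OF \<delta>(1)], folded S_def]
        have AS: "A \<omega> - B \<omega> = kn * S \<omega>" for \<omega>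
        proof -
          have "B \<omega> = kn * (\<Sum>i=1..n. (x' i \<omega>)\<^sup>2 * s)"
            unfolding B_def s_def sum_distrib_right[symmetric] using knb by (simp add: mult_ac)
          then show ?thesis
            by (simp add: A_def S_def power_mult_distrib right_diff_distrib sum_subtractf)
        qed
        have "integrable M (\<lambda>\<omega>. (kn * S \<omega>)\<^sup>2)" using L(1) by (simp add: power_mult_distrib)
        from L1_le_L2[OF _ this \<eta>(1)]
        have "(\<integral>\<^sup>+\<omega>. ennreal \<bar>A \<omega> - B \<omega>\<bar> \<partial>M) \<le> ennreal (\<eta> + expectation (\<lambda>\<omega>. (kn * S \<omega>)\<^sup>2) / \<eta>)"
          by (simp add: AS)
        also have "\<dots> \<le> ennreal (2 * \<eta>)"
        proof (rule ennreal_leI)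
          have "expectation (\<lambda>\<omega>. (kn * S \<omega>)\<^sup>2) \<le> kn\<^sup>2 * (real n * (2 * real K * (N ^ 4 * (2 * s\<^sup>2))))"
            using L(2) by (simp add: power_mult_distrib mult_left_mono)
          also have "\<dots> = 4 * real K * N ^ 4 * v\<^sup>2 * (kn * real n * \<delta> powr (1 - \<beta>))\<^sup>2 / real n"
            using n by (simp add: s_def power_mult_distrib power2_eq_square)
          also have "\<dots> = Q2 / real n" unfolding knd by (simp add: Q2_def)
          also have "\<dots> \<le> \<eta> * \<eta>" using elim(1) by (simp add: power2_eq_square)
          finally have "expectation (\<lambda>\<omega>. (kn * S \<omega>)\<^sup>2) / \<eta> \<le> \<eta>" using \<eta> by (simp add: pos_divide_le_eq)
          then show "\<eta> + expectation (\<lambda>\<omega>. (kn * S \<omega>)\<^sup>2) / \<eta> \<le> 2 * \<eta>" by simp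
        qed
        finally show ?thesis .
      qed
      have BR: "(\<integral>\<^sup>+\<omega>. ennreal \<bar>B \<omega> - R \<omega>\<bar> \<partial>M) \<le> ennreal (\<Delta> powr (1 - \<beta>) * (\<eta> * b))"
      proof -
        let ?f = "\<lambda>z. source (fst z, (snd z, x))"
        have fe: "?f (\<omega>, r) = \<sigma> (u r x \<omega>)" if "0 < r" for r \<omega> using that by (simp add: source_def max_def)
        have cell: "(\<integral>\<^sup>+\<omega>. ennreal \<bar>v * (x' i \<omega>)\<^sup>2 - c * (?f (\<omega>, r))\<^sup>2\<bar> \<partial>M) \<le> ennreal (\<eta> * b)"
          if i: "i \<in> {1..n}" and r: "r \<in> {grid_time T1 T2 n i - (T2 - T1) / real n<..grid_time T1 T2 n i}" for i r
        proof -
          have r': "r \<in> {t i - \<delta>..t i}" using r by (auto simp: t_def \<delta>_def \<Delta>_def)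
          have r0: "0 < r" "r \<le> T2" using r' td[OF i] t(2)[OF i] by auto
          note [measurable] = xm[OF i] u_measurable[OF r0(1)]
          have fm: "(\<lambda>\<omega>. \<sigma> (u r x \<omega>)) \<in> borel_measurable M" by measurable
          from square_bound_expectation[OF fm C(2)[OF r0]] C
          have f2: "integrable M (\<lambda>\<omega>. (\<sigma> (u r x \<omega>))\<^sup>2)" "expectation (\<lambda>\<omega>. (\<sigma> (u r x \<omega>))\<^sup>2) \<le> C" by auto
          from square_bound_expectation[OF _ F1[OF i r']]
          have e2: "integrable M (\<lambda>\<omega>. (\<sigma> (u r x \<omega>) - x' i \<omega>)\<^sup>2)" "expectation (\<lambda>\<omega>. (\<sigma> (u r x \<omega>) - x' i \<omega>)\<^sup>2) \<le> \<eta>\<^sup>2" by auto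
          note L = L1_square_diff_bound[OF fm xm[OF i] f2(1) e2(1) \<eta>(1)]
          have "expectation (\<lambda>\<omega>. \<bar>(\<sigma> (u r x \<omega>))\<^sup>2 - (x' i \<omega>)\<^sup>2\<bar>) \<le> \<eta> * C + (1 + 1 / \<eta>) * \<eta>\<^sup>2"
            using \<eta> by (intro order_trans[OF L(2)] add_mono mult_left_mono f2 e2) (auto simp: add_nonneg_nonneg)
          also have "\<dots> = \<eta> * (C + 1 + \<eta>)" using \<eta> by (simp add: field_simps power2_eq_square)
          also have "\<dots> \<le> \<eta> * (C + 2)" using \<eta> by (intro mult_left_mono) auto
          finally have g: "expectation (\<lambda>\<omega>. \<bar>(\<sigma> (u r x \<omega>))\<^sup>2 - (x' i \<omega>)\<^sup>2\<bar>) \<le> \<eta> * (C + 2)" .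
          have i1: "integrable M (\<lambda>\<omega>. \<bar>v * (x' i \<omega>)\<^sup>2 - c * (\<sigma> (u r x \<omega>))\<^sup>2\<bar>)" using L(1) f2(1) by simp
          have i2: "integrable M (\<lambda>\<omega>. \<bar>v - c\<bar> * (\<sigma> (u r x \<omega>))\<^sup>2 + v * \<bar>(\<sigma> (u r x \<omega>))\<^sup>2 - (x' i \<omega>)\<^sup>2\<bar>)" using L(1) f2(1) by simp
          have "(\<integral>\<^sup>+\<omega>. ennreal \<bar>v * (x' i \<omega>)\<^sup>2 - c * (?f (\<omega>, r))\<^sup>2\<bar> \<partial>M) = ennreal (expectation (\<lambda>\<omega>. \<bar>v * (x' i \<omega>)\<^sup>2 - c * (\<sigma> (u r x \<omega>))\<^sup>2\<bar>))"
            unfolding fe[OF r0(1)] using i1 by (intro nn_integral_eq_integral) auto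
          also have "expectation (\<lambda>\<omega>. \<bar>v * (x' i \<omega>)\<^sup>2 - c * (\<sigma> (u r x \<omega>))\<^sup>2\<bar>) \<le>
             expectation (\<lambda>\<omega>. \<bar>v - c\<bar> * (\<sigma> (u r x \<omega>))\<^sup>2 + v * \<bar>(\<sigma> (u r x \<omega>))\<^sup>2 - (x' i \<omega>)\<^sup>2\<bar>)"
          proof (rule integral_mono[OF i1 i2])
            fix \<omega>
            \<comment> \<open>Split into the variance error v - c on the true coefficient and v
              times the freezing error.\<close>
            have "v * (x' i \<omega>)\<^sup>2 - c * (\<sigma> (u r x \<omega>))\<^sup>2 = (v - c) * (\<sigma> (u r x \<omega>))\<^sup>2 - v * ((\<sigma> (u r x \<omega>))\<^sup>2 - (x' i \<omega>)\<^sup>2)"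
              by (simp add: algebra_simps)
            then show "\<bar>v * (x' i \<omega>)\<^sup>2 - c * (\<sigma> (u r x \<omega>))\<^sup>2\<bar> \<le> \<bar>v - c\<bar> * (\<sigma> (u r x \<omega>))\<^sup>2 + v * \<bar>(\<sigma> (u r x \<omega>))\<^sup>2 - (x' i \<omega>)\<^sup>2\<bar>"
              using abs_triangle_ineq4[of "(v - c) * (\<sigma> (u r x \<omega>))\<^sup>2" "v * ((\<sigma> (u r x \<omega>))\<^sup>2 - (x' i \<omega>)\<^sup>2)"] v(1) by (simp add: abs_mult)
          qed
          also have "\<dots> = \<bar>v - c\<bar> * expectation (\<lambda>\<omega>. (\<sigma> (u r x \<omega>))\<^sup>2) + v * expectation (\<lambda>\<omega>. \<bar>(\<sigma> (u r x \<omega>))\<^sup>2 - (x' i \<omega>)\<^sup>2\<bar>)"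
            using L(1) f2(1) by simp
          also have "\<dots> \<le> \<eta> * C + (c + 1) * (\<eta> * (C + 2))"
            using vc v(1) g f2(2) \<eta> C c by (intro add_mono mult_mono) (auto intro!: integral_nonneg)
          also have "\<dots> = \<eta> * b" by (simp add: b_def algebra_simps)
          finally show ?thesis by (simp add: ennreal_leI)
        qed
        have "0 \<le> \<eta> * b" using \<eta> b by simp
        from Riemann_sum_L1[OF path_source_measurable xm T(2) n(1) this source_square_integrable_time[OF T] cell]
        have le: "(\<integral>\<^sup>+\<omega>. ennreal \<bar>v * \<delta> * (\<Sum>i=1..n. (x' i \<omega>)\<^sup>2) - c * (LBINT r:{T1..T2}. (?f (\<omega>, r))\<^sup>2)\<bar> \<partial>M) \<le> ennreal (\<Delta> * (\<eta> * b))"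
          by (simp add: \<delta>_def \<Delta>_def)
        have "(LBINT r:{T1..T2}. (?f (\<omega>, r))\<^sup>2) = (LBINT r:{T1..T2}. (\<sigma> (u r x \<omega>))\<^sup>2)" for \<omega>
          using T by (intro set_lebesgue_integral_cong) (auto simp: source_def max_def)
        then have "\<bar>B \<omega> - R \<omega>\<bar> = \<Delta> powr (- \<beta>) * \<bar>v * \<delta> * (\<Sum>i=1..n. (x' i \<omega>)\<^sup>2) - c * (LBINT r:{T1..T2}. (?f (\<omega>, r))\<^sup>2)\<bar>" for \<omega>
          by (simp add: B_def R_def abs_mult flip: right_diff_distrib)
        then have "(\<integral>\<^sup>+\<omega>. ennreal \<bar>B \<omega> - R \<omega>\<bar> \<partial>M) =
          (\<integral>\<^sup>+\<omega>. ennreal (\<Delta> powr (- \<beta>)) * ennreal \<bar>v * \<delta> * (\<Sum>i=1..n. (x' i \<omega>)\<^sup>2) - c * (LBINT r:{T1..T2}. (?f (\<omega>, r))\<^sup>2)\<bar> \<partial>M)"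
          by (simp add: ennreal_mult)
        also have "\<dots> = ennreal (\<Delta> powr (- \<beta>)) * (\<integral>\<^sup>+\<omega>. ennreal \<bar>v * \<delta> * (\<Sum>i=1..n. (x' i \<omega>)\<^sup>2) - c * (LBINT r:{T1..T2}. (?f (\<omega>, r))\<^sup>2)\<bar> \<partial>M)"
        proof (rule nn_integral_cmult)
          have "(\<lambda>\<omega>. LBINT r:{T1..T2}. (?f (\<omega>, r))\<^sup>2) \<in> borel_measurable M"
            using occupation_integral_measurable[OF T(1), of T2 x] \<open>\<And>\<omega>. (LBINT r:{T1..T2}. (?f (\<omega>, r))\<^sup>2) = _ \<omega>\<close> by simp
          then show "(\<lambda>\<omega>. ennreal \<bar>v * \<delta> * (\<Sum>i=1..n. (x' i \<omega>)\<^sup>2) - c * (LBINT r:{T1..T2}. (?f (\<omega>, r))\<^sup>2)\<bar>) \<in> borel_measurable M"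
            by measurable
        qed
        also have "\<dots> \<le> ennreal (\<Delta> powr (- \<beta>)) * ennreal (\<Delta> * (\<eta> * b))" by (intro mult_left_mono le) auto
        also have "\<dots> = ennreal (\<Delta> powr (- \<beta>) * (\<Delta> * (\<eta> * b)))" by (rule ennreal_mult'[symmetric]) simp
        also have "\<Delta> powr (- \<beta>) * (\<Delta> * (\<eta> * b)) = \<Delta> powr (1 - \<beta>) * (\<eta> * b)"
          using \<Delta> by (simp add: powr_diff powr_minus field_simps)
        finally show ?thesis .
      qed
      have e: "?E n = (\<integral>\<^sup>+\<omega>. ennreal \<bar>Q \<omega> - R \<omega>\<bar> \<partial>M)"
        by (simp add: Qe[symmetric] R_def \<beta>_def c_def \<Delta>_def)
      have s1: "(\<integral>\<^sup>+\<omega>. ennreal \<bar>Q \<omega> - R \<omega>\<bar> \<partial>M) \<le> (\<integral>\<^sup>+\<omega>. ennreal \<bar>Q \<omega> - A \<omega>\<bar> \<partial>M) + (\<integral>\<^sup>+\<omega>. ennreal \<bar>A \<omega> - R \<omega>\<bar> \<partial>M)"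
        by (rule nn_integral_abs_triangle[OF ABQ(3,1) Rm])
      have s2: "(\<integral>\<^sup>+\<omega>. ennreal \<bar>A \<omega> - R \<omega>\<bar> \<partial>M) \<le> (\<integral>\<^sup>+\<omega>. ennreal \<bar>A \<omega> - B \<omega>\<bar> \<partial>M) + (\<integral>\<^sup>+\<omega>. ennreal \<bar>B \<omega> - R \<omega>\<bar> \<partial>M)"
        by (rule nn_integral_abs_triangle[OF ABQ(1,2) Rm])
      have "?E n \<le> ennreal (\<Delta> powr (1 - \<beta>) * (\<eta> * (C' + 2))) + (ennreal (2 * \<eta>) + ennreal (\<Delta> powr (1 - \<beta>) * (\<eta> * b)))"
        unfolding e by (rule order_trans[OF s1 add_mono[OF QA order_trans[OF s2 add_mono[OF AB BR]]]])
      also have "\<dots> = ennreal (\<Delta> powr (1 - \<beta>) * (\<eta> * (C' + 2)) + (2 * \<eta> + \<Delta> powr (1 - \<beta>) * (\<eta> * b)))"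
        using \<eta> C' b by (simp add: ennreal_plus[symmetric] del: ennreal_plus)
      also have "\<Delta> powr (1 - \<beta>) * (\<eta> * (C' + 2)) + (2 * \<eta> + \<Delta> powr (1 - \<beta>) * (\<eta> * b)) = \<eta> * C0"
        by (simp add: C0_def algebra_simps)
      finally show ?case .
    qed
  qed
  show ?thesis by (rule ennreal_tendsto_zero_linear[OF C0 key])
qed

end

section \<open>Convergence in probability\<close>

lemma (in prob_space) L1_imp_tendsto_in_probability:
  assumes [measurable]: "\<And>n. X n \<in> borel_measurable M" "Y \<in> borel_measurable M"
    and lim: "(\<lambda>n. \<integral>\<^sup>+\<omega>. ennreal \<bar>X n \<omega> - Y \<omega>\<bar> \<partial>M) \<longlonglongrightarrow> 0"
  shows "tendsto_in_probability M X Y"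
  unfolding tendsto_in_probability_def
proof (intro conjI allI impI assms(1,2))
  fix \<epsilon> :: real assume \<epsilon>: "0 < \<epsilon>"
  let ?A = "\<lambda>n. {\<omega> \<in> space M. \<bar>X n \<omega> - Y \<omega>\<bar> > \<epsilon>}"
  have le: "emeasure M (?A n) \<le> ennreal (1 / \<epsilon>) * (\<integral>\<^sup>+\<omega>. ennreal \<bar>X n \<omega> - Y \<omega>\<bar> \<partial>M)" for n
  proof -
    have "?A n \<subseteq> {\<omega> \<in> space M. 1 \<le> ennreal (1 / \<epsilon>) * ennreal \<bar>X n \<omega> - Y \<omega>\<bar>}"
    proof (intro subsetI CollectI conjI)
      fix \<omega> assume w: "\<omega> \<in> ?A n"
      then have "1 \<le> 1 / \<epsilon> * \<bar>X n \<omega> - Y \<omega>\<bar>" using \<epsilon> by (simp add: field_simps)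
      then have "ennreal 1 \<le> ennreal (1 / \<epsilon> * \<bar>X n \<omega> - Y \<omega>\<bar>)" by (rule ennreal_leI)
      also have "\<dots> = ennreal (1 / \<epsilon>) * ennreal \<bar>X n \<omega> - Y \<omega>\<bar>" using \<epsilon> by (intro ennreal_mult) auto
      finally show "1 \<le> ennreal (1 / \<epsilon>) * ennreal \<bar>X n \<omega> - Y \<omega>\<bar>" by simp
    qed auto
    then have "emeasure M (?A n) \<le> emeasure M {\<omega> \<in> space M. 1 \<le> ennreal (1 / \<epsilon>) * ennreal \<bar>X n \<omega> - Y \<omega>\<bar>}"
      by (intro emeasure_mono) measurable
    also have "\<dots> \<le> ennreal (1 / \<epsilon>) * (\<integral>\<^sup>+\<omega>. ennreal \<bar>X n \<omega> - Y \<omega>\<bar> * indicator (space M) \<omega> \<partial>M)"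
      by (rule nn_integral_Markov_inequality) measurable
    also have "(\<integral>\<^sup>+\<omega>. ennreal \<bar>X n \<omega> - Y \<omega>\<bar> * indicator (space M) \<omega> \<partial>M) = (\<integral>\<^sup>+\<omega>. ennreal \<bar>X n \<omega> - Y \<omega>\<bar> \<partial>M)"
      by (intro nn_integral_cong) auto
    finally show ?thesis .
  qed
  have "(\<lambda>n. emeasure M (?A n)) \<longlonglongrightarrow> 0"
  proof (rule tendsto_sandwich[OF _ _ tendsto_const])
    have "(\<lambda>n. ennreal (1 / \<epsilon>) * (\<integral>\<^sup>+\<omega>. ennreal \<bar>X n \<omega> - Y \<omega>\<bar> \<partial>M)) \<longlonglongrightarrow> ennreal (1 / \<epsilon>) * 0"
      by (intro ennreal_tendsto_cmult lim) auto
    then show "(\<lambda>n. ennreal (1 / \<epsilon>) * (\<integral>\<^sup>+\<omega>. ennreal \<bar>X n \<omega> - Y \<omega>\<bar> \<partial>M)) \<longlonglongrightarrow> 0" by simp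
  qed (use le in auto)
  then have "(\<lambda>n. ennreal (measure M (?A n))) \<longlonglongrightarrow> 0" by (simp add: emeasure_eq_measure)
  then show "(\<lambda>n. measure M (?A n)) \<longlonglongrightarrow> 0" by (subst (asm) ennreal_tendsto_0_iff) auto
qed

text \<open>\<open>J\<close> has a positive lower bound but no upper bound, so the estimate must be
  uniform in \<open>J\<close>: \<kappa> S - Q is at most (\<kappa> + 1) \<eta> in absolute value
  whatever J is, while Q stays above \<kappa> j0 / 2.\<close>

lemma ratio_powr_close:
  fixes \<kappa> j0 a \<alpha> \<epsilon> :: real
  assumes \<kappa>: "0 < \<kappa>" and j0: "0 < j0" and a: "0 < a" and \<epsilon>: "0 < \<epsilon>"
  obtains \<eta> where "0 < \<eta>" "\<And>S Q J. \<bar>S - J\<bar> \<le> \<eta> \<Longrightarrow> \<bar>Q - \<kappa> * J\<bar> \<le> \<eta> \<Longrightarrow> j0 \<le> J \<Longrightarrow> \<bar>(a * (S / Q)) powr \<alpha> - (a / \<kappa>) powr \<alpha>\<bar> \<le> \<epsilon>"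
proof -
  have "isCont (\<lambda>y. y powr \<alpha>) (a / \<kappa>)" using a \<kappa> by (intro continuous_intros) auto
  then obtain \<rho> where \<rho>: "0 < \<rho>" "\<And>y. \<bar>y - a / \<kappa>\<bar> < \<rho> \<Longrightarrow> \<bar>y powr \<alpha> - (a / \<kappa>) powr \<alpha>\<bar> < \<epsilon>"
    unfolding continuous_at_eps_delta using \<epsilon> by (auto simp: dist_real_def)
  \<comment> \<open>The first entry keeps Q at least \<kappa> j0 / 2; the second makes the error of
    the base of the power at most \<rho> / 2.\<close>
  define \<eta> where "\<eta> = min (\<kappa> * j0 / 2) (\<rho> * \<kappa>\<^sup>2 * j0 / (4 * a * (\<kappa> + 1)))"
  have \<eta>: "0 < \<eta>" using \<kappa> j0 a \<rho> by (simp add: \<eta>_def)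
  show ?thesis
  proof (rule that[OF \<eta>])
    fix S Q J assume h: "\<bar>S - J\<bar> \<le> \<eta>" "\<bar>Q - \<kappa> * J\<bar> \<le> \<eta>" "j0 \<le> J"
    have kj: "\<kappa> * j0 \<le> \<kappa> * J" using h(3) \<kappa> by (intro mult_left_mono) auto
    have "\<eta> \<le> \<kappa> * j0 / 2" by (simp add: \<eta>_def)
    then have Q: "\<kappa> * j0 / 2 \<le> Q" using h(2) kj by linarith
    have kj0: "0 < \<kappa> * j0 / 2" using \<kappa> j0 by simp
    have Q0: "0 < Q" using Q kj0 by linarith
    have "\<bar>\<kappa> * S - Q\<bar> \<le> \<bar>\<kappa> * (S - J)\<bar> + \<bar>Q - \<kappa> * J\<bar>"
      using abs_triangle_ineq4[of "\<kappa> * (S - J)" "Q - \<kappa> * J"] by (simp add: algebra_simps)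
    also have "\<dots> \<le> \<kappa> * \<eta> + \<eta>" using h \<kappa> by (intro add_mono) (auto simp: abs_mult intro!: mult_left_mono)
    finally have num: "\<bar>\<kappa> * S - Q\<bar> \<le> (\<kappa> + 1) * \<eta>" by (simp add: algebra_simps)
    have "a * (S / Q) - a / \<kappa> = a * (\<kappa> * S - Q) / (\<kappa> * Q)" using Q0 \<kappa> by (simp add: field_simps)
    then have "\<bar>a * (S / Q) - a / \<kappa>\<bar> = a * \<bar>\<kappa> * S - Q\<bar> / (\<kappa> * Q)" using a \<kappa> Q0 by (simp add: abs_mult)
    also have "\<dots> \<le> a * ((\<kappa> + 1) * \<eta>) / (\<kappa> * (\<kappa> * j0 / 2))"
      using num a \<kappa> Q kj0 by (intro frac_le mult_left_mono mult_pos_pos) auto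
    also have "\<dots> = (2 * a * (\<kappa> + 1)) * \<eta> / (\<kappa>\<^sup>2 * j0)" by (simp add: power2_eq_square mult_ac)
    also have "\<dots> \<le> (2 * a * (\<kappa> + 1)) * (\<rho> * \<kappa>\<^sup>2 * j0 / (4 * a * (\<kappa> + 1))) / (\<kappa>\<^sup>2 * j0)"
      using a \<kappa> j0 by (intro divide_right_mono mult_left_mono) (auto simp: \<eta>_def)
    also have "\<dots> = \<rho> / 2"
    proof -
      have "\<kappa> + 1 \<noteq> 0" using \<kappa> by simp
      then show ?thesis using a \<kappa> j0 by (simp add: divide_simps)
    qed
    also have "\<dots> < \<rho>" using \<rho> by simp
    finally show "\<bar>(a * (S / Q)) powr \<alpha> - (a / \<kappa>) powr \<alpha>\<bar> \<le> \<epsilon>" using \<rho>(2) by (simp add: less_imp_le)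
  qed
qed

text \<open>Off the union of two events of vanishing probability, and off a null set, the
  deterministic estimate applies. The formula for \<open>E\<close> is asked for n > 0 only, since at
  n = 0 the normalisations degenerate.\<close>

lemma (in prob_space) ratio_tendsto_in_probability:
  assumes S: "tendsto_in_probability M S J" and Q: "tendsto_in_probability M Q (\<lambda>\<omega>. \<kappa> * J \<omega>)"
    and J: "AE \<omega> in M. j0 \<le> J \<omega>" and pos: "0 < \<kappa>" "0 < j0" "0 < a"
    and E[measurable]: "\<And>n. E n \<in> borel_measurable M"
    and e: "\<And>n \<omega>. 0 < n \<Longrightarrow> E n \<omega> = (a * (S n \<omega> / Q n \<omega>)) powr \<alpha>"
  shows "tendsto_in_probability M E (\<lambda>\<omega>. (a / \<kappa>) powr \<alpha>)"
  unfolding tendsto_in_probability_def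
proof (intro conjI allI impI E)
  have [measurable]: "S n \<in> borel_measurable M" "Q n \<in> borel_measurable M" "J \<in> borel_measurable M" for n
    using S Q by (auto simp: tendsto_in_probability_def)
  fix \<epsilon> :: real assume \<epsilon>: "0 < \<epsilon>"
  obtain \<eta> where \<eta>: "0 < \<eta>" "\<And>S Q J. \<bar>S - J\<bar> \<le> \<eta> \<Longrightarrow> \<bar>Q - \<kappa> * J\<bar> \<le> \<eta> \<Longrightarrow> j0 \<le> J \<Longrightarrow> \<bar>(a * (S / Q)) powr \<alpha> - (a / \<kappa>) powr \<alpha>\<bar> \<le> \<epsilon>"
    by (rule ratio_powr_close[OF pos \<epsilon>, of \<alpha>]) blast
  let ?A = "\<lambda>n. {\<omega> \<in> space M. \<bar>S n \<omega> - J \<omega>\<bar> > \<eta>}" and ?B = "\<lambda>n. {\<omega> \<in> space M. \<bar>Q n \<omega> - \<kappa> * J \<omega>\<bar> > \<eta>}"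
  show "(\<lambda>n. measure M {\<omega> \<in> space M. \<bar>E n \<omega> - (a / \<kappa>) powr \<alpha>\<bar> > \<epsilon>}) \<longlonglongrightarrow> 0"
  proof (rule tendsto_sandwich[OF _ _ tendsto_const])
    show "\<forall>\<^sub>F n in sequentially. measure M {\<omega> \<in> space M. \<bar>E n \<omega> - (a / \<kappa>) powr \<alpha>\<bar> > \<epsilon>} \<le> measure M (?A n) + measure M (?B n)"
      using eventually_gt_at_top[of "0 :: nat"]
    proof eventually_elim
      case (elim n)
      have "measure M {\<omega> \<in> space M. \<bar>E n \<omega> - (a / \<kappa>) powr \<alpha>\<bar> > \<epsilon>} \<le> measure M (?A n \<union> ?B n)"
      proof (rule finite_measure_mono_AE)
        show "AE \<omega> in M. \<omega> \<in> {\<omega> \<in> space M. \<bar>E n \<omega> - (a / \<kappa>) powr \<alpha>\<bar> > \<epsilon>} \<longrightarrow> \<omega> \<in> ?A n \<union> ?B n"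
          using J
        proof eventually_elim
          case (elim \<omega>)
          show ?case
          proof
            assume w: "\<omega> \<in> {\<omega> \<in> space M. \<bar>E n \<omega> - (a / \<kappa>) powr \<alpha>\<bar> > \<epsilon>}"
            show "\<omega> \<in> ?A n \<union> ?B n"
            proof (rule ccontr)
              assume "\<omega> \<notin> ?A n \<union> ?B n"
              then have "\<bar>S n \<omega> - J \<omega>\<bar> \<le> \<eta>" "\<bar>Q n \<omega> - \<kappa> * J \<omega>\<bar> \<le> \<eta>" using w by auto
              from \<eta>(2)[OF this elim] have "\<bar>E n \<omega> - (a / \<kappa>) powr \<alpha>\<bar> \<le> \<epsilon>"
                by (simp only: e[OF \<open>0 < n\<close>])
              with w show False by simp
            qed
          qed
        qed
      qed measurable
      also have "\<dots> \<le> measure M (?A n) + measure M (?B n)"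
        by (rule measure_Un_le) measurable
      finally show ?case .
    qed
    have "(\<lambda>n. measure M (?A n) + measure M (?B n)) \<longlonglongrightarrow> 0 + 0"
      using S Q \<eta>(1) by (intro tendsto_add) (auto simp: tendsto_in_probability_def)
    then show "(\<lambda>n. measure M (?A n) + measure M (?B n)) \<longlonglongrightarrow> 0" by simp
  qed auto
qed auto

context heat_spde begin

text \<open>The case of weights 1 with the grid values as coefficients; the cell bound is the L2
  modulus of \<open>u\<close>, transported by the Lipschitz constant of \<sigma>.\<close>

lemma source_Riemann_sum_L1:
  assumes T: "0 < T1" "T1 < T2"
  shows "(\<lambda>n. \<integral>\<^sup>+\<omega>. ennreal \<bar>(T2 - T1) / real n * (\<Sum>i=1..n. (\<sigma> (u (grid_time T1 T2 n i) x \<omega>))\<^sup>2) -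
      (LBINT r:{T1..T2}. (\<sigma> (u r x \<omega>))\<^sup>2)\<bar> \<partial>M) \<longlonglongrightarrow> 0" (is "?E \<longlonglongrightarrow> 0")
proof -
  have T2: "0 < T2" using T by simp
  obtain C where C: "0 < C" "\<And>t x. 0 < t \<Longrightarrow> t \<le> T2 \<Longrightarrow> (\<integral>\<^sup>+\<omega>. ennreal ((\<sigma> (u t x \<omega>))\<^sup>2) \<partial>M) \<le> ennreal C"
    by (rule source_second_moment[OF T2]) blast
  obtain L where L: "0 < L" "\<And>a b. \<bar>\<sigma> a - \<sigma> b\<bar> \<le> L * \<bar>a - b\<bar>" by (rule lipschitz_bound) blast
  define C0 where "C0 = (T2 - T1) * (C + 2)"
  have C0: "0 < C0" using C T by (simp add: C0_def)
  have key: "\<forall>\<^sub>F n in sequentially. ?E n \<le> ennreal (\<eta> * C0)" if \<eta>: "0 < \<eta>" "\<eta> \<le> 1" for \<eta>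
  proof -
    have e': "0 < \<eta>\<^sup>2 / L\<^sup>2" using \<eta> L by simp
    obtain m where m: "0 < m" "\<And>t t' x'. T1 \<le> t \<Longrightarrow> t \<le> T2 \<Longrightarrow> T1 \<le> t' \<Longrightarrow> t' \<le> T2 \<Longrightarrow> \<bar>t - t'\<bar> < m \<Longrightarrow> \<bar>x' - x\<bar> < m \<Longrightarrow>
       (\<integral>\<^sup>+\<omega>. ennreal ((u t' x' \<omega> - u t x \<omega>)\<^sup>2) \<partial>M) \<le> ennreal (\<eta>\<^sup>2 / L\<^sup>2)"
      by (rule u_L2_continuous[OF T e', of x]) blast
    have "(\<lambda>n. (T2 - T1) / real n) \<longlonglongrightarrow> 0" by (rule lim_const_over_n)
    then have "\<forall>\<^sub>F n in sequentially. (T2 - T1) / real n < m" using m by (intro order_tendstoD) auto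
    then show ?thesis using eventually_gt_at_top[of "0 :: nat"]
    proof eventually_elim
      case (elim n)
      define t where "t i = grid_time T1 T2 n i" for i
      have t: "T1 \<le> t i" "t i \<le> T2" "0 < t i" if "i \<in> {1..n}" for i
        using grid_time_bounds[OF T(2) elim(2), of i] that T by (auto simp: t_def)
      have Xm: "(\<lambda>\<omega>. \<sigma> (u (t i) x \<omega>)) \<in> borel_measurable M" if "i \<in> {1..n}" for i
        using u_measurable[OF t(3)[OF that], of x] by measurable
      have cell: "(\<integral>\<^sup>+\<omega>. ennreal \<bar>1 * (\<sigma> (u (t i) x \<omega>))\<^sup>2 - 1 * (source (fst (\<omega>, r), (snd (\<omega>, r), x)))\<^sup>2\<bar> \<partial>M) \<le> ennreal (\<eta> * (C + 2))"
        if i: "i \<in> {1..n}" and r: "r \<in> {grid_time T1 T2 n i - (T2 - T1) / real n<..grid_time T1 T2 n i}" for i r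
      proof -
        have "T1 \<le> grid_time T1 T2 n (i - 1)" using i by (intro grid_time_bounds[OF T(2) elim(2)]) auto
        then have r1: "T1 \<le> r" "r \<le> T2" "\<bar>t i - r\<bar> < m"
          using grid_time_bounds(3)[OF T(2) elim(2), of i] i r t(2)[OF i] elim(1) by (auto simp: t_def)
        have r0: "0 < r" using r1 T by simp
        note [measurable] = u_measurable[OF r0] u_measurable[OF t(3)[OF i]]
        have fm: "(\<lambda>\<omega>. \<sigma> (u (t i) x \<omega>)) \<in> borel_measurable M" "(\<lambda>\<omega>. \<sigma> (u r x \<omega>)) \<in> borel_measurable M" by measurable
        from square_bound_expectation[OF fm(1) C(2)[OF t(3)[OF i] t(2)[OF i]]] C
        have f2: "integrable M (\<lambda>\<omega>. (\<sigma> (u (t i) x \<omega>))\<^sup>2)" "expectation (\<lambda>\<omega>. (\<sigma> (u (t i) x \<omega>))\<^sup>2) \<le> C" by auto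
        have "(\<integral>\<^sup>+\<omega>. ennreal ((\<sigma> (u (t i) x \<omega>) - \<sigma> (u r x \<omega>))\<^sup>2) \<partial>M) \<le> (\<integral>\<^sup>+\<omega>. ennreal (L\<^sup>2) * ennreal ((u (t i) x \<omega> - u r x \<omega>)\<^sup>2) \<partial>M)"
        proof (rule nn_integral_mono)
          fix \<omega>
          have "(\<sigma> (u (t i) x \<omega>) - \<sigma> (u r x \<omega>))\<^sup>2 \<le> (L * \<bar>u (t i) x \<omega> - u r x \<omega>\<bar>)\<^sup>2"
            using L(2)[of "u (t i) x \<omega>" "u r x \<omega>"] by (metis abs_ge_zero power2_abs power_mono)
          then show "ennreal ((\<sigma> (u (t i) x \<omega>) - \<sigma> (u r x \<omega>))\<^sup>2) \<le> ennreal (L\<^sup>2) * ennreal ((u (t i) x \<omega> - u r x \<omega>)\<^sup>2)"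
            by (simp add: ennreal_mult[symmetric] power_mult_distrib ennreal_leI)
        qed
        also have "\<dots> = ennreal (L\<^sup>2) * (\<integral>\<^sup>+\<omega>. ennreal ((u (t i) x \<omega> - u r x \<omega>)\<^sup>2) \<partial>M)"
          by (rule nn_integral_cmult) measurable
        also have "\<dots> \<le> ennreal (L\<^sup>2) * ennreal (\<eta>\<^sup>2 / L\<^sup>2)"
          using m(2)[of r "t i" x] r1 t(1,2)[OF i] m(1) by (intro mult_left_mono) (auto simp: abs_minus_commute)
        also have "\<dots> = ennreal (\<eta>\<^sup>2)" using L by (simp add: ennreal_mult[symmetric])
        finally have "(\<integral>\<^sup>+\<omega>. ennreal ((\<sigma> (u (t i) x \<omega>) - \<sigma> (u r x \<omega>))\<^sup>2) \<partial>M) \<le> ennreal (\<eta>\<^sup>2)" .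
        from square_bound_expectation[OF _ this]
        have e2: "integrable M (\<lambda>\<omega>. (\<sigma> (u (t i) x \<omega>) - \<sigma> (u r x \<omega>))\<^sup>2)" "expectation (\<lambda>\<omega>. (\<sigma> (u (t i) x \<omega>) - \<sigma> (u r x \<omega>))\<^sup>2) \<le> \<eta>\<^sup>2" by auto
        note B = L1_square_diff_bound[OF fm f2(1) e2(1) \<eta>(1)]
        have "(\<integral>\<^sup>+\<omega>. ennreal \<bar>(\<sigma> (u (t i) x \<omega>))\<^sup>2 - (\<sigma> (u r x \<omega>))\<^sup>2\<bar> \<partial>M) = ennreal (expectation (\<lambda>\<omega>. \<bar>(\<sigma> (u (t i) x \<omega>))\<^sup>2 - (\<sigma> (u r x \<omega>))\<^sup>2\<bar>))"
          using f2(1) B(1) by (intro nn_integral_eq_integral) auto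
        also have "\<dots> \<le> ennreal (\<eta> * C + (1 + 1 / \<eta>) * \<eta>\<^sup>2)"
          using \<eta> by (intro ennreal_leI order_trans[OF B(2)] add_mono mult_left_mono f2 e2) (auto simp: add_nonneg_nonneg)
        also have "\<eta> * C + (1 + 1 / \<eta>) * \<eta>\<^sup>2 = \<eta> * (C + 1 + \<eta>)" using \<eta> by (simp add: field_simps power2_eq_square)
        also have "ennreal (\<eta> * (C + 1 + \<eta>)) \<le> ennreal (\<eta> * (C + 2))" using \<eta> by (intro ennreal_leI mult_left_mono) auto
        finally show ?thesis using r0 by (simp add: source_def max_def)
      qed
      have "0 \<le> \<eta> * (C + 2)" using \<eta> C by simp
      from Riemann_sum_L1[OF path_source_measurable Xm T(2) elim(2) this source_square_integrable_time[OF T] cell]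
      have "(\<integral>\<^sup>+\<omega>. ennreal \<bar>(T2 - T1) / real n * (\<Sum>i=1..n. (\<sigma> (u (t i) x \<omega>))\<^sup>2) - (LBINT r:{T1..T2}. (source (\<omega>, (r, x)))\<^sup>2)\<bar> \<partial>M) \<le> ennreal ((T2 - T1) * (\<eta> * (C + 2)))"
        by simp
      moreover have "(LBINT r:{T1..T2}. (source (\<omega>, (r, x)))\<^sup>2) = (LBINT r:{T1..T2}. (\<sigma> (u r x \<omega>))\<^sup>2)" for \<omega>
        using T by (intro set_lebesgue_integral_cong) (auto simp: source_def max_def)
      ultimately show ?case by (simp add: t_def C0_def mult_ac)
    qed
  qed
  show ?thesis by (rule ennreal_tendsto_zero_linear[OF C0 key])
qed

text \<open>Almost surely only: if a path is not square integrable, its Bochner integral is 0.\<close>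

lemma occupation_integral_lower_bound:
  assumes T: "0 < T1" "T1 < T2" and \<sigma>0: "0 < \<sigma>0" "\<And>y. \<sigma>0 \<le> \<bar>\<sigma> y\<bar>"
  shows "AE \<omega> in M. \<sigma>0\<^sup>2 * (T2 - T1) \<le> (LBINT r:{T1..T2}. (\<sigma> (u r x \<omega>))\<^sup>2)"
proof -
  interpret P: pair_sigma_finite M "lborel :: real measure" ..
  let ?f = "\<lambda>\<omega> r. indicator {T1<..T2} r * (source (\<omega>, (r, x)))\<^sup>2"
  have fm[measurable]: "(\<lambda>z. ?f (fst z) (snd z)) \<in> borel_measurable (M \<Otimes>\<^sub>M lborel)" by measurable
  have "(\<integral>\<^sup>+\<omega>. (\<integral>\<^sup>+r. ennreal (?f \<omega> r) \<partial>lborel) \<partial>M) = (\<integral>\<^sup>+r. (\<integral>\<^sup>+\<omega>. ennreal (?f \<omega> r) \<partial>M) \<partial>lborel)"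
    using P.Fubini'[of "\<lambda>\<omega> r. ennreal (?f \<omega> r)"] by (simp add: case_prod_beta)
  also have "\<dots> = (\<integral>\<^sup>+r\<in>{T1<..T2}. (\<integral>\<^sup>+\<omega>. ennreal ((source (fst (\<omega>, r), (snd (\<omega>, r), x)))\<^sup>2) \<partial>M) \<partial>lborel)"
    by (intro nn_integral_cong) (auto simp: indicator_def)
  also have "\<dots> < \<infinity>" by (rule source_square_integrable_time[OF T])
  finally have fin: "(\<integral>\<^sup>+\<omega>. (\<integral>\<^sup>+r. ennreal (?f \<omega> r) \<partial>lborel) \<partial>M) < \<infinity>" .
  have "(\<lambda>\<omega>. \<integral>\<^sup>+r. ennreal (?f \<omega> r) \<partial>lborel) \<in> borel_measurable M"
    by (rule lborel.borel_measurable_nn_integral) (simp add: case_prod_beta)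
  then have "AE \<omega> in M. (\<integral>\<^sup>+r. ennreal (?f \<omega> r) \<partial>lborel) \<noteq> \<infinity>"
    by (rule nn_integral_noteq_infinite) (use fin in auto)
  then show ?thesis using AE_space
  proof eventually_elim
    case (elim \<omega>)
    have [measurable]: "(\<lambda>r. source (\<omega>, (r, x))) \<in> borel_measurable lborel"
      using measurable_compose[OF measurable_Pair1'[OF elim(2)] path_source_measurable[of x]] by simp
    have fi: "integrable lborel (?f \<omega>)"
      by (rule integrableI_bounded) (use elim(1) in \<open>auto simp: less_top\<close>)
    have "(LBINT r:{T1..T2}. (\<sigma> (u r x \<omega>))\<^sup>2) = (LBINT r:{T1..T2}. (source (\<omega>, (r, x)))\<^sup>2)"
      using T by (intro set_lebesgue_integral_cong) (auto simp: source_def max_def)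
    also have "\<dots> = (LBINT r. ?f \<omega> r)"
      unfolding set_lebesgue_integral_def
    proof (rule integral_cong_AE)
      show "AE r in lborel. indicator {T1..T2} r *\<^sub>R (source (\<omega>, (r, x)))\<^sup>2 = ?f \<omega> r"
        using AE_lborel_singleton[of T1] by eventually_elim (auto simp: indicator_def)
    qed measurable
    finally have e: "(LBINT r:{T1..T2}. (\<sigma> (u r x \<omega>))\<^sup>2) = (LBINT r. ?f \<omega> r)" .
    have "\<sigma>0\<^sup>2 \<le> (\<sigma> y)\<^sup>2" for y using power_mono[OF \<sigma>0(2)[of y], of 2] \<sigma>0(1) by simp
    then have "(LBINT r. \<sigma>0\<^sup>2 * indicator {T1<..T2} r) \<le> (LBINT r. ?f \<omega> r)"
      using T by (intro integral_mono fi integrable_mult_right integrable_real_indicator) (auto simp: source_def indicator_def)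
    then show ?case using T by (simp add: e)
  qed
qed

theorem quadratic_variation_in_probability:
  assumes T: "0 < T1" "T1 < T2"
  shows "tendsto_in_probability M
     (\<lambda>n \<omega>. 1 / real n powr (1 / \<alpha>) * quadratic_variation_sum u x T1 T2 n \<omega>)
     (\<lambda>\<omega>. (T2 - T1) powr (- 1 / \<alpha>) * (variance_const * (LBINT r:{T1..T2}. (\<sigma> (u r x \<omega>))\<^sup>2)))"
  by (intro L1_imp_tendsto_in_probability quadratic_variation_L1 T borel_measurable_times
      quadratic_variation_measurable occupation_integral_measurable borel_measurable_const)

text \<open>Numerator and denominator of the estimator converge to multiples of the same positive
  random variable, the time integral of \<sigma>^2, which cancels; what is left inside the outer
  power is \<mu>^(1/\<alpha>).\<close>

theorem drift_estimator_consistent: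
  assumes T: "0 < T1" "T1 < T2" and \<sigma>0: "0 < \<sigma>0" "\<And>y. \<sigma>0 \<le> \<bar>\<sigma> y\<bar>"
  shows "tendsto_in_probability M (\<lambda>n. drift_estimator \<alpha> \<sigma> u x T1 T2 n) (\<lambda>\<omega>. \<mu>)"
proof -
  let ?J = "\<lambda>\<omega>. LBINT r:{T1..T2}. (\<sigma> (u r x \<omega>))\<^sup>2"
  define k where "k = (T2 - T1) powr (- 1 / \<alpha>)"
  define S where "S n \<omega> = (T2 - T1) / real n * (\<Sum>i=1..n. (\<sigma> (u (grid_time T1 T2 n i) x \<omega>))\<^sup>2)" for n \<omega>
  define Q where "Q n \<omega> = 1 / real n powr (1 / \<alpha>) * quadratic_variation_sum u x T1 T2 n \<omega>" for n \<omega>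
  have c: "0 < c_const \<alpha>" using alpha by (auto simp: c_const_def intro!: divide_pos_pos mult_pos_pos Gamma_real_pos)
  have k: "0 < k" using T by (simp add: k_def)
  have gm: "u (grid_time T1 T2 n i) x \<in> borel_measurable M" for n i
  proof (rule u_measurable)
    have "0 \<le> real i * ((T2 - T1) / real n)" using T by (intro mult_nonneg_nonneg divide_nonneg_nonneg) auto
    then show "0 < grid_time T1 T2 n i" using T unfolding grid_time_def by linarith
  qed
  have Sm: "S n \<in> borel_measurable M" for n
    unfolding S_def[abs_def] using gm by measurable
  have "(\<lambda>n. \<integral>\<^sup>+\<omega>. ennreal \<bar>S n \<omega> - ?J \<omega>\<bar> \<partial>M) \<longlonglongrightarrow> 0"
    unfolding S_def by (rule source_Riemann_sum_L1[OF T])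
  then have SJ: "tendsto_in_probability M S ?J"
    by (rule L1_imp_tendsto_in_probability[OF Sm occupation_integral_measurable[OF T(1)]])
  have QJ: "tendsto_in_probability M Q (\<lambda>\<omega>. (k * variance_const) * ?J \<omega>)"
    using quadratic_variation_in_probability[OF T, of x] by (simp add: Q_def[abs_def] k_def mult.assoc)
  have Em: "drift_estimator \<alpha> \<sigma> u x T1 T2 n \<in> borel_measurable M" for n
    unfolding drift_estimator_def[abs_def] using gm quadratic_variation_measurable[OF T, of x n] by measurable
  have E: "drift_estimator \<alpha> \<sigma> u x T1 T2 n \<omega> = ((c_const \<alpha> * k) * (S n \<omega> / Q n \<omega>)) powr \<alpha>" if n: "0 < n" for n \<omega>
  proof -
    define p where "p = 1 / \<alpha>"
    have e: "(\<alpha> - 1) / \<alpha> = 1 - p" "- 1 / \<alpha> = - p" using alpha by (auto simp: p_def field_simps)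
    \<comment> \<open>Redistribution of powers: the normalisation of the estimator splits into (T2 -
      T1) / n for the numerator and n^(-1/\<alpha>) for the denominator, with (T2 -
      T1)^(-1/\<alpha>) left over.\<close>
    have "c * (T2 - T1) powr (1 - p) / real n powr (1 - p) * (a / b) =
        c * (T2 - T1) powr (- p) * ((T2 - T1) / real n * a / (1 / real n powr p * b))" for a b c
      using T n by (simp add: powr_diff powr_minus field_simps)
    then show ?thesis
      unfolding drift_estimator_def S_def Q_def k_def e p_def[symmetric] by (simp only:)
  qed
  have "tendsto_in_probability M (\<lambda>n. drift_estimator \<alpha> \<sigma> u x T1 T2 n) (\<lambda>\<omega>. ((c_const \<alpha> * k) / (k * variance_const)) powr \<alpha>)"
    by (rule ratio_tendsto_in_probability[OF SJ QJ occupation_integral_lower_bound[OF T \<sigma>0] _ _ _ Em E])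
      (use k c T \<sigma>0 variance_const_pos in auto)
  also have "(c_const \<alpha> * k) / (k * variance_const) = \<mu> powr (1 / \<alpha>)"
    using k c \<mu>_pos by (simp add: variance_const_def)
  also have "(\<mu> powr (1 / \<alpha>)) powr \<alpha> = \<mu>" using alpha \<mu>_pos by (simp add: powr_powr)
  finally show ?thesis .
qed

end

theorem proposition4p2:
  fixes M :: "'w measure"
    and W :: "(real \<times> real) set \<Rightarrow> 'w \<Rightarrow> real"
    and G :: "real \<Rightarrow> real \<Rightarrow> real"
    and \<sigma> :: "real \<Rightarrow> real"
    and u :: "real \<Rightarrow> real \<Rightarrow> 'w \<Rightarrow> real"
    and \<alpha> \<mu> T1 T2 x :: real
  assumes "prob_space M"
    and "space_time_white_noise M W"
    and "1 < \<alpha>" and "\<alpha> \<le> 2"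
    and "fractional_heat_kernel \<alpha> G"
    and "\<exists>L. L-lipschitz_on UNIV \<sigma>"
    and "0 < \<mu>"
    and "mild_solution M W G \<mu> \<sigma> u"
    and "continuous_field M u"
    and "0 < T1" and "T1 < T2"
  shows "tendsto_in_probability M
           (\<lambda>n \<omega>. 1 / real n powr (1 / \<alpha>) * quadratic_variation_sum u x T1 T2 n \<omega>)
           (\<lambda>\<omega>. c_const \<alpha> * (T2 - T1) powr (- 1 / \<alpha>) / \<mu> powr (1 / \<alpha>) *
                 (LBINT r:{T1..T2}. (\<sigma> (u r x \<omega>))\<^sup>2))
         \<and> ((\<exists>\<sigma>0>0. \<forall>y. \<bar>\<sigma> y\<bar> \<ge> \<sigma>0) \<longrightarrow>
             tendsto_in_probability M (\<lambda>n. drift_estimator \<alpha> \<sigma> u x T1 T2 n) (\<lambda>\<omega>. \<mu>))"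
proof -
  interpret prob_space M by fact
  interpret heat_spde M W \<alpha> G \<sigma> \<mu> u
    by unfold_locales (use assms in auto)
  have "tendsto_in_probability M
           (\<lambda>n \<omega>. 1 / real n powr (1 / \<alpha>) * quadratic_variation_sum u x T1 T2 n \<omega>)
           (\<lambda>\<omega>. c_const \<alpha> * (T2 - T1) powr (- 1 / \<alpha>) / \<mu> powr (1 / \<alpha>) *
                 (LBINT r:{T1..T2}. (\<sigma> (u r x \<omega>))\<^sup>2))"
    using quadratic_variation_in_probability[OF \<open>0 < T1\<close> \<open>T1 < T2\<close>, of x]
    by (simp add: variance_const_def mult_ac)
  then show ?thesis
    using drift_estimator_consistent[OF \<open>0 < T1\<close> \<open>T1 < T2\<close>, of _ x] by blast
qed

end
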